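(* Let $X^{\alpha}_t$, $t\ge 0$, be a strictly $\alpha$-stable process with $\alpha\in(1,2]$ on a probability space $(\Omega,\mathcal{F},\mathbb{P})$, let $L$ be its local time, and let $C=\lim_{n\to+\infty}\frac1n\mathbb{E}\,\mathrm{TV}^1(X^{\alpha},[0,n])$. There exist a sequence $(c_n)_{n\ge1}$ of positive reals with $c_n\to0+$ as $n\to+\infty$ and a measurable set $\Omega_\alpha\subset\Omega$ with $\mathbb{P}(\Omega_\alpha)=1$ such that for each $\omega\in\Omega_\alpha$ and each $t\in[0,+\infty)$ the measures $c_n^{\alpha-1}\,\mathrm{n}^{y,c_n}(X^{\alpha}(\omega),[0,t])\,\mathrm{d}y$ converge weakly to $C\cdot L^y_t(\omega)\,\mathrm{d}y$ as $n\to+\infty$. Moreover, the measures $c^{\alpha-1}\,\mathrm{n}^{y,c}(X^{\alpha}(\omega),[0,t])\,\mathrm{d}y$, $t\ge0$, tend weakly locally uniformly in probability as $c\to0+$ to the measures $C\cdot L^y_t\,\mathrm{d}y$, $t\ge 0$.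
   Context: A strictly $\alpha$-stable process is a (non-zero) real Lévy process with càdlàg paths which is self-similar with index $1/\alpha$, i.e. $(A^{-1/\alpha}X^\alpha_{At})_{t\ge0}$ has the same law as $X^\alpha$ for all $A>0$. Truncated variation: for $x:[0,+\infty)\to\mathbb{R}$, $c\ge 0$ and $0\le s<t$, $\mathrm{TV}^{c}(x,[s,t])=\sup_{\pi}\sum_{[u,v]\in\pi}\max(|x_v-x_u|-c,0)$, the supremum being over all finite partitions $\pi$ of $[s,t]$ into subintervals with disjoint interiors. Numbers of interval crossings of a càdlàg path $x$: for $y\in\mathbb{R}$, $c>0$, put $\sigma^c_0=s$ and for $n=0,1,2,\dots$ $$\rho^c_n=\inf\{u\in[\sigma^c_n,t]: x_u\ge y+c/2\},\qquad \sigma^c_{n+1}=\inf\{u\in[\rho^c_n,t]: x_u<y-c/2\},$$ with $\inf\emptyset=+\infty$ and $[+\infty,t]=\emptyset$. Then $\mathrm{d}^{y,c}(x,[s,t])=\max\{n:\sigma^c_n\le t\}$, $\mathrm{u}^{y,c}(x,[s,t])=\mathrm{d}^{-y,c}(-x,[s,t])$ and $\mathrm{n}^{y,c}(x,[s,t])=\mathrm{u}^{y,c}(x,[s,t])+\mathrm{d}^{y,c}(x,[s,t])$. Local time of a process $X$ (relative to Lebesgue measures in space and time): with the occupation measure $\mu_t(\Gamma)=\int_{[0,t]}\mathbf{1}_\Gamma(X_s(\omega))\,\mathrm{d}s$, $X$ possesses a local time if for each $t\ge0$, $\mu_t$ is $\mathbb{P}$-a.s. absolutely continuous with respect to the Lebesgue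 measure $\mathrm{d}y$; the local time is $L^y_t(\omega)=(\mathrm{d}\mu_t/\mathrm{d}y)(y)$ (defined $\mathbb{P}$-a.s.). It is known that $X^\alpha$, $\alpha\in(1,2]$, possesses a local time. Weak local uniform convergence in probability: finite random measures $\mu^c_t$, $t\ge0$, on $\mathbb{R}$ tend weakly locally uniformly in probability as $c\to0+$ to random measures $\mu^0_t$, $t\ge0$, if for any continuous and bounded $g:\mathbb{R}\to\mathbb{R}$ and any $T\ge0$, $D^c_T=\sup_{t\in[0,T]}\left|\int_{\mathbb{R}}g\,\mathrm{d}\mu^c_t-\int_{\mathbb{R}}g\,\mathrm{d}\mu^0_t\right|$ is a random variable (measurable) and $D^c_T\to0$ in probability as $c\to0+$. *)

theory Defs
  imports "HOL-Probability.Probability"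
begin

definition cadlag :: "(real \<Rightarrow> real) \<Rightarrow> bool" where
  "cadlag x \<longleftrightarrow>
     (\<forall>t\<ge>0. (x \<longlongrightarrow> x t) (at_right t)) \<and> (\<forall>t>0. \<exists>l. (x \<longlongrightarrow> l) (at_left t))"

(* Processes are indexed by real; only times t >= 0 are ever referred to.
   Stochastic continuity is not listed, since it follows from stationarity of the increments
   and right-continuity of the paths at 0. *)
locale levy_process = prob_space M for M :: "'a measure" +
  fixes X :: "real \<Rightarrow> 'a \<Rightarrow> real"
  assumes random_variable_X: "\<And>t. t \<ge> 0 \<Longrightarrow> X t \<in> borel_measurable M"
    and starts_at_0: "AE \<omega> in M. X 0 \<omega> = 0"
    and cadlag_paths: "\<And>\<omega>. \<omega> \<in> space M \<Longrightarrow> cadlag (\<lambda>t. X t \<omega>)"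
    and indep_increments:
      "\<And>\<tau> n. incseq \<tau> \<Longrightarrow> \<tau> 0 \<ge> 0 \<Longrightarrow>
         indep_vars (\<lambda>_. borel) (\<lambda>i \<omega>. X (\<tau> (Suc i)) \<omega> - X (\<tau> i) \<omega>) {..<n::nat}"
    and stationary_increments:
      "\<And>s h. s \<ge> 0 \<Longrightarrow> h \<ge> 0 \<Longrightarrow>
         distr M borel (\<lambda>\<omega>. X (s + h) \<omega> - X s \<omega>) = distr M borel (X h)"

definition process_law :: "'a measure \<Rightarrow> (real \<Rightarrow> 'a \<Rightarrow> real) \<Rightarrow> (real \<Rightarrow> real) measure" where
  "process_law M X = distr M (PiM {0..} (\<lambda>_. borel)) (\<lambda>\<omega>. \<lambda>t\<in>{0..}. X t \<omega>)"

locale strictly_stable_process = levy_process M X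
  for M :: "'a measure" and X :: "real \<Rightarrow> 'a \<Rightarrow> real" +
  fixes \<alpha> :: real
  assumes index_pos: "\<alpha> > 0"
    and non_zero: "\<not> (\<forall>t\<ge>0. AE \<omega> in M. X t \<omega> = 0)"
    and self_similar:
      "\<And>A. A > 0 \<Longrightarrow> process_law M (\<lambda>t \<omega>. A powr (- 1 / \<alpha>) * X (A * t) \<omega>) = process_law M X"

(* The library's divisions may contain degenerate intervals [u,u]; these contribute 0. *)
definition truncated_variation :: "real \<Rightarrow> (real \<Rightarrow> real) \<Rightarrow> real \<Rightarrow> real \<Rightarrow> ennreal" where
  "truncated_variation c x s t =
     (SUP \<pi> \<in> {\<pi>. \<pi> division_of {s..t}}. ennreal (\<Sum>K\<in>\<pi>. max (\<bar>x (Sup K) - x (Inf K)\<bar> - c) 0))"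

(* hit_above ... r is the first time u in [r,t] with x u >= y + c/2, and hit_below ... r the first
   time u in [r,t] with x u < y - c/2.  Times live in ereal, where Inf {} = \<infinity>. *)
definition hit_above :: "real \<Rightarrow> real \<Rightarrow> (real \<Rightarrow> real) \<Rightarrow> real \<Rightarrow> ereal \<Rightarrow> ereal" where
  "hit_above y c x t r = Inf (ereal ` {u. r \<le> ereal u \<and> u \<le> t \<and> x u \<ge> y + c / 2})"

definition hit_below :: "real \<Rightarrow> real \<Rightarrow> (real \<Rightarrow> real) \<Rightarrow> real \<Rightarrow> ereal \<Rightarrow> ereal" where
  "hit_below y c x t r = Inf (ereal ` {u. r \<le> ereal u \<and> u \<le> t \<and> x u < y - c / 2})"

primrec crossing_time :: "real \<Rightarrow> real \<Rightarrow> (real \<Rightarrow> real) \<Rightarrow> real \<Rightarrow> real \<Rightarrow> nat \<Rightarrow> ereal" where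
  "crossing_time y c x s t 0 = ereal s"
| "crossing_time y c x s t (Suc n) =
     hit_below y c x t (hit_above y c x t (crossing_time y c x s t n))"

(* For c > 0 and a cadlag path the set under Max is finite; it contains 0 whenever s <= t. *)
definition downcrossings :: "real \<Rightarrow> real \<Rightarrow> (real \<Rightarrow> real) \<Rightarrow> real \<Rightarrow> real \<Rightarrow> nat" where
  "downcrossings y c x s t = Max {n. crossing_time y c x s t n \<le> ereal t}"

definition upcrossings :: "real \<Rightarrow> real \<Rightarrow> (real \<Rightarrow> real) \<Rightarrow> real \<Rightarrow> real \<Rightarrow> nat" where
  "upcrossings y c x s t = downcrossings (- y) c (\<lambda>u. - x u) s t"

definition crossings :: "real \<Rightarrow> real \<Rightarrow> (real \<Rightarrow> real) \<Rightarrow> real \<Rightarrow> real \<Rightarrow> nat" where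
  "crossings y c x s t = upcrossings y c x s t + downcrossings y c x s t"

definition occupation_measure :: "(real \<Rightarrow> real) \<Rightarrow> real \<Rightarrow> real measure" where
  "occupation_measure x t = distr (restrict_space lborel {0..t}) borel x"

(* A pathwise definition: the Radon-Nikodym derivative of the occupation measure wherever that
   measure is absolutely continuous (and 0 elsewhere).  An arbitrary family of densities, each
   correct only up to a null set depending on t, could fail for uncountably many t at once. *)
definition local_time :: "(real \<Rightarrow> real) \<Rightarrow> real \<Rightarrow> real \<Rightarrow> ennreal" where
  "local_time x t = RN_deriv lborel (occupation_measure x t)"

(* Weak convergence of finite measures of arbitrary mass: the library's weak_conv_m, being
   convergence of distribution functions, does not prevent mass from escaping to infinity. *)
definition weakly_converges :: "(nat \<Rightarrow> real measure) \<Rightarrow> real measure \<Rightarrow> bool" where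
  "weakly_converges \<mu> \<nu> \<longleftrightarrow>
     (\<forall>n. finite_borel_measure (\<mu> n)) \<and> finite_borel_measure \<nu> \<and>
     (\<forall>g::real \<Rightarrow> real. continuous_on UNIV g \<longrightarrow> bounded (range g) \<longrightarrow>
        (\<lambda>n. \<integral>y. g y \<partial>\<mu> n) \<longlonglongrightarrow> (\<integral>y. g y \<partial>\<nu>))"

definition finite_random_measure :: "'a measure \<Rightarrow> ('a \<Rightarrow> real measure) \<Rightarrow> bool" where
  "finite_random_measure M \<mu> \<longleftrightarrow>
     (\<forall>\<omega>\<in>space M. finite_borel_measure (\<mu> \<omega>)) \<and>
     (\<forall>\<Gamma>\<in>sets borel. (\<lambda>\<omega>. emeasure (\<mu> \<omega>) \<Gamma>) \<in> borel_measurable M)"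

definition weak_deviation ::
  "(real \<Rightarrow> real) \<Rightarrow> real \<Rightarrow> (real \<Rightarrow> 'a \<Rightarrow> real measure) \<Rightarrow> (real \<Rightarrow> 'a \<Rightarrow> real measure) \<Rightarrow> 'a \<Rightarrow> ennreal"
  where
  "weak_deviation g T \<mu> \<nu> \<omega> =
     (SUP t\<in>{0..T}. ennreal \<bar>(\<integral>y. g y \<partial>\<mu> t \<omega>) - (\<integral>y. g y \<partial>\<nu> t \<omega>)\<bar>)"

definition tends_weakly_loc_unif_in_prob ::
  "'a measure \<Rightarrow> (real \<Rightarrow> real \<Rightarrow> 'a \<Rightarrow> real measure) \<Rightarrow> (real \<Rightarrow> 'a \<Rightarrow> real measure) \<Rightarrow> bool" where
  "tends_weakly_loc_unif_in_prob M \<mu> \<nu> \<longleftrightarrow>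
     (\<forall>c>0. \<forall>t\<ge>0. finite_random_measure M (\<mu> c t)) \<and>
     (\<forall>t\<ge>0. finite_random_measure M (\<nu> t)) \<and>
     (\<forall>g T. continuous_on UNIV g \<longrightarrow> bounded (range g) \<longrightarrow> T \<ge> 0 \<longrightarrow>
        (\<forall>c>0. weak_deviation g T (\<mu> c) \<nu> \<in> borel_measurable M) \<and>
        (\<forall>\<epsilon>>0. ((\<lambda>c. measure M {\<omega> \<in> space M. weak_deviation g T (\<mu> c) \<nu> \<omega> > ennreal \<epsilon>})
                  \<longlongrightarrow> 0) (at_right 0)))"

definition crossing_measure :: "real \<Rightarrow> real \<Rightarrow> (real \<Rightarrow> real) \<Rightarrow> real \<Rightarrow> real measure" where
  "crossing_measure \<alpha> c x t =
     density lborel (\<lambda>y. ennreal (c powr (\<alpha> - 1) * real (crossings y c x 0 t)))"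

end

(*
  For a cadlag path the truncated variation TV^c is the integral of the number of c-crossings over
  all levels (a discrete play operator attains the truncated variation), so the total mass of the
  crossing measure up to time t is c^(alpha-1) TV^c(X,[0,t]).  By self-similarity this mass at time q
  has the law of q times TV^1(X,[0,n])/n with n = q c^(-alpha).  TV^1 is additive over blocks up to a
  bounded error, so the weak law of large numbers in L^1 applies once E TV^1(X,[0,T]) is finite; that
  follows from a tail bound for the supremum (Ottaviani) and restarting the walk at its first exit
  from an interval.  Along a subsequence the masses therefore converge almost surely to C q for all
  rational q.

  The rest is pathwise.  On a time interval where the path oscillates little, almost all the crossing
  mass sits near the current value of the path, so the convergence of masses forces the integral of a
  continuous g against the crossing measures to tend to C times the integral of g(X_s) ds, uniformly
  on compact time intervals.  The latter is C times the integral of g against the local time, for all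
  t at once, because the occupation measure up to any t is almost surely absolutely continuous: the
  characteristic function of X_1 decays exponentially, hence P(|X_u - X_s| <= r) is at most
  K r |u - s|^(-1/alpha), and the expected occupation mass of pairs at distance at most r is O(r).
*)
theory Submission
  imports Defs "HOL-Library.Diagonal_Subsequence"
begin

section \<open>Alternation counts\<close>

text \<open>Crossings are defined by iterated hitting times on a real interval, where neither
  measurability in \<omega> nor comparison with a sampled path is visible. The counts are therefore
  recast as the largest number of alternations between two predicates along a linearly ordered index
  set: one notion for real times, for countable dense sets and for the indices of a walk.

  Probability is done on the space of i.i.d. sequences of dyadic increments, with monotone
  convergence in the mesh. No strong Markov property is invoked: events are split by the index of
  the first exit, and the sequence is cut at that fixed index.

  The condition \<alpha> > 1 enters through the first moment of X_1, through c^(\<alpha>-1) tending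
  to 0, which removes the boundedly many crossings per level far from the current value, through the
  integrability of |u-s|^(-1/\<alpha>), and through 2^(1/\<alpha>) < 2, which rules out a constant
  X_1.

  Where no local time exists it is 0 by convention, so the weak deviation is a supremum over
  uncountably many times of a function with a possible switch; its measurability needs an argument
  of its own.\<close>

primrec alternates :: "('i::linorder \<Rightarrow> bool) \<Rightarrow> ('i \<Rightarrow> bool) \<Rightarrow> nat \<Rightarrow> 'i set \<Rightarrow> bool" where
  "alternates H L 0 = (\<lambda>S. True)"
| "alternates H L (Suc n) =
     (\<lambda>S. \<exists>s\<in>S. \<exists>u\<in>S. s \<le> u \<and> H s \<and> L u \<and> alternates H L n (S \<inter> {..s}))"

text \<open>A chain for \<open>alternates\<close> is s_1 \<le> u_1 \<le> s_2 \<le> ... \<le> u_n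
  with \<open>H\<close> at the s_i and \<open>L\<close> at the u_i. Its last pair is peeled off
  first, as crossing times append a pair at the end. The supremum lives in \<open>ennreal\<close>,
  so it exists before finiteness is known and can be integrated over levels.\<close>

definition alt_count :: "('i::linorder \<Rightarrow> bool) \<Rightarrow> ('i \<Rightarrow> bool) \<Rightarrow> 'i set \<Rightarrow> ennreal" where
  "alt_count H L S = (SUP n. if alternates H L n S then of_nat n else 0)"

lemma alternates_SucI:
  "s \<in> S \<Longrightarrow> u \<in> S \<Longrightarrow> s \<le> u \<Longrightarrow> H s \<Longrightarrow> L u \<Longrightarrow> alternates H L n (S \<inter> {..s}) \<Longrightarrow>
     alternates H L (Suc n) S"
  unfolding alternates.simps by blast

lemma alternates_mono:
  assumes "alternates H L n S" "S \<subseteq> S'" "\<And>s. s \<in> S \<Longrightarrow> H s \<Longrightarrow> H' s" "\<And>s. s \<in> S \<Longrightarrow> L s \<Longrightarrow> L' s"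
  shows "alternates H' L' n S'"
  using assms
proof (induction n arbitrary: S S')
  case (Suc n)
  from Suc.prems(1) obtain s u where su: "s \<in> S" "u \<in> S" "s \<le> u" "H s" "L u"
    "alternates H L n (S \<inter> {..s})" by auto
  have "alternates H' L' n (S' \<inter> {..s})"
    by (rule Suc.IH[OF su(6)]) (use Suc.prems in auto)
  then show ?case by (rule alternates_SucI[rotated 5]) (use su Suc.prems in auto)
qed simp

lemma alt_count_le_iff: "alt_count H L S \<le> C \<longleftrightarrow> (\<forall>n. alternates H L n S \<longrightarrow> of_nat n \<le> C)"
  unfolding alt_count_def SUP_le_iff by (auto split: if_splits)

lemma of_nat_le_alt_count: "alternates H L n S \<Longrightarrow> of_nat n \<le> alt_count H L S"
  unfolding alt_count_def by (rule SUP_upper2[of n]) auto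

lemma alt_count_mono:
  assumes "S \<subseteq> S'" "\<And>s. s \<in> S \<Longrightarrow> H s \<Longrightarrow> H' s" "\<And>s. s \<in> S \<Longrightarrow> L s \<Longrightarrow> L' s"
  shows "alt_count H L S \<le> alt_count H' L' S'"
  unfolding alt_count_le_iff
  by (intro allI impI of_nat_le_alt_count) (erule alternates_mono, (use assms in auto))

lemma alternates_Un:
  assumes "alternates H L n S1" "alternates H L m S2" "\<And>s u. s \<in> S1 \<Longrightarrow> u \<in> S2 \<Longrightarrow> s \<le> u"
  shows "alternates H L (n + m) (S1 \<union> S2)"
  using assms(2,3)
proof (induction m arbitrary: S2)
  case 0
  then show ?case using assms(1) by (auto intro: alternates_mono)
next
  case (Suc m)
  from Suc.prems(1) obtain s u where su: "s \<in> S2" "u \<in> S2" "s \<le> u" "H s" "L u"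
    "alternates H L m (S2 \<inter> {..s})" by auto
  have "alternates H L (n + m) (S1 \<union> (S2 \<inter> {..s}))"
    by (rule Suc.IH[OF su(6)]) (use Suc.prems in auto)
  then have "alternates H L (n + m) ((S1 \<union> S2) \<inter> {..s})"
    by (rule alternates_mono) (use Suc.prems su in auto)
  then show ?case using su by auto
qed

lemma alt_count_Un_ge:
  assumes "\<And>s u. s \<in> S1 \<Longrightarrow> u \<in> S2 \<Longrightarrow> s \<le> u"
  shows "alt_count H L S1 + alt_count H L S2 \<le> alt_count H L (S1 \<union> S2)"
proof -
  have 1: "of_nat n + alt_count H L S2 \<le> alt_count H L (S1 \<union> S2)" if n: "alternates H L n S1" for n
  proof -
    have "of_nat n + alt_count H L S2
      = (SUP m. of_nat n + (if alternates H L m S2 then of_nat m else 0))"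
      unfolding alt_count_def by (rule ennreal_SUP_add_right) simp
    also have "\<dots> \<le> alt_count H L (S1 \<union> S2)"
    proof (rule SUP_least)
      fix m
      have "of_nat (n + m) \<le> alt_count H L (S1 \<union> S2)" if "alternates H L m S2"
        by (rule of_nat_le_alt_count) (rule alternates_Un[OF n that assms])
      moreover have "of_nat n \<le> alt_count H L (S1 \<union> S2)"
        by (rule of_nat_le_alt_count) (rule alternates_mono[OF n], auto)
      ultimately show "of_nat n + (if alternates H L m S2 then of_nat m else 0)
          \<le> alt_count H L (S1 \<union> S2)" by auto
    qed
    finally show ?thesis .
  qed
  have "alt_count H L S1 + alt_count H L S2
      = (SUP n. (if alternates H L n S1 then of_nat n else 0) + alt_count H L S2)"
    unfolding alt_count_def by (rule ennreal_SUP_add_left[symmetric]) simp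
  also have "\<dots> \<le> alt_count H L (S1 \<union> S2)"
  proof (rule SUP_least)
    fix n
    show "(if alternates H L n S1 then of_nat n else 0) + alt_count H L S2
        \<le> alt_count H L (S1 \<union> S2)"
      using 1[of n] 1[of 0] by auto
  qed
  finally show ?thesis .
qed

text \<open>At most one pair of a chain straddles the cut, starting in \<open>S1\<close> and ending
  in \<open>S2\<close>. That pair is given up, whence the +1.\<close>

lemma alternates_Un_split:
  assumes "alternates H L k (S1 \<union> S2)" "\<And>s u. s \<in> S1 \<Longrightarrow> u \<in> S2 \<Longrightarrow> s < u"
  shows "\<exists>n m. alternates H L n S1 \<and> alternates H L m S2 \<and> k \<le> n + m + 1"
  using assms
proof (induction k arbitrary: S1 S2)
  case 0
  then show ?case by (intro exI[of _ 0]) auto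
next
  case (Suc k)
  from Suc.prems(1) obtain s u where su: "s \<in> S1 \<union> S2" "u \<in> S1 \<union> S2" "s \<le> u" "H s" "L u"
    and r: "alternates H L k ((S1 \<union> S2) \<inter> {..s})" by auto
  show ?case
  proof (cases "s \<in> S1")
    case True
    have r1: "alternates H L k (S1 \<inter> {..s})"
      by (rule alternates_mono[OF r]) (use True Suc.prems(2) in fastforce)+
    show ?thesis
    proof (cases "u \<in> S1")
      case u: True
      then have "alternates H L (Suc k) S1" using r1 su True by auto
      then show ?thesis by (intro exI[of _ "Suc k"] exI[of _ 0]) auto
    next
      case False
      have "alternates H L k S1" by (rule alternates_mono[OF r1]) auto
      then show ?thesis by (intro exI[of _ "k"] exI[of _ 0]) auto
    qed
  next
    case False
    then have s2: "s \<in> S2" "u \<in> S2" using su Suc.prems(2) by (auto simp: not_less[symmetric])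
    have "alternates H L k ((S1 \<inter> {..s}) \<union> (S2 \<inter> {..s}))"
      by (rule alternates_mono[OF r]) auto
    from Suc.IH[OF this] Suc.prems(2) obtain n m where
      nm: "alternates H L n (S1 \<inter> {..s})" "alternates H L m (S2 \<inter> {..s})" "k \<le> n + m + 1" by auto
    have "alternates H L n S1" by (rule alternates_mono[OF nm(1)]) auto
    moreover have "alternates H L (Suc m) S2" using s2 su nm by auto
    ultimately show ?thesis using nm(3) by (intro exI[of _ n] exI[of _ "Suc m"]) auto
  qed
qed

lemma alt_count_Un_le:
  assumes "\<And>s u. s \<in> S1 \<Longrightarrow> u \<in> S2 \<Longrightarrow> s < u"
  shows "alt_count H L (S1 \<union> S2) \<le> alt_count H L S1 + alt_count H L S2 + 1"
  unfolding alt_count_le_iff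
proof (intro allI impI)
  fix k assume "alternates H L k (S1 \<union> S2)"
  from alternates_Un_split[OF this assms] obtain n m where
    nm: "alternates H L n S1" "alternates H L m S2" "k \<le> n + m + 1" by blast
  have "(of_nat k :: ennreal) \<le> of_nat (n + m + 1)" using nm(3) by (rule of_nat_mono)
  also have "\<dots> = of_nat n + of_nat m + 1" by simp
  also have "\<dots> \<le> alt_count H L S1 + alt_count H L S2 + 1"
    using nm by (intro add_mono of_nat_le_alt_count) auto
  finally show "of_nat k \<le> alt_count H L S1 + alt_count H L S2 + 1" .
qed

text \<open>Nothing is lost when the cut is made at a time where \<open>H\<close> or
  \<open>L\<close> holds: a straddling pair (s,u) is replaced by (t,u) if \<open>H t\<close> and by
  (s,t) if \<open>L t\<close>.\<close>

lemma alternates_split_at: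
  assumes "alternates H L k S" "t \<in> S" "H t \<or> L t"
  shows "\<exists>n m. alternates H L n (S \<inter> {..t}) \<and> alternates H L m (S \<inter> {t..}) \<and> k \<le> n + m"
  using assms(1,2)
proof (induction k arbitrary: S)
  case 0
  then show ?case by (intro exI[of _ 0]) auto
next
  case (Suc k)
  from Suc.prems(1) obtain s u where su: "s \<in> S" "u \<in> S" "s \<le> u" "H s" "L u"
    and r: "alternates H L k (S \<inter> {..s})" by auto
  show ?case
  proof (cases "t \<le> s")
    case True
    then have "t \<in> S \<inter> {..s}" using Suc.prems by auto
    from Suc.IH[OF r this] obtain n m where nm: "alternates H L n (S \<inter> {..s} \<inter> {..t})"
      "alternates H L m (S \<inter> {..s} \<inter> {t..})" "k \<le> n + m" by blast
    have "alternates H L n (S \<inter> {..t})" by (rule alternates_mono[OF nm(1)]) auto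
    moreover have "alternates H L m (S \<inter> {t..} \<inter> {..s})" by (rule alternates_mono[OF nm(2)]) auto
    then have "alternates H L (Suc m) (S \<inter> {t..})"
      by (rule alternates_SucI[rotated 5]) (use su True in auto)
    ultimately show ?thesis using nm(3) by (intro exI[of _ n] exI[of _ "Suc m"]) auto
  next
    case False
    then have st: "s < t" by simp
    have r1: "alternates H L k (S \<inter> {..t} \<inter> {..s})" by (rule alternates_mono[OF r]) (use st in auto)
    have r2: "alternates H L k (S \<inter> {..t})" by (rule alternates_mono[OF r]) (use st in auto)
    consider "u \<le> t" | "u > t" "H t" | "L t" using assms(3) by fastforce
    then show ?thesis
    proof cases
      case 1
      then have "alternates H L (Suc k) (S \<inter> {..t})" using su r1 st by auto
      then show ?thesis by (intro exI[of _ "Suc k"] exI[of _ 0]) auto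
    next
      case 2
      then have "alternates H L (Suc 0) (S \<inter> {t..})"
        by (intro alternates_SucI[of t _ u]) (use su Suc.prems(2) in auto)
      with r2 show ?thesis by (intro exI[of _ k] exI[of _ "Suc 0"]) auto
    next
      case 3
      then have "alternates H L (Suc k) (S \<inter> {..t})"
        by (intro alternates_SucI[of s _ t]) (use su r1 st Suc.prems(2) in auto)
      then show ?thesis by (intro exI[of _ "Suc k"] exI[of _ 0]) auto
    qed
  qed
qed

lemma alt_count_split_at_le:
  assumes "t \<in> S" "H t \<or> L t"
  shows "alt_count H L S \<le> alt_count H L (S \<inter> {..t}) + alt_count H L (S \<inter> {t..})"
  unfolding alt_count_le_iff
proof (intro allI impI)
  fix k assume "alternates H L k S"
  from alternates_split_at[OF this assms] obtain n m where
    nm: "alternates H L n (S \<inter> {..t})" "alternates H L m (S \<inter> {t..})" "k \<le> n + m" by blast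
  have "(of_nat k :: ennreal) \<le> of_nat (n + m)" using nm(3) by (rule of_nat_mono)
  also have "\<dots> = of_nat n + of_nat m" by simp
  also have "\<dots> \<le> alt_count H L (S \<inter> {..t}) + alt_count H L (S \<inter> {t..})"
    using nm by (intro add_mono of_nat_le_alt_count) auto
  finally show "of_nat k \<le> alt_count H L (S \<inter> {..t}) + alt_count H L (S \<inter> {t..})" .
qed

lemma alt_count_split_at_le_Suc:
  assumes "\<And>s. \<not> (H s \<and> L s)"
  shows "alt_count H L S \<le> alt_count H L (S \<inter> {..t}) + alt_count H L (S \<inter> {t..}) + 1"
proof -
  have "S = (S \<inter> {..t}) \<union> (S \<inter> {t<..})" by auto
  then have "alt_count H L S \<le> alt_count H L (S \<inter> {..t}) + alt_count H L (S \<inter> {t<..}) + 1"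
    by (metis (no_types, lifting) IntE alt_count_Un_le atMost_iff greaterThan_iff order_le_less_trans)
  also have "\<dots> \<le> alt_count H L (S \<inter> {..t}) + alt_count H L (S \<inter> {t..}) + 1"
    by (intro add_mono alt_count_mono order_refl) auto
  finally show ?thesis .
qed

lemma alternates_image:
  assumes "strict_mono_on S \<phi>"
  shows "alternates H L n (\<phi> ` S) \<longleftrightarrow> alternates (\<lambda>s. H (\<phi> s)) (\<lambda>s. L (\<phi> s)) n S"
  using assms
proof (induction n arbitrary: S)
  case (Suc n)
  have le: "\<phi> s \<le> \<phi> u \<longleftrightarrow> s \<le> u" if "s \<in> S" "u \<in> S" for s u
    using Suc.prems that by (simp add: strict_mono_on_less_eq)
  have "\<phi> ` S \<inter> {..\<phi> s} = \<phi> ` (S \<inter> {..s})" if "s \<in> S" for s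
    using le that by auto
  moreover have "strict_mono_on (S \<inter> {..s}) \<phi>" for s
    using Suc.prems by (auto simp: strict_mono_on_def)
  ultimately show ?case using Suc.IH le by auto
qed simp

lemma alt_count_image:
  "strict_mono_on S \<phi> \<Longrightarrow>
     alt_count H L (\<phi> ` S) = alt_count (\<lambda>s. H (\<phi> s)) (\<lambda>s. L (\<phi> s)) S"
  unfolding alt_count_def by (simp add: alternates_image)

text \<open>A chain has finitely many members, so it lies in one set of the increasing
  sequence.\<close>

lemma alternates_UN:
  fixes S :: "nat \<Rightarrow> 'i::linorder set"
  assumes "alternates H L n (\<Union>k. S k)" "incseq S"
  shows "\<exists>k. alternates H L n (S k)"
proof -
  \<comment> \<open>Relativised to an arbitrary \<open>A\<close>, since the induction hypothesis is
    applied below the point \<open>s\<close>.\<close>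
  have "\<exists>k. alternates H L n (S k \<inter> A)" if "alternates H L n ((\<Union>k. S k) \<inter> A)" for A
    using that
  proof (induction n arbitrary: A)
    case (Suc n)
    then obtain s u where su: "s \<in> (\<Union>k. S k) \<inter> A" "u \<in> (\<Union>k. S k) \<inter> A" "s \<le> u" "H s" "L u"
      and r: "alternates H L n ((\<Union>k. S k) \<inter> (A \<inter> {..s}))" by (auto simp: Int_assoc)
    from Suc.IH[OF r] obtain k where k: "alternates H L n (S k \<inter> (A \<inter> {..s}))" by blast
    obtain i j where ij: "s \<in> S i" "u \<in> S j" using su by auto
    define m where "m = max k (max i j)"
    have sub: "S k \<subseteq> S m" "S i \<subseteq> S m" "S j \<subseteq> S m"
      using assms(2) by (auto simp: m_def incseq_def max_def)
    have "alternates H L n (S m \<inter> A \<inter> {..s})"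
      by (rule alternates_mono[OF k]) (use sub in auto)
    then have "alternates H L (Suc n) (S m \<inter> A)"
      by (intro alternates_SucI[of s _ u]) (use su ij sub in auto)
    then show ?case by blast
  qed simp
  from this[of UNIV] assms(1) show ?thesis by simp
qed

lemma alt_count_UN:
  fixes S :: "nat \<Rightarrow> 'i::linorder set"
  assumes "incseq S"
  shows "alt_count H L (\<Union>k. S k) = (SUP k. alt_count H L (S k))"
proof (rule antisym)
  show "alt_count H L (\<Union>k. S k) \<le> (SUP k. alt_count H L (S k))"
    unfolding alt_count_le_iff
  proof (intro allI impI)
    fix n assume "alternates H L n (\<Union>k. S k)"
    from alternates_UN[OF this assms] obtain k where "alternates H L n (S k)" ..
    then show "of_nat n \<le> (SUP k. alt_count H L (S k))"
      by (intro SUP_upper2[of k] of_nat_le_alt_count) auto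
  qed
  show "(SUP k. alt_count H L (S k)) \<le> alt_count H L (\<Union>k. S k)"
    by (intro SUP_least alt_count_mono) auto
qed

lemma pred_Bex_countable:
  assumes "countable S" "\<And>s. s \<in> S \<Longrightarrow> Measurable.pred N (\<lambda>w. P w s)"
  shows "Measurable.pred N (\<lambda>w. \<exists>s\<in>S. P w s)"
proof -
  have "{w \<in> space N. \<exists>s\<in>S. P w s} = (\<Union>s\<in>S. {w \<in> space N. P w s})" by auto
  also have "\<dots> \<in> sets N" using assms by (intro sets.countable_UN') (auto simp: pred_def)
  finally show ?thesis by (simp add: pred_def)
qed

lemma alternates_measurable:
  assumes "countable S" "\<And>s. s \<in> S \<Longrightarrow> Measurable.pred N (\<lambda>w. H w s)"
    "\<And>s. s \<in> S \<Longrightarrow> Measurable.pred N (\<lambda>w. L w s)"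
  shows "Measurable.pred N (\<lambda>w. alternates (H w) (L w) n S)"
  using assms
proof (induction n arbitrary: S)
  case (Suc n)
  have "Measurable.pred N (\<lambda>w. alternates (H w) (L w) n (S \<inter> {..s}))" for s
    by (rule Suc.IH) (use Suc.prems in auto)
  note [measurable] = this Suc.prems(2,3)
  show ?case
    unfolding alternates.simps
    by (intro pred_Bex_countable[OF Suc.prems(1)] pred_intros_logic) measurable
qed simp

lemma alt_count_measurable:
  assumes "countable S" "\<And>s. s \<in> S \<Longrightarrow> Measurable.pred N (\<lambda>w. H w s)"
    "\<And>s. s \<in> S \<Longrightarrow> Measurable.pred N (\<lambda>w. L w s)"
  shows "(\<lambda>w. alt_count (H w) (L w) S) \<in> borel_measurable N"
proof -
  note [measurable] = alternates_measurable[OF assms]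
  show ?thesis unfolding alt_count_def by measurable
qed

lemma alt_count_eq_0: "(\<And>s u. s \<in> S \<Longrightarrow> u \<in> S \<Longrightarrow> H s \<Longrightarrow> L u \<Longrightarrow> s \<le> u \<Longrightarrow> False) \<Longrightarrow> alt_count H L S = 0"
proof -
  assume *: "\<And>s u. s \<in> S \<Longrightarrow> u \<in> S \<Longrightarrow> H s \<Longrightarrow> L u \<Longrightarrow> s \<le> u \<Longrightarrow> False"
  have "alt_count H L S \<le> 0" unfolding alt_count_le_iff
  proof (intro allI impI)
    fix n assume "alternates H L n S"
    then have "n = 0" using * by (cases n) auto
    then show "of_nat n \<le> (0::ennreal)" by simp
  qed
  then show ?thesis by simp
qed

section \<open>Crossings of cadlag paths\<close>

lemma cadlag_right_nhds:
  assumes "cadlag x" "0 \<le> s" "open U" "x s \<in> U"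
  shows "\<exists>r>s. \<forall>v\<in>{s..<r}. x v \<in> U"
proof -
  have "(x \<longlongrightarrow> x s) (at_right s)" using assms by (auto simp: cadlag_def)
  from topological_tendstoD[OF this assms(3,4)] obtain r where "r > s" "\<And>v. s < v \<Longrightarrow> v < r \<Longrightarrow> x v \<in> U"
    unfolding eventually_at_right_field by auto
  then show ?thesis using assms(4) by (intro exI[of _ r]) (force simp: le_less)
qed

lemma cadlag_left_osc:
  assumes "cadlag x" "0 < s" "e > 0"
  shows "\<exists>r<s. 0 \<le> r \<and> (\<forall>v\<in>{r..<s}. \<forall>w\<in>{r..<s}. \<bar>x v - x w\<bar> < e)"
proof -
  obtain l where "(x \<longlongrightarrow> l) (at_left s)" using assms by (auto simp: cadlag_def)
  from tendstoD[OF this, of "e/2"] assms(3) obtain b where b: "b < s"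
    "\<And>v. b < v \<Longrightarrow> v < s \<Longrightarrow> dist (x v) l < e / 2"
    unfolding eventually_at_left_field by auto
  define r where "r = max 0 ((b + s) / 2)"
  have r: "r < s" "0 \<le> r" "b < r" using b(1) assms(2) by (auto simp: r_def max_def field_simps)
  have "\<bar>x v - x w\<bar> < e" if "v \<in> {r..<s}" "w \<in> {r..<s}" for v w
  proof -
    have "dist (x v) l < e / 2" "dist (x w) l < e / 2" using that b r by auto
    then show ?thesis unfolding dist_real_def by linarith
  qed
  with r show ?thesis by blast
qed

lemma cadlag_right_osc:
  assumes "cadlag x" "0 \<le> s" "e > 0"
  shows "\<exists>r>s. \<forall>v\<in>{s..<r}. \<forall>w\<in>{s..<r}. \<bar>x v - x w\<bar> < e"
proof -
  obtain r where r: "r > s" "\<forall>v\<in>{s..<r}. x v \<in> ball (x s) (e/2)"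
    using cadlag_right_nhds[OF assms(1,2), of "ball (x s) (e/2)"] assms(3) by auto
  have "\<bar>x v - x w\<bar> < e" if "v \<in> {s..<r}" "w \<in> {s..<r}" for v w
  proof -
    have "dist (x s) (x v) < e / 2" "dist (x s) (x w) < e / 2" using that r by auto
    then show ?thesis unfolding dist_real_def by linarith
  qed
  with r show ?thesis by blast
qed

text \<open>Compactness in the form suited to cadlag paths: every time has a left and a right
  neighbourhood on which the path oscillates by less than \<open>e\<close>, and
  \<open>Bolzano\<close> glues them. The step interval is half-open because the path may jump at its
  right end.\<close>

lemma cadlag_interval_induct [consumes 4, case_names refl trans step]:
  fixes P :: "real \<Rightarrow> real \<Rightarrow> bool"
  assumes "cadlag x" "0 \<le> a" "a \<le> b" "e > 0"
    and refl: "\<And>a. 0 \<le> a \<Longrightarrow> P a a"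
    and trans: "\<And>a b c. 0 \<le> a \<Longrightarrow> a \<le> b \<Longrightarrow> b \<le> c \<Longrightarrow> P a b \<Longrightarrow> P b c \<Longrightarrow> P a c"
    and step: "\<And>a b. 0 \<le> a \<Longrightarrow> a < b \<Longrightarrow>
      (\<And>v w. v \<in> {a..<b} \<Longrightarrow> w \<in> {a..<b} \<Longrightarrow> \<bar>x v - x w\<bar> < e) \<Longrightarrow> P a b"
  shows "P a b"
proof -
  have "0 \<le> a \<longrightarrow> P a b"
    using assms(3)
  proof (induction rule: Bolzano)
    case (trans a b c)
    then show ?case using assms(6)[of a b c] by auto
  next
    case (local s)
    then have s0: "0 \<le> s" using assms(2) by simp
    obtain r2 where r2: "r2 > s" "\<forall>v\<in>{s..<r2}. \<forall>w\<in>{s..<r2}. \<bar>x v - x w\<bar> < e"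
      using cadlag_right_osc[OF assms(1) s0 assms(4)] by blast
    have "\<exists>r<s. \<forall>v w. max 0 r \<le> v \<and> v < s \<longrightarrow> max 0 r \<le> w \<and> w < s \<longrightarrow> \<bar>x v - x w\<bar> < e"
    proof (cases "s = 0")
      case True then show ?thesis by (intro exI[of _ "-1"]) auto
    next
      case False
      then obtain r where "r<s" "0 \<le> r" "\<forall>v\<in>{r..<s}. \<forall>w\<in>{r..<s}. \<bar>x v - x w\<bar> < e"
        using cadlag_left_osc[OF assms(1) _ assms(4), of s] s0 by auto
      then show ?thesis by (intro exI[of _ r]) auto
    qed
    then obtain r1 where r1: "r1 < s"
      "\<And>v w. max 0 r1 \<le> v \<Longrightarrow> v < s \<Longrightarrow> max 0 r1 \<le> w \<Longrightarrow> w < s \<Longrightarrow> \<bar>x v - x w\<bar> < e" by blast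
    show ?case
    proof (intro exI[of _ "min (s - r1) (r2 - s)"] conjI allI impI)
      show "0 < min (s - r1) (r2 - s)" using r1 r2 by simp
      fix a b assume ab: "a \<le> s \<and> s \<le> b \<and> b - a < min (s - r1) (r2 - s)" and a0: "0 \<le> a"
      have "P a s"
      proof (cases "a = s")
        case True then show ?thesis using refl s0 by simp
      next
        case False
        then show ?thesis using ab a0 by (intro step) (auto intro!: r1(2))
      qed
      moreover have "P s b"
      proof (cases "b = s")
        case True then show ?thesis using refl s0 by simp
      next
        case False
        then show ?thesis using ab s0 r2 by (intro step) auto
      qed
      ultimately show "P a b" using ab a0 by (intro assms(6)[of a s b]) auto
    qed
  qed
  then show ?thesis using assms(2) by simp
qed

lemma cadlag_bounded:
  assumes "cadlag x" "0 \<le> t"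
  shows "\<exists>B. \<forall>v\<in>{0..t}. \<bar>x v\<bar> \<le> B"
  using assms(1) order_refl assms(2) zero_less_one
proof (induction rule: cadlag_interval_induct)
  case (trans a b c)
  then obtain B B' where "\<forall>v\<in>{a..b}. \<bar>x v\<bar> \<le> B" "\<forall>v\<in>{b..c}. \<bar>x v\<bar> \<le> B'" by blast
  then have "\<forall>v\<in>{a..c}. \<bar>x v\<bar> \<le> max B B'" by (auto simp: le_max_iff_disj)
  then show ?case by blast
next
  case (step a b)
  have "\<bar>x v\<bar> \<le> max (\<bar>x a\<bar> + 1) \<bar>x b\<bar>" if "v \<in> {a..b}" for v
  proof (cases "v = b")
    case False
    then have "\<bar>x v - x a\<bar> < 1" using step that by auto
    then show ?thesis by auto
  qed auto
  then show ?case by blast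
qed auto

text \<open>The bound is uniform in \<open>H\<close> and \<open>L\<close>, hence in the level. On a
  piece with oscillation below \<open>c\<close> no pair fits before the right end, and that end adds
  at most one.\<close>

lemma cadlag_count_bounded:
  assumes "cadlag x" "0 \<le> t" "c > 0"
  shows "\<exists>N. \<forall>H L. (\<forall>s u. H s \<longrightarrow> L u \<longrightarrow> c \<le> \<bar>x s - x u\<bar>) \<longrightarrow> alt_count H L {0..t} \<le> of_nat N"
  using assms(1) order_refl assms(2,3)
proof (induction rule: cadlag_interval_induct)
  case (refl a)
  show ?case
    by (intro exI[of _ 0] allI impI order_trans[OF eq_refl[OF alt_count_eq_0]])
      (use assms(3) in fastforce)+
next
  case (trans a b c')
  then obtain N1 N2 where N:
    "\<And>H L. (\<forall>s u. H s \<longrightarrow> L u \<longrightarrow> c \<le> \<bar>x s - x u\<bar>) \<Longrightarrow> alt_count H L {a..b} \<le> of_nat N1"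
    "\<And>H L. (\<forall>s u. H s \<longrightarrow> L u \<longrightarrow> c \<le> \<bar>x s - x u\<bar>) \<Longrightarrow> alt_count H L {b..c'} \<le> of_nat N2" by blast
  show ?case
  proof (intro exI[of _ "N1 + N2 + 1"] allI impI)
    fix H L assume HL: "\<forall>s u. H s \<longrightarrow> L u \<longrightarrow> c \<le> \<bar>x s - x u\<bar>"
    have "{a..c'} = {a..b} \<union> {b<..c'}" using trans by auto
    then have "alt_count H L {a..c'} \<le> alt_count H L {a..b} + alt_count H L {b<..c'} + 1"
      by (simp only:) (rule alt_count_Un_le, auto)
    also have "\<dots> \<le> of_nat N1 + of_nat N2 + 1"
      by (intro add_mono N(1)[OF HL] order_trans[OF alt_count_mono N(2)[OF HL]]) auto
    finally show "alt_count H L {a..c'} \<le> of_nat (N1 + N2 + 1)" by (simp add: ac_simps)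
  qed
next
  case (step a b)
  show ?case
  proof (intro exI[of _ 1] allI impI)
    fix H L assume HL: "\<forall>s u. H s \<longrightarrow> L u \<longrightarrow> c \<le> \<bar>x s - x u\<bar>"
    have "{a..b} = {a..<b} \<union> {b}" using step by auto
    then have "alt_count H L {a..b} \<le> alt_count H L {a..<b} + alt_count H L {b} + 1"
      by (simp only:) (rule alt_count_Un_le, auto)
    also have "alt_count H L {a..<b} = 0"
      by (rule alt_count_eq_0) (use HL step(3) in \<open>meson linorder_not_le\<close>)
    also have "alt_count H L {b} = 0"
      by (rule alt_count_eq_0) (use HL assms(3) in force)
    finally show "alt_count H L {a..b} \<le> of_nat 1" by simp
  qed
qed

section \<open>Hitting times and alternations\<close>

lemma hit_above_ge: "r \<le> hit_above y c x t r"
  unfolding hit_above_def by (auto intro: Inf_greatest)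

lemma hit_below_ge: "r \<le> hit_below y c x t r"
  unfolding hit_below_def by (auto intro: Inf_greatest)

text \<open>Right-continuity makes the infimum a minimum, since x \<ge> y + c/2 is a closed
  condition. The condition of \<open>hit_below\<close> is strict, and there the infimum may fail to
  be attained.\<close>

lemma hit_above_attained:
  assumes "cadlag x" "hit_above y c x t r \<le> ereal u" "0 \<le> r"
  shows "\<exists>s. hit_above y c x t r = ereal s \<and> r \<le> ereal s \<and> s \<le> t \<and> s \<le> u \<and> y + c/2 \<le> x s"
proof -
  let ?A = "{u. r \<le> ereal u \<and> u \<le> t \<and> x u \<ge> y + c / 2}"
  let ?h = "hit_above y c x t r"
  have ne: "?A \<noteq> {}"
  proof
    assume "?A = {}"
    then have "?h = \<infinity>" by (simp only: hit_above_def image_empty Inf_empty top_ereal_def)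
    with assms(2) show False by simp
  qed
  have ge: "r \<le> ?h" by (rule hit_above_ge)
  obtain s where s: "?h = ereal s" using ge assms(2,3) by (cases ?h) auto
  have s0: "0 \<le> s" using ge s assms(3) by (metis ereal_less_eq(5) order_trans)
  have lb: "s \<le> v" if "v \<in> ?A" for v
  proof -
    have "?h \<le> ereal v" unfolding hit_above_def using that by (intro Inf_lower) auto
    then show ?thesis using s by simp
  qed
  have "y + c/2 \<le> x s"
  proof (rule ccontr)
    assume "\<not> ?thesis"
    then have "x s \<in> {..<y + c/2}" by simp
    from cadlag_right_nhds[OF assms(1) s0 open_lessThan this]
    obtain v where v: "v > s" "\<forall>w\<in>{s..<v}. x w < y + c/2" by auto
    have "v \<le> w" if "w \<in> ?A" for w
      using lb[OF that] v that by (force simp: not_less[symmetric])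
    then have "ereal v \<le> ?h" unfolding hit_above_def by (auto intro!: Inf_greatest)
    with v s show False by simp
  qed
  moreover have "s \<le> t" using ne lb by force
  ultimately show ?thesis using s ge assms(2) by auto
qed

lemma crossing_time_nonneg: "0 \<le> crossing_time y c x 0 t n"
proof (induction n)
  case (Suc n)
  then show ?case unfolding crossing_time.simps
    by (rule order_trans[OF order_trans[OF _ hit_above_ge] hit_below_ge])
qed (simp add: zero_ereal_def)

lemma crossing_time_imp_alternates:
  assumes "cadlag x" "c > 0" "crossing_time y c x 0 t n \<le> ereal v" "v \<le> t" "0 \<le> v"
    "v = t \<or> y + c/2 \<le> x v"
  shows "alternates (\<lambda>s. y + c/2 \<le> x s) (\<lambda>s. x s < y - c/2) n ({0..t} \<inter> {..v})"
  using assms(3-6)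
proof (induction n arbitrary: v)
  case (Suc n)
  let ?r = "hit_above y c x t (crossing_time y c x 0 t n)"
  let ?A = "{u. ?r \<le> ereal u \<and> u \<le> t \<and> x u < y - c / 2}"
  have h: "Inf (ereal ` ?A) \<le> ereal v" using Suc.prems(1) by (simp add: hit_below_def)
  have "\<exists>u\<in>?A. u \<le> v"
  proof (rule ccontr)
    assume no: "\<not> (\<exists>u\<in>?A. u \<le> v)"
    with Suc.prems(3) have vt: "v < t"
    proof -
      have "?A \<noteq> {}"
      proof
        assume "?A = {}"
        with h show False by (simp only: image_empty Inf_empty top_ereal_def) simp
      qed
      with no show ?thesis by force
    qed
    then have "x v \<in> {y - c/2<..}" using Suc.prems(4) assms(2) by auto
    from cadlag_right_nhds[OF assms(1) Suc.prems(3) open_greaterThan this]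
    obtain w where w: "w > v" "\<forall>u\<in>{v..<w}. x u > y - c/2" by auto
    have "w \<le> u" if "u \<in> ?A" for u
    proof (rule ccontr)
      assume "\<not> w \<le> u"
      moreover have "\<not> u \<le> v" using no that by blast
      ultimately have "y - c/2 < x u" using w by auto
      then show False using that by auto
    qed
    then have "ereal w \<le> Inf (ereal ` ?A)" by (auto intro!: Inf_greatest)
    from order_trans[OF this h] w show False by simp
  qed
  then obtain u where u: "?r \<le> ereal u" "u \<le> t" "x u < y - c/2" "u \<le> v" by blast
  from hit_above_attained[OF assms(1) u(1) crossing_time_nonneg] obtain s where
    s: "crossing_time y c x 0 t n \<le> ereal s" "s \<le> t" "s \<le> u" "y + c/2 \<le> x s" by blast
  have s0: "0 \<le> s" using s(1) crossing_time_nonneg by (metis ereal_less_eq(5) order_trans)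
  have "alternates (\<lambda>s. y + c/2 \<le> x s) (\<lambda>s. x s < y - c/2) n ({0..t} \<inter> {..s})"
    using s s0 by (intro Suc.IH) auto
  then have "alternates (\<lambda>s. y + c/2 \<le> x s) (\<lambda>s. x s < y - c/2) n ({0..t} \<inter> {..v} \<inter> {..s})"
    by (rule alternates_mono) (use s u in auto)
  then show ?case
    by (intro alternates_SucI[of s _ u]) (use s u s0 in auto)
qed simp

lemma alternates_imp_crossing_time:
  assumes "alternates (\<lambda>s. y + c/2 \<le> x s) (\<lambda>s. x s < y - c/2) n ({0..t} \<inter> {..v})" "0 \<le> v"
  shows "crossing_time y c x 0 t n \<le> ereal v"
  using assms
proof (induction n arbitrary: v)
  case (Suc n)
  then obtain s u where su: "s \<in> {0..t} \<inter> {..v}" "u \<in> {0..t} \<inter> {..v}" "s \<le> u" "y + c/2 \<le> x s" "x u < y - c/2"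
    and r: "alternates (\<lambda>s. y + c/2 \<le> x s) (\<lambda>s. x s < y - c/2) n ({0..t} \<inter> {..v} \<inter> {..s})" by auto
  have "alternates (\<lambda>s. y + c/2 \<le> x s) (\<lambda>s. x s < y - c/2) n ({0..t} \<inter> {..s})"
    by (rule alternates_mono[OF r]) auto
  then have "crossing_time y c x 0 t n \<le> ereal s" using Suc.IH su by auto
  then have "hit_above y c x t (crossing_time y c x 0 t n) \<le> ereal s"
    unfolding hit_above_def by (intro Inf_lower) (use su in auto)
  then have "hit_above y c x t (crossing_time y c x 0 t n) \<le> ereal u"
    by (rule order_trans) (use su(3) in simp)
  then have "crossing_time y c x 0 t (Suc n) \<le> ereal u"
    unfolding crossing_time.simps hit_below_def by (intro Inf_lower) (use su in auto)
  then show ?case by (rule order_trans) (use su in simp)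
qed simp

lemma crossing_time_le_iff:
  assumes "cadlag x" "c > 0" "0 \<le> t"
  shows "crossing_time y c x 0 t n \<le> ereal t \<longleftrightarrow>
     alternates (\<lambda>s. y + c/2 \<le> x s) (\<lambda>s. x s < y - c/2) n {0..t}"
proof -
  have "{0..t} \<inter> {..t} = {0..t}" by auto
  then show ?thesis
    using crossing_time_imp_alternates[OF assms(1,2), of y t n t]
      alternates_imp_crossing_time[of y c x n t t] assms(3) by auto
qed

text \<open>The uniform bound on alternations makes the set under \<open>Max\<close> finite, so that
  \<open>Max\<close> is a genuine maximum and agrees with the supremum.\<close>

lemma of_nat_downcrossings:
  assumes "cadlag x" "c > 0" "0 \<le> t"
  shows "of_nat (downcrossings y c x 0 t) =
    alt_count (\<lambda>s. y + c/2 \<le> x s) (\<lambda>s. x s < y - c/2) {0..t}"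
proof -
  let ?a = "\<lambda>n. alternates (\<lambda>s. y + c/2 \<le> x s) (\<lambda>s. x s < y - c/2) n {0..t}"
  obtain N where N: "\<And>H L. (\<forall>s u. H s \<longrightarrow> L u \<longrightarrow> c \<le> \<bar>x s - x u\<bar>) \<Longrightarrow> alt_count H L {0..t} \<le> of_nat N"
    using cadlag_count_bounded[OF assms(1,3,2)] by blast
  have "n \<le> N" if "?a n" for n
  proof -
    have "(of_nat n :: ennreal) \<le> of_nat N"
    proof (rule order_trans[OF of_nat_le_alt_count[OF that] N], intro allI impI)
      fix s u assume "y + c/2 \<le> x s" "x u < y - c/2"
      then show "c \<le> \<bar>x s - x u\<bar>" by linarith
    qed
    then show ?thesis by simp
  qed
  then have "{n. ?a n} \<subseteq> {..N}" by blast
  then have fin: "finite {n. ?a n}" by (rule finite_subset) simp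
  have "0 \<in> {n. ?a n}" by simp
  then have ne: "{n. ?a n} \<noteq> {}" by blast
  define m where "m = Max {n. ?a n}"
  have m: "?a m" using Max_in[OF fin ne] unfolding m_def by blast
  have "n \<le> m" if "?a n" for n unfolding m_def by (rule Max_ge[OF fin]) (use that in blast)
  then have "of_nat m = alt_count (\<lambda>s. y + c/2 \<le> x s) (\<lambda>s. x s < y - c/2) {0..t}"
    by (intro antisym of_nat_le_alt_count m) (auto simp: alt_count_le_iff simp del: alternates.simps)
  then show ?thesis
    unfolding downcrossings_def crossing_time_le_iff[OF assms] m_def .
qed

lemma cadlag_minus: "cadlag x \<Longrightarrow> cadlag (\<lambda>t. - x t)"
  unfolding cadlag_def
proof (intro conjI allI impI)
  assume x: "(\<forall>t\<ge>0. (x \<longlongrightarrow> x t) (at_right t)) \<and> (\<forall>t>0. \<exists>l. (x \<longlongrightarrow> l) (at_left t))"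
  show "((\<lambda>t. - x t) \<longlongrightarrow> - x t) (at_right t)" if "0 \<le> t" for t
    using x that by (intro tendsto_minus) auto
  fix t :: real assume "0 < t"
  with x obtain l where "(x \<longlongrightarrow> l) (at_left t)" by blast
  then have "((\<lambda>t. - x t) \<longlongrightarrow> - l) (at_left t)" by (rule tendsto_minus)
  then show "\<exists>l. ((\<lambda>t. - x t) \<longlongrightarrow> l) (at_left t)" by blast
qed

lemma of_nat_crossings:
  assumes "cadlag x" "c > 0" "0 \<le> t"
  shows "of_nat (crossings y c x 0 t) =
    alt_count (\<lambda>s. y + c/2 \<le> x s) (\<lambda>s. x s < y - c/2) {0..t} +
    alt_count (\<lambda>s. x s \<le> y - c/2) (\<lambda>s. y + c/2 < x s) {0..t}"
proof -
  have "(\<lambda>s. - y + c/2 \<le> - x s) = (\<lambda>s. x s \<le> y - c/2)" by (auto simp: fun_eq_iff)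
  moreover have "(\<lambda>s. - x s < - y - c/2) = (\<lambda>s. y + c/2 < x s)" by (auto simp: fun_eq_iff)
  ultimately show ?thesis
    using of_nat_downcrossings[OF assms, of y]
      of_nat_downcrossings[OF cadlag_minus[OF assms(1)] assms(2,3), of "-y"]
    by (simp add: crossings_def upcrossings_def add.commute)
qed

section \<open>Reduction to countably many times\<close>

definition dense_times :: "real set \<Rightarrow> real \<Rightarrow> bool" where
  "dense_times D t \<longleftrightarrow> countable D \<and> D \<subseteq> {0..t} \<and> 0 \<in> D \<and> t \<in> D \<and>
     (\<forall>a b. 0 \<le> a \<longrightarrow> a < b \<longrightarrow> b \<le> t \<longrightarrow> (\<exists>d\<in>D. a < d \<and> d < b))"

text \<open>A chain is moved into \<open>D\<close> pair by pair. A low point moves to a slightly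
  later time, as x < lo is an open condition, unless it is \<open>t\<close>, which belongs to
  \<open>D\<close>. A high point may satisfy x = hi exactly; this is why the countably many suprema
  of the path over intervals with ends in \<open>D\<close> are excluded as values of
  \<open>hi\<close>.\<close>

lemma alternates_dense:
  assumes "cadlag x" "dense_times D t" "lo < hi" "v \<le> t" "v = t \<or> hi \<le> x v"
    and notin: "\<And>p q. p \<in> D \<Longrightarrow> q \<in> D \<Longrightarrow> hi \<noteq> Sup (x ` {p..q})"
    and "alternates (\<lambda>s. hi \<le> x s) (\<lambda>s. x s < lo) n ({0..t} \<inter> {..v})" "0 \<le> v"
  shows "\<exists>w\<in>D. w \<le> v \<and> alternates (\<lambda>s. hi < x s) (\<lambda>s. x s < lo) n (D \<inter> {..w})"
  using assms(4,5,7,8)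
proof (induction n arbitrary: v)
  case 0
  then show ?case using assms(2) by (intro bexI[of _ 0]) (auto simp: dense_times_def)
next
  case (Suc n)
  have D: "D \<subseteq> {0..t}" "t \<in> D" "\<And>a b. 0 \<le> a \<Longrightarrow> a < b \<Longrightarrow> b \<le> t \<Longrightarrow> \<exists>d\<in>D. a < d \<and> d < b"
    using assms(2) unfolding dense_times_def by auto
  from Suc.prems(3) obtain s u where su: "s \<in> {0..t}" "s \<le> v" "u \<in> {0..t}" "u \<le> v" "s \<le> u" "hi \<le> x s" "x u < lo"
    and r: "alternates (\<lambda>s. hi \<le> x s) (\<lambda>s. x s < lo) n ({0..t} \<inter> {..v} \<inter> {..s})" by auto
  have "alternates (\<lambda>s. hi \<le> x s) (\<lambda>s. x s < lo) n ({0..t} \<inter> {..s})"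
    by (rule alternates_mono[OF r]) auto
  from Suc.IH[OF _ _ this] su obtain w where w: "w \<in> D" "w \<le> s"
    "alternates (\<lambda>s. hi < x s) (\<lambda>s. x s < lo) n (D \<inter> {..w})" by fastforce
  have "\<exists>u'\<in>D. u \<le> u' \<and> u' \<le> v \<and> x u' < lo"
  proof (cases "u = t")
    case True
    then show ?thesis using su D by auto
  next
    case False
    have "u \<noteq> v"
    proof
      assume "u = v"
      then have "hi \<le> x u" using False Suc.prems(2) by auto
      then show False using su(7) assms(3) by linarith
    qed
    then have uv: "u < v" using su by simp
    have "x u \<in> {..<lo}" using su by simp
    from cadlag_right_nhds[OF assms(1) _ open_lessThan this] su
    obtain r where r: "r > u" "\<forall>v\<in>{u..<r}. x v < lo" by auto
    have "0 \<le> u" "u < min r v" "min r v \<le> t" using uv r(1) su(3) Suc.prems(1) by auto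
    from D(3)[OF this] obtain d where "d \<in> D" "u < d" "d < min r v" by blast
    then show ?thesis using r by (intro bexI[of _ d]) auto
  qed
  then obtain u' where u': "u' \<in> D" "u \<le> u'" "u' \<le> v" "x u' < lo" by blast
  have "t \<ge> 0" using su by simp
  then obtain B where B: "\<forall>v\<in>{0..t}. \<bar>x v\<bar> \<le> B" using cadlag_bounded[OF assms(1)] by blast
  have "bdd_above (x ` {w..u'})"
  proof (rule bdd_aboveI[of _ B])
    fix z assume "z \<in> x ` {w..u'}"
    then obtain v where v: "z = x v" "w \<le> v" "v \<le> u'" by auto
    have "v \<in> {0..t}" using v w(1) u'(1) D(1) by fastforce
    then have "\<bar>x v\<bar> \<le> B" using B by blast
    then show "z \<le> B" using v by simp
  qed
  then have "x s \<le> Sup (x ` {w..u'})" using w u' su by (intro cSup_upper) auto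
  \<comment> \<open>The supremum differs from \<open>hi\<close>, hence exceeds it, so the strict
    inequality holds at some \<open>r\<close> in the interval, not necessarily at
    \<open>s\<close>.\<close>
  then have "hi < Sup (x ` {w..u'})" using su(6) notin[OF w(1) u'(1)] by linarith
  then obtain r where r: "r \<in> {w..u'}" "hi < x r"
    using less_cSupD[of "x ` {w..u'}" hi] w u' su by auto
  have "r < u'" using r u' assms(3) by (cases "r = u'") auto
  have "r \<ge> 0" using r D w by auto
  have "x r \<in> {hi<..}" using r by simp
  from cadlag_right_nhds[OF assms(1) \<open>r \<ge> 0\<close> open_greaterThan this]
  obtain r' where r': "r' > r" "\<forall>v\<in>{r..<r'}. hi < x v" by auto
  obtain s' where s': "s' \<in> D" "r < s'" "s' < min r' u'"
  proof -
    have "r < min r' u'" "min r' u' \<le> t" using \<open>r < u'\<close> r'(1) u'(3) Suc.prems(1) by auto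
    from D(3)[OF \<open>0 \<le> r\<close> this] show ?thesis using that by blast
  qed
  have "alternates (\<lambda>s. hi < x s) (\<lambda>s. x s < lo) n (D \<inter> {..u'} \<inter> {..s'})"
    by (rule alternates_mono[OF w(3)]) (use s' r in auto)
  then have "alternates (\<lambda>s. hi < x s) (\<lambda>s. x s < lo) (Suc n) (D \<inter> {..u'})"
    by (intro alternates_SucI[of s' _ u']) (use s' r' u' in auto)
  then show ?case using u' by blast
qed

lemma alt_count_dense:
  assumes "cadlag x" "dense_times D t" "lo < hi"
    and notin: "\<And>p q. p \<in> D \<Longrightarrow> q \<in> D \<Longrightarrow> hi \<noteq> Sup (x ` {p..q})"
  shows "alt_count (\<lambda>s. hi \<le> x s) (\<lambda>s. x s < lo) {0..t} = alt_count (\<lambda>s. hi < x s) (\<lambda>s. x s < lo) D"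
proof (rule antisym)
  have D: "D \<subseteq> {0..t}" "0 \<le> t" using assms(2) by (auto simp: dense_times_def)
  show "alt_count (\<lambda>s. hi < x s) (\<lambda>s. x s < lo) D \<le> alt_count (\<lambda>s. hi \<le> x s) (\<lambda>s. x s < lo) {0..t}"
    by (rule alt_count_mono) (use D in auto)
  show "alt_count (\<lambda>s. hi \<le> x s) (\<lambda>s. x s < lo) {0..t} \<le> alt_count (\<lambda>s. hi < x s) (\<lambda>s. x s < lo) D"
    unfolding alt_count_le_iff
  proof (intro allI impI)
    fix n assume "alternates (\<lambda>s. hi \<le> x s) (\<lambda>s. x s < lo) n {0..t}"
    moreover have "{0..t} \<inter> {..t} = {0..t}" by auto
    ultimately obtain w where "alternates (\<lambda>s. hi < x s) (\<lambda>s. x s < lo) n (D \<inter> {..w})"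
      using alternates_dense[OF assms(1-3) order_refl _ notin, of n] D by auto
    then have "alternates (\<lambda>s. hi < x s) (\<lambda>s. x s < lo) n D" by (rule alternates_mono) auto
    then show "of_nat n \<le> alt_count (\<lambda>s. hi < x s) (\<lambda>s. x s < lo) D" by (rule of_nat_le_alt_count)
  qed
qed

text \<open>All inequalities are strict, unlike those behind \<open>crossings\<close>: along a
  right-continuous path they survive a small shift of time to the right, which is what a dense time
  set needs. The two counts then differ at countably many levels only.\<close>

definition crossing_count :: "('i::linorder \<Rightarrow> real) \<Rightarrow> real \<Rightarrow> real \<Rightarrow> 'i set \<Rightarrow> ennreal" where
  "crossing_count x c y S =
     alt_count (\<lambda>s. y + c/2 < x s) (\<lambda>s. x s < y - c/2) S +
     alt_count (\<lambda>s. x s < y - c/2) (\<lambda>s. y + c/2 < x s) S"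

lemma crossings_eq_crossing_count:
  assumes "cadlag x" "c > 0" "dense_times D t"
  shows "\<exists>B. countable B \<and> (\<forall>y. y \<notin> B \<longrightarrow> of_nat (crossings y c x 0 t) = crossing_count x c y D)"
proof -
  have t: "0 \<le> t" "countable D" using assms(3) by (auto simp: dense_times_def)
  define B where "B = (\<lambda>(p,q). Sup (x ` {p..q}) - c/2) ` (D \<times> D) \<union>
    (\<lambda>(p,q). - Sup ((\<lambda>s. - x s) ` {p..q}) + c/2) ` (D \<times> D)"
  have "countable B" unfolding B_def using t by auto
  moreover have "of_nat (crossings y c x 0 t) = crossing_count x c y D" if "y \<notin> B" for y
  proof -
    have 1: "alt_count (\<lambda>s. y + c/2 \<le> x s) (\<lambda>s. x s < y - c/2) {0..t} =
       alt_count (\<lambda>s. y + c/2 < x s) (\<lambda>s. x s < y - c/2) D"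
      by (rule alt_count_dense[OF assms(1,3)]) (use that assms(2) in \<open>force simp: B_def\<close>)+
    have "alt_count (\<lambda>s. - y + c/2 \<le> - x s) (\<lambda>s. - x s < - y - c/2) {0..t} =
       alt_count (\<lambda>s. - y + c/2 < - x s) (\<lambda>s. - x s < - y - c/2) D"
      by (rule alt_count_dense[OF cadlag_minus[OF assms(1)] assms(3)])
        (use that assms(2) in \<open>force simp: B_def\<close>)+
    moreover have "(\<lambda>s. - y + c/2 \<le> - x s) = (\<lambda>s. x s \<le> y - c/2)"
      "(\<lambda>s. - x s < - y - c/2) = (\<lambda>s. y + c/2 < x s)"
      "(\<lambda>s. - y + c/2 < - x s) = (\<lambda>s. x s < y - c/2)" by (auto simp: fun_eq_iff)
    ultimately show ?thesis
      using 1 by (simp add: of_nat_crossings[OF assms(1,2) t(1)] crossing_count_def)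
  qed
  ultimately show ?thesis by blast
qed

section \<open>Truncated variation as crossing mass\<close>

lemma crossing_count_mono: "S \<subseteq> S' \<Longrightarrow> crossing_count x c y S \<le> crossing_count x c y S'"
  unfolding crossing_count_def by (intro add_mono alt_count_mono) auto

lemma crossing_count_Un_ge:
  assumes "\<And>s u. s \<in> S1 \<Longrightarrow> u \<in> S2 \<Longrightarrow> s \<le> u"
  shows "crossing_count x c y S1 + crossing_count x c y S2 \<le> crossing_count x c y (S1 \<union> S2)"
  using add_mono[OF alt_count_Un_ge[OF assms, of S1 S2 "\<lambda>s. y + c/2 < x s" "\<lambda>s. x s < y - c/2"]
      alt_count_Un_ge[OF assms, of S1 S2 "\<lambda>s. x s < y - c/2" "\<lambda>s. y + c/2 < x s"]]
  unfolding crossing_count_def by (simp add: ac_simps)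

text \<open>If x t lies outside the closed band of width \<open>c\<close> around \<open>y\<close>,
  one of the two predicates holds at \<open>t\<close> and cutting there is free. Inside the band
  each direction can lose one crossing. The levels concerned have total length \<open>c\<close>, so
  after integration a cut costs 2c.\<close>

lemma crossing_count_split_le:
  assumes "t \<in> S" "c > 0"
  shows "crossing_count x c y S \<le> crossing_count x c y (S \<inter> {..t}) + crossing_count x c y (S \<inter> {t..})
     + 2 * indicator {x t - c/2..x t + c/2} y"
proof -
  let ?H = "\<lambda>s. y + c/2 < x s" and ?L = "\<lambda>s. x s < y - c/2"
  let ?e = "indicator {x t - c/2..x t + c/2} y :: ennreal"
  have *: "alt_count H L S \<le> alt_count H L (S \<inter> {..t}) + alt_count H L (S \<inter> {t..}) + ?e"
    if HL: "(H = ?H \<and> L = ?L) \<or> (H = ?L \<and> L = ?H)" for H L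
  proof (cases "H t \<or> L t")
    case True
    have "alt_count H L S \<le> alt_count H L (S \<inter> {..t}) + alt_count H L (S \<inter> {t..})"
      using assms(1) True by (rule alt_count_split_at_le)
    then show ?thesis by (rule order_trans) simp
  next
    case False
    then have "?e = 1" using HL by (auto simp: indicator_def)
    moreover have "\<not> (H s \<and> L s)" for s using HL assms(2) by auto
    ultimately show ?thesis using alt_count_split_at_le_Suc[of H L S t] by simp
  qed
  from add_mono[OF *[of ?H ?L] *[of ?L ?H]] show ?thesis
    unfolding crossing_count_def mult_2 by (simp add: ac_simps)
qed

lemma crossing_count_UN:
  fixes S :: "nat \<Rightarrow> 'i::linorder set"
  assumes "incseq S"
  shows "crossing_count x c y (\<Union>k. S k) = (SUP k. crossing_count x c y (S k))"
  unfolding crossing_count_def alt_count_UN[OF assms]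
  by (rule ennreal_SUP_add[symmetric])
    (use assms in \<open>auto intro!: incseq_SucI alt_count_mono simp: incseq_Suc_iff\<close>)

lemma crossing_count_measurable:
  assumes "countable S" "\<And>s. s \<in> S \<Longrightarrow> (\<lambda>w. x w s) \<in> borel_measurable N" "h \<in> borel_measurable N"
  shows "(\<lambda>w. crossing_count (x w) c (h w) S) \<in> borel_measurable N"
proof -
  note [measurable] = assms(2,3)
  show ?thesis unfolding crossing_count_def
    by (intro borel_measurable_add alt_count_measurable assms(1)) measurable
qed

lemma crossing_count_affine:
  assumes "k > 0"
  shows "crossing_count (\<lambda>s. k * x s + a) (k * c) (k * y + a) S = crossing_count x c y S"
proof -
  have "k * y + a + k * c / 2 < k * v + a \<longleftrightarrow> k * (y + c/2) < k * v" for v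
    by (auto simp: field_simps)
  moreover have "k * v + a < k * y + a - k * c / 2 \<longleftrightarrow> k * v < k * (y - c/2)" for v
    by (auto simp: field_simps)
  ultimately show ?thesis unfolding crossing_count_def using assms by simp
qed

lemma crossing_count_image:
  "strict_mono_on S \<phi> \<Longrightarrow> crossing_count x c y (\<phi> ` S) = crossing_count (\<lambda>s. x (\<phi> s)) c y S"
  unfolding crossing_count_def by (simp add: alt_count_image)

lemma crossing_count_eq_0:
  assumes "\<And>s u. s \<in> S \<Longrightarrow> u \<in> S \<Longrightarrow> \<bar>x s - x u\<bar> \<le> c"
  shows "crossing_count x c y S = 0"
proof -
  have *: False if "s \<in> S" "u \<in> S" "y + c/2 < x s" "x u < y - c/2" for s u
    using assms[OF that(1,2)] that(3,4) by linarith
  have "alt_count (\<lambda>s. y + c/2 < x s) (\<lambda>s. x s < y - c/2) S = 0"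
    "alt_count (\<lambda>s. x s < y - c/2) (\<lambda>s. y + c/2 < x s) S = 0"
    by (rule alt_count_eq_0, use * in blast)+
  then show ?thesis by (simp add: crossing_count_def)
qed

text \<open>A Banach indicatrix with band width \<open>c\<close>. For a cadlag path and a countable
  dense set of times it equals the truncated variation (\<open>crossings_mass\<close>); unlike the
  latter it is visibly measurable and makes sense for walks.\<close>

definition crossing_mass :: "('i::linorder \<Rightarrow> real) \<Rightarrow> real \<Rightarrow> 'i set \<Rightarrow> ennreal" where
  "crossing_mass x c S = (\<integral>\<^sup>+y. crossing_count x c y S \<partial>lborel)"

lemma crossing_count_measurable_level:
  "countable S \<Longrightarrow> (\<lambda>y. crossing_count x c y S) \<in> borel_measurable borel"
  by (rule crossing_count_measurable) auto

lemma crossing_mass_mono: "S \<subseteq> S' \<Longrightarrow> crossing_mass x c S \<le> crossing_mass x c S'"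
  unfolding crossing_mass_def by (intro nn_integral_mono crossing_count_mono)

lemma crossing_mass_Un_ge:
  assumes "countable S1" "countable S2" "\<And>s u. s \<in> S1 \<Longrightarrow> u \<in> S2 \<Longrightarrow> s \<le> u"
  shows "crossing_mass x c S1 + crossing_mass x c S2 \<le> crossing_mass x c (S1 \<union> S2)"
proof -
  note [measurable] = crossing_count_measurable_level[OF assms(1)] crossing_count_measurable_level[OF assms(2)]
  show ?thesis unfolding crossing_mass_def
    by (subst nn_integral_add[symmetric]) (auto intro!: nn_integral_mono crossing_count_Un_ge assms(3))
qed

lemma crossing_mass_split_le:
  assumes "countable S" "t \<in> S" "c > 0"
  shows "crossing_mass x c S \<le> crossing_mass x c (S \<inter> {..t}) + crossing_mass x c (S \<inter> {t..}) + ennreal (2 * c)"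
proof -
  have m: "(\<lambda>y. crossing_count x c y (S \<inter> A)) \<in> borel_measurable borel" for A
    by (rule crossing_count_measurable_level) (use assms(1) in auto)
  note [measurable] = this[of "{..t}"] this[of "{t..}"]
  have "crossing_mass x c S \<le> (\<integral>\<^sup>+y. crossing_count x c y (S \<inter> {..t}) + crossing_count x c y (S \<inter> {t..})
     + 2 * indicator {x t - c/2..x t + c/2} y \<partial>lborel)"
    unfolding crossing_mass_def by (intro nn_integral_mono crossing_count_split_le assms)
  also have "\<dots> = crossing_mass x c (S \<inter> {..t}) + crossing_mass x c (S \<inter> {t..}) + 2 * ennreal c"
    unfolding crossing_mass_def using assms(3)
    by (simp add: nn_integral_add nn_integral_cmult)
  also have "2 * ennreal c = ennreal (2 * c)" using assms(3) by (simp add: ennreal_mult)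
  finally show ?thesis .
qed

lemma crossing_mass_UN:
  fixes S :: "nat \<Rightarrow> 'i::linorder set"
  assumes "incseq S" "\<And>k. countable (S k)"
  shows "crossing_mass x c (\<Union>k. S k) = (SUP k. crossing_mass x c (S k))"
  unfolding crossing_mass_def crossing_count_UN[OF assms(1)]
  by (rule nn_integral_monotone_convergence_SUP)
    (use assms in \<open>auto simp: incseq_def le_fun_def intro!: crossing_count_mono crossing_count_measurable_level\<close>)

lemma crossing_mass_affine:
  assumes "k > 0" "countable S"
  shows "crossing_mass (\<lambda>s. k * x s + a) (k * c) S = ennreal k * crossing_mass x c S"
proof -
  have "crossing_mass (\<lambda>s. k * x s + a) (k * c) S =
     ennreal \<bar>k\<bar> * (\<integral>\<^sup>+y. crossing_count (\<lambda>s. k * x s + a) (k * c) (a + k * y) S \<partial>lborel)"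
    unfolding crossing_mass_def
    by (rule nn_integral_real_affine) (use assms in \<open>auto intro!: crossing_count_measurable\<close>)
  also have "\<dots> = ennreal k * crossing_mass x c S"
    using crossing_count_affine[OF assms(1), of x a c _ S] assms(1)
    by (simp add: crossing_mass_def add.commute)
  finally show ?thesis .
qed

lemma crossing_mass_translate:
  "countable S \<Longrightarrow> crossing_mass (\<lambda>s. x s + a) c S = crossing_mass x c S"
  using crossing_mass_affine[of 1 S x a c] by simp

lemma crossing_mass_image:
  "strict_mono_on S \<phi> \<Longrightarrow> crossing_mass x c (\<phi> ` S) = crossing_mass (\<lambda>s. x (\<phi> s)) c S"
  unfolding crossing_mass_def by (simp add: crossing_count_image)

lemma crossing_mass_measurable:
  assumes "countable S" "\<And>s. s \<in> S \<Longrightarrow> (\<lambda>w. x w s) \<in> borel_measurable N"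
  shows "(\<lambda>w. crossing_mass (x w) c S) \<in> borel_measurable N"
  unfolding crossing_mass_def
proof (rule lborel.borel_measurable_nn_integral)
  have [measurable]: "(\<lambda>p. x (fst p) s) \<in> borel_measurable (N \<Otimes>\<^sub>M lborel)" if "s \<in> S" for s
    using measurable_compose[OF measurable_fst assms(2)[OF that]] .
  have "(\<lambda>p. crossing_count (x (fst p)) c (snd p) S) \<in> borel_measurable (N \<Otimes>\<^sub>M lborel)"
    by (rule crossing_count_measurable[OF assms(1)]) measurable
  then show "(\<lambda>(w, y). crossing_count (x w) c y S) \<in> borel_measurable (N \<Otimes>\<^sub>M lborel)"
    by (simp add: case_prod_beta)
qed

text \<open>A discrete form of the Skorokhod (play) operator: \<open>f\<close> stays within \<open>c/2\<close> of \<open>x\<close> and moves only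
  when it is pushed, so that each of its monotone runs is an increment of \<open>x\<close> shortened by \<open>c\<close>.\<close>

lemma play_operator:
  fixes x :: "nat \<Rightarrow> real" and W :: "nat \<Rightarrow> ennreal"
  assumes c: "c > 0"
    and W: "\<And>i j. i \<le> j \<Longrightarrow> j \<le> N \<Longrightarrow> c \<le> \<bar>x j - x i\<bar> \<Longrightarrow> W i + ennreal (\<bar>x j - x i\<bar> - c) \<le> W j"
  shows "(\<forall>j\<le>N. \<forall>k\<le>N. \<bar>x j - x k\<bar> \<le> c) \<or>
    (\<exists>f i j \<sigma>. (\<forall>k\<le>N. \<bar>x k - f k\<bar> \<le> c/2) \<and> i \<le> j \<and> j \<le> N \<and> (\<sigma> = 1 \<or> \<sigma> = - 1) \<and>
       \<sigma> * x j = \<sigma> * f N + c/2 \<and> c \<le> \<sigma> * (x j - x i) \<and>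
       ennreal (\<Sum>k<N. \<bar>f (Suc k) - f k\<bar>) \<le> W i + ennreal (\<sigma> * (x j - x i) - c))"
    (is "?A N \<or> (\<exists>f i j \<sigma>. ?B N f i j \<sigma>)")
  using W
\<comment> \<open>In the second alternative \<open>i\<close> is where the current monotone run began
  and \<open>j\<close> its latest extremum, reached in direction \<sigma>; \<open>f\<close> trails
  \<open>x j\<close> by c/2. Completed runs are charged to \<open>W\<close>, the current one is kept
  apart.\<close>
proof (induction N)
  case 0
  then show ?case using c by auto
next
  case (Suc N)
  from Suc.IH Suc.prems consider "?A N" | "\<exists>f i j \<sigma>. ?B N f i j \<sigma>" by force
  then show ?case
  proof cases
    case 1
    show ?thesis
    proof (cases "?A (Suc N)")
      case False
      then obtain m where m: "m \<le> N" "\<bar>x (Suc N) - x m\<bar> > c"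
        using 1 c by (auto simp: le_Suc_eq not_le abs_minus_commute)
      define \<sigma> :: real where "\<sigma> = (if x (Suc N) > x m then 1 else - 1)"
      have \<sigma>: "\<sigma> = 1 \<or> \<sigma> = -1" "\<sigma> * (x (Suc N) - x m) > c" using m by (auto simp: \<sigma>_def)
      \<comment> \<open>With \<open>i\<close> at the extremum opposite to the new move, the constant
        x i + \<sigma> c/2 stays within c/2 of all earlier values, because these differ from x i by
        at most c and lie on one side of it.\<close>
      have "\<exists>i. i \<in> {..N} \<and> (\<forall>k. k \<in> {..N} \<longrightarrow> \<sigma> * x i \<le> \<sigma> * x k)"
        using ex_min_if_finite[of "(\<lambda>k. \<sigma> * x k) ` {..N}"] by (auto simp: not_less)
      then obtain i where i: "i \<le> N" "\<And>k. k \<le> N \<Longrightarrow> \<sigma> * x i \<le> \<sigma> * x k" by auto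
      define f where "f k = (if k \<le> N then x i + \<sigma> * c/2 else x (Suc N) - \<sigma> * c/2)" for k
      have s2: "\<sigma> * \<sigma> = 1" using \<sigma>(1) by auto
      have big: "c < \<sigma> * (x (Suc N) - x i)" using i(2)[OF m(1)] \<sigma>(2) by (simp add: algebra_simps)
      have "\<bar>x k - f k\<bar> \<le> c/2" if "k \<le> Suc N" for k
      proof (cases "k \<le> N")
        case True
        then have "\<bar>x k - x i\<bar> \<le> c" "\<sigma> * x i \<le> \<sigma> * x k" using 1 i by auto
        then show ?thesis using \<sigma>(1) True by (auto simp: f_def abs_le_iff field_simps)
      next
        case False
        then show ?thesis using that \<sigma>(1) c by (auto simp: f_def le_Suc_eq abs_if)
      qed
      moreover have "(\<Sum>k<Suc N. \<bar>f (Suc k) - f k\<bar>) = \<sigma> * (x (Suc N) - x i) - c"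
      proof -
        have "(\<Sum>k<N. \<bar>f (Suc k) - f k\<bar>) = 0" by (intro sum.neutral) (auto simp: f_def)
        then have "(\<Sum>k<Suc N. \<bar>f (Suc k) - f k\<bar>) = \<bar>x (Suc N) - \<sigma> * c/2 - (x i + \<sigma> * c/2)\<bar>"
          by (simp add: f_def)
        also have "\<dots> = \<sigma> * (x (Suc N) - x i) - c" using \<sigma>(1) big by auto
        finally show ?thesis .
      qed
      moreover have "\<sigma> * x (Suc N) = \<sigma> * f (Suc N) + c/2" using s2 by (simp add: f_def algebra_simps)
      ultimately have "?B (Suc N) f i (Suc N) \<sigma>" using i(1) big \<sigma>(1) by auto
      then show ?thesis by blast
    qed simp
  next
    case 2
    then obtain f i j \<sigma> where f: "\<And>k. k \<le> N \<Longrightarrow> \<bar>x k - f k\<bar> \<le> c/2" and ij: "i \<le> j" "j \<le> N"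
      and \<sigma>: "\<sigma> = 1 \<or> \<sigma> = - 1" "\<sigma> * x j = \<sigma> * f N + c/2" "c \<le> \<sigma> * (x j - x i)"
      and le: "ennreal (\<Sum>k<N. \<bar>f (Suc k) - f k\<bar>) \<le> W i + ennreal (\<sigma> * (x j - x i) - c)" by blast
    have s2: "\<sigma> * \<sigma> = 1" using \<sigma>(1) by auto
    define S where "S = (\<Sum>k<N. \<bar>f (Suc k) - f k\<bar>)"
    have S0: "0 \<le> S" by (auto simp: S_def intro: sum_nonneg)
    have "\<bar>\<sigma> * (x j - x i)\<bar> = \<bar>x j - x i\<bar>" using \<sigma>(1) by auto
    then have "\<bar>x j - x i\<bar> = \<sigma> * (x j - x i)" using \<sigma>(3) c by linarith
    \<comment> \<open>The current run is closed by superadditivity of \<open>W\<close>; a change of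
      direction needs the bound in this form.\<close>
    then have WS: "ennreal S \<le> W j"
      using order_trans[OF le, of "W j"] Suc.prems[of i j] ij \<sigma>(3) by (simp add: S_def)
    show ?thesis
    proof (cases "\<bar>x (Suc N) - f N\<bar> \<le> c/2")
      case True
      define g where "g = f(Suc N := f N)"
      have "(\<Sum>k<Suc N. \<bar>g (Suc k) - g k\<bar>) = S"
        by (simp add: g_def S_def)
      then have "?B (Suc N) g i j \<sigma>"
        using f True ij \<sigma> le by (auto simp: g_def S_def le_Suc_eq)
      then show ?thesis by blast
    next
      case False
      define \<tau> :: real where "\<tau> = (if x (Suc N) > f N then 1 else - 1)"
      have \<tau>: "\<tau> = 1 \<or> \<tau> = -1" "\<tau> * (x (Suc N) - f N) > c/2" using False by (auto simp: \<tau>_def)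
      have t2: "\<tau> * \<tau> = 1" using \<tau>(1) by auto
      define g where "g = f(Suc N := x (Suc N) - \<tau> * c/2)"
      have gc: "\<bar>x k - g k\<bar> \<le> c/2" if "k \<le> Suc N" for k
        using that f[of k] \<tau>(1) c by (auto simp: g_def le_Suc_eq)
      have gN: "\<tau> * x (Suc N) = \<tau> * g (Suc N) + c/2"
        using t2 by (simp add: g_def algebra_simps)
      have "(\<Sum>k<N. \<bar>g (Suc k) - g k\<bar>) = S" by (simp add: g_def S_def)
      moreover have "\<bar>x (Suc N) - \<tau> * c/2 - f N\<bar> = \<tau> * (x (Suc N) - f N) - c/2" using \<tau> by auto
      ultimately have gS: "(\<Sum>k<Suc N. \<bar>g (Suc k) - g k\<bar>) = S + (\<tau> * (x (Suc N) - f N) - c/2)"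
        by (simp add: g_def)
      show ?thesis
      proof (cases "\<tau> = \<sigma>")
        case True
        \<comment> \<open>The run goes on: \<open>j\<close> advances to \<open>Suc N\<close> with
          \<open>i\<close> kept, and \<open>c\<close> is deducted once per run.\<close>
        have e: "\<sigma> * (x (Suc N) - x i) - c = (\<sigma> * (x j - x i) - c) + (\<sigma> * (x (Suc N) - f N) - c/2)"
          using \<sigma>(2) by (simp add: algebra_simps)
        have "ennreal (S + (\<tau> * (x (Suc N) - f N) - c/2))
          = ennreal S + ennreal (\<sigma> * (x (Suc N) - f N) - c/2)"
          using S0 \<tau>(2) True by (simp add: ennreal_plus[symmetric] del: ennreal_plus)
        also have "\<dots> \<le> (W i + ennreal (\<sigma> * (x j - x i) - c)) + ennreal (\<sigma> * (x (Suc N) - f N) - c/2)"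
          using le by (intro add_right_mono) (simp add: S_def)
        also have "\<dots> = W i + ennreal (\<sigma> * (x (Suc N) - x i) - c)"
          unfolding e add.assoc using \<sigma>(3) \<tau>(2) True by (subst ennreal_plus) auto
        finally have "ennreal (S + (\<tau> * (x (Suc N) - f N) - c/2)) \<le> W i + ennreal (\<sigma> * (x (Suc N) - x i) - c)" .
        moreover have "c \<le> \<sigma> * (x (Suc N) - x i)" using e \<sigma>(3) \<tau>(2)[unfolded True] by linarith
        ultimately have "?B (Suc N) g i (Suc N) \<sigma>"
          using gc ij gN gS \<sigma>(1) True by auto
        then show ?thesis by blast
      next
        case False
        then have ts: "\<tau> = - \<sigma>" using \<tau>(1) \<sigma>(1) by auto
        \<comment> \<open>The run turns: the new one starts at the old extremum \<open>j\<close>,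
          with the past charged to \<open>W j\<close>.\<close>
        have e: "\<tau> * (x (Suc N) - x j) - c = \<tau> * (x (Suc N) - f N) - c/2"
          using \<sigma>(2) ts by (simp add: algebra_simps)
        have "ennreal (S + (\<tau> * (x (Suc N) - f N) - c/2)) \<le> W j + ennreal (\<tau> * (x (Suc N) - x j) - c)"
          unfolding e using S0 \<tau>(2) WS by (simp add: ennreal_plus add_right_mono)
        moreover have "c \<le> \<tau> * (x (Suc N) - x j)" using e \<tau>(2) by linarith
        ultimately have "?B (Suc N) g j (Suc N) \<tau>"
          using gc ij gN gS \<tau>(1) by auto
        then show ?thesis by blast
      qed
    qed
  qed
qed

text \<open>The sequence never takes the value \<open>y\<close>, so each passage from above to below
  happens within a single step that jumps over \<open>y\<close>.\<close>

lemma alternates_le_level_crossings: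
  fixes f :: "nat \<Rightarrow> real"
  assumes "alternates (\<lambda>k. y < f k) (\<lambda>k. f k < y) n {..m}" "\<And>k. f k \<noteq> y"
  shows "of_nat n \<le> (\<Sum>k<m. indicator {f (Suc k)<..<f k} y :: ennreal)"
  using assms(1)
proof (induction n arbitrary: m)
  case (Suc n)
  then obtain s u where su: "s \<le> u" "u \<le> m" "y < f s" "f u < y"
    and r: "alternates (\<lambda>k. y < f k) (\<lambda>k. f k < y) n ({..m} \<inter> {..s})" by auto
  have r': "alternates (\<lambda>k. y < f k) (\<lambda>k. f k < y) n {..s}" by (rule alternates_mono[OF r]) auto
  have "\<exists>k. s \<le> k \<and> k < u \<and> y < f k \<and> f (Suc k) < y"
  proof (rule ccontr)
    assume no: "\<not> ?thesis"
    have "y \<le> f (s + d)" if "s + d \<le> u" for d using that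
    proof (induction d)
      case (Suc d)
      then have "y < f (s + d)" using assms(2)[of "s + d"] by simp
      then show ?case using no[simplified, rule_format, of "s + d"] Suc.prems by auto
    qed (use su in simp)
    from this[of "u - s"] su show False by simp
  qed
  then obtain k where k: "s \<le> k" "k < u" "y < f k" "f (Suc k) < y" by blast
  let ?i = "\<lambda>k. indicator {f (Suc k)<..<f k} y :: ennreal"
  have "of_nat (Suc n) = of_nat n + (1::ennreal)" by simp
  also have "\<dots> \<le> (\<Sum>k<s. ?i k) + ?i k"
    using Suc.IH[OF r'] k by (intro add_mono) (auto simp: indicator_def)
  also have "\<dots> = (\<Sum>k\<in>insert k {..<s}. ?i k)" using k by (simp add: add.commute)
  also have "\<dots> \<le> (\<Sum>k<m. ?i k)" using k su by (intro sum_mono2) auto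
  finally show ?case .
qed simp

text \<open>As \<open>f\<close> stays within c/2 of \<open>x\<close>, every crossing of the band
  around \<open>y\<close> by \<open>x\<close> forces \<open>f\<close> across \<open>y\<close>. For
  one step of \<open>f\<close> the levels jumped over have the length of the step, so integration
  yields the total variation of \<open>f\<close>.\<close>

lemma crossing_mass_le_variation:
  fixes x f :: "nat \<Rightarrow> real"
  assumes "\<And>k. k \<le> N \<Longrightarrow> \<bar>x k - f k\<bar> \<le> c/2"
  shows "crossing_mass x c {..N} \<le> ennreal (\<Sum>k<N. \<bar>f (Suc k) - f k\<bar>)"
proof -
  have bounds: "x k \<le> f k + c/2 \<and> f k \<le> x k + c/2" if "k \<le> N" for k
    using assms[OF that] by linarith
  have 1: "alt_count (\<lambda>s. y + c/2 < x s) (\<lambda>s. x s < y - c/2) {..N} \<le> (\<Sum>k<N. indicator {f (Suc k)<..<f k} y)"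
    if "y \<notin> range f" for y
    unfolding alt_count_le_iff
  proof (intro allI impI)
    fix n assume "alternates (\<lambda>s. y + c/2 < x s) (\<lambda>s. x s < y - c/2) n {..N}"
    then have "alternates (\<lambda>k. y < f k) (\<lambda>k. f k < y) n {..N}"
      by (rule alternates_mono) (auto dest!: bounds)
    from alternates_le_level_crossings[OF this] that
    show "of_nat n \<le> (\<Sum>k<N. indicator {f (Suc k)<..<f k} y :: ennreal)" by auto
  qed
  have 2: "alt_count (\<lambda>s. x s < y - c/2) (\<lambda>s. y + c/2 < x s) {..N} \<le> (\<Sum>k<N. indicator {f k<..<f (Suc k)} y)"
    if "y \<notin> range f" for y
    unfolding alt_count_le_iff
  proof (intro allI impI)
    fix n assume "alternates (\<lambda>s. x s < y - c/2) (\<lambda>s. y + c/2 < x s) n {..N}"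
    then have "alternates (\<lambda>k. - y < - f k) (\<lambda>k. - f k < - y) n {..N}"
      by (rule alternates_mono) (auto dest!: bounds)
    from alternates_le_level_crossings[OF this] that
    have "of_nat n \<le> (\<Sum>k<N. indicator {- f (Suc k)<..<- f k} (-y) :: ennreal)" by fastforce
    also have "\<dots> = (\<Sum>k<N. indicator {f k<..<f (Suc k)} y :: ennreal)"
      by (intro sum.cong) (auto simp: indicator_def)
    finally show "of_nat n \<le> (\<Sum>k<N. indicator {f k<..<f (Suc k)} y :: ennreal)" .
  qed
  have "AE y in lborel. y \<notin> range f"
    by (rule AE_not_in) (simp add: countable_imp_null_set_lborel)
  then have "crossing_mass x c {..N} \<le>
    (\<integral>\<^sup>+y. (\<Sum>k<N. indicator {f (Suc k)<..<f k} y + indicator {f k<..<f (Suc k)} y) \<partial>lborel)"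
    unfolding crossing_mass_def
    by (intro nn_integral_mono_AE) (use 1 2 in \<open>auto simp: crossing_count_def sum.distrib elim!: eventually_mono intro!: add_mono\<close>)
  also have "\<dots> = (\<Sum>k<N. emeasure lborel {f (Suc k)<..<f k} + emeasure lborel {f k<..<f (Suc k)})"
    by (simp add: nn_integral_sum nn_integral_add)
  also have "\<dots> = (\<Sum>k<N. ennreal \<bar>f (Suc k) - f k\<bar>)"
  proof (intro sum.cong refl)
    fix k
    show "emeasure lborel {f (Suc k)<..<f k} + emeasure lborel {f k<..<f (Suc k)} = ennreal \<bar>f (Suc k) - f k\<bar>"
      by (cases "f (Suc k) \<le> f k") auto
  qed
  also have "\<dots> = ennreal (\<Sum>k<N. \<bar>f (Suc k) - f k\<bar>)" by (rule sum_ennreal) auto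
  finally show ?thesis .
qed

text \<open>In the application \<open>W j\<close> is the truncated variation up to the j-th sampled
  time. Allowing any superadditive \<open>W\<close> keeps partitions of real intervals out of the
  discrete argument.\<close>

lemma crossing_mass_le_superadditive:
  fixes x :: "nat \<Rightarrow> real" and W :: "nat \<Rightarrow> ennreal"
  assumes "c > 0"
    and W: "\<And>i j. i \<le> j \<Longrightarrow> j \<le> N \<Longrightarrow> c \<le> \<bar>x j - x i\<bar> \<Longrightarrow> W i + ennreal (\<bar>x j - x i\<bar> - c) \<le> W j"
    and mono: "\<And>j. j \<le> N \<Longrightarrow> W j \<le> W N"
  shows "crossing_mass x c {..N} \<le> W N"
proof -
  have "(\<forall>j\<le>N. \<forall>k\<le>N. \<bar>x j - x k\<bar> \<le> c) \<or>
    (\<exists>f i j \<sigma>. (\<forall>k\<le>N. \<bar>x k - f k\<bar> \<le> c/2) \<and> i \<le> j \<and> j \<le> N \<and> (\<sigma> = 1 \<or> \<sigma> = - 1) \<and>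
       \<sigma> * x j = \<sigma> * f N + c/2 \<and> c \<le> \<sigma> * (x j - x i) \<and>
       ennreal (\<Sum>k<N. \<bar>f (Suc k) - f k\<bar>) \<le> W i + ennreal (\<sigma> * (x j - x i) - c))"
    using assms(1) W by (rule play_operator)
  then show ?thesis
  proof (elim disjE)
    assume "\<forall>j\<le>N. \<forall>k\<le>N. \<bar>x j - x k\<bar> \<le> c"
    then have "crossing_count x c y {..N} = 0" for y by (intro crossing_count_eq_0) auto
    then show ?thesis by (simp add: crossing_mass_def)
  next
    assume "\<exists>f i j \<sigma>. (\<forall>k\<le>N. \<bar>x k - f k\<bar> \<le> c/2) \<and> i \<le> j \<and> j \<le> N \<and> (\<sigma> = 1 \<or> \<sigma> = - 1) \<and>
       \<sigma> * x j = \<sigma> * f N + c/2 \<and> c \<le> \<sigma> * (x j - x i) \<and>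
       ennreal (\<Sum>k<N. \<bar>f (Suc k) - f k\<bar>) \<le> W i + ennreal (\<sigma> * (x j - x i) - c)"
    then obtain f i j and \<sigma> :: real where f: "\<forall>k\<le>N. \<bar>x k - f k\<bar> \<le> c/2" and ij: "i \<le> j" "j \<le> N"
      and \<sigma>: "\<sigma> = 1 \<or> \<sigma> = - 1" "c \<le> \<sigma> * (x j - x i)"
      and le: "ennreal (\<Sum>k<N. \<bar>f (Suc k) - f k\<bar>) \<le> W i + ennreal (\<sigma> * (x j - x i) - c)" by blast
  have "\<bar>\<sigma> * (x j - x i)\<bar> = \<bar>x j - x i\<bar>" using \<sigma>(1) by auto
  then have e: "\<bar>x j - x i\<bar> = \<sigma> * (x j - x i)" using \<sigma>(2) assms(1) by linarith
  have "crossing_mass x c {..N} \<le> ennreal (\<Sum>k<N. \<bar>f (Suc k) - f k\<bar>)"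
    by (rule crossing_mass_le_variation) (use f in auto)
  also note le
  also have "W i + ennreal (\<sigma> * (x j - x i) - c) \<le> W j" using W[OF ij] e \<sigma>(2) by simp
  also have "W j \<le> W N" by (rule mono[OF ij(2)])
  finally show ?thesis .
  qed
qed

section \<open>Comparison with partitions of real intervals\<close>

lemma truncated_variation_superadditive:
  assumes "0 \<le> s" "s < t"
  shows "truncated_variation c x 0 s + ennreal (max (\<bar>x t - x s\<bar> - c) 0) \<le> truncated_variation c x 0 t"
proof -
  let ?g = "\<lambda>K. max (\<bar>x (Sup K) - x (Inf K)\<bar> - c) 0"
  have ne: "{\<pi>. \<pi> division_of {0..s}} \<noteq> {}"
    using elementary_interval[of 0 s] by auto
  have "truncated_variation c x 0 s + ennreal (max (\<bar>x t - x s\<bar> - c) 0) =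
    (SUP \<pi> \<in> {\<pi>. \<pi> division_of {0..s}}. ennreal (sum ?g \<pi>) + ennreal (max (\<bar>x t - x s\<bar> - c) 0))"
    unfolding truncated_variation_def by (rule ennreal_SUP_add_left[OF ne, symmetric])
  also have "\<dots> \<le> truncated_variation c x 0 t"
  proof (rule SUP_least)
    fix \<pi> assume "\<pi> \<in> {\<pi>. \<pi> division_of {0..s}}"
    then have \<pi>: "\<pi> division_of {0..s}" by simp
    have "{{s..t}} division_of {s..t}"
      using division_of_self[of s t] assms by simp
    then have U: "(\<pi> \<union> {{s..t}}) division_of ({0..s} \<union> {s..t})"
      by (intro division_disjoint_union[OF \<pi>]) auto
    moreover have "{0..s} \<union> {s..t} = {0..t}" using assms by auto
    ultimately have "(\<pi> \<union> {{s..t}}) division_of {0..t}" by simp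
    moreover have "{s..t} \<notin> \<pi>"
    proof
      assume "{s..t} \<in> \<pi>"
      then have "{s..t} \<subseteq> {0..s}" using \<pi> by (auto dest: division_ofD(2))
      with assms show False by auto
    qed
    then have "sum ?g (\<pi> \<union> {{s..t}}) = sum ?g \<pi> + max (\<bar>x t - x s\<bar> - c) 0"
      using division_of_finite[OF \<pi>] assms by simp
    then have "ennreal (sum ?g \<pi>) + ennreal (max (\<bar>x t - x s\<bar> - c) 0) = ennreal (sum ?g (\<pi> \<union> {{s..t}}))"
      by (simp add: ennreal_plus sum_nonneg)
    ultimately show "ennreal (sum ?g \<pi>) + ennreal (max (\<bar>x t - x s\<bar> - c) 0) \<le> truncated_variation c x 0 t"
      unfolding truncated_variation_def by (intro SUP_upper2[of "\<pi> \<union> {{s..t}}"]) auto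
  qed
  finally show ?thesis .
qed

lemma truncated_variation_mono:
  assumes "0 \<le> s" "s \<le> t"
  shows "truncated_variation c x 0 s \<le> truncated_variation c x 0 t"
proof (cases "s = t")
  case False
  then have "truncated_variation c x 0 s + ennreal (max (\<bar>x t - x s\<bar> - c) 0) \<le> truncated_variation c x 0 t"
    using assms by (intro truncated_variation_superadditive) auto
  then show ?thesis by (rule order_trans[rotated]) simp
qed simp

lemma crossing_mass_finite_le_truncated_variation:
  assumes "finite F" "F \<subseteq> {0..t}" "t \<in> F" "c > 0"
  shows "crossing_mass x c F \<le> truncated_variation c x 0 t"
proof -
  define l where "l = sorted_list_of_set F"
  have l: "sorted_wrt (<) l" "set l = F" using assms(1) by (auto simp: l_def)
  define N where "N = length l - 1"
  have "l \<noteq> []" using l(2) assms(3) by auto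
  then have N: "length l = Suc N" by (simp add: N_def)
  have mono: "strict_mono_on {..N} (\<lambda>i. l ! i)"
    using l(1) N by (auto simp: strict_mono_on_def sorted_wrt_iff_nth_less)
  have F: "F = (\<lambda>i. l ! i) ` {..N}"
    using l(2) N by (auto simp: set_conv_nth less_Suc_eq_le)
  have in_t: "l ! i \<in> {0..t}" if "i \<le> N" for i using that F assms(2) by auto
  have "crossing_mass (\<lambda>i. x (l ! i)) c {..N} \<le> truncated_variation c x 0 (l ! N)"
  proof (rule crossing_mass_le_superadditive[OF assms(4), where W = "\<lambda>i. truncated_variation c x 0 (l ! i)"])
    fix i j assume ij: "i \<le> j" "j \<le> N" "c \<le> \<bar>x (l ! j) - x (l ! i)\<bar>"
    then have "i \<noteq> j" using assms(4) by auto
    then have "l ! i < l ! j" using ij mono by (auto simp: strict_mono_on_def)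
    from truncated_variation_superadditive[OF _ this, of c x] in_t[of i] ij
      max.absorb1[of 0 "\<bar>x (l ! j) - x (l ! i)\<bar> - c"]
    show "truncated_variation c x 0 (l ! i) + ennreal (\<bar>x (l ! j) - x (l ! i)\<bar> - c)
        \<le> truncated_variation c x 0 (l ! j)" by simp
  next
    fix j assume "j \<le> N"
    then have "l ! j \<le> l ! N"
      using mono by (cases "j = N") (auto simp: strict_mono_on_def intro: less_imp_le)
    then show "truncated_variation c x 0 (l ! j) \<le> truncated_variation c x 0 (l ! N)"
      using in_t[OF \<open>j \<le> N\<close>] by (intro truncated_variation_mono) auto
  qed
  also have "\<dots> \<le> truncated_variation c x 0 t"
    using in_t[of N] by (intro truncated_variation_mono) auto
  finally show ?thesis unfolding F crossing_mass_image[OF mono] .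
qed

lemma crossing_mass_le_truncated_variation:
  assumes "countable D" "D \<subseteq> {0..t}" "t \<in> D" "c > 0"
  shows "crossing_mass x c D \<le> truncated_variation c x 0 t"
proof -
  \<comment> \<open>The right end \<open>t\<close> is adjoined to every finite subset because the
    finite case asks for it among its times.\<close>
  define S where "S k = insert t (from_nat_into D ` {..k})" for k :: nat
  have sub: "S k \<subseteq> D" for k using assms(3) from_nat_into[of D] by (auto simp: S_def)
  have "D = (\<Union>k. S k)"
  proof
    show "D \<subseteq> (\<Union>k. S k)"
    proof
      fix d assume "d \<in> D"
      then obtain k where "from_nat_into D k = d" using from_nat_into_surj[OF assms(1)] by blast
      then show "d \<in> (\<Union>k. S k)" by (auto simp: S_def)
    qed
  qed (use sub in auto)
  moreover have "incseq S" by (auto simp: S_def incseq_def)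
  moreover have fin: "finite (S k)" for k by (simp add: S_def)
  ultimately have "crossing_mass x c D = (SUP k. crossing_mass x c (S k))"
    using crossing_mass_UN[of S x c] by (simp add: countable_finite)
  also have "\<dots> \<le> truncated_variation c x 0 t"
    using sub assms fin by (intro SUP_least crossing_mass_finite_le_truncated_variation) (auto simp: S_def)
  finally show ?thesis .
qed

text \<open>The interval that ends last is removed; all others end before it starts, so
  superadditivity applies at its left end.\<close>

lemma sum_alt_count_le:
  fixes P :: "(real \<times> real) set"
  assumes "finite P" "\<And>a b. (a, b) \<in> P \<Longrightarrow> 0 \<le> a \<and> a < b \<and> b \<le> t"
    "\<And>a b a' b'. (a, b) \<in> P \<Longrightarrow> (a', b') \<in> P \<Longrightarrow> (a, b) = (a', b') \<or> b \<le> a' \<or> b' \<le> a"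
  shows "(\<Sum>(a, b)\<in>P. crossing_count x c y {a..b}) \<le> crossing_count x c y {0..t}"
  using assms
proof (induction "card P" arbitrary: P t)
  case (Suc n)
  have "P \<noteq> {}" using Suc by auto
  define b where "b = Max (snd ` P)"
  have "b \<in> snd ` P" unfolding b_def using Suc.prems(1) \<open>P \<noteq> {}\<close> by (intro Max_in) auto
  then obtain a where ab: "(a, b) \<in> P" by force
  have b_max: "b' \<le> b" if "(a', b') \<in> P" for a' b'
    unfolding b_def using Suc.prems(1) that by (intro Max_ge) force+
  have a: "0 \<le> a" "a < b" "b \<le> t" using Suc.prems(2)[OF ab] by auto
  have "(\<Sum>(a, b)\<in>P. crossing_count x c y {a..b}) =
    crossing_count x c y {a..b} + (\<Sum>(a, b)\<in>P - {(a, b)}. crossing_count x c y {a..b})"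
    using Suc.prems(1) ab by (subst sum.remove[of P "(a, b)"]) auto
  also have "(\<Sum>(a, b)\<in>P - {(a, b)}. crossing_count x c y {a..b}) \<le> crossing_count x c y {0..a}"
  proof (rule Suc.hyps(1))
    show "n = card (P - {(a, b)})" using Suc.hyps(2) ab Suc.prems(1) by simp
    show "0 \<le> a' \<and> a' < b' \<and> b' \<le> a" if "(a', b') \<in> P - {(a, b)}" for a' b'
      using Suc.prems(2)[of a' b'] Suc.prems(3)[OF ab, of a' b'] b_max[of a' b'] that by auto
  qed (use Suc.prems in auto)
  also have "crossing_count x c y {a..b} + crossing_count x c y {0..a} \<le> crossing_count x c y ({0..a} \<union> {a..b})"
    by (subst add.commute) (rule crossing_count_Un_ge, auto)
  also have "\<dots> \<le> crossing_count x c y {0..t}"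
    by (rule crossing_count_mono) (use a in auto)
  finally show ?case by (simp add: add_left_mono)
qed simp

text \<open>An interval [a,b] contributes the length of the set of levels whose band lies strictly
  between x a and x b, and each such level is crossed on [a,b]. The count over all real times enters
  only through a measurable majorant \<open>f\<close>, for which \<open>crossings\<close> is taken
  later.\<close>

lemma truncated_variation_le:
  assumes f: "f \<in> borel_measurable borel" "AE y in lborel. crossing_count x c y {0..t} \<le> f y" and "c > 0"
  shows "truncated_variation c x 0 t \<le> (\<integral>\<^sup>+y. f y \<partial>lborel)"
  unfolding truncated_variation_def
proof (rule SUP_least)
  fix \<pi> assume "\<pi> \<in> {\<pi>. \<pi> division_of {0..t}}"
  then have \<pi>: "\<pi> division_of {0..t}" by simp
  \<comment> \<open>Degenerate members of the division contribute 0; the others are determined by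
    their end points.\<close>
  define P where "P = (\<lambda>K. (Inf K, Sup K)) ` {K\<in>\<pi>. Inf K < Sup K}"
  let ?J = "\<lambda>a b. {min (x a) (x b) + c/2<..<max (x a) (x b) - c/2}"
  have fin: "finite \<pi>" by (rule division_of_finite[OF \<pi>])
  have K: "\<exists>a b. K = {a..b} \<and> a \<le> b \<and> 0 \<le> a \<and> b \<le> t" if KK: "K \<in> \<pi>" for K
  proof -
    obtain a b where "K = {a..b}" using division_ofD(4)[OF \<pi> KK] by auto
    moreover have "K \<noteq> {}" "K \<subseteq> {0..t}" using division_ofD(2,3)[OF \<pi> KK] by auto
    ultimately show ?thesis by auto
  qed
  have inj: "inj_on (\<lambda>K. (Inf K, Sup K)) {K\<in>\<pi>. Inf K < Sup K}"
  proof (rule inj_onI)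
    fix K K' assume *: "K \<in> {K\<in>\<pi>. Inf K < Sup K}" "K' \<in> {K\<in>\<pi>. Inf K < Sup K}"
      "(Inf K, Sup K) = (Inf K', Sup K')"
    obtain a b a' b' where "K = {a..b}" "a \<le> b" "K' = {a'..b'}" "a' \<le> b'"
      using K[of K] K[of K'] * by blast
    then show "K = K'" using * by simp
  qed
  have pair: "indicator (?J a b) y \<le> crossing_count x c y {a..b}" if "a < b" for a b y
  proof (cases "y \<in> ?J a b")
    case True
    then consider "y + c/2 < x a" "x b < y - c/2" | "x a < y - c/2" "y + c/2 < x b"
      using assms(3) by (auto simp: min_def max_def split: if_splits)
    then show ?thesis
    proof cases
      case 1
      then have "alternates (\<lambda>s. y + c/2 < x s) (\<lambda>s. x s < y - c/2) (Suc 0) {a..b}"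
        using that by (intro alternates_SucI[of a _ b]) auto
      from of_nat_le_alt_count[OF this] True show ?thesis by (simp add: crossing_count_def add_increasing2)
    next
      case 2
      then have "alternates (\<lambda>s. x s < y - c/2) (\<lambda>s. y + c/2 < x s) (Suc 0) {a..b}"
        using that by (intro alternates_SucI[of a _ b]) auto
      from of_nat_le_alt_count[OF this] True show ?thesis by (simp add: crossing_count_def add_increasing)
    qed
  qed simp
  have P: "finite P" "\<And>a b. (a, b) \<in> P \<Longrightarrow> 0 \<le> a \<and> a < b \<and> b \<le> t"
    using fin K by (auto simp: P_def) (metis cInf_atLeastAtMost, metis cSup_atLeastAtMost)
  have P3: "(a, b) = (a', b') \<or> b \<le> a' \<or> b' \<le> a" if ab: "(a, b) \<in> P" "(a', b') \<in> P" for a b a' b'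
  proof -
    obtain K1 where K1: "K1 \<in> \<pi>" "a = Inf K1" "b = Sup K1" "a < b" using ab(1) by (auto simp: P_def)
    obtain K2 where K2: "K2 \<in> \<pi>" "a' = Inf K2" "b' = Sup K2" "a' < b'" using ab(2) by (auto simp: P_def)
    have e: "K1 = {a..b}" "K2 = {a'..b'}" using K[OF K1(1)] K[OF K2(1)] K1 K2 by auto
    show ?thesis
    proof (cases "K1 = K2")
      case False
      then have "interior K1 \<inter> interior K2 = {}" using division_ofD(5)[OF \<pi> K1(1) K2(1)] by simp
      then have d: "{a<..<b} \<inter> {a'<..<b'} = {}" by (simp add: e)
      have "\<not> max a a' < min b b'"
      proof
        assume "max a a' < min b b'"
        then obtain z where "max a a' < z" "z < min b b'" using dense by blast
        then have "z \<in> {a<..<b} \<inter> {a'<..<b'}" by auto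
        with d show False by simp
      qed
      then show ?thesis using K1(4) K2(4) by (auto simp: max_def min_def split: if_splits)
    qed (use K1 K2 in simp)
  qed
  have "ennreal (\<Sum>K\<in>\<pi>. max (\<bar>x (Sup K) - x (Inf K)\<bar> - c) 0) =
    ennreal (\<Sum>K\<in>{K\<in>\<pi>. Inf K < Sup K}. max (\<bar>x (Sup K) - x (Inf K)\<bar> - c) 0)"
  proof (intro arg_cong[of _ _ ennreal] sum.mono_neutral_right)
    show "\<forall>K\<in>\<pi> - {K \<in> \<pi>. Inf K < Sup K}. max (\<bar>x (Sup K) - x (Inf K)\<bar> - c) 0 = 0"
    proof
      fix K assume "K \<in> \<pi> - {K \<in> \<pi>. Inf K < Sup K}"
      with K[of K] obtain a b where "K = {a..b}" "a \<le> b" "\<not> Inf K < Sup K" by auto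
      then show "max (\<bar>x (Sup K) - x (Inf K)\<bar> - c) 0 = 0" using assms(3) by simp
    qed
  qed (use fin in auto)
  also have "\<dots> = ennreal (\<Sum>(a, b)\<in>P. max (\<bar>x b - x a\<bar> - c) 0)"
    unfolding P_def by (subst sum.reindex[OF inj]) simp
  also have "\<dots> = (\<Sum>(a, b)\<in>P. ennreal (max (\<bar>x b - x a\<bar> - c) 0))"
    by (subst sum_ennreal[symmetric]) (auto simp: case_prod_beta)
  also have "\<dots> = (\<Sum>(a, b)\<in>P. (\<integral>\<^sup>+y. indicator (?J a b) y \<partial>lborel))"
  proof (intro sum.cong refl, clarify)
    fix a b
    show "ennreal (max (\<bar>x b - x a\<bar> - c) 0) = (\<integral>\<^sup>+y. indicator (?J a b) y \<partial>lborel)"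
    proof (cases "c \<le> \<bar>x b - x a\<bar>")
      case True
      then have "min (x a) (x b) + c/2 \<le> max (x a) (x b) - c/2"
        "max (x a) (x b) - c/2 - (min (x a) (x b) + c/2) = max (\<bar>x b - x a\<bar> - c) 0" by auto
      then show ?thesis by simp
    next
      case False
      then have "?J a b = {}" by auto
      then show ?thesis using False by simp
    qed
  qed
  also have "\<dots> = (\<integral>\<^sup>+y. (\<Sum>(a, b)\<in>P. indicator (?J a b) y) \<partial>lborel)"
    by (simp add: case_prod_beta nn_integral_sum)
  also have "\<dots> \<le> (\<integral>\<^sup>+y. f y \<partial>lborel)"
  proof (rule nn_integral_mono_AE)
    have "(\<Sum>(a, b)\<in>P. indicator (?J a b) y) \<le> crossing_count x c y {0..t}" for y
    proof -
      have "(\<Sum>(a, b)\<in>P. indicator (?J a b) y) \<le> (\<Sum>(a, b)\<in>P. crossing_count x c y {a..b})"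
        using P(2) pair by (intro sum_mono) auto
      also have "\<dots> \<le> crossing_count x c y {0..t}" by (rule sum_alt_count_le[OF P P3])
      finally show ?thesis .
    qed
    then show "AE y in lborel. (\<Sum>(a, b)\<in>P. indicator (?J a b) y) \<le> f y"
      using f(2) by (auto elim!: eventually_mono intro: order_trans)
  qed
  finally show "ennreal (\<Sum>K\<in>\<pi>. max (\<bar>x (Sup K) - x (Inf K)\<bar> - c) 0) \<le> (\<integral>\<^sup>+y. f y \<partial>lborel)" .
qed

lemma dense_times_rat: "0 \<le> t \<Longrightarrow> dense_times (insert 0 (insert t (\<rat> \<inter> {0..t}))) t"
  unfolding dense_times_def
proof (intro conjI allI impI)
  fix a b :: real assume ab: "0 \<le> a" "a < b" "b \<le> t"
  from Rats_dense_in_real[OF ab(2)] obtain r where "r \<in> \<rat>" "a < r" "r < b" by blast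
  then show "\<exists>d\<in>insert 0 (insert t (\<rat> \<inter> {0..t})). a < d \<and> d < b" using ab by auto
qed (auto simp: countable_rat)

lemma crossing_count_le_crossings:
  assumes "cadlag x" "c > 0" "0 \<le> t"
  shows "crossing_count x c y {0..t} \<le> of_nat (crossings y c x 0 t)"
  unfolding of_nat_crossings[OF assms] crossing_count_def by (intro add_mono alt_count_mono) auto

lemma crossings_measurable:
  assumes "cadlag x" "c > 0" "0 \<le> t"
  shows "(\<lambda>y. of_nat (crossings y c x 0 t) :: ennreal) \<in> borel_measurable borel"
proof -
  let ?D = "insert 0 (insert t (\<rat> \<inter> {0..t}))"
  have D: "dense_times ?D t" by (rule dense_times_rat[OF assms(3)])
  obtain B where B: "countable B" "\<And>y. y \<notin> B \<Longrightarrow> of_nat (crossings y c x 0 t) = crossing_count x c y ?D"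
    using crossings_eq_crossing_count[OF assms(1,2) D] by blast
  have "(\<lambda>y. crossing_count x c y ?D) \<in> borel_measurable borel"
    using D by (intro crossing_count_measurable_level) (auto simp: dense_times_def)
  then show ?thesis
    by (rule measurable_discrete_difference[where X = B]) (use B in auto)
qed

text \<open>A closed chain of inequalities: the crossing mass over \<open>D\<close> is at most the
  truncated variation (play operator), which is at most the integral of \<open>crossings\<close>
  (partitions), which equals the crossing mass because the two counts differ at countably many
  levels.\<close>

lemma crossings_mass:
  assumes "cadlag x" "c > 0" "dense_times D t"
  shows "(\<integral>\<^sup>+y. of_nat (crossings y c x 0 t) \<partial>lborel) = crossing_mass x c D"
    "truncated_variation c x 0 t = crossing_mass x c D"
proof -
  have t: "0 \<le> t" "countable D" "D \<subseteq> {0..t}" "t \<in> D" using assms(3) by (auto simp: dense_times_def)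
  obtain B where B: "countable B" "\<And>y. y \<notin> B \<Longrightarrow> of_nat (crossings y c x 0 t) = crossing_count x c y D"
    using crossings_eq_crossing_count[OF assms] by blast
  have "AE y in lborel. y \<notin> B" using B(1) by (intro AE_not_in countable_imp_null_set_lborel)
  then show 1: "(\<integral>\<^sup>+y. of_nat (crossings y c x 0 t) \<partial>lborel) = crossing_mass x c D"
    unfolding crossing_mass_def using B(2) by (intro nn_integral_cong_AE) auto
  show "truncated_variation c x 0 t = crossing_mass x c D"
  proof (rule antisym)
    show "truncated_variation c x 0 t \<le> crossing_mass x c D"
      unfolding 1[symmetric] using assms t crossings_measurable
      by (intro truncated_variation_le) (auto intro!: crossing_count_le_crossings)
    show "crossing_mass x c D \<le> truncated_variation c x 0 t"
      using t assms(2) by (intro crossing_mass_le_truncated_variation)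
  qed
qed

section \<open>Pathwise convergence of crossing integrals\<close>

text \<open>Right-continuity gives X u as a limit of X at grid times strictly to the right of u, and
  each approximation uses countably many times. \<open>max 0\<close> extends the process to the
  whole line, so that it can be integrated against Lebesgue measure there.\<close>

lemma cadlag_process_jointly_measurable:
  fixes X :: "real \<Rightarrow> 'a \<Rightarrow> real"
  assumes [measurable]: "\<And>t. 0 \<le> t \<Longrightarrow> X t \<in> borel_measurable M"
    and cadlag: "\<And>\<omega>. \<omega> \<in> space M \<Longrightarrow> cadlag (\<lambda>t. X t \<omega>)"
  shows "(\<lambda>p. X (max 0 (fst p)) (snd p)) \<in> borel_measurable (borel \<Otimes>\<^sub>M M)"
proof -
  define \<tau> where "\<tau> n u = (real_of_int \<lfloor>u * real (Suc n)\<rfloor> + 1) / real (Suc n)" for n u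
  have \<tau>: "u < \<tau> n u" "\<tau> n u \<le> u + 1 / real (Suc n)" for n u
  proof -
    have "u * real (Suc n) < real_of_int \<lfloor>u * real (Suc n)\<rfloor> + 1" by linarith
    then show "u < \<tau> n u" unfolding \<tau>_def by (subst pos_less_divide_eq) auto
    have "\<tau> n u \<le> (u * real (Suc n) + 1) / real (Suc n)"
      unfolding \<tau>_def by (intro divide_right_mono add_right_mono) auto
    also have "\<dots> = u + 1 / real (Suc n)" by (simp add: add_divide_distrib del: of_nat_Suc)
    finally show "\<tau> n u \<le> u + 1 / real (Suc n)" .
  qed
  have "(\<lambda>p. X (max 0 ((real_of_int i + 1) / real (Suc n))) (snd p)) \<in> borel_measurable ((borel :: real measure) \<Otimes>\<^sub>M M)"
    for i :: int and n by measurable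
  moreover have "(\<lambda>p. \<lfloor>max 0 (fst p :: real) * real (Suc n)\<rfloor>) \<in> (borel \<Otimes>\<^sub>M M) \<rightarrow>\<^sub>M count_space UNIV" for n
    by measurable
  ultimately have m: "(\<lambda>p. X (max 0 (\<tau> n (max 0 (fst p)))) (snd p)) \<in> borel_measurable (borel \<Otimes>\<^sub>M M)" for n
    unfolding \<tau>_def by (rule measurable_compose_countable)
  show ?thesis
  proof (rule borel_measurable_LIMSEQ_real[OF _ m])
    fix p :: "real \<times> 'a" assume "p \<in> space (borel \<Otimes>\<^sub>M M)"
    then have c: "cadlag (\<lambda>t. X t (snd p))" using cadlag by (auto simp: space_pair_measure)
    define u where "u = max 0 (fst p)"
    have "((\<lambda>t. X t (snd p)) \<longlongrightarrow> X u (snd p)) (at_right u)"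
      using c by (auto simp: cadlag_def u_def)
    moreover have "filterlim (\<lambda>n. max 0 (\<tau> n u)) (at_right u) sequentially"
      unfolding filterlim_at
    proof
      show "\<forall>\<^sub>F n in sequentially. max 0 (\<tau> n u) \<in> {u<..} \<and> max 0 (\<tau> n u) \<noteq> u"
      proof (intro always_eventually allI)
        fix n
        have "u < max 0 (\<tau> n u)" using \<tau>(1)[of u n] by linarith
        then show "max 0 (\<tau> n u) \<in> {u<..} \<and> max 0 (\<tau> n u) \<noteq> u" by simp
      qed
      have 1: "(\<lambda>n. u + 1 / real (Suc n)) \<longlonglongrightarrow> u"
        using tendsto_add[OF tendsto_const LIMSEQ_Suc[OF lim_1_over_n], of u] by (simp only: add_0_right)
      show "(\<lambda>n. max 0 (\<tau> n u)) \<longlonglongrightarrow> u"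
      proof (rule tendsto_sandwich[OF _ _ tendsto_const 1])
        show "\<forall>\<^sub>F n in sequentially. u \<le> max 0 (\<tau> n u)"
          using \<tau>(1)[of u] by (intro always_eventually allI) (simp add: le_max_iff_disj less_imp_le)
        show "\<forall>\<^sub>F n in sequentially. max 0 (\<tau> n u) \<le> u + 1 / real (Suc n)"
          using \<tau>(2)[of _ u] by (intro always_eventually allI) (auto simp: u_def add_nonneg_nonneg)
      qed
    qed
    ultimately have "(\<lambda>n. X (max 0 (\<tau> n u)) (snd p)) \<longlonglongrightarrow> X u (snd p)"
      by (rule filterlim_compose)
    then show "(\<lambda>n. X (max 0 (\<tau> n (max 0 (fst p)))) (snd p)) \<longlonglongrightarrow> X (max 0 (fst p)) (snd p)"
      by (simp add: u_def)
  qed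
qed

text \<open>A path is a process that does not depend on \<omega>; the real line serves as a dummy
  sample space.\<close>

lemma cadlag_measurable:
  assumes "cadlag x"
  shows "(\<lambda>t. x (max 0 t)) \<in> borel_measurable borel"
proof -
  have "(\<lambda>p. x (max 0 (fst p))) \<in> borel_measurable (borel \<Otimes>\<^sub>M (borel :: real measure))"
    by (rule cadlag_process_jointly_measurable) (use assms in auto)
  moreover have "(\<lambda>t. (t, 0)) \<in> borel \<rightarrow>\<^sub>M borel \<Otimes>\<^sub>M (borel :: real measure)" by measurable
  ultimately have "(\<lambda>t. x (max 0 (fst (t, 0 :: real)))) \<in> borel_measurable borel"
    by (rule measurable_compose[rotated])
  then show ?thesis by simp
qed

lemma crossings_mono:
  assumes "cadlag x" "c > 0" "0 \<le> s" "s \<le> t"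
  shows "crossings y c x 0 s \<le> crossings y c x 0 t"
proof -
  have t: "0 \<le> t" using assms(3,4) by simp
  have "(of_nat (crossings y c x 0 s) :: ennreal) \<le> of_nat (crossings y c x 0 t)"
    unfolding of_nat_crossings[OF assms(1-3)] of_nat_crossings[OF assms(1,2) t]
    by (intro add_mono alt_count_mono) (use assms(4) in auto)
  then show ?thesis by simp
qed

lemma crossings_bounded:
  assumes "cadlag x" "c > 0" "0 \<le> t"
  shows "\<exists>N. \<forall>y. crossings y c x 0 t \<le> N"
proof -
  obtain N where N: "\<And>H L. (\<forall>s u. H s \<longrightarrow> L u \<longrightarrow> c \<le> \<bar>x s - x u\<bar>) \<Longrightarrow> alt_count H L {0..t} \<le> of_nat N"
    using cadlag_count_bounded[OF assms(1,3,2)] by blast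
  have "crossings y c x 0 t \<le> N + N" for y
  proof -
    have "(of_nat (crossings y c x 0 t) :: ennreal) \<le> of_nat N + of_nat N"
      unfolding of_nat_crossings[OF assms]
    proof (intro add_mono N allI impI)
      show "c \<le> \<bar>x s - x u\<bar>" if "y + c/2 \<le> x s" "x u < y - c/2" for s u using that by linarith
      show "c \<le> \<bar>x s - x u\<bar>" if "x s \<le> y - c/2" "y + c/2 < x u" for s u using that by linarith
    qed
    then show ?thesis by (simp only: of_nat_add[symmetric] of_nat_le_iff)
  qed
  then show ?thesis by blast
qed

lemma crossings_support:
  assumes "cadlag x" "c > 0" "0 \<le> t" "\<And>v. v \<in> {0..t} \<Longrightarrow> \<bar>x v\<bar> \<le> B" "B < \<bar>y\<bar>"
  shows "crossings y c x 0 t = 0"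
proof -
  have no: False if "v \<in> {0..t}" "w \<in> {0..t}" "y + c/2 \<le> x v" "x w \<le> y - c/2" for v w
    using assms(4)[OF that(1)] assms(4)[OF that(2)] that(3,4) assms(2,5) by linarith
  have "alt_count (\<lambda>s. y + c/2 \<le> x s) (\<lambda>s. x s < y - c/2) {0..t} = 0"
  proof (rule alt_count_eq_0)
    fix s u assume "s \<in> {0..t}" "u \<in> {0..t}" "y + c/2 \<le> x s" "x u < y - c/2"
    then show False by (intro no[of s u]) auto
  qed
  moreover have "alt_count (\<lambda>s. x s \<le> y - c/2) (\<lambda>s. y + c/2 < x s) {0..t} = 0"
  proof (rule alt_count_eq_0)
    fix s u assume "s \<in> {0..t}" "u \<in> {0..t}" "x s \<le> y - c/2" "y + c/2 < x u"
    then show False by (intro no[of u s]) auto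
  qed
  ultimately have "(of_nat (crossings y c x 0 t) :: ennreal) = 0"
    by (simp add: of_nat_crossings[OF assms(1-3)])
  then show ?thesis by simp
qed

text \<open>At a level farther than \<delta> from x s no crossing is made inside the open interval
  (s,t). In each direction at most two new ones remain, one straddling \<open>s\<close> and one
  ending with the possible jump at \<open>t\<close>; hence 4.\<close>

lemma crossings_jump:
  assumes "cadlag x" "c > 0" "0 \<le> s" "s < t"
    and osc: "\<And>v w. v \<in> {s..<t} \<Longrightarrow> w \<in> {s..<t} \<Longrightarrow> \<bar>x v - x w\<bar> < \<delta>"
    and gt: "crossings y c x 0 s + 4 < crossings y c x 0 t"
  shows "\<bar>y - x s\<bar> \<le> \<delta>"
proof (rule ccontr)
  assume far: "\<not> ?thesis"
  have split: "alt_count H L {0..t} \<le> alt_count H L {0..s} + 2"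
    if HL: "\<And>v w. v \<in> {s<..<t} \<Longrightarrow> w \<in> {s<..<t} \<Longrightarrow> H v \<Longrightarrow> L w \<Longrightarrow> False" "\<not> (H t \<and> L t)" for H L
  proof -
    have "{0..t} = {0..s} \<union> ({s<..<t} \<union> {t})" using assms by auto
    then have "alt_count H L {0..t} \<le> alt_count H L {0..s} + alt_count H L ({s<..<t} \<union> {t}) + 1"
      by (simp only:) (rule alt_count_Un_le, use assms in auto)
    also have "alt_count H L ({s<..<t} \<union> {t}) \<le> alt_count H L {s<..<t} + alt_count H L {t} + 1"
      by (rule alt_count_Un_le) auto
    also have "alt_count H L {s<..<t} = 0" by (rule alt_count_eq_0) (rule HL(1))
    also have "alt_count H L {t} = 0" by (rule alt_count_eq_0) (use HL(2) in simp)
    finally show ?thesis by (simp add: add.assoc)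
  qed
  have near: False if "v \<in> {s<..<t}" "w \<in> {s<..<t}" "y + c/2 \<le> x v" "x w \<le> y - c/2" for v w
  proof -
    have "\<bar>x v - x s\<bar> < \<delta>" "\<bar>x w - x s\<bar> < \<delta>" using that assms(4) by (auto intro!: osc)
    then show False using that far assms(2) by linarith
  qed
  have "alt_count (\<lambda>s. y + c/2 \<le> x s) (\<lambda>s. x s < y - c/2) {0..t} \<le>
      alt_count (\<lambda>s. y + c/2 \<le> x s) (\<lambda>s. x s < y - c/2) {0..s} + 2"
  proof (rule split)
    show "\<not> (y + c/2 \<le> x t \<and> x t < y - c/2)" using assms(2) by linarith
    fix v w assume "v \<in> {s<..<t}" "w \<in> {s<..<t}" "y + c/2 \<le> x v" "x w < y - c/2"
    then show False by (intro near[of v w]) auto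
  qed
  moreover have "alt_count (\<lambda>s. x s \<le> y - c/2) (\<lambda>s. y + c/2 < x s) {0..t} \<le>
      alt_count (\<lambda>s. x s \<le> y - c/2) (\<lambda>s. y + c/2 < x s) {0..s} + 2"
  proof (rule split)
    show "\<not> (x t \<le> y - c/2 \<and> y + c/2 < x t)" using assms(2) by linarith
    fix v w assume "v \<in> {s<..<t}" "w \<in> {s<..<t}" "x v \<le> y - c/2" "y + c/2 < x w"
    then show False by (intro near[of w v]) auto
  qed
  ultimately have "(of_nat (crossings y c x 0 t) :: ennreal) \<le>
     (alt_count (\<lambda>s. y + c/2 \<le> x s) (\<lambda>s. x s < y - c/2) {0..s} + 2) +
     (alt_count (\<lambda>s. x s \<le> y - c/2) (\<lambda>s. y + c/2 < x s) {0..s} + 2)"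
    unfolding of_nat_crossings[OF assms(1,2) order_trans[OF assms(3) less_imp_le[OF assms(4)]]]
    by (rule add_mono)
  also have "\<dots> = of_nat (crossings y c x 0 s) + (2 + 2)"
    unfolding of_nat_crossings[OF assms(1,2,3)] by (simp only: ac_simps)
  also have "(2 + 2 :: ennreal) = of_nat 4" by simp
  finally have "crossings y c x 0 t \<le> crossings y c x 0 s + 4"
    by (simp only: of_nat_add[symmetric] of_nat_le_iff)
  with gt show False by simp
qed

lemma crossings_borel_measurable:
  assumes "cadlag x" "c > 0" "0 \<le> t"
  shows "(\<lambda>y. real (crossings y c x 0 t)) \<in> borel_measurable borel"
proof -
  have "(\<lambda>y. enn2real (of_nat (crossings y c x 0 t))) \<in> borel_measurable borel"
    using crossings_measurable[OF assms] by (rule borel_measurable_enn2real)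
  then show ?thesis by simp
qed

lemma integrable_crossings:
  assumes "cadlag x" "c > 0" "0 \<le> t" "g \<in> borel_measurable borel" "\<And>y. \<bar>g y\<bar> \<le> K"
  shows "integrable lborel (\<lambda>y. g y * real (crossings y c x 0 t))"
proof -
  obtain N where N: "\<And>y. crossings y c x 0 t \<le> N" using crossings_bounded[OF assms(1-3)] by blast
  obtain B where B: "\<And>v. v \<in> {0..t} \<Longrightarrow> \<bar>x v\<bar> \<le> B" using cadlag_bounded[OF assms(1,3)] by blast
  note [measurable] = assms(4) crossings_borel_measurable[OF assms(1-3)]
  have K: "0 \<le> K" using assms(5)[of 0] by simp
  show ?thesis
  proof (rule integrableI_bounded_set[where A = "{-B..B}" and B = "K * real N"])
    show "emeasure lborel {-B..B} < \<infinity>" by (cases "-B \<le> B") auto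
    show "AE y\<in>{-B..B} in lborel. norm (g y * real (crossings y c x 0 t)) \<le> K * real N"
      using assms(5) N K by (intro always_eventually) (auto simp: abs_mult intro!: mult_mono)
    show "AE y in lborel. y \<notin> {-B..B} \<longrightarrow> g y * real (crossings y c x 0 t) = 0"
      using crossings_support[OF assms(1-3) B] by (intro always_eventually) (auto simp: abs_if not_le)
  qed auto
qed

section \<open>Integrals of a function against crossings and along the path\<close>

definition crossing_integral :: "real \<Rightarrow> (real \<Rightarrow> real) \<Rightarrow> (real \<Rightarrow> real) \<Rightarrow> real \<Rightarrow> real \<Rightarrow> real" where
  "crossing_integral \<alpha> x g c t = c powr (\<alpha> - 1) * (\<integral>y. g y * real (crossings y c x 0 t) \<partial>lborel)"

lemma crossing_integral_diff:
  assumes "cadlag x" "c > 0" "0 \<le> s" "s \<le> t" "g \<in> borel_measurable borel" "\<And>y. \<bar>g y\<bar> \<le> K"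
  shows "crossing_integral \<alpha> x g c t - crossing_integral \<alpha> x g c s
    = c powr (\<alpha> - 1) * (\<integral>y. g y * (real (crossings y c x 0 t) - real (crossings y c x 0 s)) \<partial>lborel)"
  unfolding crossing_integral_def right_diff_distrib
  using assms by (subst Bochner_Integration.integral_diff) (auto intro!: integrable_crossings simp: right_diff_distrib)

text \<open>Counts are nondecreasing in time, so the increment over (s,t] is again the integral
  against a positive measure.\<close>

lemma crossing_integral_increment_le:
  assumes "cadlag x" "c > 0" "0 \<le> s" "s \<le> t" "g \<in> borel_measurable borel" "\<And>y. \<bar>g y\<bar> \<le> K"
  shows "\<bar>crossing_integral \<alpha> x g c t - crossing_integral \<alpha> x g c s\<bar>
    \<le> K * (crossing_integral \<alpha> x (\<lambda>_. 1) c t - crossing_integral \<alpha> x (\<lambda>_. 1) c s)"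
proof -
  let ?m = "\<lambda>y. real (crossings y c x 0 t) - real (crossings y c x 0 s)"
  have t: "0 \<le> t" using assms by simp
  have m0: "0 \<le> ?m y" for y using crossings_mono[OF assms(1-4)] by simp
  have i1: "integrable lborel (\<lambda>y. g y * ?m y)"
    using assms t by (auto intro!: integrable_crossings Bochner_Integration.integrable_diff simp: right_diff_distrib)
  have i2: "integrable lborel (\<lambda>y. 1 * ?m y)"
    using assms t by (auto intro!: integrable_crossings[of _ _ _ "\<lambda>_. 1" 1, simplified] Bochner_Integration.integrable_diff)
  have "\<bar>\<integral>y. g y * ?m y \<partial>lborel\<bar> \<le> (\<integral>y. \<bar>g y * ?m y\<bar> \<partial>lborel)" by simp
  also have "\<dots> \<le> (\<integral>y. K * (1 * ?m y) \<partial>lborel)"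
  proof (rule integral_mono)
    show "\<bar>g y * ?m y\<bar> \<le> K * (1 * ?m y)" for y
      using mult_right_mono[OF assms(6) m0, of y y] m0[of y] by (simp add: abs_mult)
  qed (use i1 i2 in \<open>auto intro: integrable_abs\<close>)
  also have "\<dots> = K * (\<integral>y. 1 * ?m y \<partial>lborel)" by simp
  finally have "c powr (\<alpha> - 1) * \<bar>\<integral>y. g y * ?m y \<partial>lborel\<bar> \<le> c powr (\<alpha> - 1) * (K * (\<integral>y. 1 * ?m y \<partial>lborel))"
    by (rule mult_left_mono) simp
  then show ?thesis
    using crossing_integral_diff[OF assms(1-4), of g K] crossing_integral_diff[OF assms(1-4), of "\<lambda>_. 1" 1] assms
    by (simp add: abs_mult mult.left_commute)
qed

text \<open>Levels near x s see a nearly constant \<open>g\<close>. Elsewhere at most 4 crossings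
  per level are added, for |y| \<le> B only, and |g y - g (x s)| \<le> 2K. The error is 4 times 2K
  times 2B, and the factor c^(\<alpha>-1) makes it vanish in the limit.\<close>

lemma crossing_integral_small_osc:
  assumes "cadlag x" "c > 0" "0 \<le> s" "s < t" "g \<in> borel_measurable borel" "\<And>y. \<bar>g y\<bar> \<le> K"
    and osc: "\<And>v w. v \<in> {s..<t} \<Longrightarrow> w \<in> {s..<t} \<Longrightarrow> \<bar>x v - x w\<bar> < \<delta>"
    and B: "\<And>v. v \<in> {0..t} \<Longrightarrow> \<bar>x v\<bar> \<le> B"
    and g: "\<And>y. \<bar>y - x s\<bar> \<le> \<delta> \<Longrightarrow> \<bar>g y - g (x s)\<bar> \<le> e"
  shows "\<bar>crossing_integral \<alpha> x g c t - crossing_integral \<alpha> x g c s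
      - g (x s) * (crossing_integral \<alpha> x (\<lambda>_. 1) c t - crossing_integral \<alpha> x (\<lambda>_. 1) c s)\<bar>
    \<le> e * (crossing_integral \<alpha> x (\<lambda>_. 1) c t - crossing_integral \<alpha> x (\<lambda>_. 1) c s)
      + c powr (\<alpha> - 1) * (16 * K * B)"
proof -
  let ?m = "\<lambda>y. real (crossings y c x 0 t) - real (crossings y c x 0 s)"
  have t: "0 \<le> t" "s \<le> t" using assms by auto
  have m0: "0 \<le> ?m y" for y using crossings_mono[OF assms(1-3) t(2)] by simp
  have B0: "0 \<le> B" using B[of 0] t by auto
  have K0: "0 \<le> K" using assms(6)[of 0] by simp
  have "\<bar>x s - x s\<bar> < \<delta>" using assms(4) by (intro osc) auto
  then have e0: "0 \<le> e" using g[of "x s"] by simp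
  have i1: "integrable lborel (\<lambda>y. g y * ?m y)"
    using assms t by (auto intro!: integrable_crossings Bochner_Integration.integrable_diff simp: right_diff_distrib)
  have i2: "integrable lborel ?m"
    using assms t by (auto intro!: integrable_crossings[of _ _ _ "\<lambda>_. 1" 1, simplified] Bochner_Integration.integrable_diff)
  have i3: "integrable lborel (\<lambda>y. 8 * K * indicator {-B..B} y)"
    using B0 by simp
  have pw: "\<bar>(g y - g (x s)) * ?m y\<bar> \<le> e * ?m y + 8 * K * indicator {-B..B} y" for y
  proof (cases "\<bar>y\<bar> \<le> B")
    case False
    then have "crossings y c x 0 t = 0" using assms(1,2) t B by (intro crossings_support[of x c t B]) auto
    then have "?m y = 0" using m0[of y] by simp
    then show ?thesis using K0 by simp
  next
    case True
    then have ind: "indicator {-B..B} y = (1::real)" by (auto simp: abs_le_iff)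
    show ?thesis
    proof (cases "crossings y c x 0 s + 4 < crossings y c x 0 t")
      case gt: True
      have "\<bar>y - x s\<bar> \<le> \<delta>" using assms(1-4) osc gt by (rule crossings_jump)
      from g[OF this] have "\<bar>g y - g (x s)\<bar> * ?m y \<le> e * ?m y" using m0 by (rule mult_right_mono)
      then show ?thesis using m0[of y] K0 by (simp add: abs_mult add_increasing2)
    next
      case False
      then have "?m y \<le> 4" by simp
      moreover have "\<bar>g y - g (x s)\<bar> \<le> 2 * K" using assms(6)[of y] assms(6)[of "x s"] by linarith
      ultimately have "\<bar>g y - g (x s)\<bar> * ?m y \<le> (2 * K) * 4" using m0[of y] K0 by (intro mult_mono) auto
      then show ?thesis using m0[of y] ind e0 by (simp add: abs_mult add_increasing)
    qed
  qed
  have "\<bar>(\<integral>y. g y * ?m y \<partial>lborel) - g (x s) * (\<integral>y. ?m y \<partial>lborel)\<bar> = \<bar>\<integral>y. (g y - g (x s)) * ?m y \<partial>lborel\<bar>"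
    using i1 i2 by (simp add: left_diff_distrib)
  also have "\<dots> \<le> (\<integral>y. \<bar>(g y - g (x s)) * ?m y\<bar> \<partial>lborel)" by simp
  also have "\<dots> \<le> (\<integral>y. e * ?m y + 8 * K * indicator {-B..B} y \<partial>lborel)"
    using i1 i2 i3 pw by (intro integral_mono) (auto simp: left_diff_distrib)
  also have "\<dots> = e * (\<integral>y. ?m y \<partial>lborel) + 16 * K * B"
    using i2 i3 B0 by simp
  finally have "c powr (\<alpha> - 1) * \<bar>(\<integral>y. g y * ?m y \<partial>lborel) - g (x s) * (\<integral>y. ?m y \<partial>lborel)\<bar>
     \<le> c powr (\<alpha> - 1) * (e * (\<integral>y. ?m y \<partial>lborel) + 16 * K * B)"
    by (rule mult_left_mono) simp
  then have "\<bar>c powr (\<alpha> - 1) * ((\<integral>y. g y * ?m y \<partial>lborel) - g (x s) * (\<integral>y. ?m y \<partial>lborel))\<bar>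
     \<le> c powr (\<alpha> - 1) * (e * (\<integral>y. ?m y \<partial>lborel) + 16 * K * B)"
    by (simp add: abs_mult)
  then show ?thesis
    using crossing_integral_diff[OF assms(1-3) t(2), of g K \<alpha>] crossing_integral_diff[OF assms(1-3) t(2), of "\<lambda>_. 1" 1 \<alpha>] assms(5,6)
    by (simp add: distrib_left right_diff_distrib mult.left_commute)
qed

text \<open>This is the integral of \<open>g\<close> against the occupation measure
  (\<open>integral_occupation\<close>), written over times; \<open>max 0\<close> makes the integrand
  Borel on the whole line.\<close>

definition path_integral :: "(real \<Rightarrow> real) \<Rightarrow> (real \<Rightarrow> real) \<Rightarrow> real \<Rightarrow> real" where
  "path_integral x g t = (\<integral>u. indicator {0..t} u * g (x (max 0 u)) \<partial>lborel)"

lemma integrable_path: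
  fixes g :: "real \<Rightarrow> real"
  assumes "cadlag x" "g \<in> borel_measurable borel" "\<And>y. \<bar>g y\<bar> \<le> K" "A \<in> sets borel" "A \<subseteq> {s..t}"
  shows "integrable lborel (\<lambda>u. indicator A u * g (x (max 0 u)))"
proof (rule integrableI_bounded_set[where A = "{s..t}" and B = K])
  note [measurable] = assms(2,4) cadlag_measurable[OF assms(1)]
  show "(\<lambda>u. indicator A u * g (x (max 0 u))) \<in> borel_measurable lborel" by measurable
  show "emeasure lborel {s..t} < \<infinity>" by (cases "s \<le> t") auto
  have "0 \<le> K" using assms(3)[of 0] by simp
  then show "AE u\<in>{s..t} in lborel. norm (indicator A u * g (x (max 0 u))) \<le> K"
    using assms(3) by (intro always_eventually) (auto simp: indicator_def)
  show "AE u in lborel. u \<notin> {s..t} \<longrightarrow> indicator A u * g (x (max 0 u)) = 0"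
    using assms(5) by (intro always_eventually) (auto simp: indicator_def)
qed simp

lemma path_integral_diff:
  assumes "cadlag x" "g \<in> borel_measurable borel" "\<And>y. \<bar>g y\<bar> \<le> K" "0 \<le> s" "s \<le> t"
  shows "path_integral x g t - path_integral x g s = (\<integral>u. indicator {s<..t} u * g (x (max 0 u)) \<partial>lborel)"
proof -
  have "path_integral x g t = (\<integral>u. indicator {0..s} u * g (x (max 0 u)) + indicator {s<..t} u * g (x (max 0 u)) \<partial>lborel)"
    unfolding path_integral_def using assms(4,5) by (intro Bochner_Integration.integral_cong) (auto simp: indicator_def)
  also have "\<dots> = path_integral x g s + (\<integral>u. indicator {s<..t} u * g (x (max 0 u)) \<partial>lborel)"
    unfolding path_integral_def using assms(1-3)
    by (intro Bochner_Integration.integral_add integrable_path[of x g K _ 0 s] integrable_path[of x g K _ s t]) auto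
  finally show ?thesis by simp
qed

text \<open>Closeness is asked on the open interval only, as the path may jump at \<open>t\<close>;
  the end points have Lebesgue measure 0.\<close>

lemma path_integral_close:
  assumes "cadlag x" "g \<in> borel_measurable borel" "\<And>y. \<bar>g y\<bar> \<le> K" "0 \<le> s" "s \<le> t"
    and e: "\<And>u. u \<in> {s<..<t} \<Longrightarrow> \<bar>g (x u) - a\<bar> \<le> e"
  shows "\<bar>path_integral x g t - path_integral x g s - a * (t - s)\<bar> \<le> e * (t - s)"
proof (cases "s = t")
  case False
  then obtain v where "v \<in> {s<..<t}" using assms(5) dense[of s t] by auto
  then have e0: "0 \<le> e" using e[of v] by simp
  have i: "integrable lborel (\<lambda>u. indicator {s<..<t} u * g (x (max 0 u)))"
    using assms(1-3) by (rule integrable_path[of x g K _ s t]) auto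
  have ic: "integrable lborel (\<lambda>u. indicator {s<..<t} u * b)" for b :: real using assms(5) by simp
  have "path_integral x g t - path_integral x g s = (\<integral>u. indicator {s<..<t} u * g (x (max 0 u)) \<partial>lborel)"
    unfolding path_integral_diff[OF assms(1-5)]
  proof (rule integral_cong_AE)
    note [measurable] = assms(2) cadlag_measurable[OF assms(1)]
    show "(\<lambda>u. indicator {s<..t} u * g (x (max 0 u))) \<in> borel_measurable lborel"
      "(\<lambda>u. indicator {s<..<t} u * g (x (max 0 u))) \<in> borel_measurable lborel" by measurable
    show "AE u in lborel. indicator {s<..t} u * g (x (max 0 u)) = indicator {s<..<t} u * g (x (max 0 u))"
      using AE_lborel_singleton[of t] by (auto elim!: eventually_mono simp: indicator_def)
  qed
  moreover have "a * (t - s) = (\<integral>u. indicator {s<..<t} u * a \<partial>lborel)" using assms(5) by simp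
  ultimately have "\<bar>path_integral x g t - path_integral x g s - a * (t - s)\<bar>
    = \<bar>\<integral>u. indicator {s<..<t} u * g (x (max 0 u)) - indicator {s<..<t} u * a \<partial>lborel\<bar>"
    using i ic by (simp only: Bochner_Integration.integral_diff)
  also have "\<dots> \<le> (\<integral>u. \<bar>indicator {s<..<t} u * g (x (max 0 u)) - indicator {s<..<t} u * a\<bar> \<partial>lborel)" by simp
  also have "\<dots> \<le> (\<integral>u. indicator {s<..<t} u * e \<partial>lborel)"
    using i ic e assms(4) by (intro integral_mono integrable_abs Bochner_Integration.integrable_diff) (auto simp: indicator_def)
  also have "\<dots> = e * (t - s)" using assms(5) by simp
  finally show ?thesis .
qed simp

text \<open>Both sides are additive in time. On a piece [a,b] of small oscillation each is close to
  g(x a) C (b - a): the crossing side because its total mass converges to C (b - a) and sits near x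
  a, the path side by continuity of \<open>g\<close>. \<open>cadlag_interval_induct\<close> adds up
  the pieces.\<close>

lemma crossing_integral_limit:
  fixes c :: "nat \<Rightarrow> real"
  assumes x: "cadlag x" and c: "\<And>n. c n > 0" "c \<longlonglongrightarrow> 0" and \<alpha>: "1 < \<alpha>" and C: "0 \<le> C"
    and lim: "\<And>t. 0 \<le> t \<Longrightarrow> (\<lambda>n. crossing_integral \<alpha> x (\<lambda>_. 1) (c n) t) \<longlonglongrightarrow> C * t"
    and g: "continuous_on UNIV g" "\<And>y. \<bar>g y\<bar> \<le> K" and t: "0 \<le> t"
  shows "(\<lambda>n. crossing_integral \<alpha> x g (c n) t) \<longlonglongrightarrow> C * path_integral x g t"
proof -
  have gm: "g \<in> borel_measurable borel" using g(1) by (rule borel_measurable_continuous_onI)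
  obtain B where B: "\<And>v. v \<in> {0..t} \<Longrightarrow> \<bar>x v\<bar> \<le> B" using cadlag_bounded[OF x t] by blast
  have K0: "0 \<le> K" using g(2)[of 0] by simp
  let ?F = "\<lambda>n s. crossing_integral \<alpha> x (\<lambda>_. 1) (c n) s"
  define E where "E n s = crossing_integral \<alpha> x g (c n) s - C * path_integral x g s" for n s
  \<comment> \<open>Here \<alpha> > 1 is used: this factor removes the boundedly many crossings per
    level far from the path.\<close>
  have pw0: "(\<lambda>n. c n powr (\<alpha> - 1)) \<longlonglongrightarrow> 0"
    using tendsto_powr'[OF c(2) tendsto_const[of "\<alpha> - 1"]] \<alpha> c(1) by (simp add: less_imp_le)
  have main: "\<forall>\<eta>>0. \<forall>\<^sub>F n in sequentially. \<bar>E n t - E n 0\<bar> \<le> 2 * e * C * (t - 0) + \<eta>" if e: "e > 0" for e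
  proof -
    \<comment> \<open>The margin 1 keeps every level within \<delta> \<le> 1 of the path inside the
      compact interval.\<close>
    have "uniformly_continuous_on {-B-1..B+1} g"
      by (intro compact_uniformly_continuous continuous_on_subset[OF g(1)]) auto
    then obtain d where d: "d > 0" "\<And>y z. y \<in> {-B-1..B+1} \<Longrightarrow> z \<in> {-B-1..B+1} \<Longrightarrow> \<bar>y - z\<bar> < d \<Longrightarrow> \<bar>g y - g z\<bar> < e"
    proof -
      assume *: thesis if "d > 0" "\<And>y z. y \<in> {-B-1..B+1} \<Longrightarrow> z \<in> {-B-1..B+1} \<Longrightarrow> \<bar>y - z\<bar> < d \<Longrightarrow> \<bar>g y - g z\<bar> < e" for d
      assume "uniformly_continuous_on {-B-1..B+1} g"
      then obtain d where "d > 0" "\<forall>x\<in>{-B-1..B+1}. \<forall>x'\<in>{-B-1..B+1}. dist x' x < d \<longrightarrow> dist (g x') (g x) < e"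
        using e unfolding uniformly_continuous_on_def by blast
      then show thesis by (intro *[of d]) (auto simp: dist_real_def)
    qed
    define \<delta> where "\<delta> = min (d/2) 1"
    have \<delta>: "\<delta> > 0" "\<delta> < d" "\<delta> \<le> 1" using d(1) by (auto simp: \<delta>_def)
    \<comment> \<open>The slack \<eta> is quantified inside and halved at each concatenation, so
      finitely many pieces cost an arbitrarily small total, while the main error stays proportional
      to b - a.\<close>
    define Q where "Q a b \<longleftrightarrow> (b \<le> t \<longrightarrow>
      (\<forall>\<eta>>0. \<forall>\<^sub>F n in sequentially. \<bar>E n b - E n a\<bar> \<le> 2 * e * C * (b - a) + \<eta>))" for a b
    have "Q 0 t"
      using x order_refl t \<delta>(1)
    proof (induction rule: cadlag_interval_induct)
      case (refl a)
      then show ?case by (simp add: Q_def)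
    next
      case (trans a b b')
      show ?case unfolding Q_def
      proof (intro impI allI)
        fix \<eta> :: real assume "b' \<le> t" "0 < \<eta>"
        then have "\<forall>\<^sub>F n in sequentially. \<bar>E n b - E n a\<bar> \<le> 2 * e * C * (b - a) + \<eta>/2"
          "\<forall>\<^sub>F n in sequentially. \<bar>E n b' - E n b\<bar> \<le> 2 * e * C * (b' - b) + \<eta>/2"
        proof -
          have "0 < \<eta> / 2" "b \<le> t" using \<open>0 < \<eta>\<close> \<open>b' \<le> t\<close> trans(3) by auto
          then show "\<forall>\<^sub>F n in sequentially. \<bar>E n b - E n a\<bar> \<le> 2 * e * C * (b - a) + \<eta>/2"
            using trans(4) unfolding Q_def by blast
          show "\<forall>\<^sub>F n in sequentially. \<bar>E n b' - E n b\<bar> \<le> 2 * e * C * (b' - b) + \<eta>/2"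
            using trans(5) \<open>0 < \<eta> / 2\<close> \<open>b' \<le> t\<close> unfolding Q_def by blast
        qed
        then show "\<forall>\<^sub>F n in sequentially. \<bar>E n b' - E n a\<bar> \<le> 2 * e * C * (b' - a) + \<eta>"
          
        proof eventually_elim
          case (elim n)
          have "2 * e * C * (b' - a) = 2 * e * C * (b - a) + 2 * e * C * (b' - b)" by (simp add: algebra_simps)
          then show ?case using elim by linarith
        qed
      qed
    next
      case (step a b)
      show ?case unfolding Q_def
      proof (intro impI allI)
        fix \<eta> :: real assume b: "b \<le> t" and \<eta>: "0 < \<eta>"
        have xa: "\<bar>x a\<bar> \<le> B" using B step b by auto
        have ga: "\<bar>g y - g (x a)\<bar> \<le> e" if "\<bar>y - x a\<bar> \<le> \<delta>" for y
          using d(2)[of y "x a"] that xa \<delta> by (auto simp: abs_le_iff)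
        have 1: "\<bar>crossing_integral \<alpha> x g (c n) b - crossing_integral \<alpha> x g (c n) a - g (x a) * (?F n b - ?F n a)\<bar>
            \<le> e * (?F n b - ?F n a) + c n powr (\<alpha> - 1) * (16 * K * B)" for n
          by (rule crossing_integral_small_osc[OF x c(1) step(1,2) gm g(2) step(3)])
            (use B b ga in auto)
        have 2: "\<bar>path_integral x g b - path_integral x g a - g (x a) * (b - a)\<bar> \<le> e * (b - a)"
        proof (rule path_integral_close[OF x gm g(2) step(1)])
          fix u assume "u \<in> {a<..<b}"
          then have "\<bar>x u - x a\<bar> < \<delta>" using step by auto
          then show "\<bar>g (x u) - g (x a)\<bar> \<le> e" by (intro ga) simp
        qed (use step in auto)
        have F: "(\<lambda>n. ?F n b - ?F n a) \<longlonglongrightarrow> C * b - C * a"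
          using step by (intro tendsto_diff lim) auto
        have "(\<lambda>n. e * (?F n b - ?F n a) + c n powr (\<alpha> - 1) * (16 * K * B) + K * \<bar>(?F n b - ?F n a) - (C * b - C * a)\<bar>)
           \<longlonglongrightarrow> e * (C * b - C * a) + 0 * (16 * K * B) + K * \<bar>(C * b - C * a) - (C * b - C * a)\<bar>"
          by (intro tendsto_intros F pw0)
        then have "\<forall>\<^sub>F n in sequentially. e * (?F n b - ?F n a) + c n powr (\<alpha> - 1) * (16 * K * B)
           + K * \<bar>(?F n b - ?F n a) - (C * b - C * a)\<bar> < e * (C * b - C * a) + \<eta>"
          using \<eta> by (intro order_tendstoD(2)) auto
        then show "\<forall>\<^sub>F n in sequentially. \<bar>E n b - E n a\<bar> \<le> 2 * e * C * (b - a) + \<eta>"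
        proof eventually_elim
          case (elim n)
          let ?R = "crossing_integral \<alpha> x g (c n) b - crossing_integral \<alpha> x g (c n) a - g (x a) * (?F n b - ?F n a)"
          let ?P = "path_integral x g b - path_integral x g a - g (x a) * (b - a)"
          have eq: "E n b - E n a = ?R + g (x a) * ((?F n b - ?F n a) - (C * b - C * a)) - C * ?P"
            by (simp add: E_def algebra_simps)
          have "\<bar>E n b - E n a\<bar> \<le> \<bar>?R\<bar> + \<bar>g (x a) * ((?F n b - ?F n a) - (C * b - C * a))\<bar> + \<bar>C * ?P\<bar>"
            unfolding eq by (rule order_trans[OF abs_triangle_ineq4 add_right_mono[OF abs_triangle_ineq]])
          moreover have "\<bar>g (x a) * ((?F n b - ?F n a) - (C * b - C * a))\<bar> \<le> K * \<bar>(?F n b - ?F n a) - (C * b - C * a)\<bar>"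
            unfolding abs_mult by (rule mult_right_mono[OF g(2)]) simp
          moreover have "\<bar>C * ?P\<bar> \<le> C * (e * (b - a))"
            unfolding abs_mult abs_of_nonneg[OF C] by (rule mult_left_mono[OF 2 C])
          moreover note 1[of n] elim
          ultimately have "\<bar>E n b - E n a\<bar> \<le> e * (C * b - C * a) + \<eta> + C * (e * (b - a))" by linarith
          also have "\<dots> = 2 * e * C * (b - a) + \<eta>" by (simp add: algebra_simps)
          finally show ?case .
        qed
      qed
    qed
    then show ?thesis by (simp add: Q_def)
  qed
  have E0: "(\<lambda>n. E n 0) \<longlonglongrightarrow> 0"
  proof (rule Lim_null_comparison)
    have "path_integral x g 0 = 0"
    proof -
      have "path_integral x g 0 = (\<integral>u. 0 \<partial>(lborel :: real measure))"
        unfolding path_integral_def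
        by (intro integral_cong_AE) (use AE_lborel_singleton[of 0] gm cadlag_measurable[OF x] in \<open>auto elim!: eventually_mono\<close>)
      then show ?thesis by simp
    qed
    moreover have "crossings y (c n) x 0 0 = 0" for y n
    proof -
      have "alt_count (\<lambda>s. y + c n/2 \<le> x s) (\<lambda>s. x s < y - c n/2) {0..0} = 0"
        by (rule alt_count_eq_0) (use c(1)[of n] in auto)
      moreover have "alt_count (\<lambda>s. x s \<le> y - c n/2) (\<lambda>s. y + c n/2 < x s) {0..0} = 0"
        by (rule alt_count_eq_0) (use c(1)[of n] in auto)
      ultimately have "(of_nat (crossings y (c n) x 0 0) :: ennreal) = 0"
        by (simp add: of_nat_crossings[OF x c(1)])
      then show ?thesis by simp
    qed
    ultimately show "\<forall>\<^sub>F n in sequentially. norm (E n 0) \<le> (\<lambda>_. 0) n"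
      by (simp add: E_def crossing_integral_def)
  qed simp
  have "(\<lambda>n. E n t - E n 0) \<longlonglongrightarrow> 0"
  proof (rule tendstoI)
    fix r :: real assume r: "0 < r"
    \<comment> \<open>Chosen so that 2 e C t \<le> r/2; the +1 covers the case C t = 0.\<close>
    define e where "e = r / (4 * (C * t + 1))"
    have Ct: "0 \<le> C * t" using C t by simp
    have e: "e > 0" "2 * e * C * t \<le> r / 2" using r Ct by (auto simp: e_def field_simps)
    have "\<forall>\<^sub>F n in sequentially. \<bar>E n t - E n 0\<bar> \<le> 2 * e * C * (t - 0) + r/4"
      using main[OF e(1)] r by (elim allE[of _ "r/4"]) simp
    then show "\<forall>\<^sub>F n in sequentially. dist (E n t - E n 0) 0 < r"
      by eventually_elim (use e r in simp)
  qed
  from tendsto_add[OF tendsto_add[OF this E0] tendsto_const[of "C * path_integral x g t"]]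
  show ?thesis by (simp add: E_def)
qed

lemma crossing_integral_one_mono:
  assumes "cadlag x" "c > 0" "0 \<le> s" "s \<le> t"
  shows "crossing_integral \<alpha> x (\<lambda>_. 1) c s \<le> crossing_integral \<alpha> x (\<lambda>_. 1) c t"
  using crossing_integral_increment_le[OF assms, of "\<lambda>_. 1" 1 \<alpha>] by simp

text \<open>Monotonicity in time squeezes the value at \<open>t\<close> between those at nearby
  rationals, and the limit is continuous in time.\<close>

lemma crossing_integral_one_limit:
  fixes c :: "nat \<Rightarrow> real"
  assumes x: "cadlag x" and c: "\<And>n. c n > 0" and C: "0 \<le> C"
    and lim: "\<And>q. q \<in> \<rat> \<Longrightarrow> 0 \<le> q \<Longrightarrow> (\<lambda>n. crossing_integral \<alpha> x (\<lambda>_. 1) (c n) q) \<longlonglongrightarrow> C * q"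
    and t: "0 \<le> t"
  shows "(\<lambda>n. crossing_integral \<alpha> x (\<lambda>_. 1) (c n) t) \<longlonglongrightarrow> C * t"
proof (rule tendstoI)
  let ?F = "\<lambda>n s. crossing_integral \<alpha> x (\<lambda>_. 1) (c n) s"
  fix r :: real assume r: "0 < r"
  define d where "d = r / (2 * (C + 1))"
  have d: "d > 0" "C * d \<le> r/2" using r C by (auto simp: d_def field_simps)
  obtain q where q: "q \<in> \<rat>" "t < q" "q < t + d" using Rats_dense_in_real[of t "t + d"] d by auto
  have "\<exists>p\<in>\<rat>. 0 \<le> p \<and> p \<le> t \<and> t - d < p"
  proof (cases "t = 0")
    case True then show ?thesis using d by (intro bexI[of _ 0]) auto
  next
    case False
    then show ?thesis using Rats_dense_in_real[of "max 0 (t - d)" t] t d by (auto intro: less_imp_le)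
  qed
  then obtain p where p: "p \<in> \<rat>" "0 \<le> p" "p \<le> t" "t - d < p" by blast
  have "\<forall>\<^sub>F n in sequentially. dist (?F n p) (C * p) < r/2" "\<forall>\<^sub>F n in sequentially. dist (?F n q) (C * q) < r/2"
    using tendstoD[OF lim, of p "r/2"] tendstoD[OF lim, of q "r/2"] p q t r by simp_all
  then show "\<forall>\<^sub>F n in sequentially. dist (?F n t) (C * t) < r"
  proof eventually_elim
    case (elim n)
    have "?F n p \<le> ?F n t" "?F n t \<le> ?F n q"
      using p q t by (auto intro!: crossing_integral_one_mono[OF x c])
    moreover have "C * q \<le> C * t + C * d" "C * t \<le> C * p + C * d"
      unfolding distrib_left[symmetric] using C p q by (auto intro!: mult_left_mono)
    moreover note elim[unfolded dist_real_def abs_less_iff] d(2)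
    ultimately show ?case unfolding dist_real_def abs_less_iff by linarith
  qed
qed

text \<open>Convergence at finitely many grid times becomes uniform because increments of the
  \<open>g\<close>-integral are at most K times increments of the total mass, which are monotone and
  have limiting slope C.\<close>

lemma crossing_integral_limit_uniform:
  fixes c :: "nat \<Rightarrow> real"
  assumes x: "cadlag x" and c: "\<And>n. c n > 0" "c \<longlonglongrightarrow> 0" and \<alpha>: "1 < \<alpha>" and C: "0 \<le> C"
    and lim: "\<And>t. 0 \<le> t \<Longrightarrow> (\<lambda>n. crossing_integral \<alpha> x (\<lambda>_. 1) (c n) t) \<longlonglongrightarrow> C * t"
    and g: "continuous_on UNIV g" "\<And>y. \<bar>g y\<bar> \<le> K" and T: "0 \<le> T" and r: "r > 0"
  shows "\<forall>\<^sub>F n in sequentially. \<forall>t\<in>{0..T}. \<bar>crossing_integral \<alpha> x g (c n) t - C * path_integral x g t\<bar> \<le> r"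
proof -
  let ?F = "\<lambda>n s. crossing_integral \<alpha> x (\<lambda>_. 1) (c n) s"
  let ?R = "\<lambda>n s. crossing_integral \<alpha> x g (c n) s"
  have gm: "g \<in> borel_measurable borel" using g(1) by (rule borel_measurable_continuous_onI)
  have K0: "0 \<le> K" using g(2)[of 0] by simp
  define A where "A = K * C * T + 1"
  have A: "A > 0" "K * C * T \<le> A" using K0 C T by (auto simp: A_def add_nonneg_pos)
  obtain m0 where "8 * A / r < real m0" using reals_Archimedean2 by blast
  define m where "m = Suc m0"
  have m: "8 * A / r < real m" "real m > 0" using \<open>8 * A / r < real m0\<close> by (auto simp: m_def)
  \<comment> \<open>The mesh gives K C h \<le> r/8, and \<open>e\<close> below gives K e \<le> r/8.
    The three errors at a time between grid points are then 3r/8, r/4 and r/8.\<close>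
  define h where "h = T / real m"
  have h0: "0 \<le> h" using T m by (simp add: h_def)
  have "K * C * h = K * C * T / real m" by (simp add: h_def)
  also have "\<dots> \<le> A / real m" using A(2) m(2) by (intro divide_right_mono) auto
  also have "\<dots> \<le> r / 8" using m r by (simp add: field_simps)
  finally have KCh: "K * C * h \<le> r / 8" .
  define e where "e = r / (8 * (K + 1))"
  have e: "e > 0" "K * e \<le> r / 8" using r K0 by (auto simp: e_def field_simps)
  have "\<forall>\<^sub>F n in sequentially. \<forall>i\<in>{..m}. dist (?R n (i * h)) (C * path_integral x g (i * h)) < r/4"
    by (intro eventually_ball_finite ballI tendstoD[OF crossing_integral_limit[OF x c \<alpha> C lim g]])
      (use h0 r in auto)
  moreover have "\<forall>\<^sub>F n in sequentially. \<forall>i\<in>{..m}. dist (?F n (i * h)) (C * (i * h)) < e"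
    by (intro eventually_ball_finite ballI tendstoD[OF lim]) (use h0 e in auto)
  ultimately show ?thesis
  proof eventually_elim
    case (elim n)
    show ?case
    proof
      fix t assume t: "t \<in> {0..T}"
      have "\<exists>i<m. real i * h \<le> t \<and> t \<le> real (Suc i) * h"
      proof (cases "t = T")
        case True
        then show ?thesis using m(2) h0 by (intro exI[of _ m0]) (auto simp: m_def h_def field_simps)
      next
        case False
        then have T0: "0 < T" "t < T" using t by auto
        then have h: "h > 0" using m by (simp add: h_def)
        define i where "i = nat \<lfloor>t / h\<rfloor>"
        have fl: "real i = real_of_int \<lfloor>t / h\<rfloor>" using t h by (simp add: i_def)
        then have "real i \<le> t / h" "t / h < real i + 1" by linarith+
        then have i: "real i * h \<le> t" "t \<le> real (Suc i) * h" using h by (auto simp: field_simps)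
        have "real i * h < real m * h" using i(1) T0 m by (simp add: h_def)
        then have "i < m" using h by simp
        with i show ?thesis by blast
      qed
      then obtain i where i: "i < m" "real i * h \<le> t" "t \<le> real (Suc i) * h" by blast
      let ?s = "real i * h" and ?u = "real (Suc i) * h"
      have s0: "0 \<le> ?s" using h0 by simp
      have "\<bar>?R n t - ?R n ?s\<bar> \<le> K * (?F n t - ?F n ?s)"
        by (rule crossing_integral_increment_le[OF x c(1) s0 i(2) gm g(2)])
      also have "\<dots> \<le> K * (?F n ?u - ?F n ?s)"
        using crossing_integral_one_mono[OF x c(1) _ i(3)] t K0 by (intro mult_left_mono) auto
      also have "\<dots> \<le> K * (C * h + 2 * e)"
      proof (rule mult_left_mono[OF _ K0])
        have "dist (?F n ?u) (C * ?u) < e" "dist (?F n ?s) (C * ?s) < e" using elim(2) i(1) by (auto simp del: of_nat_Suc)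
        moreover have "C * ?u = C * ?s + C * h" by (simp add: algebra_simps)
        ultimately show "?F n ?u - ?F n ?s \<le> C * h + 2 * e" unfolding dist_real_def by linarith
      qed
      also have "\<dots> \<le> r/8 + 2 * (r/8)" using KCh e(2) by (simp add: algebra_simps)
      finally have 1: "\<bar>?R n t - ?R n ?s\<bar> \<le> 3 * r / 8" by simp
      have "\<bar>path_integral x g t - path_integral x g ?s - 0 * (t - ?s)\<bar> \<le> K * (t - ?s)"
        using g(2) by (intro path_integral_close[OF x gm g(2) s0 i(2)]) auto
      also have "\<dots> \<le> K * h" using i K0 by (intro mult_left_mono) (auto simp: algebra_simps)
      finally have "C * \<bar>path_integral x g t - path_integral x g ?s\<bar> \<le> C * (K * h)"
        using C by (intro mult_left_mono) auto
      then have 2: "\<bar>C * path_integral x g t - C * path_integral x g ?s\<bar> \<le> r/8"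
        using KCh C by (simp add: abs_mult right_diff_distrib[symmetric] mult.assoc mult.left_commute)
      have "dist (?R n ?s) (C * path_integral x g ?s) < r/4" using elim(1) i(1) by auto
      then show "\<bar>?R n t - C * path_integral x g t\<bar> \<le> r" using 1 2 unfolding dist_real_def by linarith
    qed
  qed
qed

section \<open>Exit times of random walks\<close>

lemma ennreal_half_cancel:
  assumes "1 \<le> t + ennreal (1/2)"
  shows "ennreal (1/2) \<le> t"
proof (cases t)
  case (real r)
  have "ennreal 1 \<le> ennreal (r + 1/2)"
    using assms real by (subst ennreal_plus) auto
  then have "1 \<le> r + 1/2" using real by (subst (asm) ennreal_le_iff) auto
  then show ?thesis unfolding real(2) by (intro ennreal_leI) simp
qed simp

definition walk :: "(nat \<Rightarrow> real) \<Rightarrow> nat \<Rightarrow> real" where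
  "walk \<xi> j = (\<Sum>i<j. \<xi> i)"

definition seq_shift :: "nat \<Rightarrow> (nat \<Rightarrow> real) \<Rightarrow> nat \<Rightarrow> real" where
  "seq_shift k \<xi> = (\<lambda>i. \<xi> (k + i))"

definition first_exit :: "real \<Rightarrow> nat \<Rightarrow> (nat \<Rightarrow> real) \<Rightarrow> bool" where
  "first_exit r k \<xi> \<longleftrightarrow> r < \<bar>walk \<xi> k\<bar> \<and> (\<forall>j<k. \<bar>walk \<xi> j\<bar> \<le> r)"

lemma walk_add: "walk \<xi> (k + j) = walk \<xi> k + walk (seq_shift k \<xi>) j"
  by (induction j) (simp_all add: walk_def seq_shift_def add.assoc)

lemma walk_comb_seq: "j \<le> k \<Longrightarrow> walk (comb_seq k \<omega> \<omega>') j = walk \<omega> j"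
  unfolding walk_def by (intro sum.cong) (auto simp: comb_seq_def)

lemma seq_shift_comb_seq: "seq_shift k (comb_seq k \<omega> \<omega>') = \<omega>'"
  by (simp add: seq_shift_def comb_seq_def)

lemma first_exit_comb_seq: "first_exit r k (comb_seq k \<omega> \<omega>') \<longleftrightarrow> first_exit r k \<omega>"
  unfolding first_exit_def by (simp add: walk_comb_seq)

lemma first_exit_unique: "first_exit r k \<xi> \<Longrightarrow> first_exit r j \<xi> \<Longrightarrow> k = j"
  unfolding first_exit_def by (metis linorder_neqE_nat not_less)

text \<open>First exits at different indices exclude each other and exhaust the exits up to N; in
  this way stopping arguments are reduced to fixed indices.\<close>

lemma sum_first_exit:
  "(\<Sum>k\<le>N. indicator {\<xi>. first_exit r k \<xi>} \<xi>) = (indicator {\<xi>. \<exists>k\<le>N. r < \<bar>walk \<xi> k\<bar>} \<xi> :: ennreal)"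
proof (cases "\<exists>k\<le>N. r < \<bar>walk \<xi> k\<bar>")
  case True
  define k where "k = (LEAST k. r < \<bar>walk \<xi> k\<bar>)"
  have k: "r < \<bar>walk \<xi> k\<bar>" "k \<le> N" using True unfolding k_def by (auto intro: LeastI Least_le order_trans)
  have "\<not> r < \<bar>walk \<xi> j\<bar>" if "j < k" for j using that not_less_Least unfolding k_def by blast
  with k have "first_exit r k \<xi>" by (auto simp: first_exit_def not_less)
  then have "first_exit r j \<xi> \<longleftrightarrow> j = k" for j using first_exit_unique by blast
  then have "(\<Sum>j\<le>N. indicator {\<xi>. first_exit r j \<xi>} \<xi>) = (\<Sum>j\<le>N. if j = k then 1 else (0::ennreal))"
    by (intro sum.cong) (auto simp: indicator_def)
  also have "\<dots> = 1" using k(2) by simp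
  finally show ?thesis using True by (simp add: indicator_def)
next
  case False
  then show ?thesis by (auto simp: indicator_def first_exit_def intro!: sum.neutral)
qed

text \<open>Two positions within 1/2 of the origin differ by at most 1, so before the exit no band
  of width 1 is crossed. The exit position adds at most one crossing in each direction, and only at
  levels |y| \<le> |walk k|; this gives 2 times 2|walk k|.\<close>

lemma crossing_mass_walk_first_exit:
  assumes "first_exit (1/2) k \<xi>"
  shows "crossing_mass (walk \<xi>) 1 {..k} \<le> ennreal (4 * \<bar>walk \<xi> k\<bar>)"
proof -
  let ?w = "walk \<xi>"
  have w: "\<bar>?w j\<bar> \<le> \<bar>?w k\<bar>" if "j \<le> k" for j
  proof (cases "j = k")
    case False
    then have "\<bar>?w j\<bar> \<le> 1/2" "1/2 < \<bar>?w k\<bar>" using that assms by (auto simp: first_exit_def)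
    then show ?thesis by linarith
  qed simp
  have le1: "alt_count H L {..k} \<le> indicator {- \<bar>?w k\<bar>..\<bar>?w k\<bar>} y"
    if HL: "(\<forall>j. H j = (y + 1/2 < ?w j)) \<and> (\<forall>j. L j = (?w j < y - 1/2)) \<or>
      (\<forall>j. L j = (y + 1/2 < ?w j)) \<and> (\<forall>j. H j = (?w j < y - 1/2))" for H L y
  proof (cases "\<bar>y\<bar> \<le> \<bar>?w k\<bar>")
    case False
    have "alt_count H L {..k} = 0"
    proof (rule alt_count_eq_0)
      fix s u assume "s \<in> {..k}" "u \<in> {..k}" "H s" "L u"
      then show False using w[of s] w[of u] HL False by (elim disjE) auto
    qed
    then show ?thesis by simp
  next
    case True
    have "{..k} = {..<k} \<union> {k}" by auto
    then have "alt_count H L {..k} \<le> alt_count H L {..<k} + alt_count H L {k} + 1"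
      by (simp only:) (rule alt_count_Un_le, auto)
    moreover have "alt_count H L {..<k} = 0"
    proof (rule alt_count_eq_0)
      fix s u assume "s \<in> {..<k}" "u \<in> {..<k}" "H s" "L u"
      moreover then have "\<bar>?w s\<bar> \<le> 1/2" "\<bar>?w u\<bar> \<le> 1/2" using assms by (auto simp: first_exit_def)
      ultimately show False using HL by (elim disjE) auto
    qed
    moreover have "alt_count H L {k} = 0"
      by (rule alt_count_eq_0) (use HL in auto)
    ultimately show ?thesis using True by (simp add: indicator_def abs_le_iff)
  qed
  have "crossing_count ?w 1 y {..k} \<le> 2 * indicator {- \<bar>?w k\<bar>..\<bar>?w k\<bar>} y" for y
    unfolding crossing_count_def mult_2 by (intro add_mono le1) auto
  then have "crossing_mass ?w 1 {..k} \<le> (\<integral>\<^sup>+y. 2 * indicator {- \<bar>?w k\<bar>..\<bar>?w k\<bar>} y \<partial>lborel)"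
    unfolding crossing_mass_def by (intro nn_integral_mono) auto
  also have "\<dots> = ennreal 2 * ennreal (2 * \<bar>?w k\<bar>)" by (simp add: nn_integral_cmult)
  also have "\<dots> = ennreal (4 * \<bar>?w k\<bar>)" by (subst ennreal_mult[symmetric]) auto
  finally show ?thesis .
qed

lemma crossing_mass_walk_shift:
  "crossing_mass (walk \<xi>) c {k..k + n} = crossing_mass (walk (seq_shift k \<xi>)) c {..n}"
proof -
  have "{k..k + n} = (\<lambda>j. k + j) ` {..n}"
  proof (intro set_eqI iffI)
    fix j assume "j \<in> {k..k + n}"
    then show "j \<in> (\<lambda>j. k + j) ` {..n}" by (intro image_eqI[of _ _ "j - k"]) auto
  qed auto
  then have "crossing_mass (walk \<xi>) c {k..k + n} = crossing_mass (walk \<xi>) c ((\<lambda>j. k + j) ` {..n})"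
    by simp
  also have "\<dots> = crossing_mass (\<lambda>j. walk \<xi> (k + j)) c {..n}"
    by (rule crossing_mass_image) (auto simp: strict_mono_on_def)
  finally have "crossing_mass (walk \<xi>) c {k..k + n} = crossing_mass (\<lambda>j. walk \<xi> (k + j)) c {..n}" .
  also have "\<dots> = crossing_mass (\<lambda>j. walk (seq_shift k \<xi>) j + walk \<xi> k) c {..n}"
    by (simp only: walk_add[of \<xi> k] add.commute[of "walk \<xi> k"])
  also have "\<dots> = crossing_mass (walk (seq_shift k \<xi>)) c {..n}"
    by (rule crossing_mass_translate) auto
  finally show ?thesis .
qed

text \<open>Restart at the first exit: 4|walk k| pays for the past, 2 for the cut at width 1, and
  the rest is the mass of the shifted walk. Without an exit all positions are within distance 1 of
  each other and the mass is 0.\<close>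

lemma crossing_mass_walk_le:
  "crossing_mass (walk \<xi>) 1 {..N} \<le>
    (\<Sum>k\<le>N. indicator {\<xi>. first_exit (1/2) k \<xi>} \<xi> *
       (ennreal (4 * \<bar>walk \<xi> k\<bar> + 2) + crossing_mass (walk (seq_shift k \<xi>)) 1 {..N - k}))"
proof (cases "\<exists>k\<le>N. 1/2 < \<bar>walk \<xi> k\<bar>")
  case False
  then have "\<bar>walk \<xi> s - walk \<xi> u\<bar> \<le> 1" if "s \<in> {..N}" "u \<in> {..N}" for s u
  proof -
    have "\<bar>walk \<xi> s\<bar> \<le> 1/2" "\<bar>walk \<xi> u\<bar> \<le> 1/2" using False that by (auto simp: not_less)
    then show ?thesis by linarith
  qed
  then have "crossing_count (walk \<xi>) 1 y {..N} = 0" for y by (rule crossing_count_eq_0)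
  then show ?thesis by (simp add: crossing_mass_def)
next
  case True
  have "(\<Sum>k\<le>N. indicator {\<xi>. first_exit (1/2) k \<xi>} \<xi>) = (1::ennreal)"
    using True by (simp add: sum_first_exit)
  then obtain k where k: "k \<le> N" "first_exit (1/2) k \<xi>"
    by (metis (mono_tags, lifting) atMost_iff indicator_simps(2) mem_Collect_eq sum.neutral zero_neq_one)
  have sets: "{..N} \<inter> {..k} = {..k}" "{..N} \<inter> {k..} = {k..k + (N - k)}" using k(1) by auto
  have "crossing_mass (walk \<xi>) 1 {..N} \<le> crossing_mass (walk \<xi>) 1 {..k} + crossing_mass (walk \<xi>) 1 {k..k + (N - k)} + ennreal (2 * 1)"
    using crossing_mass_split_le[of "{..N}" k 1 "walk \<xi>"] k(1) unfolding sets by simp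
  also have "\<dots> \<le> ennreal (4 * \<bar>walk \<xi> k\<bar>) + crossing_mass (walk (seq_shift k \<xi>)) 1 {..N - k} + ennreal 2"
    unfolding crossing_mass_walk_shift using crossing_mass_walk_first_exit[OF k(2)] by (intro add_mono) auto
  also have "\<dots> = indicator {\<xi>. first_exit (1/2) k \<xi>} \<xi> *
       (ennreal (4 * \<bar>walk \<xi> k\<bar> + 2) + crossing_mass (walk (seq_shift k \<xi>)) 1 {..N - k})"
    using k(2) by (simp add: ennreal_plus ac_simps)
  also have "\<dots> \<le> (\<Sum>k\<le>N. indicator {\<xi>. first_exit (1/2) k \<xi>} \<xi> *
       (ennreal (4 * \<bar>walk \<xi> k\<bar> + 2) + crossing_mass (walk (seq_shift k \<xi>)) 1 {..N - k}))"
    using k(1) by (intro member_le_sum) auto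
  finally show ?thesis .
qed

section \<open>Random walks on the space of i.i.d. sequences\<close>

locale random_walk = sequence_space D for D :: "real measure" +
  assumes sets_D [measurable_cong]: "sets D = sets borel"
begin

lemma walk_measurable [measurable]: "(\<lambda>\<xi>. walk \<xi> j) \<in> borel_measurable S"
  unfolding walk_def by measurable

lemma seq_shift_measurable [measurable]: "seq_shift k \<in> S \<rightarrow>\<^sub>M S"
  unfolding seq_shift_def by (rule measurable_PiM_single') (auto simp: space_PiM PiE_iff)

lemma first_exit_measurable [measurable]: "Measurable.pred S (first_exit r k)"
  unfolding first_exit_def by measurable

lemma crossing_mass_walk_measurable [measurable]:
  "countable A \<Longrightarrow> (\<lambda>\<xi>. crossing_mass (walk \<xi>) c A) \<in> borel_measurable S"
  by (rule crossing_mass_measurable) auto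

lemma nn_integral_comb_seq:
  assumes [measurable]: "F \<in> borel_measurable S"
  shows "(\<integral>\<^sup>+\<omega>. F \<omega> \<partial>S) = (\<integral>\<^sup>+\<omega>. \<integral>\<^sup>+\<omega>'. F (comb_seq k \<omega> \<omega>') \<partial>S \<partial>S)"
proof -
  have "(\<integral>\<^sup>+\<omega>. F \<omega> \<partial>S) = (\<integral>\<^sup>+\<omega>. F \<omega> \<partial>distr (S \<Otimes>\<^sub>M S) S (\<lambda>(\<omega>, \<omega>'). comb_seq k \<omega> \<omega>'))"
    by (simp only: PiM_comb_seq)
  also have "\<dots> = (\<integral>\<^sup>+p. F (case p of (\<omega>, \<omega>') \<Rightarrow> comb_seq k \<omega> \<omega>') \<partial>(S \<Otimes>\<^sub>M S))"
    by (rule nn_integral_distr[OF measurable_comb_seq]) simp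
  also have "\<dots> = (\<integral>\<^sup>+\<omega>. \<integral>\<^sup>+\<omega>'. F (comb_seq k \<omega> \<omega>') \<partial>S \<partial>S)"
    by (subst P.nn_integral_fst[symmetric]) (auto intro!: measurable_compose[OF measurable_comb_seq assms])
  finally show ?thesis .
qed

text \<open>The Markov property at the fixed index \<open>k\<close>: \<open>F\<close> ignores all
  coordinates from \<open>k\<close> on, and \<open>comb_seq\<close> glues an independent
  continuation to the first \<open>k\<close> coordinates.\<close>

lemma nn_integral_split:
  assumes [measurable]: "F \<in> borel_measurable S" "G \<in> borel_measurable S"
    and F: "\<And>\<omega> \<omega>'. F (comb_seq k \<omega> \<omega>') = F \<omega>"
  shows "(\<integral>\<^sup>+\<omega>. F \<omega> * G (seq_shift k \<omega>) \<partial>S) = (\<integral>\<^sup>+\<omega>. F \<omega> \<partial>S) * (\<integral>\<^sup>+\<omega>. G \<omega> \<partial>S)"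
proof -
  have "(\<integral>\<^sup>+\<omega>. F \<omega> * G (seq_shift k \<omega>) \<partial>S) = (\<integral>\<^sup>+\<omega>. \<integral>\<^sup>+\<omega>'. F \<omega> * G \<omega>' \<partial>S \<partial>S)"
    by (subst nn_integral_comb_seq[where k = k]) (auto simp: F seq_shift_comb_seq)
  also have "\<dots> = (\<integral>\<^sup>+\<omega>. F \<omega> \<partial>S) * (\<integral>\<^sup>+\<omega>. G \<omega> \<partial>S)"
    by (simp add: nn_integral_cmult nn_integral_multc)
  finally show ?thesis .
qed

lemma nn_integral_shift:
  assumes [measurable]: "G \<in> borel_measurable S"
  shows "(\<integral>\<^sup>+\<omega>. G (seq_shift k \<omega>) \<partial>S) = (\<integral>\<^sup>+\<omega>. G \<omega> \<partial>S)"
  using nn_integral_split[of "\<lambda>_. 1" G k] by (simp add: P.emeasure_space_1)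

definition exit_prob :: "real \<Rightarrow> nat \<Rightarrow> ennreal" where
  "exit_prob r N = (\<integral>\<^sup>+\<xi>. indicator {\<xi>. \<exists>k\<le>N. r < \<bar>walk \<xi> k\<bar>} \<xi> \<partial>S)"

definition tail_prob :: "real \<Rightarrow> nat \<Rightarrow> ennreal" where
  "tail_prob r j = (\<integral>\<^sup>+\<xi>. indicator {\<xi>. r < \<bar>walk \<xi> j\<bar>} \<xi> \<partial>S)"

text \<open>After a first exit from the radius x + z at index k, the remaining walk stays within z
  with probability at least 1/2, independently of the past, and then |walk N| > x. Summing over k
  gives the factor 2.\<close>

lemma ottaviani:
  assumes "\<And>j. j \<le> N \<Longrightarrow> tail_prob z j \<le> ennreal (1/2)"
  shows "exit_prob (x + z) N \<le> 2 * tail_prob x N"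
proof -
  let ?A = "\<lambda>k. indicator {\<xi>. first_exit (x + z) k \<xi>} :: _ \<Rightarrow> ennreal"
  let ?T = "\<lambda>j. indicator {\<xi>. \<bar>walk \<xi> j\<bar> \<le> z} :: _ \<Rightarrow> ennreal"
  have half: "ennreal (1/2) \<le> (\<integral>\<^sup>+\<xi>. ?T j \<xi> \<partial>S)" if "j \<le> N" for j
  proof -
    have "1 = (\<integral>\<^sup>+\<xi>. ?T j \<xi> + indicator {\<xi>. z < \<bar>walk \<xi> j\<bar>} \<xi> \<partial>S)"
    proof -
      have "?T j \<xi> + indicator {\<xi>. z < \<bar>walk \<xi> j\<bar>} \<xi> = 1" for \<xi> by (auto simp: indicator_def)
      then show ?thesis by (simp add: P.emeasure_space_1)
    qed
    also have "\<dots> = (\<integral>\<^sup>+\<xi>. ?T j \<xi> \<partial>S) + tail_prob z j"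
      unfolding tail_prob_def by (rule nn_integral_add) measurable
    also have "\<dots> \<le> (\<integral>\<^sup>+\<xi>. ?T j \<xi> \<partial>S) + ennreal (1/2)" by (rule add_left_mono[OF assms[OF that]])
    finally have "1 \<le> (\<integral>\<^sup>+\<xi>. ?T j \<xi> \<partial>S) + ennreal (1/2)" .
    then show ?thesis by (rule ennreal_half_cancel)
  qed
  have two: "(2::ennreal) * ennreal (1/2) = 1"
    by (subst ennreal_numeral[symmetric], subst ennreal_mult[symmetric]) auto
  have "(\<integral>\<^sup>+\<xi>. ?A k \<xi> \<partial>S) * ennreal (1/2) \<le> (\<integral>\<^sup>+\<xi>. ?A k \<xi> * indicator {\<xi>. x < \<bar>walk \<xi> N\<bar>} \<xi> \<partial>S)" if k: "k \<le> N" for k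
  proof -
    have "(\<integral>\<^sup>+\<xi>. ?A k \<xi> \<partial>S) * ennreal (1/2) \<le> (\<integral>\<^sup>+\<xi>. ?A k \<xi> \<partial>S) * (\<integral>\<^sup>+\<xi>. ?T (N - k) \<xi> \<partial>S)"
      by (rule mult_left_mono[OF half]) auto
    also have "\<dots> = (\<integral>\<^sup>+\<xi>. ?A k \<xi> * ?T (N - k) (seq_shift k \<xi>) \<partial>S)"
      by (rule nn_integral_split[symmetric]) (measurable, simp add: first_exit_comb_seq indicator_def)
    also have "\<dots> \<le> (\<integral>\<^sup>+\<xi>. ?A k \<xi> * indicator {\<xi>. x < \<bar>walk \<xi> N\<bar>} \<xi> \<partial>S)"
    proof (rule nn_integral_mono)
      fix \<xi>
      have "walk \<xi> N = walk \<xi> k + walk (seq_shift k \<xi>) (N - k)" using walk_add[of \<xi> k "N - k"] k by simp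
      then show "?A k \<xi> * ?T (N - k) (seq_shift k \<xi>) \<le> ?A k \<xi> * indicator {\<xi>. x < \<bar>walk \<xi> N\<bar>} \<xi>"
        by (auto simp: indicator_def first_exit_def)
    qed
    finally show ?thesis .
  qed
  then have "(\<Sum>k\<le>N. (\<integral>\<^sup>+\<xi>. ?A k \<xi> \<partial>S) * ennreal (1/2)) \<le> (\<Sum>k\<le>N. (\<integral>\<^sup>+\<xi>. ?A k \<xi> * indicator {\<xi>. x < \<bar>walk \<xi> N\<bar>} \<xi> \<partial>S))"
    by (intro sum_mono) auto
  also have "\<dots> = (\<integral>\<^sup>+\<xi>. (\<Sum>k\<le>N. ?A k \<xi>) * indicator {\<xi>. x < \<bar>walk \<xi> N\<bar>} \<xi> \<partial>S)"
    by (subst nn_integral_sum[symmetric]) (measurable, simp add: sum_distrib_right)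
  also have "\<dots> \<le> tail_prob x N"
    unfolding tail_prob_def sum_first_exit by (intro nn_integral_mono) (auto simp: indicator_def)
  also have "(\<Sum>k\<le>N. (\<integral>\<^sup>+\<xi>. ?A k \<xi> \<partial>S) * ennreal (1/2)) = exit_prob (x + z) N * ennreal (1/2)"
    unfolding exit_prob_def sum_first_exit[symmetric]
    by (subst nn_integral_sum) (measurable, simp add: sum_distrib_right)
  finally have "2 * (exit_prob (x + z) N * ennreal (1/2)) \<le> 2 * tail_prob x N"
    by (rule mult_left_mono) simp
  moreover have "2 * (exit_prob (x + z) N * ennreal (1/2)) = (2 * ennreal (1/2)) * exit_prob (x + z) N"
    by (simp only: ac_simps)
  ultimately show ?thesis by (simp only: two mult_1)
qed

lemma exit_prob_mono: "N \<le> N' \<Longrightarrow> exit_prob r N \<le> exit_prob r N'"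
  unfolding exit_prob_def by (intro nn_integral_mono indicator_leI) (auto intro: order_trans)

definition expected_mass :: "nat \<Rightarrow> ennreal" where
  "expected_mass N = (\<integral>\<^sup>+\<xi>. crossing_mass (walk \<xi>) 1 {..N} \<partial>S)"

text \<open>Since an exit has probability at most 1/2, restarting bounds the mass by 8m + 2 plus
  half of the bound valid for smaller indices. Twice 8m + 2 is the fixed point of this recursion, so
  the bound does not grow with N.\<close>

lemma expected_mass_bound:
  assumes p: "exit_prob (1/2) N \<le> ennreal (1/2)" and m: "\<And>j. j \<le> N \<Longrightarrow> (\<integral>\<^sup>+\<xi>. ennreal \<bar>walk \<xi> j\<bar> \<partial>S) \<le> m"
  shows "expected_mass N \<le> 2 * (8 * m + 2)"
  using assms
proof (induction N rule: less_induct)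
  case (less N)
  let ?A = "\<lambda>k. indicator {\<xi>. first_exit (1/2) k \<xi>} :: _ \<Rightarrow> ennreal"
  let ?B = "8 * m + 2"
  have p: "(\<Sum>k\<le>N. \<integral>\<^sup>+\<xi>. ?A k \<xi> \<partial>S) = exit_prob (1/2) N"
    unfolding exit_prob_def sum_first_exit[symmetric] by (rule nn_integral_sum[symmetric]) measurable
  have p1: "exit_prob (1/2) N \<le> 1" using less.prems(1) ennreal_leI[of "1/2" 1] by (simp only: ennreal_1) (rule order_trans, auto)
  \<comment> \<open>The walk starts at 0, so k = 0 is never an exit, and N - k < N whenever the
    indicator can be nonzero.\<close>
  have IH: "(\<integral>\<^sup>+\<xi>. ?A k \<xi> \<partial>S) * expected_mass (N - k) \<le> (\<integral>\<^sup>+\<xi>. ?A k \<xi> \<partial>S) * (2 * ?B)" if k: "k \<le> N" for k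
  proof (cases "k = 0")
    case True
    then have "?A k \<xi> = 0" for \<xi> by (simp add: first_exit_def walk_def)
    then show ?thesis by simp
  next
    case False
    then show ?thesis using k less.prems exit_prob_mono[of "N - k" N "1/2"]
      by (intro mult_left_mono less.IH) auto
  qed
  \<comment> \<open>The position at the exit, overshoot included, is controlled by the terminal
    position and the independent remainder; thus first moments at fixed indices suffice.\<close>
  have W: "(\<integral>\<^sup>+\<xi>. ?A k \<xi> * ennreal \<bar>walk \<xi> k\<bar> \<partial>S) \<le>
      (\<integral>\<^sup>+\<xi>. ?A k \<xi> * ennreal \<bar>walk \<xi> N\<bar> \<partial>S) + (\<integral>\<^sup>+\<xi>. ?A k \<xi> \<partial>S) * m" if k: "k \<le> N" for k
  proof -
    have "(\<integral>\<^sup>+\<xi>. ?A k \<xi> * ennreal \<bar>walk \<xi> k\<bar> \<partial>S) \<le>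
      (\<integral>\<^sup>+\<xi>. ?A k \<xi> * ennreal \<bar>walk \<xi> N\<bar> + ?A k \<xi> * ennreal \<bar>walk (seq_shift k \<xi>) (N - k)\<bar> \<partial>S)"
    proof (rule nn_integral_mono)
      fix \<xi>
      have "walk \<xi> N = walk \<xi> k + walk (seq_shift k \<xi>) (N - k)" using walk_add[of \<xi> k "N - k"] k by simp
      then have "\<bar>walk \<xi> k\<bar> \<le> \<bar>walk \<xi> N\<bar> + \<bar>walk (seq_shift k \<xi>) (N - k)\<bar>" by linarith
      then have "ennreal \<bar>walk \<xi> k\<bar> \<le> ennreal \<bar>walk \<xi> N\<bar> + ennreal \<bar>walk (seq_shift k \<xi>) (N - k)\<bar>"
        by (subst ennreal_plus[symmetric]) (auto intro!: ennreal_leI simp del: ennreal_plus)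
      then show "?A k \<xi> * ennreal \<bar>walk \<xi> k\<bar> \<le> ?A k \<xi> * ennreal \<bar>walk \<xi> N\<bar> + ?A k \<xi> * ennreal \<bar>walk (seq_shift k \<xi>) (N - k)\<bar>"
        by (auto simp: indicator_def)
    qed
    also have "\<dots> = (\<integral>\<^sup>+\<xi>. ?A k \<xi> * ennreal \<bar>walk \<xi> N\<bar> \<partial>S) + (\<integral>\<^sup>+\<xi>. ?A k \<xi> * ennreal \<bar>walk (seq_shift k \<xi>) (N - k)\<bar> \<partial>S)"
      by (rule nn_integral_add) measurable
    also have "(\<integral>\<^sup>+\<xi>. ?A k \<xi> * ennreal \<bar>walk (seq_shift k \<xi>) (N - k)\<bar> \<partial>S)
       = (\<integral>\<^sup>+\<xi>. ?A k \<xi> \<partial>S) * (\<integral>\<^sup>+\<xi>. ennreal \<bar>walk \<xi> (N - k)\<bar> \<partial>S)"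
      by (rule nn_integral_split) (measurable, simp add: first_exit_comb_seq indicator_def)
    finally show ?thesis
      by (rule order_trans) (intro add_left_mono mult_left_mono less.prems(2), auto)
  qed
  have "expected_mass N \<le> (\<integral>\<^sup>+\<xi>. (\<Sum>k\<le>N. ?A k \<xi> *
       (ennreal (4 * \<bar>walk \<xi> k\<bar> + 2) + crossing_mass (walk (seq_shift k \<xi>)) 1 {..N - k})) \<partial>S)"
    unfolding expected_mass_def by (intro nn_integral_mono crossing_mass_walk_le)
  also have "\<dots> = (\<integral>\<^sup>+\<xi>. (\<Sum>k\<le>N. 4 * (?A k \<xi> * ennreal \<bar>walk \<xi> k\<bar>) + 2 * ?A k \<xi>
      + ?A k \<xi> * crossing_mass (walk (seq_shift k \<xi>)) 1 {..N - k}) \<partial>S)"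
    by (intro nn_integral_cong sum.cong refl)
      (auto simp: indicator_def ennreal_plus ennreal_mult distrib_left ac_simps)
  also have "\<dots> = (\<Sum>k\<le>N. 4 * (\<integral>\<^sup>+\<xi>. ?A k \<xi> * ennreal \<bar>walk \<xi> k\<bar> \<partial>S) + 2 * (\<integral>\<^sup>+\<xi>. ?A k \<xi> \<partial>S)
      + (\<integral>\<^sup>+\<xi>. ?A k \<xi> * crossing_mass (walk (seq_shift k \<xi>)) 1 {..N - k} \<partial>S))"
    by (subst nn_integral_sum) (measurable, simp add: nn_integral_add nn_integral_cmult)
  also have "\<dots> = (\<Sum>k\<le>N. 4 * (\<integral>\<^sup>+\<xi>. ?A k \<xi> * ennreal \<bar>walk \<xi> k\<bar> \<partial>S) + 2 * (\<integral>\<^sup>+\<xi>. ?A k \<xi> \<partial>S)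
      + (\<integral>\<^sup>+\<xi>. ?A k \<xi> \<partial>S) * expected_mass (N - k))"
    unfolding expected_mass_def
    by (intro sum.cong refl arg_cong2[where f = "(+)"] nn_integral_split)
      (measurable, simp add: first_exit_comb_seq indicator_def)
  also have "\<dots> \<le> (\<Sum>k\<le>N. 4 * ((\<integral>\<^sup>+\<xi>. ?A k \<xi> * ennreal \<bar>walk \<xi> N\<bar> \<partial>S) + (\<integral>\<^sup>+\<xi>. ?A k \<xi> \<partial>S) * m)
      + 2 * (\<integral>\<^sup>+\<xi>. ?A k \<xi> \<partial>S) + (\<integral>\<^sup>+\<xi>. ?A k \<xi> \<partial>S) * (2 * ?B))"
  proof (rule sum_mono)
    fix k assume "k \<in> {..N}"
    then have k: "k \<le> N" by simp
    show "4 * (\<integral>\<^sup>+\<xi>. ?A k \<xi> * ennreal \<bar>walk \<xi> k\<bar> \<partial>S) + 2 * (\<integral>\<^sup>+\<xi>. ?A k \<xi> \<partial>S)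
        + (\<integral>\<^sup>+\<xi>. ?A k \<xi> \<partial>S) * expected_mass (N - k)
      \<le> 4 * ((\<integral>\<^sup>+\<xi>. ?A k \<xi> * ennreal \<bar>walk \<xi> N\<bar> \<partial>S) + (\<integral>\<^sup>+\<xi>. ?A k \<xi> \<partial>S) * m)
        + 2 * (\<integral>\<^sup>+\<xi>. ?A k \<xi> \<partial>S) + (\<integral>\<^sup>+\<xi>. ?A k \<xi> \<partial>S) * (2 * ?B)"
      by (rule add_mono[OF add_mono[OF mult_left_mono[OF W[OF k]] order_refl] IH[OF k]]) simp
  qed
  also have "\<dots> = 4 * ((\<Sum>k\<le>N. \<integral>\<^sup>+\<xi>. ?A k \<xi> * ennreal \<bar>walk \<xi> N\<bar> \<partial>S) + (\<Sum>k\<le>N. \<integral>\<^sup>+\<xi>. ?A k \<xi> \<partial>S) * m)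
      + 2 * (\<Sum>k\<le>N. \<integral>\<^sup>+\<xi>. ?A k \<xi> \<partial>S) + (\<Sum>k\<le>N. \<integral>\<^sup>+\<xi>. ?A k \<xi> \<partial>S) * (2 * ?B)"
    by (simp add: sum.distrib sum_distrib_left sum_distrib_right distrib_left mult.assoc)
  also have "\<dots> \<le> 4 * (m + 1 * m) + 2 * 1 + ennreal (1/2) * (2 * ?B)"
  proof -
    have "(\<Sum>k\<le>N. \<integral>\<^sup>+\<xi>. ?A k \<xi> * ennreal \<bar>walk \<xi> N\<bar> \<partial>S) = (\<integral>\<^sup>+\<xi>. (\<Sum>k\<le>N. ?A k \<xi>) * ennreal \<bar>walk \<xi> N\<bar> \<partial>S)"
      by (subst nn_integral_sum[symmetric]) (measurable, simp add: sum_distrib_right)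
    also have "\<dots> \<le> (\<integral>\<^sup>+\<xi>. ennreal \<bar>walk \<xi> N\<bar> \<partial>S)"
      unfolding sum_first_exit by (intro nn_integral_mono) (auto simp: indicator_def)
    also have "\<dots> \<le> m" by (rule less.prems(2)) simp
    finally show ?thesis unfolding p using p1 less.prems(1)
      by (intro add_mono mult_left_mono mult_right_mono) auto
  qed
  also have "\<dots> = 2 * ?B"
  proof -
    have "(2::ennreal) * ennreal (1/2) = 1"
      by (subst ennreal_numeral[symmetric], subst ennreal_mult[symmetric]) auto
    moreover have "ennreal (1/2) * (2 * ?B) = (2 * ennreal (1/2)) * ?B" by (simp only: ac_simps)
    ultimately have e1: "ennreal (1/2) * (2 * ?B) = ?B" by (simp only: mult_1)
    have e2: "4 * (m + 1 * m) + 2 * 1 = ?B" by (simp add: mult_2[symmetric] flip: mult.assoc)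
    show ?thesis unfolding e1 e2 by (rule mult_2[symmetric])
  qed
  finally show ?case .
qed

text \<open>By Ottaviani's inequality the whole walk stays within 2r with probability at least 1/2,
  and then every step is at most 4r. So (1 - p)^n \<ge> 1/2 for the probability p of a larger step,
  which forces n p \<le> 1.\<close>

lemma tail_single_bound:
  assumes "\<And>j. j \<le> n \<Longrightarrow> tail_prob r j \<le> ennreal (1/4)"
  shows "real n * measure D {v. 4 * r < \<bar>v\<bar>} \<le> 1"
proof -
  let ?E = "{v. \<bar>v\<bar> \<le> 4 * r}"
  have [measurable]: "?E \<in> sets D" "{v. 4 * r < \<bar>v\<bar>} \<in> sets D" unfolding sets_D by measurable
  have prod: "(\<integral>\<^sup>+\<xi>. indicator {\<xi>. \<forall>i<n. \<xi> i \<in> ?E} \<xi> \<partial>S) = emeasure D ?E ^ n" for n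
  proof (induction n)
    case 0
    then show ?case by (simp add: P.emeasure_space_1)
  next
    case (Suc n)
    have "indicator {\<xi>. \<forall>i<Suc n. \<xi> i \<in> ?E} \<xi> =
       (indicator {\<xi>. \<forall>i<n. \<xi> i \<in> ?E} \<xi> * indicator {\<xi>. \<xi> 0 \<in> ?E} (seq_shift n \<xi>) :: ennreal)" for \<xi>
      by (auto simp: indicator_def seq_shift_def less_Suc_eq)
    then have "(\<integral>\<^sup>+\<xi>. indicator {\<xi>. \<forall>i<Suc n. \<xi> i \<in> ?E} \<xi> \<partial>S)
      = (\<integral>\<^sup>+\<xi>. indicator {\<xi>. \<forall>i<n. \<xi> i \<in> ?E} \<xi> \<partial>S) * (\<integral>\<^sup>+\<xi>. indicator {\<xi>. \<xi> 0 \<in> ?E} \<xi> \<partial>S)"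
      by (simp only:) (rule nn_integral_split, measurable, auto simp: indicator_def comb_seq_def)
    also have "(\<integral>\<^sup>+\<xi>. indicator {\<xi>. \<xi> 0 \<in> ?E} \<xi> \<partial>S) = (\<integral>\<^sup>+v. indicator ?E v \<partial>distr S D (\<lambda>\<xi>. \<xi> 0))"
      by (subst nn_integral_distr) (auto simp: indicator_def intro!: nn_integral_cong)
    also have "\<dots> = emeasure D ?E"
      using PiM_component[of 0] by simp
    finally show ?case using Suc by (simp add: mult.commute)
  qed
  have "exit_prob (r + r) n \<le> 2 * tail_prob r n"
  proof (rule ottaviani)
    fix j assume "j \<le> n"
    have "ennreal (1/4) \<le> ennreal (1/2)" by (rule ennreal_leI) simp
    with assms[OF \<open>j \<le> n\<close>] show "tail_prob r j \<le> ennreal (1/2)" by (rule order_trans)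
  qed
  also have "\<dots> \<le> 2 * ennreal (1/4)" using assms[of n] by (intro mult_left_mono) auto
  also have "\<dots> = ennreal (1/2)"
    by (subst ennreal_numeral[symmetric], subst ennreal_mult[symmetric]) auto
  finally have e: "exit_prob (r + r) n \<le> ennreal (1/2)" .
  have "1 = (\<integral>\<^sup>+\<xi>. 1 \<partial>S)" by (simp add: P.emeasure_space_1)
  also have "\<dots> \<le> (\<integral>\<^sup>+\<xi>. indicator {\<xi>. \<forall>i<n. \<xi> i \<in> ?E} \<xi> + indicator {\<xi>. \<exists>k\<le>n. r + r < \<bar>walk \<xi> k\<bar>} \<xi> \<partial>S)"
  proof (rule nn_integral_mono)
    fix \<xi>
    have "\<xi> i \<in> ?E" if no: "\<And>k. k \<le> n \<Longrightarrow> \<bar>walk \<xi> k\<bar> \<le> r + r" and "i < n" for i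
    proof -
      have "\<xi> i = walk \<xi> (Suc i) - walk \<xi> i" by (simp add: walk_def)
      with no[of "Suc i"] no[of i] \<open>i < n\<close> show ?thesis by auto
    qed
    then show "1 \<le> indicator {\<xi>. \<forall>i<n. \<xi> i \<in> ?E} \<xi> + (indicator {\<xi>. \<exists>k\<le>n. r + r < \<bar>walk \<xi> k\<bar>} \<xi> :: ennreal)"
      by (auto simp: indicator_def not_less)
  qed
  also have "\<dots> = emeasure D ?E ^ n + exit_prob (r + r) n"
    unfolding exit_prob_def prod[symmetric] by (rule nn_integral_add) measurable
  also have "\<dots> \<le> emeasure D ?E ^ n + ennreal (1/2)" using e by (rule add_left_mono)
  finally have "1 \<le> emeasure D ?E ^ n + ennreal (1/2)" .
  then have "ennreal (1/2) \<le> emeasure D ?E ^ n" by (rule ennreal_half_cancel)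
  also have "\<dots> = ennreal (measure D ?E ^ n)" by (simp add: M.emeasure_eq_measure ennreal_power)
  finally have half: "1/2 \<le> measure D ?E ^ n" by (subst (asm) ennreal_le_iff) auto
  define p where "p = measure D {v. 4 * r < \<bar>v\<bar>}"
  have "measure D ?E = 1 - p"
  proof -
    have "?E = space D - {v. 4 * r < \<bar>v\<bar>}" using sets_eq_imp_space_eq[OF sets_D] by auto
    then show ?thesis using M.prob_compl[of "{v. 4 * r < \<bar>v\<bar>}"] by (simp add: p_def)
  qed
  have p: "0 \<le> p" "p \<le> 1" by (auto simp: p_def)
  \<comment> \<open>Bernoulli's inequality for (1 + p)^n is multiplied by 1/2 \<le> (1 - p)^n; the
    product of the right-hand sides is at most 1.\<close>
  have "(1 + real n * p) * (1/2) \<le> (1 + p) ^ n * (1 - p) ^ n"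
    using half p Bernoulli_inequality[of p n] unfolding \<open>measure D ?E = 1 - p\<close>
    by (intro mult_mono) auto
  also have "\<dots> = (1 - p\<^sup>2) ^ n" by (simp add: power_mult_distrib[symmetric] algebra_simps power2_eq_square)
  also have "\<dots> \<le> 1" using p by (intro power_le_one) (auto simp: power_le_one)
  finally show ?thesis by (simp add: p_def)
qed

end

section \<open>Levy processes\<close>

context levy_process
begin

definition incr :: "real \<Rightarrow> 'a \<Rightarrow> nat \<Rightarrow> real" where
  "incr h \<omega> i = X (real (Suc i) * h) \<omega> - X (real i * h) \<omega>"

abbreviation law :: "real \<Rightarrow> real measure" where
  "law h \<equiv> distr M borel (X h)"

text \<open>\<open>X 0\<close> vanishes only almost surely, so on a single path it has to be
  subtracted; \<open>nn_integral_X_diff\<close> removes it under the integral.\<close>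

lemma walk_incr: "walk (incr h \<omega>) j = X (real j * h) \<omega> - X 0 \<omega>"
  unfolding walk_def incr_def by (subst sum_lessThan_telescope) simp

lemma X_measurable' [measurable]: "0 \<le> t \<Longrightarrow> X t \<in> borel_measurable M"
  by (rule random_variable_X)

lemma random_walk_law: "0 \<le> h \<Longrightarrow> random_walk (law h)"
proof -
  assume h: "0 \<le> h"
  interpret L: prob_space "law h" by (rule prob_space_distr) (use h in measurable)
  show ?thesis by unfold_locales (auto)
qed

lemma incr_component_measurable: "0 \<le> h \<Longrightarrow> (\<lambda>\<omega>. incr h \<omega> i) \<in> borel_measurable M"
  unfolding incr_def by (intro borel_measurable_diff X_measurable') auto

lemma incr_measurable: "0 \<le> h \<Longrightarrow> incr h \<in> M \<rightarrow>\<^sub>M PiM UNIV (\<lambda>_. law h)"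
  by (rule measurable_PiM_single') (auto simp: incr_component_measurable)

text \<open>Independence is a property of finite subfamilies, so it extends from initial segments to
  the whole sequence, whose law is then an infinite product.\<close>

lemma incr_law:
  assumes h: "0 \<le> h"
  shows "distr M (PiM UNIV (\<lambda>_. law h)) (incr h) = PiM UNIV (\<lambda>_. law h)"
proof -
  note [measurable] = incr_component_measurable[OF h]
  have iv: "indep_vars (\<lambda>_. borel) (\<lambda>i \<omega>. incr h \<omega> i) {..<n}" for n
  proof -
    have "incseq (\<lambda>i. real i * h)" using h by (auto simp: incseq_def intro!: mult_right_mono)
    from indep_increments[OF this, of n] show ?thesis by (simp add: incr_def)
  qed
  have "indep_vars (\<lambda>_. borel) (\<lambda>i \<omega>. incr h \<omega> i) UNIV"
    unfolding indep_vars_def2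
  proof (intro conjI ballI)
    show "indep_sets (\<lambda>i. {(\<lambda>\<omega>. incr h \<omega> i) -` A \<inter> space M |A. A \<in> sets borel}) UNIV"
      unfolding indep_sets_finite_index_sets[of _ UNIV]
    proof (intro allI impI)
      fix J :: "nat set" assume "finite J"
      then obtain n where "J \<subseteq> {..<n}" using finite_nat_iff_bounded by blast
      moreover have "indep_sets (\<lambda>i. {(\<lambda>\<omega>. incr h \<omega> i) -` A \<inter> space M |A. A \<in> sets borel}) {..<n}"
        using iv[of n] by (simp add: indep_vars_def2)
      ultimately show "indep_sets (\<lambda>i. {(\<lambda>\<omega>. incr h \<omega> i) -` A \<inter> space M |A. A \<in> sets borel}) J"
        by (rule indep_sets_mono_index)
    qed
  qed auto
  then have "distr M (PiM UNIV (\<lambda>_. borel)) (\<lambda>\<omega>. \<lambda>i\<in>UNIV. incr h \<omega> i) = PiM UNIV (\<lambda>i. distr M borel (\<lambda>\<omega>. incr h \<omega> i))"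
    by (subst (asm) indep_vars_iff_distr_eq_PiM) auto
  moreover have "distr M borel (\<lambda>\<omega>. incr h \<omega> i) = law h" for i
  proof -
    have "real (Suc i) * h = real i * h + h" by (simp add: algebra_simps)
    then show ?thesis using stationary_increments[of "real i * h" h] h by (simp add: incr_def)
  qed
  ultimately have "distr M (PiM UNIV (\<lambda>_. borel)) (\<lambda>\<omega>. incr h \<omega>) = PiM UNIV (\<lambda>_. law h)"
    by (simp add: restrict_UNIV)
  moreover have "sets (PiM UNIV (\<lambda>_::nat. law h)) = sets (PiM UNIV (\<lambda>_. borel))"
    by (intro sets_PiM_cong) auto
  ultimately show ?thesis by (metis (no_types, lifting) distr_cong eta_contract_eq)
qed

lemma nn_integral_incr:
  assumes h: "0 \<le> h" and [measurable]: "F \<in> borel_measurable (PiM UNIV (\<lambda>_. law h))"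
  shows "(\<integral>\<^sup>+\<omega>. F (incr h \<omega>) \<partial>M) = (\<integral>\<^sup>+\<xi>. F \<xi> \<partial>PiM UNIV (\<lambda>_. law h))"
proof -
  have "(\<integral>\<^sup>+\<xi>. F \<xi> \<partial>PiM UNIV (\<lambda>_. law h)) = (\<integral>\<^sup>+\<xi>. F \<xi> \<partial>distr M (PiM UNIV (\<lambda>_. law h)) (incr h))"
    by (simp only: incr_law[OF h])
  also have "\<dots> = (\<integral>\<^sup>+\<omega>. F (incr h \<omega>) \<partial>M)"
    by (rule nn_integral_distr[OF incr_measurable[OF h]]) simp
  finally show ?thesis by simp
qed

lemma nn_integral_X_diff:
  assumes "0 \<le> t" "f \<in> borel_measurable borel"
  shows "(\<integral>\<^sup>+\<omega>. f (X t \<omega> - X 0 \<omega>) \<partial>M) = (\<integral>\<^sup>+\<omega>. f (X t \<omega>) \<partial>M)"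
proof (rule nn_integral_cong_AE)
  show "AE \<omega> in M. f (X t \<omega> - X 0 \<omega>) = f (X t \<omega>)"
    using starts_at_0 by eventually_elim simp
qed

lemma tail_prob_law:
  assumes h: "0 \<le> h"
  shows "random_walk.tail_prob (law h) r j = emeasure M {\<omega>\<in>space M. r < \<bar>X (real j * h) \<omega>\<bar>}"
proof -
  interpret R: random_walk "law h" by (rule random_walk_law[OF h])
  have jh: "0 \<le> real j * h" using h by simp
  note [measurable] = X_measurable'[OF jh]
  have "R.tail_prob r j = (\<integral>\<^sup>+\<omega>. indicator {\<xi>. r < \<bar>walk \<xi> j\<bar>} (incr h \<omega>) \<partial>M)"
    unfolding R.tail_prob_def by (rule nn_integral_incr[OF h, symmetric]) measurable
  also have "\<dots> = (\<integral>\<^sup>+\<omega>. indicator {v. r < \<bar>v\<bar>} (X (real j * h) \<omega> - X 0 \<omega>) \<partial>M)"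
    by (simp add: indicator_def walk_incr)
  also have "\<dots> = (\<integral>\<^sup>+\<omega>. indicator {v. r < \<bar>v\<bar>} (X (real j * h) \<omega>) \<partial>M)"
    by (rule nn_integral_X_diff[OF jh]) measurable
  also have "\<dots> = (\<integral>\<^sup>+\<omega>. indicator {\<omega>\<in>space M. r < \<bar>X (real j * h) \<omega>\<bar>} \<omega> \<partial>M)"
    by (intro nn_integral_cong) (auto simp: indicator_def)
  also have "\<dots> = emeasure M {\<omega>\<in>space M. r < \<bar>X (real j * h) \<omega>\<bar>}"
    by (intro nn_integral_indicator) measurable
  finally show ?thesis .
qed

lemma tv_finite:
  assumes "\<omega> \<in> space M" "c > 0" "0 \<le> t"
  shows "truncated_variation c (\<lambda>t. X t \<omega>) 0 t < \<infinity>"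
proof -
  let ?x = "\<lambda>t. X t \<omega>"
  have x: "cadlag ?x" by (rule cadlag_paths[OF assms(1)])
  have "truncated_variation c ?x 0 t = (\<integral>\<^sup>+y. of_nat (crossings y c ?x 0 t) \<partial>lborel)"
    using crossings_mass[OF x assms(2) dense_times_rat[OF assms(3)]] by simp
  also have "\<dots> = (\<integral>\<^sup>+y. ennreal (1 * real (crossings y c ?x 0 t)) \<partial>lborel)" by (simp add: ennreal_of_nat_eq_real_of_nat)
  also have "\<dots> = ennreal (\<integral>y. 1 * real (crossings y c ?x 0 t) \<partial>lborel)"
    by (intro nn_integral_eq_integral integrable_crossings[OF x assms(2,3), of "\<lambda>_. 1" 1]) auto
  finally show ?thesis by simp
qed

text \<open>The supremum over uncountably many partitions is replaced by the crossing mass over a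
  countable dense set of times.\<close>

lemma tv_measurable [measurable]:
  assumes "c > 0" "0 \<le> t"
  shows "(\<lambda>\<omega>. truncated_variation c (\<lambda>t. X t \<omega>) 0 t) \<in> borel_measurable M"
proof -
  let ?D = "insert 0 (insert t (\<rat> \<inter> {0..t}))"
  have D: "dense_times ?D t" by (rule dense_times_rat[OF assms(2)])
  then have "(\<lambda>\<omega>. crossing_mass (\<lambda>t. X t \<omega>) c ?D) \<in> borel_measurable M"
    by (intro crossing_mass_measurable) (auto simp: dense_times_def)
  then show ?thesis
    by (rule measurable_cong[THEN iffD1, rotated]) (use crossings_mass(2)[OF cadlag_paths assms(1) D] in simp)
qed

end

section \<open>Dyadic times and independent time blocks\<close>

definition dyadic_grid :: "real \<Rightarrow> nat \<Rightarrow> nat \<Rightarrow> nat \<Rightarrow> real set" where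
  "dyadic_grid m a b k = (\<lambda>j. real j * (m / 2 ^ k)) ` {a * 2 ^ k..b * 2 ^ k}"

text \<open>The grids are nested, and each contains the multiples of \<open>m\<close> between its
  ends, so a cut between two blocks is a grid time at every level.\<close>

definition dyadics :: "real \<Rightarrow> nat \<Rightarrow> nat \<Rightarrow> real set" where
  "dyadics m a b = (\<Union>k. dyadic_grid m a b k)"

lemma dyadicsI: "a * 2 ^ k \<le> j \<Longrightarrow> j \<le> b * 2 ^ k \<Longrightarrow> real j * (m / 2 ^ k) \<in> dyadics m a b"
  unfolding dyadics_def dyadic_grid_def by (intro UN_I[of k] image_eqI[of _ _ j]) auto

lemma dyadicsE:
  assumes "t \<in> dyadics m a b"
  obtains j k where "t = real j * (m / 2 ^ k)" "a * 2 ^ k \<le> j" "j \<le> b * 2 ^ k"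
  using assms unfolding dyadics_def dyadic_grid_def image_iff UN_iff Bex_def atLeastAtMost_iff by blast

lemma incseq_dyadic_grid: "incseq (dyadic_grid m a b)"
proof (rule incseq_SucI, rule subsetI)
  fix k t assume "t \<in> dyadic_grid m a b k"
  then obtain j where j: "t = real j * (m / 2 ^ k)" "a * 2 ^ k \<le> j" "j \<le> b * 2 ^ k"
    unfolding dyadic_grid_def image_iff Bex_def atLeastAtMost_iff by blast
  then show "t \<in> dyadic_grid m a b (Suc k)"
    unfolding dyadic_grid_def by (intro image_eqI[of _ _ "2 * j"]) auto
qed

lemma countable_dyadics: "countable (dyadics m a b)" "countable (dyadic_grid m a b k)"
  by (auto simp: dyadics_def dyadic_grid_def)

lemma dyadics_bounds:
  assumes "m > 0" "t \<in> dyadics m a b"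
  shows "real a * m \<le> t" "t \<le> real b * m"
proof -
  obtain k j where j: "t = real j * (m / 2 ^ k)" "a * 2 ^ k \<le> j" "j \<le> b * 2 ^ k"
    using assms(2) by (rule dyadicsE)
  have ab: "real (a * 2 ^ k) \<le> real j" "real j \<le> real (b * 2 ^ k)" using j by (simp_all only: of_nat_le_iff)
  have p: "0 \<le> m / 2 ^ k" using assms(1) by simp
  have "real (a * 2 ^ k) * (m / 2 ^ k) \<le> t" "t \<le> real (b * 2 ^ k) * (m / 2 ^ k)"
    unfolding j(1) by (fact mult_right_mono[OF ab(1) p], fact mult_right_mono[OF ab(2) p])
  then show "real a * m \<le> t" "t \<le> real b * m" by simp_all
qed

lemma dyadics_endpoints:
  assumes "a \<le> i" "i \<le> b"
  shows "real i * m \<in> dyadics m a b"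
  using dyadicsI[of a 0 i b m] assms by simp

lemma dense_times_dyadics:
  assumes "m > 0"
  shows "dense_times (dyadics m 0 n) (real n * m)"
  unfolding dense_times_def
proof (intro conjI allI impI)
  show "dyadics m 0 n \<subseteq> {0..real n * m}" using dyadics_bounds[OF assms] by force
  show "0 \<in> dyadics m 0 n" using dyadics_endpoints[of 0 0 n m] by simp
  show "real n * m \<in> dyadics m 0 n" using dyadics_endpoints[of 0 n n m] by simp
  fix a b :: real assume ab: "0 \<le> a" "a < b" "b \<le> real n * m"
  obtain k where k: "m / (b - a) < 2 ^ k" using real_arch_pow[of 2 "m / (b - a)"] by auto
  define h where "h = m / 2 ^ k"
  have h: "0 < h" "h < b - a" using k assms ab by (auto simp: h_def field_simps)
  define j where "j = Suc (nat \<lfloor>a / h\<rfloor>)"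
  have fl: "real (nat \<lfloor>a / h\<rfloor>) = real_of_int \<lfloor>a / h\<rfloor>" using ab h by simp
  have "a / h < real j" "real j \<le> a / h + 1" unfolding j_def of_nat_Suc fl by linarith+
  then have j: "a < real j * h" "real j * h \<le> a + h" using h by (auto simp: field_simps)
  have "real j * h < real n * m" using j(2) h ab by linarith
  also have "real n * m = real (n * 2 ^ k) * h" by (simp add: h_def)
  finally have "j < n * 2 ^ k" using h(1) by (simp del: of_nat_mult)
  then have "real j * h \<in> dyadics m 0 n"
    unfolding h_def by (intro dyadicsI) auto
  then show "\<exists>d\<in>dyadics m 0 n. a < d \<and> d < b" using j h by (intro bexI[of _ "real j * h"]) auto
qed (rule countable_dyadics)

lemma dyadics_split:
  assumes "m > 0" "a \<le> i" "i \<le> b"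
  shows "dyadics m a b \<inter> {..real i * m} = dyadics m a i" "dyadics m a b \<inter> {real i * m..} = dyadics m i b"
    "dyadics m a b = dyadics m a i \<union> dyadics m i b"
proof -
  have *: "real j * (m / 2 ^ k) \<le> real i * m \<longleftrightarrow> j \<le> i * 2 ^ k" "real i * m \<le> real j * (m / 2 ^ k) \<longleftrightarrow> i * 2 ^ k \<le> j" for j k
  proof -
    have e: "real i * m = real (i * 2 ^ k) * (m / 2 ^ k)" by simp
    have p: "0 < m / 2 ^ k" using assms(1) by simp
    show "real j * (m / 2 ^ k) \<le> real i * m \<longleftrightarrow> j \<le> i * 2 ^ k"
      unfolding e using p by (simp only: mult_le_cancel_right_pos of_nat_le_iff)
    show "real i * m \<le> real j * (m / 2 ^ k) \<longleftrightarrow> i * 2 ^ k \<le> j"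
      unfolding e using p by (simp only: mult_le_cancel_right_pos of_nat_le_iff)
  qed
  have ik: "a * 2 ^ k \<le> i * 2 ^ k" "i * 2 ^ k \<le> b * 2 ^ k" for k :: nat using assms by auto
  show 1: "dyadics m a b \<inter> {..real i * m} = dyadics m a i"
  proof (intro set_eqI iffI)
    fix t assume "t \<in> dyadics m a b \<inter> {..real i * m}"
    then have t: "t \<in> dyadics m a b" "t \<le> real i * m" by auto
    from t(1) obtain j k where j: "t = real j * (m / 2 ^ k)" "a * 2 ^ k \<le> j" by (rule dyadicsE)
    then have "j \<le> i * 2 ^ k" using t(2) unfolding j(1) * by simp
    with j show "t \<in> dyadics m a i" by (simp only: dyadicsI)
  next
    fix t assume "t \<in> dyadics m a i"
    then obtain j k where j: "t = real j * (m / 2 ^ k)" "a * 2 ^ k \<le> j" "j \<le> i * 2 ^ k" by (rule dyadicsE)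
    then have "j \<le> b * 2 ^ k" using ik(2)[of k] by linarith
    then have "t \<in> dyadics m a b" unfolding j(1) using j(2) by (intro dyadicsI)
    moreover have "t \<le> real i * m" unfolding j(1) * by (rule j(3))
    ultimately show "t \<in> dyadics m a b \<inter> {..real i * m}" by simp
  qed
  show 2: "dyadics m a b \<inter> {real i * m..} = dyadics m i b"
  proof (intro set_eqI iffI)
    fix t assume "t \<in> dyadics m a b \<inter> {real i * m..}"
    then have t: "t \<in> dyadics m a b" "real i * m \<le> t" by auto
    from t(1) obtain j k where j: "t = real j * (m / 2 ^ k)" "j \<le> b * 2 ^ k" by (rule dyadicsE)
    then have "i * 2 ^ k \<le> j" using t(2) unfolding j(1) * by simp
    with j show "t \<in> dyadics m i b" by (simp only: dyadicsI)
  next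
    fix t assume "t \<in> dyadics m i b"
    then obtain j k where j: "t = real j * (m / 2 ^ k)" "i * 2 ^ k \<le> j" "j \<le> b * 2 ^ k" by (rule dyadicsE)
    then have "a * 2 ^ k \<le> j" using ik(1)[of k] by linarith
    then have "t \<in> dyadics m a b" unfolding j(1) using j(3) by (intro dyadicsI)
    moreover have "real i * m \<le> t" unfolding j(1) * by (rule j(2))
    ultimately show "t \<in> dyadics m a b \<inter> {real i * m..}" by simp
  qed
  have "dyadics m a b = (dyadics m a b \<inter> {..real i * m}) \<union> (dyadics m a b \<inter> {real i * m..})" by auto
  then show "dyadics m a b = dyadics m a i \<union> dyadics m i b" unfolding 1 2 .
qed

lemma incseq_SUP_mult:
  fixes a b :: "nat \<Rightarrow> ennreal"
  assumes "incseq a" "incseq b"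
  shows "(SUP k. a k) * (SUP k. b k) = (SUP k. a k * b k)"
proof (rule antisym)
  have "a i * (SUP k. b k) \<le> (SUP k. a k * b k)" for i
    unfolding SUP_mult_left_ennreal
  proof (rule SUP_least)
    fix j
    have "a i * b j \<le> a (max i j) * b (max i j)"
      using assms by (intro mult_mono) (auto simp: incseq_def)
    then show "a i * b j \<le> (SUP k. a k * b k)" by (rule order_trans) (rule SUP_upper, simp)
  qed
  then show "(SUP k. a k) * (SUP k. b k) \<le> (SUP k. a k * b k)"
    unfolding SUP_mult_right_ennreal by (rule SUP_least)
  show "(SUP k. a k * b k) \<le> (SUP k. a k) * (SUP k. b k)"
    by (intro SUP_least mult_mono SUP_upper) auto
qed

lemma crossing_mass_cong:
  assumes "\<And>s. s \<in> A \<Longrightarrow> x s = x' s"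
  shows "crossing_mass x c A = crossing_mass x' c A"
proof -
  have *: "alt_count H L A = alt_count H' L' A"
    if "\<And>s. s \<in> A \<Longrightarrow> H s = H' s" "\<And>s. s \<in> A \<Longrightarrow> L s = L' s" for H L H' L'
    using that by (intro antisym alt_count_mono) auto
  have "crossing_count x c y A = crossing_count x' c y A" for y
    unfolding crossing_count_def by (rule arg_cong2[where f = "(+)"]; rule *; simp add: assms)
  then show ?thesis unfolding crossing_mass_def by simp
qed

context levy_process
begin

text \<open>Plays the role of the truncated variation over the times from a m to b m
  (\<open>block_tv\<close> for a = 0). Written this way it is an increasing limit of functionals of
  finitely many i.i.d. increments, which hands independence and stationarity down to blocks.\<close>

definition block :: "real \<Rightarrow> nat \<Rightarrow> nat \<Rightarrow> 'a \<Rightarrow> ennreal" where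
  "block m a b \<omega> = crossing_mass (\<lambda>t. X t \<omega>) 1 (dyadics m a b)"

definition block_level :: "real \<Rightarrow> nat \<Rightarrow> nat \<Rightarrow> nat \<Rightarrow> 'a \<Rightarrow> ennreal" where
  "block_level m a b k \<omega> = crossing_mass (walk (incr (m / 2 ^ k) \<omega>)) 1 {a * 2 ^ k..b * 2 ^ k}"

lemma block_level_eq:
  assumes "m > 0"
  shows "block_level m a b k \<omega> = crossing_mass (\<lambda>t. X t \<omega>) 1 (dyadic_grid m a b k)"
proof -
  have "crossing_mass (\<lambda>t. X t \<omega>) 1 (dyadic_grid m a b k)
    = crossing_mass (\<lambda>j. X (real j * (m / 2 ^ k)) \<omega>) 1 {a * 2 ^ k..b * 2 ^ k}"
    unfolding dyadic_grid_def
    by (rule crossing_mass_image) (use assms in \<open>auto simp: strict_mono_on_def divide_strict_right_mono\<close>)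
  also have "\<dots> = crossing_mass (\<lambda>j. walk (incr (m / 2 ^ k) \<omega>) j + X 0 \<omega>) 1 {a * 2 ^ k..b * 2 ^ k}"
    by (simp add: walk_incr)
  also have "\<dots> = block_level m a b k \<omega>"
    unfolding block_level_def by (rule crossing_mass_translate) simp
  finally show ?thesis by simp
qed

lemma block_level_mono: "m > 0 \<Longrightarrow> incseq (\<lambda>k. block_level m a b k \<omega>)"
  unfolding block_level_eq using incseq_dyadic_grid[of m a b]
  by (auto simp: incseq_def intro!: crossing_mass_mono)

lemma block_SUP: "m > 0 \<Longrightarrow> block m a b \<omega> = (SUP k. block_level m a b k \<omega>)"
  unfolding block_level_eq block_def dyadics_def
  by (rule crossing_mass_UN[OF incseq_dyadic_grid countable_dyadics(2)])

lemma block_level_measurable [measurable]: "m > 0 \<Longrightarrow> block_level m a b k \<in> borel_measurable M"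
proof -
  assume m: "m > 0"
  then have h: "0 \<le> m / 2 ^ k" by simp
  interpret R: random_walk "law (m / 2 ^ k)" by (rule random_walk_law[OF h])
  show ?thesis unfolding block_level_def
    by (rule measurable_compose[OF incr_measurable[OF h] R.crossing_mass_walk_measurable]) simp
qed

lemma block_measurable [measurable]: "m > 0 \<Longrightarrow> block m a b \<in> borel_measurable M"
proof -
  assume m [measurable]: "m > 0"
  have "(\<lambda>\<omega>. SUP k. block_level m a b k \<omega>) \<in> borel_measurable M" using m by measurable
  then show ?thesis using block_SUP[OF m] by (simp add: fun_eq_iff cong: measurable_cong)
qed

lemma block_tv:
  assumes "m > 0" "\<omega> \<in> space M"
  shows "block m 0 n \<omega> = truncated_variation 1 (\<lambda>t. X t \<omega>) 0 (real n * m)"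
  unfolding block_def using crossings_mass(2)[OF cadlag_paths[OF assms(2)] zero_less_one dense_times_dyadics[OF assms(1)]] by simp

lemma block_add_le:
  assumes "m > 0" "a \<le> i" "i \<le> b"
  shows "block m a i \<omega> + block m i b \<omega> \<le> block m a b \<omega>"
  unfolding block_def dyadics_split(3)[OF assms]
  by (rule crossing_mass_Un_ge[OF countable_dyadics(1) countable_dyadics(1)])
    (use dyadics_bounds[OF assms(1)] in \<open>blast intro: order_trans\<close>)

text \<open>Together with \<open>block_add_le\<close> this is additivity up to 2, the price 2c of a
  cut at width c = 1.\<close>

lemma block_le_add:
  assumes "m > 0" "a \<le> i" "i \<le> b"
  shows "block m a b \<omega> \<le> block m a i \<omega> + block m i b \<omega> + 2"
  using crossing_mass_split_le[OF countable_dyadics(1) dyadics_endpoints[OF assms(2,3), of m] zero_less_one, of "\<lambda>t. X t \<omega>"]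
  unfolding block_def dyadics_split(1,2)[OF assms] by simp

lemma block_sum_le:
  assumes "m > 0"
  shows "(\<Sum>i<n. block m i (Suc i) \<omega>) \<le> block m 0 n \<omega>"
proof (induction n)
  case (Suc n)
  have "(\<Sum>i<Suc n. block m i (Suc i) \<omega>) \<le> block m 0 n \<omega> + block m n (Suc n) \<omega>"
    using Suc by (simp add: add_right_mono)
  also have "\<dots> \<le> block m 0 (Suc n) \<omega>" by (rule block_add_le) (use assms in auto)
  finally show ?case .
qed simp

lemma block_le_sum:
  assumes "m > 0"
  shows "block m 0 n \<omega> \<le> (\<Sum>i<n. block m i (Suc i) \<omega>) + ennreal (2 * real n)"
proof (induction n)
  case 0
  have "dyadics m 0 0 \<subseteq> {0}" using dyadics_bounds[OF assms, of _ 0 0] by force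
  then have "crossing_mass (\<lambda>t. X t \<omega>) 1 (dyadics m 0 0) \<le> crossing_mass (\<lambda>t. X t \<omega>) 1 {0}"
    by (rule crossing_mass_mono)
  also have "\<dots> = 0" unfolding crossing_mass_def by (subst crossing_count_eq_0) auto
  finally show ?case by (simp add: block_def)
next
  case (Suc n)
  have "block m 0 (Suc n) \<omega> \<le> block m 0 n \<omega> + block m n (Suc n) \<omega> + 2"
    by (rule block_le_add) (use assms in auto)
  also have "\<dots> \<le> ((\<Sum>i<n. block m i (Suc i) \<omega>) + ennreal (2 * real n)) + block m n (Suc n) \<omega> + ennreal 2"
    using Suc by (intro add_mono) auto
  also have "\<dots> = (\<Sum>i<Suc n. block m i (Suc i) \<omega>) + ennreal (2 * real n + 2)"
    by (subst ennreal_plus) (auto simp: ac_simps)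
  finally show ?case by (simp add: algebra_simps)
qed

text \<open>Independence and equal distribution of blocks, tested on \<open>f\<close> and
  \<open>g\<close>. Sup-continuity carries the identity from the grid levels to the limit by
  monotone convergence; it holds for the identity map and for truncations, the functions needed
  later.\<close>

lemma nn_integral_block_pair:
  fixes f g :: "ennreal \<Rightarrow> ennreal"
  assumes m: "m > 0" and f: "sup_continuous f" "f \<in> borel_measurable borel"
    and g: "sup_continuous g" "g \<in> borel_measurable borel" and ij: "i < j"
  shows "(\<integral>\<^sup>+\<omega>. f (block m i (Suc i) \<omega>) * g (block m j (Suc j) \<omega>) \<partial>M)
    = (\<integral>\<^sup>+\<omega>. f (block m 0 1 \<omega>) \<partial>M) * (\<integral>\<^sup>+\<omega>. g (block m 0 1 \<omega>) \<partial>M)"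
proof -
  note [measurable] = f(2) g(2) m
  have mono: "mono f" "mono g" using f g by (auto intro: sup_continuous_mono)
  have SUP: "\<phi> (block m a b \<omega>) = (SUP k. \<phi> (block_level m a b k \<omega>))"
    if "sup_continuous \<phi>" for \<phi> :: "ennreal \<Rightarrow> ennreal" and a b \<omega>
    unfolding block_SUP[OF m] by (rule sup_continuousD[OF that block_level_mono[OF m]])
  have inc: "incseq (\<lambda>k. \<phi> (block_level m a b k \<omega>))" if "mono \<phi>" for \<phi> :: "ennreal \<Rightarrow> ennreal" and a b \<omega>
    using block_level_mono[OF m, of a b \<omega>] that by (auto simp: incseq_def mono_def)
  have single: "(\<integral>\<^sup>+\<omega>. \<phi> (block m 0 1 \<omega>) \<partial>M) = (SUP k. (\<integral>\<^sup>+\<omega>. \<phi> (block_level m 0 1 k \<omega>) \<partial>M))"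
    if "sup_continuous \<phi>" and [measurable]: "\<phi> \<in> borel_measurable borel" for \<phi> :: "ennreal \<Rightarrow> ennreal"
    unfolding SUP[OF that(1)] using inc[OF sup_continuous_mono[OF that(1)]]
    by (intro nn_integral_monotone_convergence_SUP) (auto simp: incseq_def le_fun_def)
  have level: "(\<integral>\<^sup>+\<omega>. f (block_level m i (Suc i) k \<omega>) * g (block_level m j (Suc j) k \<omega>) \<partial>M)
    = (\<integral>\<^sup>+\<omega>. f (block_level m 0 1 k \<omega>) \<partial>M) * (\<integral>\<^sup>+\<omega>. g (block_level m 0 1 k \<omega>) \<partial>M)" for k
  proof -
    define h where "h = m / 2 ^ k"
    define N where "N = (2::nat) ^ k"
    have h: "0 \<le> h" using m by (simp add: h_def)
    interpret R: random_walk "law h" by (rule random_walk_law[OF h])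
    have set: "{a * N..Suc a * N} = {a * N..a * N + N}" for a by (simp add: add.commute)
    have bl: "block_level m a (Suc a) k \<omega> = crossing_mass (walk (seq_shift (a * N) (incr h \<omega>))) 1 {..N}" for a \<omega>
      unfolding block_level_def h_def[symmetric] N_def[symmetric] set by (rule crossing_mass_walk_shift)
    have [measurable]: "(\<lambda>\<xi>. \<phi> (crossing_mass (walk \<xi>) 1 {..N})) \<in> borel_measurable R.S"
      if [measurable]: "\<phi> \<in> borel_measurable borel" for \<phi> :: "ennreal \<Rightarrow> ennreal"
      by measurable
    have Nij: "i * N + N \<le> j * N" using ij mult_le_mono1[of "Suc i" j N] by simp
    \<comment> \<open>All increments of block \<open>i\<close> precede index j N, so they are
      untouched when the sequence is cut there.\<close>
    have ff: "f (crossing_mass (walk (seq_shift (i * N) (comb_seq (j * N) \<omega> \<omega>'))) 1 {..N})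
       = f (crossing_mass (walk (seq_shift (i * N) \<omega>)) 1 {..N})" for \<omega> \<omega>' :: "nat \<Rightarrow> real"
    proof -
      have "walk (seq_shift (i * N) (comb_seq (j * N) \<omega> \<omega>')) a = walk (seq_shift (i * N) \<omega>) a" if "a \<le> N" for a
        unfolding walk_def seq_shift_def using that Nij by (intro sum.cong) (auto simp: comb_seq_def)
      then show ?thesis by (subst crossing_mass_cong) auto
    qed
    have "(\<integral>\<^sup>+\<omega>. f (block_level m i (Suc i) k \<omega>) * g (block_level m j (Suc j) k \<omega>) \<partial>M)
      = (\<integral>\<^sup>+\<xi>. f (crossing_mass (walk (seq_shift (i * N) \<xi>)) 1 {..N}) * g (crossing_mass (walk (seq_shift (j * N) \<xi>)) 1 {..N}) \<partial>R.S)"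
      unfolding bl by (rule nn_integral_incr[OF h]) measurable
    also have "\<dots> = (\<integral>\<^sup>+\<xi>. f (crossing_mass (walk (seq_shift (i * N) \<xi>)) 1 {..N}) \<partial>R.S) * (\<integral>\<^sup>+\<xi>. g (crossing_mass (walk \<xi>) 1 {..N}) \<partial>R.S)"
      by (rule R.nn_integral_split[where G = "\<lambda>\<xi>. g (crossing_mass (walk \<xi>) 1 {..N})"]) (measurable, rule ff)
    also have "(\<integral>\<^sup>+\<xi>. f (crossing_mass (walk (seq_shift (i * N) \<xi>)) 1 {..N}) \<partial>R.S) = (\<integral>\<^sup>+\<xi>. f (crossing_mass (walk \<xi>) 1 {..N}) \<partial>R.S)"
      by (rule R.nn_integral_shift) measurable
    also have "(\<integral>\<^sup>+\<xi>. f (crossing_mass (walk \<xi>) 1 {..N}) \<partial>R.S) = (\<integral>\<^sup>+\<omega>. f (block_level m 0 1 k \<omega>) \<partial>M)"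
      unfolding block_level_def h_def[symmetric] N_def[symmetric]
      by (subst nn_integral_incr[OF h]) (auto simp: atMost_atLeast0)
    also have "(\<integral>\<^sup>+\<xi>. g (crossing_mass (walk \<xi>) 1 {..N}) \<partial>R.S) = (\<integral>\<^sup>+\<omega>. g (block_level m 0 1 k \<omega>) \<partial>M)"
      unfolding block_level_def h_def[symmetric] N_def[symmetric]
      by (subst nn_integral_incr[OF h]) (auto simp: atMost_atLeast0)
    finally show ?thesis .
  qed
  have "(\<integral>\<^sup>+\<omega>. f (block m i (Suc i) \<omega>) * g (block m j (Suc j) \<omega>) \<partial>M)
    = (\<integral>\<^sup>+\<omega>. (SUP k. f (block_level m i (Suc i) k \<omega>) * g (block_level m j (Suc j) k \<omega>)) \<partial>M)"
    unfolding SUP[OF f(1)] SUP[OF g(1)] by (intro nn_integral_cong incseq_SUP_mult inc mono)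
  also have "\<dots> = (SUP k. (\<integral>\<^sup>+\<omega>. f (block_level m i (Suc i) k \<omega>) * g (block_level m j (Suc j) k \<omega>) \<partial>M))"
    using inc[OF mono(1)] inc[OF mono(2)]
    by (intro nn_integral_monotone_convergence_SUP) (auto simp: incseq_def le_fun_def intro!: mult_mono)
  also have "\<dots> = (SUP k. (\<integral>\<^sup>+\<omega>. f (block_level m 0 1 k \<omega>) \<partial>M) * (\<integral>\<^sup>+\<omega>. g (block_level m 0 1 k \<omega>) \<partial>M))"
    by (simp only: level)
  also have "\<dots> = (SUP k. (\<integral>\<^sup>+\<omega>. f (block_level m 0 1 k \<omega>) \<partial>M)) * (SUP k. (\<integral>\<^sup>+\<omega>. g (block_level m 0 1 k \<omega>) \<partial>M))"
    using inc[OF mono(1)] inc[OF mono(2)]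
    by (intro incseq_SUP_mult[symmetric]) (auto simp: incseq_def intro!: nn_integral_mono)
  also have "\<dots> = (\<integral>\<^sup>+\<omega>. f (block m 0 1 \<omega>) \<partial>M) * (\<integral>\<^sup>+\<omega>. g (block m 0 1 \<omega>) \<partial>M)"
    by (simp only: single[OF f] single[OF g])
  finally show ?thesis .
qed

lemma nn_integral_block:
  fixes f :: "ennreal \<Rightarrow> ennreal"
  assumes m: "m > 0" and f: "sup_continuous f" "f \<in> borel_measurable borel"
  shows "(\<integral>\<^sup>+\<omega>. f (block m i (Suc i) \<omega>) \<partial>M) = (\<integral>\<^sup>+\<omega>. f (block m 0 1 \<omega>) \<partial>M)"
  using nn_integral_block_pair[OF m f, of "\<lambda>_. 1" i "Suc i"]
  by (simp add: sup_continuous_const emeasure_space_1)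

end

section \<open>Self-similarity\<close>

context strictly_stable_process
begin

lemma nn_integral_scale:
  assumes A: "A > 0" and [measurable]: "\<Phi> \<in> borel_measurable (PiM {0::real..} (\<lambda>_. borel :: real measure))"
  shows "(\<integral>\<^sup>+\<omega>. \<Phi> (\<lambda>t\<in>{0..}. A powr (- 1 / \<alpha>) * X (A * t) \<omega>) \<partial>M) = (\<integral>\<^sup>+\<omega>. \<Phi> (\<lambda>t\<in>{0..}. X t \<omega>) \<partial>M)"
proof -
  have 1 [measurable]: "(\<lambda>\<omega>. \<lambda>t\<in>{0..}. X t \<omega>) \<in> M \<rightarrow>\<^sub>M PiM {0..} (\<lambda>_. borel)"
    by (rule measurable_restrict) simp
  have 2 [measurable]: "(\<lambda>\<omega>. \<lambda>t\<in>{0..}. A powr (- 1 / \<alpha>) * X (A * t) \<omega>) \<in> M \<rightarrow>\<^sub>M PiM {0..} (\<lambda>_. borel)"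
    by (rule measurable_restrict) (use A in simp)
  have "(\<integral>\<^sup>+x. \<Phi> x \<partial>process_law M (\<lambda>t \<omega>. A powr (- 1 / \<alpha>) * X (A * t) \<omega>)) = (\<integral>\<^sup>+x. \<Phi> x \<partial>process_law M X)"
    by (simp only: self_similar[OF A])
  moreover have "(\<integral>\<^sup>+x. \<Phi> x \<partial>process_law M (\<lambda>t \<omega>. A powr (- 1 / \<alpha>) * X (A * t) \<omega>))
      = (\<integral>\<^sup>+\<omega>. \<Phi> (\<lambda>t\<in>{0..}. A powr (- 1 / \<alpha>) * X (A * t) \<omega>) \<partial>M)"
    unfolding process_law_def by (rule nn_integral_distr[OF 2]) simp
  moreover have "(\<integral>\<^sup>+x. \<Phi> x \<partial>process_law M X) = (\<integral>\<^sup>+\<omega>. \<Phi> (\<lambda>t\<in>{0..}. X t \<omega>) \<partial>M)"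
    unfolding process_law_def by (rule nn_integral_distr[OF 1]) simp
  ultimately show ?thesis by simp
qed

lemma nn_integral_scale1:
  assumes "t > 0" and f: "f \<in> borel_measurable borel"
  shows "(\<integral>\<^sup>+\<omega>. f (X t \<omega>) \<partial>M) = (\<integral>\<^sup>+\<omega>. f (t powr (1 / \<alpha>) * X 1 \<omega>) \<partial>M)"
proof -
  have "1 / \<alpha> + - 1 / \<alpha> = 0" by simp
  then have pp: "t powr (1 / \<alpha>) * t powr (- 1 / \<alpha>) = 1"
    using assms(1) unfolding powr_add[symmetric] by simp
  have m: "(\<lambda>x. f (t powr (1 / \<alpha>) * x 1)) \<in> borel_measurable (PiM {0::real..} (\<lambda>_. borel :: real measure))"
  proof (rule measurable_compose[OF _ f])
    have "(\<lambda>x. x 1) \<in> borel_measurable (PiM {0::real..} (\<lambda>_. borel :: real measure))"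
      by (rule measurable_component_singleton) simp
    then show "(\<lambda>x. t powr (1 / \<alpha>) * x 1) \<in> borel_measurable (PiM {0::real..} (\<lambda>_. borel :: real measure))"
      by (intro borel_measurable_times borel_measurable_const)
  qed
  have e: "t powr (1 / \<alpha>) * (t powr (- 1 / \<alpha>) * v) = v" for v
    unfolding mult.assoc[symmetric] pp by simp
  have "t powr (1 / \<alpha>) * (t powr - (1 / \<alpha>) * v) = v" for v
    unfolding minus_divide_left by (rule e)
  with nn_integral_scale[OF assms(1) m] show ?thesis by simp
qed

text \<open>With A = c^\<alpha> space is scaled by 1/c, which turns width \<open>c\<close> into
  width 1. Laws of processes live on a product \<sigma>-algebra, so the truncated variation is first
  rewritten as a crossing mass over countably many times: \<open>D\<close> for the end time T, and
  its image under multiplication by A for the end time A T.\<close>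

lemma nn_integral_tv_scale:
  assumes c: "c > 0" and T: "0 < T" and [measurable]: "f \<in> borel_measurable borel"
  shows "(\<integral>\<^sup>+\<omega>. f (ennreal (c powr (- 1)) * truncated_variation c (\<lambda>t. X t \<omega>) 0 (c powr \<alpha> * T)) \<partial>M)
    = (\<integral>\<^sup>+\<omega>. f (truncated_variation 1 (\<lambda>t. X t \<omega>) 0 T) \<partial>M)"
proof -
  define A where "A = c powr \<alpha>"
  have A: "A > 0" using c by (simp add: A_def)
  have A': "A powr (- 1 / \<alpha>) = c powr (- 1)" using index_pos by (simp add: A_def powr_powr)
  define D where "D = insert 0 (insert T (\<rat> \<inter> {0..T}))"
  have D: "dense_times D T" unfolding D_def using T by (intro dense_times_rat) simp
  have Dc: "countable D" "D \<subseteq> {0..}" using D unfolding dense_times_def by auto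
  have AD: "dense_times ((\<lambda>t. A * t) ` D) (A * T)"
    unfolding dense_times_def
  proof (intro conjI allI impI)
    fix a b assume ab: "0 \<le> a" "a < b" "b \<le> A * T"
    then have "0 \<le> a / A" "a / A < b / A" "b / A \<le> T" using A by (auto simp: field_simps)
    then obtain d where "d \<in> D" "a / A < d" "d < b / A" using D unfolding dense_times_def by blast
    then have "a < A * d" "A * d < b" using A by (simp_all add: field_simps)
    then show "\<exists>d\<in>(\<lambda>t. A * t) ` D. a < d \<and> d < b" using \<open>d \<in> D\<close> by blast
  next
    have *: "countable D" "D \<subseteq> {0..T}" "0 \<in> D" "T \<in> D" using D unfolding dense_times_def by blast+
    show "countable ((\<lambda>t. A * t) ` D)" using *(1) by simp
    show "(\<lambda>t. A * t) ` D \<subseteq> {0..A * T}" using *(2) A by (auto intro!: mult_left_mono)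
    show "0 \<in> (\<lambda>t. A * t) ` D" using *(3) by (intro image_eqI[of _ _ 0]) auto
    show "A * T \<in> (\<lambda>t. A * t) ` D" using *(4) by (rule imageI)
  qed
  have [measurable]: "(\<lambda>x. f (crossing_mass x 1 D)) \<in> borel_measurable (PiM {0..} (\<lambda>_. borel))"
  proof (rule measurable_compose[OF crossing_mass_measurable[OF Dc(1)]])
    fix s assume "s \<in> D"
    then show "(\<lambda>x. x s) \<in> borel_measurable (PiM {0::real..} (\<lambda>_. borel :: real measure))"
      using Dc(2) by (intro measurable_component_singleton) auto
  qed simp
  have restr: "crossing_mass (\<lambda>t\<in>{0..}. x t) 1 D = crossing_mass x 1 D" for x :: "real \<Rightarrow> real"
    using Dc(2) by (intro crossing_mass_cong) auto
  have 1: "crossing_mass (\<lambda>t. A powr (- 1 / \<alpha>) * X (A * t) \<omega>) 1 D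
    = ennreal (c powr (- 1)) * truncated_variation c (\<lambda>t. X t \<omega>) 0 (A * T)" if "\<omega> \<in> space M" for \<omega>
  proof -
    have "crossing_mass (\<lambda>t. c powr (- 1) * X (A * t) \<omega> + 0) (c powr (- 1) * c) D
      = ennreal (c powr (- 1)) * crossing_mass (\<lambda>t. X (A * t) \<omega>) c D"
      using c Dc(1) by (intro crossing_mass_affine) auto
    also have "c powr (- 1) * c = 1" using c by (simp add: powr_minus_divide)
    also have "crossing_mass (\<lambda>t. X (A * t) \<omega>) c D = crossing_mass (\<lambda>t. X t \<omega>) c ((\<lambda>t. A * t) ` D)"
      using A by (intro crossing_mass_image[symmetric]) (auto simp: strict_mono_on_def)
    also have "\<dots> = truncated_variation c (\<lambda>t. X t \<omega>) 0 (A * T)"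
      by (rule crossings_mass(2)[OF cadlag_paths[OF that] c AD, symmetric])
    finally show ?thesis unfolding A' by simp
  qed
  have 2: "crossing_mass (\<lambda>t. X t \<omega>) 1 D = truncated_variation 1 (\<lambda>t. X t \<omega>) 0 T" if "\<omega> \<in> space M" for \<omega>
    by (rule crossings_mass(2)[OF cadlag_paths[OF that] zero_less_one D, symmetric])
  have "(\<integral>\<^sup>+\<omega>. f (crossing_mass (\<lambda>t\<in>{0..}. A powr (- 1 / \<alpha>) * X (A * t) \<omega>) 1 D) \<partial>M)
    = (\<integral>\<^sup>+\<omega>. f (crossing_mass (\<lambda>t\<in>{0..}. X t \<omega>) 1 D) \<partial>M)"
    by (rule nn_integral_scale[OF A]) measurable
  then show ?thesis unfolding restr A_def[symmetric]
    using 1 2 by (simp cong: nn_integral_cong_simp)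
qed

lemma tail_scale:
  assumes "0 < t"
  shows "emeasure M {\<omega>\<in>space M. r < \<bar>X t \<omega>\<bar>} = emeasure M {\<omega>\<in>space M. r / t powr (1 / \<alpha>) < \<bar>X 1 \<omega>\<bar>}"
proof -
  have m: "{\<omega>\<in>space M. r' < \<bar>X t' \<omega>\<bar>} \<in> sets M" if t': "0 \<le> t'" for r' t'
  proof -
    note [measurable] = X_measurable'[OF t']
    show ?thesis by measurable
  qed
  have e: "emeasure M {\<omega>\<in>space M. r' < \<bar>X t' \<omega>\<bar>} = (\<integral>\<^sup>+\<omega>. indicator {v. r' < \<bar>v\<bar>} (X t' \<omega>) \<partial>M)"
    if "0 \<le> t'" for r' t'
    unfolding nn_integral_indicator[symmetric, OF m[OF that]]
    by (intro nn_integral_cong) (simp add: indicator_def)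
  have "emeasure M {\<omega>\<in>space M. r < \<bar>X t \<omega>\<bar>} = (\<integral>\<^sup>+\<omega>. indicator {v. r < \<bar>v\<bar>} (t powr (1 / \<alpha>) * X 1 \<omega>) \<partial>M)"
    unfolding e[OF less_imp_le[OF assms]] by (rule nn_integral_scale1[OF assms]) measurable
  also have "\<dots> = (\<integral>\<^sup>+\<omega>. indicator {v. r / t powr (1 / \<alpha>) < \<bar>v\<bar>} (X 1 \<omega>) \<partial>M)"
    using assms by (intro nn_integral_cong) (simp add: indicator_def abs_mult pos_divide_less_eq mult.commute)
  also have "\<dots> = emeasure M {\<omega>\<in>space M. r / t powr (1 / \<alpha>) < \<bar>X 1 \<omega>\<bar>}"
    by (rule e[symmetric]) simp
  finally show ?thesis .
qed

text \<open>The value 1/4 is dictated by Ottaviani's inequality: its factor 2 leaves an exit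
  probability of 1/2.\<close>

lemma exists_tail_level: "\<exists>K>0. emeasure M {\<omega>\<in>space M. K < \<bar>X 1 \<omega>\<bar>} \<le> ennreal (1/4)"
proof -
  let ?A = "\<lambda>n::nat. {\<omega>\<in>space M. real n + 1 < \<bar>X 1 \<omega>\<bar>}"
  have [measurable]: "X 1 \<in> borel_measurable M" by simp
  have "(\<lambda>n. emeasure M (?A n)) \<longlonglongrightarrow> emeasure M (\<Inter>n. ?A n)"
    by (rule Lim_emeasure_decseq) (auto simp: decseq_def)
  moreover have "(\<Inter>n. ?A n) = {}"
  proof -
    have False if "\<And>n::nat. real n + 1 < \<bar>X 1 \<omega>\<bar>" for \<omega>
    proof -
      obtain n where "\<bar>X 1 \<omega>\<bar> < real n" using reals_Archimedean2 by blast
      with that[of n] show False by simp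
    qed
    then show ?thesis by blast
  qed
  ultimately have "(\<lambda>n. emeasure M (?A n)) \<longlonglongrightarrow> 0" by simp
  then have "\<forall>\<^sub>F n in sequentially. emeasure M (?A n) < ennreal (1/4)"
    by (rule order_tendstoD(2)) simp
  then obtain n where "emeasure M (?A n) < ennreal (1/4)" by (auto simp: eventually_sequentially)
  then show ?thesis by (intro exI[of _ "real n + 1"]) auto
qed

lemma tail_bound:
  assumes K: "K > 0" "emeasure M {\<omega>\<in>space M. K < \<bar>X 1 \<omega>\<bar>} \<le> ennreal (1/4)" and t: "0 \<le> t" "t \<le> s"
    and r: "K * s powr (1 / \<alpha>) \<le> r"
  shows "emeasure M {\<omega>\<in>space M. r < \<bar>X t \<omega>\<bar>} \<le> ennreal (1/4)"
proof (cases "t = 0")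
  case True
  have r0: "0 \<le> r" using r K(1) by (rule_tac order_trans[OF _ r]) simp
  have "AE \<omega> in M. \<not> r < \<bar>X t \<omega>\<bar>" using starts_at_0 by eventually_elim (use True r0 in simp)
  then have "emeasure M {\<omega>\<in>space M. r < \<bar>X t \<omega>\<bar>} = 0"
    using X_measurable'[OF t(1)] by (subst (asm) AE_iff_measurable[OF _ refl]) (auto, measurable)
  then show ?thesis by simp
next
  case False
  then have t0: "0 < t" using t by simp
  have "K * t powr (1/\<alpha>) \<le> K * s powr (1/\<alpha>)"
    using K(1) t index_pos by (intro mult_left_mono powr_mono2) auto
  then have "K \<le> r / t powr (1/\<alpha>)" using r t0 by (simp add: field_simps)
  then have "emeasure M {\<omega>\<in>space M. r / t powr (1 / \<alpha>) < \<bar>X 1 \<omega>\<bar>} \<le> emeasure M {\<omega>\<in>space M. K < \<bar>X 1 \<omega>\<bar>}"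
    using X_measurable'[of 1] by (intro emeasure_mono) (auto, measurable)
  with K(2) show ?thesis unfolding tail_scale[OF t0] by (rule order_trans[rotated])
qed

text \<open>In the walk with unit time steps all positions up to n have scale n^(1/\<alpha>), while
  a single step has the law of X_1. Thus a tail of order \<alpha> follows from self-similarity and
  independent increments alone.\<close>

lemma tail_decay:
  assumes K: "K > 0" "emeasure M {\<omega>\<in>space M. K < \<bar>X 1 \<omega>\<bar>} \<le> ennreal (1/4)"
  shows "real n * measure M {\<omega>\<in>space M. 4 * (K * real n powr (1 / \<alpha>)) < \<bar>X 1 \<omega>\<bar>} \<le> 1"
proof -
  interpret R: random_walk "law 1" by (rule random_walk_law) simp
  let ?r = "K * real n powr (1 / \<alpha>)"
  have "real n * measure (law 1) {v. 4 * ?r < \<bar>v\<bar>} \<le> 1"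
  proof (rule R.tail_single_bound)
    fix j assume "j \<le> n"
    then show "R.tail_prob ?r j \<le> ennreal (1/4)"
      unfolding tail_prob_law[OF zero_le_one] by (intro tail_bound[OF K, of _ "real n"]) auto
  qed
  also have "measure (law 1) {v. 4 * ?r < \<bar>v\<bar>} = measure M {\<omega>\<in>space M. 4 * ?r < \<bar>X 1 \<omega>\<bar>}"
    by (subst measure_distr) (auto simp: vimage_def Int_def conj_commute intro!: arg_cong[where f = "measure M"])
  finally show ?thesis .
qed

end

section \<open>Finiteness of the expected truncated variation\<close>

text \<open>Truncation: the variance handles min (Y i) K, and the remainder is small in L^1 because
  the truncated means converge to the mean. Uncorrelatedness is assumed for the truncated variables,
  as the variables themselves need not have second moments.\<close>

lemma (in prob_space) weak_law_of_large_numbers_L1: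
  fixes Y :: "nat \<Rightarrow> 'a \<Rightarrow> real"
  assumes Y [measurable]: "\<And>i. Y i \<in> borel_measurable M" and nonneg: "\<And>i \<omega>. 0 \<le> Y i \<omega>"
    and int: "\<And>i. integrable M (Y i)" and mean: "\<And>i. expectation (Y i) = a"
    and mean_min: "\<And>i K. 0 \<le> K \<Longrightarrow> expectation (\<lambda>\<omega>. min (Y i \<omega>) K) = expectation (\<lambda>\<omega>. min (Y 0 \<omega>) K)"
    and uncorrelated: "\<And>i j K. i < j \<Longrightarrow> 0 \<le> K \<Longrightarrow>
      expectation (\<lambda>\<omega>. min (Y i \<omega>) K * min (Y j \<omega>) K) = expectation (\<lambda>\<omega>. min (Y 0 \<omega>) K) * expectation (\<lambda>\<omega>. min (Y 0 \<omega>) K)"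
    and e: "0 < e"
  shows "\<exists>n0. \<forall>n\<ge>n0. expectation (\<lambda>\<omega>. \<bar>(\<Sum>i<n. Y i \<omega>) - real n * a\<bar>) \<le> e * real n"
proof -
  have "(\<lambda>k. expectation (\<lambda>\<omega>. min (Y 0 \<omega>) (real k))) \<longlonglongrightarrow> expectation (Y 0)"
  proof (rule integral_dominated_convergence[where w = "Y 0"])
    show "AE \<omega> in M. (\<lambda>k. min (Y 0 \<omega>) (real k)) \<longlonglongrightarrow> Y 0 \<omega>"
    proof (rule AE_I2, rule tendsto_eventually)
      fix \<omega>
      obtain k0 where "Y 0 \<omega> \<le> real k0" using real_arch_simple by blast
      then show "\<forall>\<^sub>F k in sequentially. min (Y 0 \<omega>) (real k) = Y 0 \<omega>"
        unfolding eventually_sequentially by (intro exI[of _ k0]) auto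
    qed
  qed (use int nonneg in auto)
  then have "\<forall>\<^sub>F k in sequentially. dist (expectation (\<lambda>\<omega>. min (Y 0 \<omega>) (real k))) a < e / 4"
    unfolding mean using e by (intro tendstoD) auto
  then obtain k where k: "dist (expectation (\<lambda>\<omega>. min (Y 0 \<omega>) (real k))) a < e / 4"
    by (auto simp: eventually_sequentially)
  define K where "K = real k"
  have K: "0 \<le> K" by (simp add: K_def)
  define w where "w = expectation (\<lambda>\<omega>. min (Y 0 \<omega>) K)"
  have wa: "a - w \<le> e / 4" using k unfolding w_def K_def dist_real_def by linarith
  define W where "W i = (\<lambda>\<omega>. min (Y i \<omega>) K)" for i
  have W [measurable]: "W i \<in> borel_measurable M" for i unfolding W_def by measurable
  have W01: "0 \<le> W i \<omega>" "W i \<omega> \<le> K" for i \<omega> using nonneg K by (auto simp: W_def)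
  have intW: "integrable M (W i)" for i
    by (rule integrable_const_bound[where B = K]) (use W01 in auto)
  have EW: "expectation (W i) = w" for i using mean_min[OF K, of i] by (simp add: W_def w_def)
  have "0 \<le> expectation (W 0)" using W01 by (intro Bochner_Integration.integral_nonneg) auto
  moreover have "expectation (W 0) \<le> K"
    using W01(2) by (intro integral_le_const[OF intW]) auto
  ultimately have w: "0 \<le> w" "w \<le> K" using EW by auto
  define U where "U i \<omega> = W i \<omega> - w" for i \<omega>
  have U [measurable]: "U i \<in> borel_measurable M" for i unfolding U_def by measurable
  have Ub: "\<bar>U i \<omega>\<bar> \<le> K" for i \<omega> using W01[of i \<omega>] w by (auto simp: U_def)
  have UU: "\<bar>U i \<omega> * U j \<omega>\<bar> \<le> K * K" for i j \<omega>
    unfolding abs_mult using Ub K by (intro mult_mono) auto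
  have intUU: "integrable M (\<lambda>\<omega>. U i \<omega> * U j \<omega>)" for i j
    by (rule integrable_const_bound[where B = "K * K"]) (use UU in auto)
  have intWW: "integrable M (\<lambda>\<omega>. W i \<omega> * W j \<omega>)" for i j
    by (rule integrable_const_bound[where B = "K * K"]) (use W01 K in \<open>auto simp: abs_mult intro!: mult_mono\<close>)
  have lt: "expectation (\<lambda>\<omega>. U i \<omega> * U j \<omega>) = 0" if "i < j" for i j
  proof -
    have "expectation (\<lambda>\<omega>. U i \<omega> * U j \<omega>) = expectation (\<lambda>\<omega>. W i \<omega> * W j \<omega> - w * W i \<omega> - w * W j \<omega> + w * w)"
      by (intro Bochner_Integration.integral_cong) (auto simp: U_def algebra_simps)
    also have "\<dots> = expectation (\<lambda>\<omega>. W i \<omega> * W j \<omega>) - w * expectation (W i) - w * expectation (W j) + w * w"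
      using intWW[of i j] intW[of i] intW[of j] by (simp add: prob_space)
    also have "\<dots> = 0" using uncorrelated[OF that K] by (simp add: EW) (simp add: W_def w_def)
    finally show ?thesis .
  qed
  have UUle: "expectation (\<lambda>\<omega>. U i \<omega> * U j \<omega>) \<le> (if i = j then K * K else 0)" for i j
  proof (cases "i = j")
    case True
    have "expectation (\<lambda>\<omega>. U i \<omega> * U j \<omega>) \<le> K * K"
      by (rule integral_le_const[OF intUU]) (use UU in \<open>auto simp: abs_le_iff\<close>)
    with True show ?thesis by simp
  next
    case False
    then consider "i < j" | "j < i" by linarith
    then show ?thesis using lt[of i j] lt[of j i] False by cases (simp_all add: mult.commute)
  qed
  \<comment> \<open>A quarter of e n goes to each of four terms: the quadratic one, n l, and the
    truncation error, which is counted twice.\<close>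
  define l where "l = e / 4"
  have l: "0 < l" using e by (simp add: l_def)
  obtain n0 where n0: "4 * (K * K) / (l * e) < real n0" using reals_Archimedean2 by blast
  show ?thesis
  proof (intro exI[of _ "Suc n0"] allI impI)
    fix n assume "Suc n0 \<le> n"
    then have n: "real n > 0" "4 * (K * K) / (l * e) \<le> real n" using n0 by auto
    define Z where "Z \<omega> = (\<Sum>i<n. U i \<omega>)" for \<omega>
    have Z [measurable]: "Z \<in> borel_measurable M" unfolding Z_def by measurable
    have Z2: "(Z \<omega>)\<^sup>2 = (\<Sum>i<n. \<Sum>j<n. U i \<omega> * U j \<omega>)" for \<omega>
      by (simp add: Z_def power2_eq_square sum_product)
    have intZ2: "integrable M (\<lambda>\<omega>. (Z \<omega>)\<^sup>2)" unfolding Z2 using intUU by simp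
    have "expectation (\<lambda>\<omega>. (Z \<omega>)\<^sup>2) = (\<Sum>i<n. \<Sum>j<n. expectation (\<lambda>\<omega>. U i \<omega> * U j \<omega>))"
      unfolding Z2 using intUU by simp
    also have "\<dots> \<le> (\<Sum>i<n. \<Sum>j<n. if i = j then K * K else 0)"
      by (intro sum_mono UUle)
    also have "\<dots> = real n * (K * K)" by simp
    finally have EZ2: "expectation (\<lambda>\<omega>. (Z \<omega>)\<^sup>2) \<le> real n * (K * K)" .
    \<comment> \<open>Splitting at |Z| = n l turns the variance bound n K^2 directly into a bound
      for E|Z|.\<close>
    have Zabs: "\<bar>Z \<omega>\<bar> \<le> (Z \<omega>)\<^sup>2 / (real n * l) + real n * l" for \<omega>
    proof (cases "\<bar>Z \<omega>\<bar> \<le> real n * l")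
      case False
      then have "(real n * l) * \<bar>Z \<omega>\<bar> \<le> \<bar>Z \<omega>\<bar> * \<bar>Z \<omega>\<bar>" by (intro mult_right_mono) auto
      then have "\<bar>Z \<omega>\<bar> \<le> (Z \<omega>)\<^sup>2 / (real n * l)" using n l by (simp add: field_simps power2_eq_square)
      moreover have "0 \<le> real n * l" using n l by simp
      ultimately show ?thesis by linarith
    next
      case True
      moreover have "0 \<le> (Z \<omega>)\<^sup>2 / (real n * l)" using n l by simp
      ultimately show ?thesis by linarith
    qed
    have pw: "\<bar>(\<Sum>i<n. Y i \<omega>) - real n * a\<bar> \<le>
      (Z \<omega>)\<^sup>2 / (real n * l) + real n * l + (\<Sum>i<n. Y i \<omega> - W i \<omega>) + real n * (a - w)" for \<omega>
    proof -
      have "expectation (W 0) \<le> expectation (Y 0)"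
        by (intro integral_mono intW int) (simp add: W_def)
      then have aw: "0 \<le> a - w" using EW mean by simp
      have "0 \<le> (\<Sum>i<n. Y i \<omega> - W i \<omega>)" by (intro sum_nonneg) (simp add: W_def)
      moreover have "(\<Sum>i<n. Y i \<omega>) - real n * a = Z \<omega> + (\<Sum>i<n. Y i \<omega> - W i \<omega>) - real n * (a - w)"
        by (simp add: Z_def U_def sum_subtractf algebra_simps)
      moreover have "0 \<le> real n * (a - w)" using aw by simp
      ultimately have "\<bar>(\<Sum>i<n. Y i \<omega>) - real n * a\<bar> \<le> \<bar>Z \<omega>\<bar> + (\<Sum>i<n. Y i \<omega> - W i \<omega>) + real n * (a - w)"
        by linarith
      with Zabs[of \<omega>] show ?thesis by linarith
    qed
    have "expectation (\<lambda>\<omega>. \<bar>(\<Sum>i<n. Y i \<omega>) - real n * a\<bar>) \<le> expectation (\<lambda>\<omega>.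
      (Z \<omega>)\<^sup>2 / (real n * l) + real n * l + (\<Sum>i<n. Y i \<omega> - W i \<omega>) + real n * (a - w))"
      using int intW intZ2 pw by (intro integral_mono integrable_abs) auto
    also have "\<dots> = expectation (\<lambda>\<omega>. (Z \<omega>)\<^sup>2) / (real n * l) + real n * l + real n * (a - w) + real n * (a - w)"
      using int intW intZ2 by (simp add: prob_space mean EW)
    also have "\<dots> \<le> real n * (K * K) / (real n * l) + real n * l + real n * (e/4) + real n * (e/4)"
      using EZ2 wa n l by (intro add_mono divide_right_mono mult_left_mono) auto
    also have "real n * (K * K) / (real n * l) \<le> real n * (e / 4)"
      using n l e by (simp add: field_simps)
    finally show "expectation (\<lambda>\<omega>. \<bar>(\<Sum>i<n. Y i \<omega>) - real n * a\<bar>) \<le> e * real n"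
      by (simp add: l_def algebra_simps)
  qed
qed

section \<open>First moments when \<alpha> > 1\<close>

locale stable_process_gt_1 = strictly_stable_process +
  assumes index_gt_1: "1 < \<alpha>"
begin

text \<open>At the levels b j = 4 K q^j with q = 2^(1/\<alpha>) the tail is at most 2^(-j). Up to
  the constant b 0, E|X_1| is thus bounded by a geometric series of ratio q/2, and q < 2 is where
  \<alpha> > 1 is used.\<close>

lemma X_first_moment: "(\<integral>\<^sup>+\<omega>. ennreal \<bar>X 1 \<omega>\<bar> \<partial>M) < \<infinity>"
proof -
  obtain K where K: "K > 0" "emeasure M {\<omega>\<in>space M. K < \<bar>X 1 \<omega>\<bar>} \<le> ennreal (1/4)"
    using exists_tail_level by blast
  define q where "q = 2 powr (1 / \<alpha>)"
  have q: "1 < q" "q < 2" using index_gt_1 powr_less_mono[of "1/\<alpha>" 1 2] by (auto simp: q_def)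
  define b where "b j = 4 * (K * q ^ j)" for j
  have bq: "4 * (K * real (2 ^ j) powr (1 / \<alpha>)) = b j" for j
  proof -
    have "real (2 ^ j) powr (1 / \<alpha>) = (2 powr real j) powr (1 / \<alpha>)" by (simp add: powr_realpow)
    also have "\<dots> = q powr real j" unfolding q_def powr_powr by (simp only: mult.commute)
    also have "\<dots> = q ^ j" using q(1) by (simp add: powr_realpow)
    finally show ?thesis by (simp only: b_def)
  qed
  have [measurable]: "X 1 \<in> borel_measurable M" by simp
  have tail: "emeasure M {\<omega>\<in>space M. b j < \<bar>X 1 \<omega>\<bar>} \<le> ennreal (1 / 2 ^ j)" for j
  proof -
    define p where "p = prob {\<omega>\<in>space M. b j < \<bar>X 1 \<omega>\<bar>}"
    have "real (2 ^ j) * p \<le> 1" using tail_decay[OF K, of "2 ^ j"] unfolding bq p_def .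
    then have "(2 ^ j * p) / 2 ^ j \<le> 1 / 2 ^ j" by (intro divide_right_mono) simp_all
    then have "p \<le> 1 / 2 ^ j" by simp
    then have "ennreal p \<le> ennreal (1 / 2 ^ j)" by (rule ennreal_leI)
    then show ?thesis by (simp only: emeasure_eq_measure p_def)
  qed
  have pw: "ennreal \<bar>v\<bar> \<le> ennreal (b 0) + (\<Sum>j. ennreal (b (Suc j)) * indicator {v. b j < \<bar>v\<bar>} v)" for v
  proof (cases "\<bar>v\<bar> \<le> b 0")
    case True
    from ennreal_leI[OF this] show ?thesis by (rule order_trans) simp
  next
    case False
    obtain n where "\<bar>v\<bar> / (4 * K) < q ^ n" using real_arch_pow[OF q(1)] by blast
    then have ex: "\<exists>n. \<bar>v\<bar> \<le> b n" using K(1) by (intro exI[of _ n]) (simp add: b_def field_simps)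
    define n where "n = (LEAST n. \<bar>v\<bar> \<le> b n)"
    have n: "\<bar>v\<bar> \<le> b n" unfolding n_def by (rule LeastI_ex[OF ex])
    have "n \<noteq> 0"
    proof
      assume "n = 0"
      with n False show False by simp
    qed
    then obtain j where j: "n = Suc j" by (cases n) auto
    then have "\<not> \<bar>v\<bar> \<le> b j" using not_less_Least[of j "\<lambda>n. \<bar>v\<bar> \<le> b n"] by (simp add: n_def[symmetric])
    then have "ennreal \<bar>v\<bar> \<le> ennreal (b (Suc j)) * indicator {v. b j < \<bar>v\<bar>} v"
      using n j by (simp add: ennreal_leI)
    also have "\<dots> \<le> (\<Sum>j. ennreal (b (Suc j)) * indicator {v. b j < \<bar>v\<bar>} v)"
    proof -
      let ?f = "\<lambda>j. ennreal (b (Suc j)) * indicator {v. b j < \<bar>v\<bar>} v"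
      have "sum ?f {j} \<le> suminf ?f" by (rule sum_le_suminf) auto
      then show ?thesis by (simp only: sum.insert[OF finite.emptyI] sum.empty empty_iff not_False_eq_True add_0_right)
    qed
    finally show ?thesis by (rule order_trans) simp
  qed
  have "(\<integral>\<^sup>+\<omega>. ennreal \<bar>X 1 \<omega>\<bar> \<partial>M) \<le>
     (\<integral>\<^sup>+\<omega>. ennreal (b 0) + (\<Sum>j. ennreal (b (Suc j)) * indicator {v. b j < \<bar>v\<bar>} (X 1 \<omega>)) \<partial>M)"
    by (intro nn_integral_mono pw)
  also have "\<dots> = ennreal (b 0) + (\<Sum>j. ennreal (b (Suc j)) * emeasure M {\<omega>\<in>space M. b j < \<bar>X 1 \<omega>\<bar>})"
  proof -
    have "(\<integral>\<^sup>+\<omega>. indicator {v. b j < \<bar>v\<bar>} (X 1 \<omega>) \<partial>M) = emeasure M {\<omega>\<in>space M. b j < \<bar>X 1 \<omega>\<bar>}" for j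
    proof -
      have "{\<omega>\<in>space M. b j < \<bar>X 1 \<omega>\<bar>} \<in> sets M" by measurable
      note nn_integral_indicator[OF this, symmetric]
      moreover have "(\<integral>\<^sup>+\<omega>. indicator {\<omega>\<in>space M. b j < \<bar>X 1 \<omega>\<bar>} \<omega> \<partial>M) = (\<integral>\<^sup>+\<omega>. indicator {v. b j < \<bar>v\<bar>} (X 1 \<omega>) \<partial>M)"
        by (intro nn_integral_cong) (simp add: indicator_def)
      ultimately show ?thesis by simp
    qed
    then show ?thesis
      by (simp add: nn_integral_add nn_integral_suminf nn_integral_cmult emeasure_space_1)
  qed
  also have "\<dots> \<le> ennreal (b 0) + (\<Sum>j. ennreal (4 * K * q * (q / 2) ^ j))"
  proof (intro add_left_mono suminf_le)
    fix j
    have "ennreal (b (Suc j)) * emeasure M {\<omega>\<in>space M. b j < \<bar>X 1 \<omega>\<bar>} \<le> ennreal (b (Suc j)) * ennreal (1 / 2 ^ j)"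
      by (rule mult_left_mono[OF tail]) simp
    also have "\<dots> = ennreal (4 * K * q * (q / 2) ^ j)"
      using K(1) q by (subst ennreal_mult[symmetric]) (auto simp: b_def power_divide field_simps)
    finally show "ennreal (b (Suc j)) * emeasure M {\<omega>\<in>space M. b j < \<bar>X 1 \<omega>\<bar>} \<le> ennreal (4 * K * q * (q / 2) ^ j)" .
  qed auto
  also have "\<dots> < \<infinity>"
  proof -
    have "(\<Sum>j. ennreal (4 * K * q * (q / 2) ^ j)) \<noteq> \<top>"
      using q K(1) by (intro ennreal_suminf_neq_top summable_mult summable_geometric) auto
    then show ?thesis by (simp add: less_top)
  qed
  finally show ?thesis .
qed

definition m1 :: ennreal where "m1 = (\<integral>\<^sup>+\<omega>. ennreal \<bar>X 1 \<omega>\<bar> \<partial>M)"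

lemma X_moment: "0 \<le> t \<Longrightarrow> (\<integral>\<^sup>+\<omega>. ennreal \<bar>X t \<omega>\<bar> \<partial>M) \<le> ennreal (t powr (1 / \<alpha>)) * m1"
proof (cases "t = 0")
  case True
  have "(\<integral>\<^sup>+\<omega>. ennreal \<bar>X t \<omega>\<bar> \<partial>M) = (\<integral>\<^sup>+\<omega>. 0 \<partial>M)"
    by (rule nn_integral_cong_AE) (use starts_at_0 True in \<open>auto elim!: eventually_mono\<close>)
  then show ?thesis by simp
next
  case False
  assume "0 \<le> t"
  with False have t: "0 < t" by simp
  have [measurable]: "X 1 \<in> borel_measurable M" by simp
  have "(\<integral>\<^sup>+\<omega>. ennreal \<bar>X t \<omega>\<bar> \<partial>M) = (\<integral>\<^sup>+\<omega>. ennreal \<bar>t powr (1 / \<alpha>) * X 1 \<omega>\<bar> \<partial>M)"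
    by (rule nn_integral_scale1[OF t]) measurable
  also have "\<dots> = (\<integral>\<^sup>+\<omega>. ennreal (t powr (1 / \<alpha>)) * ennreal \<bar>X 1 \<omega>\<bar> \<partial>M)"
    by (simp add: abs_mult ennreal_mult)
  also have "\<dots> = ennreal (t powr (1 / \<alpha>)) * m1" unfolding m1_def by (rule nn_integral_cmult) measurable
  finally show ?thesis by simp
qed

text \<open>On a short time interval the sampled walk leaves [-1/2,1/2] with probability at most 1/2
  whatever the mesh, so \<open>expected_mass_bound\<close> holds uniformly in the grid level and
  survives the monotone limit.\<close>

lemma tv_expectation_finite_small: "\<exists>T>0. (\<integral>\<^sup>+\<omega>. block T 0 1 \<omega> \<partial>M) < \<infinity>"
proof -
  obtain K where K: "K > 0" "emeasure M {\<omega>\<in>space M. K < \<bar>X 1 \<omega>\<bar>} \<le> ennreal (1/4)"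
    using exists_tail_level by blast
  \<comment> \<open>Solves K T^(1/\<alpha>) = 1/4, so that P(|X_t| > 1/4) \<le> 1/4 for all t in
    [0,T].\<close>
  define T where "T = (1 / (4 * K)) powr \<alpha>"
  have T: "0 < T" using K by (simp add: T_def)
  have KT: "K * T powr (1 / \<alpha>) \<le> 1/4" using K index_pos by (simp add: T_def powr_powr)
  define m where "m = ennreal (T powr (1 / \<alpha>)) * m1"
  have bound: "(\<integral>\<^sup>+\<omega>. block_level T 0 1 k \<omega> \<partial>M) \<le> 2 * (8 * m + 2)" for k
  proof -
    define h where "h = T / 2 ^ k"
    define N where "N = (2::nat) ^ k"
    have h: "0 \<le> h" using T by (simp add: h_def)
    have Nh: "real N * h = T" by (simp add: N_def h_def)
    have jh: "0 \<le> real j * h" "real j * h \<le> T" if "j \<le> N" for j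
      using that h unfolding Nh[symmetric] by (auto intro!: mult_right_mono)
    interpret R: random_walk "law h" by (rule random_walk_law[OF h])
    have tail: "R.tail_prob (1/4) j \<le> ennreal (1/4)" if "j \<le> N" for j
      unfolding tail_prob_law[OF h] by (rule tail_bound[OF K jh[OF that] KT])
    have "R.exit_prob (1/4 + 1/4) N \<le> 2 * R.tail_prob (1/4) N"
    proof (rule R.ottaviani)
      fix j assume "j \<le> N"
      have "ennreal (1/4) \<le> ennreal (1/2)" by (rule ennreal_leI) simp
      with tail[OF \<open>j \<le> N\<close>] show "R.tail_prob (1/4) j \<le> ennreal (1/2)" by (rule order_trans)
    qed
    also have "\<dots> \<le> 2 * ennreal (1/4)" using tail[of N] by (intro mult_left_mono) auto
    also have "\<dots> = ennreal (1/2)"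
      by (subst ennreal_numeral[symmetric], subst ennreal_mult[symmetric]) auto
    finally have ex: "R.exit_prob (1/2) N \<le> ennreal (1/2)" by simp
    have mom: "(\<integral>\<^sup>+\<xi>. ennreal \<bar>walk \<xi> j\<bar> \<partial>R.S) \<le> m" if j: "j \<le> N" for j
    proof -
      have "(\<integral>\<^sup>+\<xi>. ennreal \<bar>walk \<xi> j\<bar> \<partial>R.S) = (\<integral>\<^sup>+\<omega>. ennreal \<bar>walk (incr h \<omega>) j\<bar> \<partial>M)"
        by (rule nn_integral_incr[OF h, symmetric]) measurable
      also have "\<dots> = (\<integral>\<^sup>+\<omega>. ennreal \<bar>X (real j * h) \<omega>\<bar> \<partial>M)"
        unfolding walk_incr by (rule nn_integral_X_diff[OF jh(1)[OF j]]) measurable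
      also have "\<dots> \<le> ennreal ((real j * h) powr (1 / \<alpha>)) * m1" by (rule X_moment[OF jh(1)[OF j]])
      also have "\<dots> \<le> m" unfolding m_def using jh[OF j] index_pos
        by (intro mult_right_mono ennreal_leI powr_mono2) auto
      finally show ?thesis .
    qed
    have "(\<integral>\<^sup>+\<omega>. block_level T 0 1 k \<omega> \<partial>M) = (\<integral>\<^sup>+\<omega>. crossing_mass (walk (incr h \<omega>)) 1 {..N} \<partial>M)"
      by (simp add: block_level_def h_def N_def atMost_atLeast0)
    also have "\<dots> = R.expected_mass N"
      unfolding R.expected_mass_def by (rule nn_integral_incr[OF h]) measurable
    also have "\<dots> \<le> 2 * (8 * m + 2)" by (rule R.expected_mass_bound[OF ex mom])
    finally show ?thesis .
  qed
  have "(\<integral>\<^sup>+\<omega>. block T 0 1 \<omega> \<partial>M) = (SUP k. (\<integral>\<^sup>+\<omega>. block_level T 0 1 k \<omega> \<partial>M))"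
    unfolding block_SUP[OF T] using block_level_mono[OF T] T
    by (intro nn_integral_monotone_convergence_SUP) (auto simp: incseq_def le_fun_def)
  also have "\<dots> \<le> 2 * (8 * m + 2)" by (intro SUP_least bound)
  also have "\<dots> < \<infinity>"
    using X_first_moment by (auto simp: m_def m1_def ennreal_mult_less_top ennreal_add_less_top less_top[symmetric] ennreal_mult_eq_top_iff)
  finally show ?thesis using T by blast
qed

lemma tv_expectation_finite:
  assumes "0 \<le> t"
  shows "(\<integral>\<^sup>+\<omega>. truncated_variation 1 (\<lambda>t. X t \<omega>) 0 t \<partial>M) < \<infinity>"
proof -
  obtain T where T: "T > 0" "(\<integral>\<^sup>+\<omega>. block T 0 1 \<omega> \<partial>M) < \<infinity>" using tv_expectation_finite_small by blast
  obtain n :: nat where "t / T < real n" using reals_Archimedean2 by blast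
  then have n: "t \<le> real n * T" using T(1) by (simp add: field_simps)
  have "(\<integral>\<^sup>+\<omega>. truncated_variation 1 (\<lambda>t. X t \<omega>) 0 t \<partial>M) \<le> (\<integral>\<^sup>+\<omega>. (\<Sum>i<n. block T i (Suc i) \<omega>) + ennreal (2 * real n) \<partial>M)"
  proof (rule nn_integral_mono)
    fix \<omega> assume \<omega>: "\<omega> \<in> space M"
    have "truncated_variation 1 (\<lambda>t. X t \<omega>) 0 t \<le> truncated_variation 1 (\<lambda>t. X t \<omega>) 0 (real n * T)"
      by (rule truncated_variation_mono[OF assms n])
    also have "\<dots> = block T 0 n \<omega>" by (rule block_tv[OF T(1) \<omega>, symmetric])
    also have "\<dots> \<le> (\<Sum>i<n. block T i (Suc i) \<omega>) + ennreal (2 * real n)" by (rule block_le_sum[OF T(1)])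
    finally show "truncated_variation 1 (\<lambda>t. X t \<omega>) 0 t \<le> (\<Sum>i<n. block T i (Suc i) \<omega>) + ennreal (2 * real n)" .
  qed
  also have "\<dots> = (\<Sum>i<n. \<integral>\<^sup>+\<omega>. block T i (Suc i) \<omega> \<partial>M) + ennreal (2 * real n)"
    using T(1) by (simp add: nn_integral_add nn_integral_sum emeasure_space_1)
  also have "\<dots> = (\<Sum>i<n. \<integral>\<^sup>+\<omega>. block T 0 1 \<omega> \<partial>M) + ennreal (2 * real n)"
    using nn_integral_block[OF T(1), of "\<lambda>x. x"]
    by (intro arg_cong2[where f = "(+)"] sum.cong refl) (simp add: sup_continuous_id)
  also have "\<dots> < \<infinity>" using T(2) by (auto simp: ennreal_mult_less_top ennreal_add_less_top of_nat_less_top)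
  finally show ?thesis .
qed

end

section \<open>Limit of the rescaled truncated variation\<close>

lemma crossing_integral_one_eq:
  assumes "cadlag x" "c > 0" "0 \<le> t"
  shows "crossing_integral \<alpha> x (\<lambda>_. 1) c t = c powr (\<alpha> - 1) * enn2real (truncated_variation c x 0 t)"
proof -
  have "(\<integral>y. 1 * real (crossings y c x 0 t) \<partial>lborel) = enn2real (\<integral>\<^sup>+y. ennreal (1 * real (crossings y c x 0 t)) \<partial>lborel)"
    using crossings_borel_measurable[OF assms] by (intro integral_eq_nn_integral) auto
  also have "(\<integral>\<^sup>+y. ennreal (1 * real (crossings y c x 0 t)) \<partial>lborel) = (\<integral>\<^sup>+y. of_nat (crossings y c x 0 t) \<partial>lborel)"
    by (simp add: ennreal_of_nat_eq_real_of_nat)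
  also have "\<dots> = truncated_variation c x 0 t"
    using crossings_mass[OF assms(1,2) dense_times_rat[OF assms(3)]] by simp
  finally show ?thesis by (simp add: crossing_integral_def)
qed

lemma sup_continuous_min_const:
  fixes K :: ennreal
  shows "sup_continuous (\<lambda>x. min x K)"
  unfolding sup_continuous_def
proof (intro allI impI)
  fix u :: "nat \<Rightarrow> ennreal"
  show "min (SUP i. u i) K = (SUP i. min (u i) K)"
  proof (rule antisym)
    show "min (SUP i. u i) K \<le> (SUP i. min (u i) K)"
    proof (cases "\<exists>i. K \<le> u i")
      case True
      then obtain i where i: "K \<le> u i" by blast
      have "min (SUP i. u i) K \<le> min (u i) K" using i by simp
      also have "\<dots> \<le> (SUP i. min (u i) K)" by (rule SUP_upper) simp
      finally show ?thesis .
    next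
      case False
      then have "min (u i) K = u i" for i by (auto simp: not_le intro: min.absorb1 less_imp_le)
      then show ?thesis by simp
    qed
    show "(SUP i. min (u i) K) \<le> min (SUP i. u i) K"
      by (intro SUP_least min.mono SUP_upper) auto
  qed
qed

context stable_process_gt_1
begin

definition tv :: "real \<Rightarrow> 'a \<Rightarrow> real" where
  "tv T \<omega> = enn2real (truncated_variation 1 (\<lambda>t. X t \<omega>) 0 T)"

definition mean_tv :: "real \<Rightarrow> real" where
  "mean_tv T = expectation (tv T)"

lemma tv_measurable' [measurable]: "0 \<le> T \<Longrightarrow> tv T \<in> borel_measurable M"
  unfolding tv_def by (intro borel_measurable_enn2real tv_measurable) auto

lemma tv_nonneg: "0 \<le> tv T \<omega>"
  by (simp add: tv_def)

lemma ennreal_tv: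
  "\<omega> \<in> space M \<Longrightarrow> 0 \<le> T \<Longrightarrow> ennreal (tv T \<omega>) = truncated_variation 1 (\<lambda>t. X t \<omega>) 0 T"
  using tv_finite[of \<omega> 1 T] by (simp add: tv_def)

lemma tv_mono: "\<omega> \<in> space M \<Longrightarrow> 0 \<le> S \<Longrightarrow> S \<le> T \<Longrightarrow> tv S \<omega> \<le> tv T \<omega>"
  using tv_finite[of \<omega> 1 T] unfolding tv_def
  by (intro enn2real_mono truncated_variation_mono) auto

lemma nn_integral_tv:
  "0 \<le> T \<Longrightarrow> (\<integral>\<^sup>+\<omega>. ennreal (tv T \<omega>) \<partial>M) = (\<integral>\<^sup>+\<omega>. truncated_variation 1 (\<lambda>t. X t \<omega>) 0 T \<partial>M)"
  by (intro nn_integral_cong ennreal_tv)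

lemma tv_integrable: "0 \<le> T \<Longrightarrow> integrable M (tv T)"
  using tv_expectation_finite[of T] nn_integral_tv[of T]
  by (intro integrableI_nonneg) (auto simp: tv_nonneg)

lemma ennreal_mean_tv:
  "0 \<le> T \<Longrightarrow> ennreal (mean_tv T) = (\<integral>\<^sup>+\<omega>. truncated_variation 1 (\<lambda>t. X t \<omega>) 0 T \<partial>M)"
  unfolding mean_tv_def nn_integral_tv[symmetric]
  by (rule nn_integral_eq_integral[symmetric]) (auto simp: tv_nonneg tv_integrable)

lemma block_finite:
  assumes m: "m > 0" and \<omega>: "\<omega> \<in> space M"
  shows "block m i (Suc i) \<omega> < \<infinity>"
proof -
  have "block m i (Suc i) \<omega> \<le> block m 0 i \<omega> + block m i (Suc i) \<omega>" by simp
  also have "\<dots> \<le> block m 0 (Suc i) \<omega>" by (rule block_add_le[OF m]) auto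
  also have "\<dots> < \<infinity>" unfolding block_tv[OF m \<omega>] using m by (intro tv_finite[OF \<omega>]) auto
  finally show ?thesis .
qed

definition block_var :: "real \<Rightarrow> nat \<Rightarrow> 'a \<Rightarrow> real" where
  "block_var m i \<omega> = enn2real (block m i (Suc i) \<omega>)"

lemma block_var_measurable [measurable]: "m > 0 \<Longrightarrow> block_var m i \<in> borel_measurable M"
  unfolding block_var_def by (intro borel_measurable_enn2real block_measurable)

lemma block_var_nonneg: "0 \<le> block_var m i \<omega>"
  by (simp add: block_var_def)

lemma ennreal_block_var: "m > 0 \<Longrightarrow> \<omega> \<in> space M \<Longrightarrow> ennreal (block_var m i \<omega>) = block m i (Suc i) \<omega>"
  using block_finite[of m \<omega> i] by (simp add: block_var_def)

lemma nn_integral_block_var: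
  assumes m: "m > 0"
  shows "(\<integral>\<^sup>+\<omega>. ennreal (block_var m i \<omega>) \<partial>M) = ennreal (mean_tv m)"
proof -
  have "(\<integral>\<^sup>+\<omega>. ennreal (block_var m i \<omega>) \<partial>M) = (\<integral>\<^sup>+\<omega>. block m i (Suc i) \<omega> \<partial>M)"
    by (intro nn_integral_cong ennreal_block_var[OF m])
  also have "\<dots> = (\<integral>\<^sup>+\<omega>. block m 0 1 \<omega> \<partial>M)"
    by (rule nn_integral_block[OF m, of "\<lambda>x. x"]) (auto simp: sup_continuous_id)
  also have "\<dots> = (\<integral>\<^sup>+\<omega>. truncated_variation 1 (\<lambda>t. X t \<omega>) 0 m \<partial>M)"
    using block_tv[OF m, of _ 1] by (intro nn_integral_cong) simp
  also have "\<dots> = ennreal (mean_tv m)" using m by (intro ennreal_mean_tv[symmetric]) simp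
  finally show ?thesis .
qed

lemma mean_tv_nonneg: "0 \<le> mean_tv T"
  unfolding mean_tv_def by (intro Bochner_Integration.integral_nonneg tv_nonneg)

lemma block_var_integrable: "m > 0 \<Longrightarrow> integrable M (block_var m i)"
  using nn_integral_block_var[of m i] by (intro integrableI_nonneg) (auto simp: block_var_nonneg)

lemma expectation_block_var: "m > 0 \<Longrightarrow> expectation (block_var m i) = mean_tv m"
  using nn_integral_block_var[of m i]
  by (subst integral_eq_nn_integral) (auto simp: block_var_nonneg mean_tv_nonneg)

text \<open>Truncation is sup-continuous, so \<open>nn_integral_block_pair\<close> supplies the
  uncorrelatedness and the equal truncated means that the weak law asks for.\<close>

lemma block_var_LLN:
  assumes m: "m > 0" and e: "e > 0"
  shows "\<exists>n0. \<forall>n\<ge>n0. expectation (\<lambda>\<omega>. \<bar>(\<Sum>i<n. block_var m i \<omega>) - real n * mean_tv m\<bar>) \<le> e * real n"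
proof (rule weak_law_of_large_numbers_L1[OF block_var_measurable[OF m] block_var_nonneg block_var_integrable[OF m] expectation_block_var[OF m] _ _ e])
  let ?f = "\<lambda>K x. min x (ennreal K)"
  have min_eq: "ennreal (min (block_var m i \<omega>) K) = ?f K (block m i (Suc i) \<omega>)" if "\<omega> \<in> space M" "0 \<le> K" for i \<omega> K
    unfolding ennreal_block_var[OF m that(1), symmetric]
    by (cases "block_var m i \<omega> \<le> K") (simp_all add: min_absorb1 min_absorb2 ennreal_leI)
  have E1: "expectation (\<lambda>\<omega>. min (block_var m i \<omega>) K) = enn2real (\<integral>\<^sup>+\<omega>. ?f K (block m i (Suc i) \<omega>) \<partial>M)" if K: "0 \<le> K" for i K
  proof -
    have "expectation (\<lambda>\<omega>. min (block_var m i \<omega>) K) = enn2real (\<integral>\<^sup>+\<omega>. ennreal (min (block_var m i \<omega>) K) \<partial>M)"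
      using m K by (intro integral_eq_nn_integral) (auto simp: block_var_nonneg)
    also have "(\<integral>\<^sup>+\<omega>. ennreal (min (block_var m i \<omega>) K) \<partial>M) = (\<integral>\<^sup>+\<omega>. ?f K (block m i (Suc i) \<omega>) \<partial>M)"
      by (intro nn_integral_cong min_eq K)
    finally show ?thesis .
  qed
  have sc: "sup_continuous (?f K)" "?f K \<in> borel_measurable borel" for K
    by (rule sup_continuous_min_const) measurable
  show "expectation (\<lambda>\<omega>. min (block_var m i \<omega>) K) = expectation (\<lambda>\<omega>. min (block_var m 0 \<omega>) K)" if "0 \<le> K" for i K
    unfolding E1[OF that] nn_integral_block[OF m sc] ..
  show "expectation (\<lambda>\<omega>. min (block_var m i \<omega>) K * min (block_var m j \<omega>) K)
     = expectation (\<lambda>\<omega>. min (block_var m 0 \<omega>) K) * expectation (\<lambda>\<omega>. min (block_var m 0 \<omega>) K)"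
    if ij: "i < j" and K: "0 \<le> K" for i j K
  proof -
    have "expectation (\<lambda>\<omega>. min (block_var m i \<omega>) K * min (block_var m j \<omega>) K)
      = enn2real (\<integral>\<^sup>+\<omega>. ennreal (min (block_var m i \<omega>) K * min (block_var m j \<omega>) K) \<partial>M)"
      using m K by (intro integral_eq_nn_integral) (auto simp: block_var_nonneg)
    also have "(\<integral>\<^sup>+\<omega>. ennreal (min (block_var m i \<omega>) K * min (block_var m j \<omega>) K) \<partial>M)
      = (\<integral>\<^sup>+\<omega>. ?f K (block m i (Suc i) \<omega>) * ?f K (block m j (Suc j) \<omega>) \<partial>M)"
      using K by (intro nn_integral_cong) (subst ennreal_mult, auto simp: block_var_nonneg min_eq)
    also have "\<dots> = (\<integral>\<^sup>+\<omega>. ?f K (block m 0 1 \<omega>) \<partial>M) * (\<integral>\<^sup>+\<omega>. ?f K (block m 0 1 \<omega>) \<partial>M)"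
      by (rule nn_integral_block_pair[OF m sc sc ij])
    finally show ?thesis unfolding E1[OF K] by (simp add: enn2real_mult)
  qed
qed

lemma tv_block_var:
  fixes n :: nat
  assumes m: "m > 0" and \<omega>: "\<omega> \<in> space M"
  shows "(\<Sum>i<n. block_var m i \<omega>) \<le> tv (real n * m) \<omega>" "tv (real n * m) \<omega> \<le> (\<Sum>i<n. block_var m i \<omega>) + 2 * real n"
proof -
  have nm: "0 \<le> real n * m" using m by simp
  have s: "(\<Sum>i<n. block m i (Suc i) \<omega>) = ennreal (\<Sum>i<n. block_var m i \<omega>)"
    unfolding ennreal_block_var[OF m \<omega>, symmetric] by (rule sum_ennreal) (simp add: block_var_nonneg)
  have t: "block m 0 n \<omega> = ennreal (tv (real n * m) \<omega>)"
    unfolding block_tv[OF m \<omega>] by (rule ennreal_tv[OF \<omega> nm, symmetric])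
  have s0: "0 \<le> (\<Sum>i<n. block_var m i \<omega>)" by (intro sum_nonneg block_var_nonneg)
  show "(\<Sum>i<n. block_var m i \<omega>) \<le> tv (real n * m) \<omega>"
    using block_sum_le[OF m, where n = n and \<omega> = \<omega>] unfolding s t by (subst (asm) ennreal_le_iff) (simp_all add: tv_nonneg)
  have "ennreal (tv (real n * m) \<omega>) \<le> ennreal ((\<Sum>i<n. block_var m i \<omega>) + 2 * real n)"
    using block_le_sum[OF m, where n = n and \<omega> = \<omega>] s0 unfolding s t by (subst ennreal_plus) auto
  then show "tv (real n * m) \<omega> \<le> (\<Sum>i<n. block_var m i \<omega>) + 2 * real n"
    using s0 by (subst (asm) ennreal_le_iff) auto
qed

lemma mean_tv_multiple:
  fixes n :: nat
  assumes m: "m > 0"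
  shows "real n * mean_tv m \<le> mean_tv (real n * m)" "mean_tv (real n * m) \<le> real n * mean_tv m + 2 * real n"
proof -
  have nm: "0 \<le> real n * m" using m by simp
  have E: "expectation (\<lambda>\<omega>. \<Sum>i<n. block_var m i \<omega>) = real n * mean_tv m"
    using block_var_integrable[OF m] expectation_block_var[OF m] by simp
  have i: "integrable M (\<lambda>\<omega>. \<Sum>i<n. block_var m i \<omega>)" using block_var_integrable[OF m] by simp
  show "real n * mean_tv m \<le> mean_tv (real n * m)"
    unfolding E[symmetric] mean_tv_def[of "real n * m"]
    by (intro integral_mono i tv_integrable[OF nm] tv_block_var(1)[OF m])
  have "mean_tv (real n * m) \<le> expectation (\<lambda>\<omega>. (\<Sum>i<n. block_var m i \<omega>) + 2 * real n)"
    unfolding mean_tv_def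
    by (intro integral_mono tv_integrable[OF nm] tv_block_var(2)[OF m] Bochner_Integration.integrable_add i) simp
  also have "\<dots> = real n * mean_tv m + 2 * real n"
    using i by (simp add: E prob_space)
  finally show "mean_tv (real n * m) \<le> real n * mean_tv m + 2 * real n" .
qed

text \<open>Both averages are compared with the one at the common multiple m n: cutting that
  interval into n blocks of length m changes the mean by at most 2n, that is by 2/m after division
  by m n.\<close>

lemma mean_tv_cauchy:
  fixes m n :: nat
  assumes "0 < m" "0 < n"
  shows "\<bar>mean_tv (real m) / real m - mean_tv (real n) / real n\<bar> \<le> 2 / real m + 2 / real n"
proof -
  have "mean_tv (real n * real m) / (real n * real m) - mean_tv (real m) / real m \<in> {0..2 / real m}" if "0 < m" "0 < n" for m n :: nat
  proof -
    define A B where "A = mean_tv (real m)" and "B = mean_tv (real n * real m)"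
    have AB: "real n * A \<le> B" "B \<le> real n * A + 2 * real n"
      using mean_tv_multiple[of "real m" n] that by (auto simp: A_def B_def)
    have e: "B / (real n * real m) - A / real m = (B - real n * A) / (real n * real m)"
      using that by (simp add: field_simps)
    have "(B - real n * A) / (real n * real m) \<le> (2 * real n) / (real n * real m)"
      using AB by (intro divide_right_mono) auto
    also have "\<dots> = 2 / real m" using that by simp
    finally have "(B - real n * A) / (real n * real m) \<le> 2 / real m" .
    moreover have "0 \<le> (B - real n * A) / (real n * real m)" using AB by simp
    ultimately show ?thesis unfolding A_def[symmetric] B_def[symmetric] e by simp
  qed
  from this[OF assms] this[OF assms(2,1)] show ?thesis by (auto simp: mult.commute abs_le_iff)
qed

text \<open>The real number behind the constant C of the theorem, see
  \<open>lim_expected_tv\<close>.\<close>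

definition limit_const :: real where
  "limit_const = lim (\<lambda>n::nat. mean_tv (real n) / real n)"

lemma mean_tv_limit: "(\<lambda>n::nat. mean_tv (real n) / real n) \<longlonglongrightarrow> limit_const"
proof -
  have "Cauchy (\<lambda>n::nat. mean_tv (real n) / real n)"
  proof (rule metric_CauchyI)
    fix e :: real assume e: "0 < e"
    obtain N :: nat where N: "4 / e < real N" using reals_Archimedean2 by blast
    have "dist (mean_tv (real m) / real m) (mean_tv (real n) / real n) < e" if "m \<ge> Suc N" "n \<ge> Suc N" for m n
    proof -
      have mn: "4 / e < real m" "4 / e < real n" "0 < m" "0 < n" using N that by auto
      then have "2 / real m < e / 2" "2 / real n < e / 2" using e by (auto simp: field_simps)
      then show ?thesis using mean_tv_cauchy[OF mn(3,4)] by (simp add: dist_real_def)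
    qed
    then show "\<exists>N. \<forall>m\<ge>N. \<forall>n\<ge>N. dist (mean_tv (real m) / real m) (mean_tv (real n) / real n) < e" by blast
  qed
  then show ?thesis unfolding limit_const_def by (simp add: convergent_LIMSEQ_iff[symmetric] Cauchy_convergent)
qed

lemma limit_const_nonneg: "0 \<le> limit_const"
  by (rule LIMSEQ_le_const[OF mean_tv_limit]) (auto simp: mean_tv_nonneg)

text \<open>Let n tend to infinity in \<open>mean_tv_cauchy\<close> and multiply by m.\<close>

lemma mean_tv_limit_bound:
  fixes m :: nat
  assumes m: "0 < m"
  shows "\<bar>mean_tv (real m) - real m * limit_const\<bar> \<le> 2"
proof -
  have "(\<lambda>n. \<bar>mean_tv (real m) / real m - mean_tv (real n) / real n\<bar>) \<longlonglongrightarrow> \<bar>mean_tv (real m) / real m - limit_const\<bar>"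
    by (intro tendsto_intros mean_tv_limit)
  moreover have "(\<lambda>n. 2 / real m + 2 / real n) \<longlonglongrightarrow> 2 / real m + 0"
    by (intro tendsto_intros lim_const_over_n)
  moreover have "\<exists>N. \<forall>n\<ge>N. \<bar>mean_tv (real m) / real m - mean_tv (real n) / real n\<bar> \<le> 2 / real m + 2 / real n"
    using mean_tv_cauchy[OF m] by (intro exI[of _ 1]) auto
  ultimately have "\<bar>mean_tv (real m) / real m - limit_const\<bar> \<le> 2 / real m + 0"
    by (rule LIMSEQ_le)
  then have "real m * \<bar>mean_tv (real m) / real m - limit_const\<bar> \<le> real m * (2 / real m)"
    by (intro mult_left_mono) auto
  moreover have "real m * \<bar>mean_tv (real m) / real m - limit_const\<bar> = \<bar>mean_tv (real m) - real m * limit_const\<bar>"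
    using m by (simp add: abs_mult_pos' right_diff_distrib flip: abs_mult)
  ultimately show ?thesis using m by simp
qed

text \<open>Blocks of a fixed but long length m are used: the cuts cost a multiple of the number n
  of blocks, a small fraction of T once m is large compared with 1/e. The law of large numbers is
  then called with the fixed accuracy 1.\<close>

lemma tv_L1_limit:
  assumes e: "e > 0"
  shows "\<exists>T1>0. \<forall>T\<ge>T1. expectation (\<lambda>\<omega>. \<bar>tv T \<omega> - limit_const * T\<bar>) \<le> e * T"
proof -
  obtain m0 :: nat where "24 / e < real m0" using reals_Archimedean2 by blast
  define m where "m = Suc m0"
  have m: "0 < m" "0 < real m" "24 / e < real m" using \<open>24 / e < real m0\<close> by (auto simp: m_def)
  let ?C = limit_const
  obtain n0 where n0: "\<And>n. n \<ge> n0 \<Longrightarrow> expectation (\<lambda>\<omega>. \<bar>(\<Sum>i<n. block_var (real m) i \<omega>) - real n * mean_tv (real m)\<bar>) \<le> 1 * real n"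
    using block_var_LLN[OF m(2) zero_less_one] by blast
  \<comment> \<open>5 is 1 from the law of large numbers, 2 from the cuts and 2 from the distance of
    the mean to its limit.\<close>
  have step: "expectation (\<lambda>\<omega>. \<bar>tv (real n * real m) \<omega> - ?C * (real n * real m)\<bar>) \<le> 5 * real n" if n: "n \<ge> n0" for n
  proof -
    have nm: "0 \<le> real n * real m" by simp
    have "expectation (\<lambda>\<omega>. \<bar>tv (real n * real m) \<omega> - ?C * (real n * real m)\<bar>) \<le>
      expectation (\<lambda>\<omega>. \<bar>(\<Sum>i<n. block_var (real m) i \<omega>) - real n * mean_tv (real m)\<bar> + 4 * real n)"
    proof (rule integral_mono)
      fix \<omega> assume \<omega>: "\<omega> \<in> space M"
      have "real n * \<bar>mean_tv (real m) - real m * ?C\<bar> \<le> real n * 2"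
        using mean_tv_limit_bound[OF m(1)] by (intro mult_left_mono) auto
      then have "\<bar>real n * mean_tv (real m) - ?C * (real n * real m)\<bar> \<le> 2 * real n"
        by (simp add: abs_mult_pos' right_diff_distrib ac_simps flip: abs_mult)
      with tv_block_var[OF m(2) \<omega>, of n]
      show "\<bar>tv (real n * real m) \<omega> - ?C * (real n * real m)\<bar> \<le> \<bar>(\<Sum>i<n. block_var (real m) i \<omega>) - real n * mean_tv (real m)\<bar> + 4 * real n"
        by linarith
    qed (use tv_integrable[OF nm] block_var_integrable[OF m(2)] in auto)
    also have "\<dots> = expectation (\<lambda>\<omega>. \<bar>(\<Sum>i<n. block_var (real m) i \<omega>) - real n * mean_tv (real m)\<bar>) + 4 * real n"
      using block_var_integrable[OF m(2)] by (simp add: prob_space)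
    finally show ?thesis using n0[OF n] by linarith
  qed
  \<comment> \<open>T lies between n m and (n+1) m. The errors at these two times add up to 10 n +
    5, and interpolation costs 2 C m.\<close>
  define c where "c = 5 + 2 * (?C * real m)"
  have c: "c > 0" using limit_const_nonneg by (simp add: c_def add_pos_nonneg)
  define T1 where "T1 = max (real (Suc n0) * real m) (2 * c / e)"
  show ?thesis
  proof (intro exI[of _ T1] conjI allI impI)
    show "0 < T1" using m by (simp add: T1_def less_max_iff_disj)
    fix T assume T: "T1 \<le> T"
    define n where "n = nat \<lfloor>T / real m\<rfloor>"
    have T0: "0 \<le> T" "real (Suc n0) \<le> T / real m" "2 * c / e \<le> T" using T m c e by (auto simp: T1_def field_simps intro: order_trans[rotated])
    have "real n = real_of_int \<lfloor>T / real m\<rfloor>" using T0 m by (simp add: n_def)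
    then have nr: "real n \<le> T / real m" "T / real m < real n + 1" by linarith+
    then have n: "real n * real m \<le> T" "T \<le> real (Suc n) * real m" using m by (auto simp: field_simps)
    have "n0 \<le> n" using nr(2) T0(2) by simp
    let ?D = "\<lambda>n \<omega>. \<bar>tv (real n * real m) \<omega> - ?C * (real n * real m)\<bar>"
    have int: "integrable M (?D k)" for k using tv_integrable[of "real k * real m"] by auto
    have "expectation (\<lambda>\<omega>. \<bar>tv T \<omega> - ?C * T\<bar>) \<le> expectation (\<lambda>\<omega>. ?D n \<omega> + ?D (Suc n) \<omega> + 2 * (?C * real m))"
    proof (rule integral_mono)
      show "integrable M (\<lambda>\<omega>. \<bar>tv T \<omega> - ?C * T\<bar>)" using tv_integrable[OF T0(1)] by auto
      show "integrable M (\<lambda>\<omega>. ?D n \<omega> + ?D (Suc n) \<omega> + 2 * (?C * real m))"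
        by (intro Bochner_Integration.integrable_add int) simp
      fix \<omega> assume \<omega>: "\<omega> \<in> space M"
      have "tv (real n * real m) \<omega> \<le> tv T \<omega>" "tv T \<omega> \<le> tv (real (Suc n) * real m) \<omega>"
        using n T0 by (auto intro!: tv_mono[OF \<omega>])
      moreover have "?C * (real n * real m) \<le> ?C * T" "?C * T \<le> ?C * (real (Suc n) * real m)"
        using n limit_const_nonneg by (auto intro!: mult_left_mono)
      moreover have "?C * (real (Suc n) * real m) = ?C * (real n * real m) + ?C * real m" by (simp add: algebra_simps)
      moreover have "0 \<le> ?C * real m" using limit_const_nonneg by simp
      ultimately show "\<bar>tv T \<omega> - ?C * T\<bar> \<le> ?D n \<omega> + ?D (Suc n) \<omega> + 2 * (?C * real m)"
        by linarith
    qed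
    also have "\<dots> = expectation (?D n) + expectation (?D (Suc n)) + 2 * (?C * real m)"
      using int by (simp add: prob_space del: of_nat_Suc)
    also have "\<dots> \<le> 5 * real n + 5 * real (Suc n) + 2 * (?C * real m)"
      using step[of n] step[of "Suc n"] \<open>n0 \<le> n\<close> by linarith
    also have "\<dots> = 10 * real n + c" by (simp add: c_def)
    also have "10 * real n \<le> e / 2 * T"
    proof -
      have "10 / real m \<le> e / 2" using m e by (simp add: field_simps)
      then have "10 / real m * T \<le> e / 2 * T" using T0(1) by (rule mult_right_mono)
      moreover have "10 * real n \<le> 10 / real m * T" using nr(1) by simp
      ultimately show ?thesis by linarith
    qed
    also have "c \<le> e / 2 * T" using T0(3) e by (simp add: field_simps)
    finally show "expectation (\<lambda>\<omega>. \<bar>tv T \<omega> - ?C * T\<bar>) \<le> e * T" by (simp add: mult.commute)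
  qed
qed

section \<open>Total mass of the rescaled crossing measures\<close>

definition mass :: "real \<Rightarrow> real \<Rightarrow> 'a \<Rightarrow> real" where
  "mass c q \<omega> = c powr (\<alpha> - 1) * enn2real (truncated_variation c (\<lambda>t. X t \<omega>) 0 q)"

lemma mass_measurable [measurable]: "0 < c \<Longrightarrow> 0 \<le> q \<Longrightarrow> mass c q \<in> borel_measurable M"
  unfolding mass_def by (intro borel_measurable_times borel_measurable_const borel_measurable_enn2real tv_measurable)

text \<open>Self-similarity turns width c at time q into width 1 at time T = q c^(-\<alpha>), so
  small c means large T. In c^(\<alpha>-1) the part 1/c is the scaling of space, and c^\<alpha> is
  the ratio q/T.\<close>

lemma mass_L1_scale:
  assumes c: "c > 0" and q: "q > 0"
  shows "(\<integral>\<^sup>+\<omega>. ennreal \<bar>mass c q \<omega> - limit_const * q\<bar> \<partial>M)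
    = ennreal (c powr \<alpha> * expectation (\<lambda>\<omega>. \<bar>tv (q * c powr (- \<alpha>)) \<omega> - limit_const * (q * c powr (- \<alpha>))\<bar>))"
proof -
  define T where "T = q * c powr (- \<alpha>)"
  have T: "0 < T" using c q by (simp add: T_def)
  have cc: "c powr \<alpha> * c powr (- \<alpha>) = 1" using c by (simp add: powr_add[symmetric])
  have q_eq: "c powr \<alpha> * T = q" using cc by (simp add: T_def ac_simps)
  define f where "f x = ennreal \<bar>c powr \<alpha> * enn2real x - limit_const * q\<bar>" for x
  have [measurable]: "f \<in> borel_measurable borel" unfolding f_def by measurable
  have f1: "f (ennreal (c powr - 1) * v) = ennreal \<bar>c powr (\<alpha> - 1) * enn2real v - limit_const * q\<bar>" for v
  proof -
    have "c powr \<alpha> * c powr - 1 = c powr (\<alpha> - 1)" unfolding powr_add[symmetric] by simp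
    then show ?thesis by (simp only: f_def enn2real_mult mult.assoc[symmetric] enn2real_ennreal[OF powr_ge_zero])
  qed
  have "(\<integral>\<^sup>+\<omega>. ennreal \<bar>mass c q \<omega> - limit_const * q\<bar> \<partial>M)
    = (\<integral>\<^sup>+\<omega>. f (ennreal (c powr (- 1)) * truncated_variation c (\<lambda>t. X t \<omega>) 0 (c powr \<alpha> * T)) \<partial>M)"
    unfolding f1 mass_def q_eq ..
  also have "\<dots> = (\<integral>\<^sup>+\<omega>. f (truncated_variation 1 (\<lambda>t. X t \<omega>) 0 T) \<partial>M)"
    by (rule nn_integral_tv_scale[OF c T]) measurable
  also have "\<dots> = (\<integral>\<^sup>+\<omega>. ennreal (c powr \<alpha> * \<bar>tv T \<omega> - limit_const * T\<bar>) \<partial>M)"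
  proof (rule nn_integral_cong)
    fix \<omega>
    have "limit_const * q = c powr \<alpha> * (limit_const * T)" unfolding q_eq[symmetric] by (simp only: ac_simps)
    then have "c powr \<alpha> * tv T \<omega> - limit_const * q = c powr \<alpha> * (tv T \<omega> - limit_const * T)"
      by (simp only: right_diff_distrib)
    then show "f (truncated_variation 1 (\<lambda>t. X t \<omega>) 0 T) = ennreal (c powr \<alpha> * \<bar>tv T \<omega> - limit_const * T\<bar>)"
      by (simp add: f_def tv_def[symmetric] abs_mult)
  qed
  also have "\<dots> = ennreal (expectation (\<lambda>\<omega>. c powr \<alpha> * \<bar>tv T \<omega> - limit_const * T\<bar>))"
    using tv_integrable[of T] T by (intro nn_integral_eq_integral) auto
  finally show ?thesis unfolding T_def by simp
qed

lemma mass_integrable: "c > 0 \<Longrightarrow> q > 0 \<Longrightarrow> integrable M (\<lambda>\<omega>. mass c q \<omega> - limit_const * q)"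
proof (rule integrableI_bounded)
  assume c: "c > 0" and q: "q > 0"
  note [measurable] = mass_measurable[OF c less_imp_le[OF q]]
  show "(\<lambda>\<omega>. mass c q \<omega> - limit_const * q) \<in> borel_measurable M" by measurable
  show "(\<integral>\<^sup>+\<omega>. ennreal (norm (mass c q \<omega> - limit_const * q)) \<partial>M) < \<infinity>"
    using mass_L1_scale[OF c q] by simp
qed

lemma mass_L1_limit:
  fixes c :: "nat \<Rightarrow> real"
  assumes c: "\<And>n. c n > 0" "c \<longlonglongrightarrow> 0" and q: "0 < q"
  shows "(\<lambda>n. expectation (\<lambda>\<omega>. \<bar>mass (c n) q \<omega> - limit_const * q\<bar>)) \<longlonglongrightarrow> 0"
proof (rule tendstoI)
  fix r :: real assume r: "0 < r"
  define e where "e = r / (2 * q)"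
  have e: "e > 0" using r q by (simp add: e_def)
  obtain T1 where T1: "T1 > 0" "\<And>T. T1 \<le> T \<Longrightarrow> expectation (\<lambda>\<omega>. \<bar>tv T \<omega> - limit_const * T\<bar>) \<le> e * T"
    using tv_L1_limit[OF e] by blast
  \<comment> \<open>For 0 < c < d one has q c^(-\<alpha>) \<ge> T1.\<close>
  define d where "d = (q / T1) powr (1 / \<alpha>)"
  have d: "0 < d" using q T1 by (simp add: d_def)
  have "\<forall>\<^sub>F n in sequentially. c n < d" using order_tendstoD(2)[OF c(2) d] .
  then show "\<forall>\<^sub>F n in sequentially. dist (expectation (\<lambda>\<omega>. \<bar>mass (c n) q \<omega> - limit_const * q\<bar>)) 0 < r"
  proof eventually_elim
    case (elim n)
    define T where "T = q * c n powr (- \<alpha>)"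
    have "c n powr \<alpha> \<le> d powr \<alpha>" using elim c(1)[of n] index_pos by (intro powr_mono2) auto
    also have "d powr \<alpha> = q / T1" using q T1 index_pos by (simp add: d_def powr_powr)
    finally have "c n powr \<alpha> \<le> q / T1" .
    then have "T1 \<le> q / c n powr \<alpha>" using T1(1) c(1)[of n] by (simp add: field_simps)
    then have "T1 \<le> T" by (simp add: T_def powr_minus_divide)
    have cc: "c n powr \<alpha> * c n powr (- \<alpha>) = 1" using c(1)[of n] by (simp add: powr_add[symmetric])
    have "ennreal (expectation (\<lambda>\<omega>. \<bar>mass (c n) q \<omega> - limit_const * q\<bar>)) = (\<integral>\<^sup>+\<omega>. ennreal \<bar>mass (c n) q \<omega> - limit_const * q\<bar> \<partial>M)"
      using mass_integrable[OF c(1) q] by (intro nn_integral_eq_integral[symmetric]) auto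
    also have "\<dots> = ennreal (c n powr \<alpha> * expectation (\<lambda>\<omega>. \<bar>tv T \<omega> - limit_const * T\<bar>))"
      unfolding T_def by (rule mass_L1_scale[OF c(1) q])
    finally have "expectation (\<lambda>\<omega>. \<bar>mass (c n) q \<omega> - limit_const * q\<bar>) = c n powr \<alpha> * expectation (\<lambda>\<omega>. \<bar>tv T \<omega> - limit_const * T\<bar>)"
      by (subst (asm) ennreal_inj) auto
    also have "\<dots> \<le> c n powr \<alpha> * (e * T)" using T1(2)[OF \<open>T1 \<le> T\<close>] by (intro mult_left_mono) auto
    also have "\<dots> = (c n powr \<alpha> * c n powr (- \<alpha>)) * (e * q)" unfolding T_def by (simp only: ac_simps)
    also have "\<dots> = r / 2" unfolding cc using q by (simp add: e_def)
    finally have "expectation (\<lambda>\<omega>. \<bar>mass (c n) q \<omega> - limit_const * q\<bar>) \<le> r / 2" .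
    moreover have "0 \<le> expectation (\<lambda>\<omega>. \<bar>mass (c n) q \<omega> - limit_const * q\<bar>)" by simp
    ultimately show ?case using r by (simp add: dist_real_def)
  qed
qed

text \<open>L^1 convergence gives almost sure convergence along a subsequence for one q;
  \<open>diagseq\<close> produces one subsequence for all positive rationals.\<close>

lemma mass_AE_subseq:
  fixes c :: "nat \<Rightarrow> real"
  assumes c: "\<And>n. c n > 0" "c \<longlonglongrightarrow> 0"
  shows "\<exists>r. strict_mono r \<and> (AE \<omega> in M. \<forall>q\<in>\<rat>. 0 < q \<longrightarrow> (\<lambda>n. mass (c (r n)) q \<omega>) \<longlonglongrightarrow> limit_const * q)"
proof -
  define Q where "Q = (\<rat> \<inter> {0<..} :: real set)"
  have Q: "countable Q" "Q \<noteq> {}" by (auto simp: Q_def countable_rat intro!: exI[of _ 1])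
  define q where "q k = from_nat_into Q k" for k
  have q: "q k > 0" for k using from_nat_into[OF Q(2), of k] by (simp add: q_def Q_def)
  define P where "P k s \<longleftrightarrow> (AE \<omega> in M. (\<lambda>n. mass (c (s n)) (q k) \<omega> - limit_const * q k) \<longlonglongrightarrow> 0)" for k and s :: "nat \<Rightarrow> nat"
  interpret subseqs P
  proof
    fix k and s :: "nat \<Rightarrow> nat" assume s: "strict_mono s"
    have cs: "c (s n) > 0" "(\<lambda>n. c (s n)) \<longlonglongrightarrow> 0" for n
      using c LIMSEQ_subseq_LIMSEQ[OF c(2) s] by (auto simp: comp_def)
    from mass_L1_limit[OF cs q[of k]]
    have "(\<lambda>n. expectation (\<lambda>\<omega>. norm (mass (c (s n)) (q k) \<omega> - limit_const * q k))) \<longlonglongrightarrow> 0" by simp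
    from tendsto_L1_AE_subseq[OF mass_integrable[OF cs(1) q] this]
    show "\<exists>r'. strict_mono r' \<and> P k (s \<circ> r')" by (auto simp: P_def)
  qed
  have "P k (diagseq \<circ> (+) (Suc k))" for k
  proof (rule diagseq_holds)
    fix n and r s :: "nat \<Rightarrow> nat" assume rs: "strict_mono r" "P n s"
    show "P n (s \<circ> r)" using rs(2) unfolding P_def
      by eventually_elim (use LIMSEQ_subseq_LIMSEQ[OF _ rs(1)] in \<open>auto simp: comp_def\<close>)
  qed
  moreover define d where "d = diagseq"
  ultimately have Pd: "P k (d \<circ> (+) (Suc k))" for k by simp
  have sd: "strict_mono d" unfolding d_def by (rule subseq_diagseq)
  have "AE \<omega> in M. (\<lambda>n. mass (c (d n)) (q k) \<omega>) \<longlonglongrightarrow> limit_const * q k" for k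
  proof -
    have "AE \<omega> in M. (\<lambda>n. mass (c (d (n + Suc k))) (q k) \<omega> - limit_const * q k) \<longlonglongrightarrow> 0"
      using Pd[of k] unfolding P_def comp_def by (simp add: add.commute)
    then show "AE \<omega> in M. (\<lambda>n. mass (c (d n)) (q k) \<omega>) \<longlonglongrightarrow> limit_const * q k"
    proof eventually_elim
      case (elim \<omega>)
      then have "(\<lambda>n. mass (c (d n)) (q k) \<omega> - limit_const * q k) \<longlonglongrightarrow> 0" by (rule LIMSEQ_offset)
      then show ?case by (rule LIM_zero_cancel)
    qed
  qed
  then have "AE \<omega> in M. \<forall>k. (\<lambda>n. mass (c (d n)) (q k) \<omega>) \<longlonglongrightarrow> limit_const * q k"
    unfolding AE_all_countable by blast
  then have "AE \<omega> in M. \<forall>p\<in>\<rat>. 0 < p \<longrightarrow> (\<lambda>n. mass (c (d n)) p \<omega>) \<longlonglongrightarrow> limit_const * p"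
  proof eventually_elim
    case (elim \<omega>)
    show ?case
    proof (intro ballI impI)
      fix p :: real assume "p \<in> \<rat>" "0 < p"
      then have "p \<in> Q" by (simp add: Q_def)
      then obtain k where "q k = p" unfolding q_def using from_nat_into_surj[OF Q(1)] by blast
      with elim show "(\<lambda>n. mass (c (d n)) p \<omega>) \<longlonglongrightarrow> limit_const * p" by blast
    qed
  qed
  with sd show ?thesis by blast
qed

lemma lim_expected_tv:
  "lim (\<lambda>n::nat. (\<integral>\<^sup>+\<omega>. truncated_variation 1 (\<lambda>s. X s \<omega>) 0 (real n) \<partial>M) / of_nat n) = ennreal limit_const"
proof (rule limI)
  have "(\<lambda>n::nat. ennreal (mean_tv (real n) / real n)) \<longlonglongrightarrow> ennreal limit_const"
    by (intro tendsto_ennrealI mean_tv_limit)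
  moreover have "\<forall>\<^sub>F n::nat in sequentially. ennreal (mean_tv (real n) / real n) = (\<integral>\<^sup>+\<omega>. truncated_variation 1 (\<lambda>s. X s \<omega>) 0 (real n) \<partial>M) / of_nat n"
    using eventually_gt_at_top[of 0]
  proof eventually_elim
    case (elim n)
    then show ?case
      by (subst divide_ennreal[symmetric]) (auto simp: mean_tv_nonneg ennreal_mean_tv ennreal_of_nat_eq_real_of_nat)
  qed
  ultimately show "(\<lambda>n::nat. (\<integral>\<^sup>+\<omega>. truncated_variation 1 (\<lambda>s. X s \<omega>) 0 (real n) \<partial>M) / of_nat n) \<longlonglongrightarrow> ennreal limit_const"
    by (rule Lim_transform_eventually)
qed

end

section \<open>Occupation measures\<close>

lemma cadlag_measurable_restrict:
  assumes "cadlag x"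
  shows "x \<in> restrict_space lborel {0..t} \<rightarrow>\<^sub>M borel"
proof -
  have "(\<lambda>u. x (max 0 u)) \<in> restrict_space lborel {0..t} \<rightarrow>\<^sub>M borel"
    using cadlag_measurable[OF assms] by (intro measurable_restrict_space1) simp
  then show ?thesis by (rule measurable_cong[THEN iffD1, rotated]) (simp add: space_restrict_space max_def)
qed

lemma sets_occupation_measure [measurable_cong, simp]: "sets (occupation_measure x t) = sets borel"
  by (simp add: occupation_measure_def)

lemma space_occupation_measure [simp]: "space (occupation_measure x t) = UNIV"
  by (simp add: occupation_measure_def)

lemma nn_integral_occupation:
  assumes x: "cadlag x" and f: "f \<in> borel_measurable borel"
  shows "(\<integral>\<^sup>+y. f y \<partial>occupation_measure x t) = (\<integral>\<^sup>+u. f (x (max 0 u)) * indicator {0..t} u \<partial>lborel)"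
proof -
  have "(\<integral>\<^sup>+y. f y \<partial>occupation_measure x t) = (\<integral>\<^sup>+u. f (x u) \<partial>restrict_space lborel {0..t})"
    unfolding occupation_measure_def using f by (intro nn_integral_distr cadlag_measurable_restrict[OF x]) simp
  also have "\<dots> = (\<integral>\<^sup>+u. f (x u) * indicator {0..t} u \<partial>lborel)"
    by (rule nn_integral_restrict_space) simp
  also have "\<dots> = (\<integral>\<^sup>+u. f (x (max 0 u)) * indicator {0..t} u \<partial>lborel)"
    by (intro nn_integral_cong) (auto simp: indicator_def max_def)
  finally show ?thesis .
qed

lemma emeasure_occupation:
  assumes x: "cadlag x" and A: "A \<in> sets borel"
  shows "emeasure (occupation_measure x t) A = (\<integral>\<^sup>+u. indicator A (x (max 0 u)) * indicator {0..t} u \<partial>lborel)"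
  using nn_integral_occupation[OF x borel_measurable_indicator[OF A], of t] A by simp

lemma emeasure_occupation_le:
  assumes x: "cadlag x" and t: "0 \<le> s" "s \<le> t" and A: "A \<in> sets borel"
  shows "emeasure (occupation_measure x s) A \<le> emeasure (occupation_measure x t) A"
    "emeasure (occupation_measure x t) A \<le> emeasure (occupation_measure x s) A + ennreal (t - s)"
proof -
  note [measurable] = cadlag_measurable[OF x] A
  show "emeasure (occupation_measure x s) A \<le> emeasure (occupation_measure x t) A"
    unfolding emeasure_occupation[OF x A] using t by (intro nn_integral_mono) (auto simp: indicator_def)
  have "emeasure (occupation_measure x t) A \<le>
      (\<integral>\<^sup>+u. indicator A (x (max 0 u)) * indicator {0..s} u + indicator {s..t} u \<partial>lborel)"
    unfolding emeasure_occupation[OF x A] by (intro nn_integral_mono) (auto simp: indicator_def)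
  also have "\<dots> = emeasure (occupation_measure x s) A + ennreal (t - s)"
    unfolding emeasure_occupation[OF x A] using t by (subst nn_integral_add) auto
  finally show "emeasure (occupation_measure x t) A \<le> emeasure (occupation_measure x s) A + ennreal (t - s)" .
qed

lemma finite_measure_occupation:
  assumes x: "cadlag x" and t: "0 \<le> t"
  shows "finite_measure (occupation_measure x t)"
proof
  have "emeasure (occupation_measure x t) UNIV = ennreal t"
    using t by (subst emeasure_occupation[OF x]) auto
  then show "emeasure (occupation_measure x t) (space (occupation_measure x t)) \<noteq> \<infinity>" by simp
qed

lemma integral_occupation:
  assumes x: "cadlag x" and g: "g \<in> borel_measurable borel"
  shows "(\<integral>y. g y \<partial>occupation_measure x t) = path_integral x g t"
proof -
  have "(\<integral>y. g y \<partial>occupation_measure x t) = (\<integral>u. g (x u) \<partial>restrict_space lborel {0..t})"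
    unfolding occupation_measure_def by (rule integral_distr[OF cadlag_measurable_restrict[OF x] g])
  also have "\<dots> = (\<integral>u. indicator {0..t} u *\<^sub>R g (x u) \<partial>lborel)"
    by (subst integral_restrict_space) (auto simp: set_lebesgue_integral_def)
  also have "\<dots> = path_integral x g t"
    unfolding path_integral_def by (intro Bochner_Integration.integral_cong) (auto simp: indicator_def max_def)
  finally show ?thesis .
qed

abbreviation has_local_time :: "(real \<Rightarrow> real) \<Rightarrow> real \<Rightarrow> bool" where
  "has_local_time x t \<equiv> absolutely_continuous lborel (occupation_measure x t)"

lemma density_local_time: "has_local_time x t \<Longrightarrow> density lborel (local_time x t) = occupation_measure x t"
  unfolding local_time_def by (rule sigma_finite_measure.density_RN_deriv[OF sigma_finite_lborel]) auto

text \<open>\<open>RN_deriv\<close> is the zero function when no density exists, and a density would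
  imply absolute continuity.\<close>

lemma local_time_eq_0: "\<not> has_local_time x t \<Longrightarrow> local_time x t = (\<lambda>_. 0)"
proof -
  assume not_ac: "\<not> has_local_time x t"
  have "\<not> (\<exists>f. f \<in> borel_measurable lborel \<and> density lborel f = occupation_measure x t)"
  proof
    assume "\<exists>f. f \<in> borel_measurable lborel \<and> density lborel f = occupation_measure x t"
    then obtain f where "f \<in> borel_measurable lborel" "density lborel f = occupation_measure x t" by blast
    with absolutely_continuousI_density[of f lborel] not_ac show False by simp
  qed
  then show ?thesis unfolding local_time_def RN_deriv_def by (rule if_not_P)
qed

lemma local_time_measurable [measurable]: "local_time x t \<in> borel_measurable borel"
  unfolding local_time_def using borel_measurable_RN_deriv[of lborel "occupation_measure x t"] by simp

lemma density_scaled_local_time: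
  assumes "0 \<le> C"
  shows "density lborel (\<lambda>y. ennreal C * local_time x t y)
    = (if has_local_time x t then density (occupation_measure x t) (\<lambda>_. ennreal C) else density lborel (\<lambda>_. 0))"
proof (cases "has_local_time x t")
  case True
  have "density (density lborel (local_time x t)) (\<lambda>_. ennreal C) = density lborel (\<lambda>y. local_time x t y * ennreal C)"
    by (rule density_density_eq) auto
  then show ?thesis unfolding density_local_time[OF True] using True by (simp add: mult.commute)
next
  case False
  then show ?thesis by (simp add: local_time_eq_0)
qed

lemma emeasure_scaled_local_time:
  assumes "0 \<le> C" "A \<in> sets borel"
  shows "emeasure (density lborel (\<lambda>y. ennreal C * local_time x t y)) A
    = (if has_local_time x t then ennreal C * emeasure (occupation_measure x t) A else 0)"
  unfolding density_scaled_local_time[OF assms(1)] using assms(2)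
  by (auto simp: emeasure_density nn_integral_cmult)

lemma integral_scaled_local_time:
  assumes x: "cadlag x" and g: "g \<in> borel_measurable borel" and C: "0 \<le> C"
  shows "(\<integral>y. g y \<partial>density lborel (\<lambda>y. ennreal C * local_time x t y))
    = (if has_local_time x t then C * path_integral x g t else 0)"
proof (cases "has_local_time x t")
  case True
  have "(\<integral>y. g y \<partial>density (occupation_measure x t) (\<lambda>_. ennreal C)) = (\<integral>y. C *\<^sub>R g y \<partial>occupation_measure x t)"
    using g C by (intro integral_density) auto
  then show ?thesis unfolding density_scaled_local_time[OF C] using True integral_occupation[OF x g, of t] by simp
next
  case False
  have "(\<integral>y. g y \<partial>density lborel (\<lambda>_. ennreal 0)) = (\<integral>y. 0 *\<^sub>R g y \<partial>lborel)"
    using g by (intro integral_density) auto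
  then show ?thesis unfolding density_scaled_local_time[OF C] using False by simp
qed

lemma finite_borel_measureI:
  "emeasure \<mu> UNIV < \<infinity> \<Longrightarrow> sets \<mu> = sets borel \<Longrightarrow> finite_borel_measure \<mu>"
  by (intro finite_borel_measure.intro finite_measureI finite_borel_measure_axioms.intro)
    (auto dest: sets_eq_imp_space_eq)

lemma finite_scaled_local_time:
  assumes x: "cadlag x" and t: "0 \<le> t" and C: "0 \<le> C"
  shows "finite_borel_measure (density lborel (\<lambda>y. ennreal C * local_time x t y))"
proof (rule finite_borel_measureI)
  interpret finite_measure "occupation_measure x t" by (rule finite_measure_occupation[OF x t])
  show "emeasure (density lborel (\<lambda>y. ennreal C * local_time x t y)) UNIV < \<infinity>"
  proof -
    have "emeasure (occupation_measure x t) UNIV < \<top>" using emeasure_finite[of UNIV] by (simp add: less_top[symmetric])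
    then show ?thesis by (subst emeasure_scaled_local_time[OF C]) (auto simp: ennreal_mult_less_top)
  qed
qed simp

lemma has_local_time_antimono:
  assumes x: "cadlag x" and t: "0 \<le> s" "s \<le> t" and ac: "has_local_time x t"
  shows "has_local_time x s"
  unfolding absolutely_continuous_def
proof
  fix N assume "N \<in> null_sets (lborel :: real measure)"
  then have N: "N \<in> null_sets (occupation_measure x t)" "N \<in> sets borel"
    using ac by (auto simp: absolutely_continuous_def null_sets_def)
  then have "emeasure (occupation_measure x s) N \<le> 0"
    using emeasure_occupation_le(1)[OF x t N(2)] by (simp add: null_setsD1)
  then show "N \<in> null_sets (occupation_measure x s)" using N(2) by (simp add: null_sets_def)
qed

text \<open>In a time span of length e the occupation measure of any set grows by at most e. With
  \<open>has_local_time_antimono\<close>, the times having a local time form an initial interval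
  closed on the right, the shape that \<open>SUP_switch_measurable\<close> asks for.\<close>

lemma has_local_time_left_closed:
  assumes x: "cadlag x" and t: "0 < t" and ac: "\<And>s. 0 \<le> s \<Longrightarrow> s < t \<Longrightarrow> has_local_time x s"
  shows "has_local_time x t"
  unfolding absolutely_continuous_def
proof
  fix N assume "N \<in> null_sets (lborel :: real measure)"
  then have N: "N \<in> sets borel" "\<And>s. 0 \<le> s \<Longrightarrow> s < t \<Longrightarrow> emeasure (occupation_measure x s) N = 0"
    using ac by (auto simp: absolutely_continuous_def null_sets_def)
  have "emeasure (occupation_measure x t) N \<le> 0 + ennreal e" if e: "0 < e" for e
  proof -
    define s where "s = max 0 (t - e)"
    have s: "0 \<le> s" "s < t" "t - s \<le> e" using e t by (auto simp: s_def)
    have "emeasure (occupation_measure x t) N \<le> emeasure (occupation_measure x s) N + ennreal (t - s)"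
      using s by (intro emeasure_occupation_le(2)[OF x _ _ N(1)]) auto
    also have "\<dots> \<le> 0 + ennreal e" using N(2)[OF s(1,2)] s(3) by (simp add: ennreal_leI)
    finally show ?thesis .
  qed
  then have "emeasure (occupation_measure x t) N \<le> 0" by (rule ennreal_le_epsilon)
  then show "N \<in> null_sets (occupation_measure x t)" using N(1) by (simp add: null_sets_def)
qed

text \<open>Truncating the density at K leaves a remainder of mass below e/2, and on a set of
  measure below d the bounded part has mass at most K d \<le> e/2.\<close>

lemma absolutely_continuous_small:
  fixes f :: "real \<Rightarrow> ennreal" and e :: real
  assumes f [measurable]: "f \<in> borel_measurable lborel" and fin: "(\<integral>\<^sup>+y. f y \<partial>lborel) < \<infinity>" and e: "0 < e"
  shows "\<exists>d>0. \<forall>U\<in>sets borel. emeasure lborel U < ennreal d \<longrightarrow> emeasure (density lborel f) U \<le> ennreal e"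
proof -
  let ?g = "\<lambda>K::nat. \<lambda>y. min (of_nat K) (f y)"
  have "(SUP K. ?g K y) = f y" for y
    using sup_continuousD[OF sup_continuous_min_const, of "of_nat :: nat \<Rightarrow> ennreal" "f y"]
    by (simp add: ennreal_SUP_of_nat_eq_top mono_def of_nat_mono)
  then have "(\<integral>\<^sup>+y. f y \<partial>lborel) = (\<integral>\<^sup>+y. (SUP K. ?g K y) \<partial>lborel)" by simp
  also have "\<dots> = (SUP K. (\<integral>\<^sup>+y. ?g K y \<partial>lborel))"
    by (rule nn_integral_monotone_convergence_SUP) (auto simp: incseq_def le_fun_def intro: min.coboundedI1 of_nat_mono)
  finally have SUP: "(\<integral>\<^sup>+y. f y \<partial>lborel) = (SUP K. (\<integral>\<^sup>+y. ?g K y \<partial>lborel))" .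
  have "\<exists>K. (\<integral>\<^sup>+y. f y \<partial>lborel) < (\<integral>\<^sup>+y. ?g K y \<partial>lborel) + ennreal (e/2)"
  proof (rule ccontr)
    assume "\<not> ?thesis"
    then have "(SUP K. (\<integral>\<^sup>+y. ?g K y \<partial>lborel) + ennreal (e/2)) \<le> (\<integral>\<^sup>+y. f y \<partial>lborel)"
      by (intro SUP_least) (simp add: not_less)
    then have "(\<integral>\<^sup>+y. f y \<partial>lborel) + ennreal (e/2) \<le> (\<integral>\<^sup>+y. f y \<partial>lborel)"
      by (subst (asm) ennreal_SUP_add_left) (simp_all add: SUP)
    then show False using fin e
      by (cases "\<integral>\<^sup>+y. f y \<partial>lborel") (auto simp flip: ennreal_plus)
  qed
  then obtain K where K: "(\<integral>\<^sup>+y. f y \<partial>lborel) < (\<integral>\<^sup>+y. ?g K y \<partial>lborel) + ennreal (e/2)" by blast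
  define d where "d = e / (2 * (real K + 1))"
  have d: "0 < d" "real K * d \<le> e / 2" using e by (auto simp: d_def field_simps)
  have "emeasure (density lborel f) U \<le> ennreal e" if U [measurable]: "U \<in> sets borel" and small: "emeasure lborel U < ennreal d" for U
  proof -
    let ?c = "\<integral>\<^sup>+y. ?g K y * indicator (- U) y \<partial>lborel"
    have gf: "(\<integral>\<^sup>+y. ?g K y \<partial>lborel) \<le> (\<integral>\<^sup>+y. f y \<partial>lborel)" by (intro nn_integral_mono) auto
    have "?c \<le> (\<integral>\<^sup>+y. f y \<partial>lborel)" by (intro nn_integral_mono) (auto simp: indicator_def)
    then have c_fin: "?c < \<infinity>" using fin by (rule order_le_less_trans)
    have "(\<integral>\<^sup>+y. f y * indicator U y \<partial>lborel) + ?c = (\<integral>\<^sup>+y. f y * indicator U y + ?g K y * indicator (- U) y \<partial>lborel)"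
      by (rule nn_integral_add[symmetric]) measurable
    also have "\<dots> \<le> (\<integral>\<^sup>+y. f y \<partial>lborel)" by (intro nn_integral_mono) (auto simp: indicator_def)
    also have "\<dots> \<le> (\<integral>\<^sup>+y. ?g K y \<partial>lborel) + ennreal (e/2)" using K by simp
    also have "(\<integral>\<^sup>+y. ?g K y \<partial>lborel) = (\<integral>\<^sup>+y. ?g K y * indicator U y + ?g K y * indicator (- U) y \<partial>lborel)"
      by (intro nn_integral_cong) (auto simp: indicator_def)
    also have "\<dots> = (\<integral>\<^sup>+y. ?g K y * indicator U y \<partial>lborel) + ?c" by (rule nn_integral_add) measurable
    finally have "(\<integral>\<^sup>+y. f y * indicator U y \<partial>lborel) + ?c \<le> ((\<integral>\<^sup>+y. ?g K y * indicator U y \<partial>lborel) + ennreal (e/2)) + ?c"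
      by (simp only: ac_simps)
    then have "?c + (\<integral>\<^sup>+y. f y * indicator U y \<partial>lborel) \<le> ?c + ((\<integral>\<^sup>+y. ?g K y * indicator U y \<partial>lborel) + ennreal (e/2))"
      by (simp only: ac_simps)
    then have "(\<integral>\<^sup>+y. f y * indicator U y \<partial>lborel) \<le> (\<integral>\<^sup>+y. ?g K y * indicator U y \<partial>lborel) + ennreal (e/2)"
      unfolding ennreal_add_left_cancel_le using c_fin by auto
    also have "\<dots> \<le> (\<integral>\<^sup>+y. of_nat K * indicator U y \<partial>lborel) + ennreal (e/2)"
      by (intro add_right_mono nn_integral_mono mult_right_mono) auto
    also have "\<dots> = of_nat K * emeasure lborel U + ennreal (e/2)"
      by (subst nn_integral_cmult_indicator) auto
    also have "\<dots> \<le> ennreal (real K) * ennreal d + ennreal (e/2)"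
      using small by (intro add_right_mono mult_mono) (auto simp: ennreal_of_nat_eq_real_of_nat)
    also have "\<dots> = ennreal (real K * d + e/2)" using d e by (simp add: ennreal_mult ennreal_plus)
    also have "\<dots> \<le> ennreal e" using d(2) by (intro ennreal_leI) simp
    finally show ?thesis by (simp add: emeasure_density)
  qed
  with d(1) show ?thesis by blast
qed

text \<open>Turns absolute continuity into countably many conditions, hence into an event. By outer
  regularity a null set is covered by an open set of small measure, and open sets are increasing
  unions of finite unions of basis sets.\<close>

lemma has_local_time_iff:
  assumes B: "countable B" "topological_basis B" and x: "cadlag x" and t: "0 \<le> t"
  shows "has_local_time x t \<longleftrightarrow> (\<forall>j::nat. \<exists>k::nat. \<forall>F\<in>{F. F \<subseteq> B \<and> finite F}.
    emeasure lborel (\<Union>F) < ennreal (1 / real (Suc k)) \<longrightarrow> emeasure (occupation_measure x t) (\<Union>F) \<le> ennreal (1 / real (Suc j)))"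
    (is "_ \<longleftrightarrow> ?R")
proof
  interpret finite_measure "occupation_measure x t" by (rule finite_measure_occupation[OF x t])
  have open_UF: "open (\<Union>F)" if "F \<subseteq> B" for F
    using that topological_basis_open[OF B(2)] by (intro open_Union) blast
  assume ac: "has_local_time x t"
  have fin: "(\<integral>\<^sup>+y. local_time x t y \<partial>lborel) < \<infinity>"
  proof -
    have "emeasure (density lborel (local_time x t)) UNIV = (\<integral>\<^sup>+y. local_time x t y \<partial>lborel)"
      by (subst emeasure_density) auto
    then show ?thesis using emeasure_finite[of UNIV] unfolding density_local_time[OF ac] by (simp add: less_top)
  qed
  show ?R
  proof
    fix j :: nat
    obtain d where d: "d > 0" "\<And>U. U \<in> sets borel \<Longrightarrow> emeasure lborel U < ennreal d \<Longrightarrow>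
        emeasure (occupation_measure x t) U \<le> ennreal (1 / real (Suc j))"
      using absolutely_continuous_small[OF _ fin, of "1 / real (Suc j)"] unfolding density_local_time[OF ac] by auto
    obtain k where k: "1 / real (Suc k) < d" using d(1) nat_approx_posE by blast
    show "\<exists>k. \<forall>F\<in>{F. F \<subseteq> B \<and> finite F}. emeasure lborel (\<Union>F) < ennreal (1 / real (Suc k)) \<longrightarrow>
        emeasure (occupation_measure x t) (\<Union>F) \<le> ennreal (1 / real (Suc j))"
    proof (intro exI[of _ k] ballI impI d(2))
      fix F assume F: "F \<in> {F. F \<subseteq> B \<and> finite F}" and lt: "emeasure lborel (\<Union>F) < ennreal (1 / real (Suc k))"
      show "\<Union>F \<in> sets borel" using open_UF[of F] F by auto
      show "emeasure lborel (\<Union>F) < ennreal d" using lt ennreal_leI[OF less_imp_le[OF k]] by (rule order_less_le_trans)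
    qed
  qed
next
  assume R: ?R
  have open_UF: "open (\<Union>F)" if "F \<subseteq> B" for F
    using that topological_basis_open[OF B(2)] by (intro open_Union) blast
  show "has_local_time x t"
    unfolding absolutely_continuous_def
  proof
    fix N assume "N \<in> null_sets (lborel :: real measure)"
    then have N: "N \<in> sets borel" "emeasure lborel N = 0" by (auto simp: null_sets_def)
    have le: "emeasure (occupation_measure x t) N \<le> ennreal (1 / real (Suc j))" for j :: nat
    proof -
      obtain k where k: "\<And>F. F \<subseteq> B \<Longrightarrow> finite F \<Longrightarrow> emeasure lborel (\<Union>F) < ennreal (1 / real (Suc k)) \<Longrightarrow>
        emeasure (occupation_measure x t) (\<Union>F) \<le> ennreal (1 / real (Suc j))" using R by blast
      obtain T where T: "open T" "N \<subseteq> T" "emeasure lborel (T - N) < ennreal (1 / real (Suc k))"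
        using outer_regular_lborel[OF N(1), of "1 / real (Suc k)"] by auto
      have Tb: "T \<in> sets borel" using T(1) by simp
      have "emeasure lborel T \<le> emeasure lborel (N \<union> (T - N))" using Tb N(1) T(2) by (intro emeasure_mono) auto
      also have "\<dots> \<le> emeasure lborel N + emeasure lborel (T - N)"
        using Tb N(1) by (intro emeasure_subadditive) auto
      also have "\<dots> < ennreal (1 / real (Suc k))"
        using T(3) N(2) by simp
      finally have Tk: "emeasure lborel T < ennreal (1 / real (Suc k))" .
      obtain B' where B': "B' \<subseteq> B" "\<Union>B' = T" using B(2) T(1) unfolding topological_basis_def by blast
      show ?thesis
      proof (cases "B' = {}")
        case True
        then show ?thesis using B'(2) T(2) by auto
      next
        case False
        have cB': "countable B'" using B'(1) B(1) by (rule countable_subset)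
        define U where "U n = \<Union>(from_nat_into B' ` {..n})" for n :: nat
        have sub: "from_nat_into B' ` {..n} \<subseteq> B'" for n using from_nat_into[OF False] by auto
        have UT: "(\<Union>n. U n) = T"
        proof
          show "(\<Union>n. U n) \<subseteq> T" using sub B'(2) by (auto simp: U_def)
          show "T \<subseteq> (\<Union>n. U n)"
          proof
            fix y assume "y \<in> T"
            then obtain b where b: "b \<in> B'" "y \<in> b" using B'(2) by auto
            then obtain n where "from_nat_into B' n = b" using from_nat_into_surj[OF cB'] by blast
            then show "y \<in> (\<Union>n. U n)" using b by (auto simp: U_def)
          qed
        qed
        have U_sets: "U n \<in> sets borel" for n
          unfolding U_def using sub[of n] B'(1) by (intro borel_open open_UF) blast
        have U_le: "emeasure (occupation_measure x t) (U n) \<le> ennreal (1 / real (Suc j))" for n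
          unfolding U_def
        proof (rule k)
          show "from_nat_into B' ` {..n} \<subseteq> B" using sub B'(1) by blast
          have "emeasure lborel (\<Union>(from_nat_into B' ` {..n})) \<le> emeasure lborel T"
            using UT Tb by (intro emeasure_mono) (auto simp: U_def[symmetric])
          then show "emeasure lborel (\<Union>(from_nat_into B' ` {..n})) < ennreal (1 / real (Suc k))"
            using Tk by (rule order_le_less_trans)
        qed simp
        have "emeasure (occupation_measure x t) N \<le> emeasure (occupation_measure x t) (\<Union>n. U n)"
          unfolding UT using T(2) Tb by (intro emeasure_mono) auto
        also have "\<dots> = (SUP n. emeasure (occupation_measure x t) (U n))"
        proof (rule SUP_emeasure_incseq[symmetric])
          show "range U \<subseteq> sets (occupation_measure x t)" using U_sets by auto
          show "incseq U" unfolding U_def by (intro incseq_SucI Union_mono image_mono) auto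
        qed
        also have "\<dots> \<le> ennreal (1 / real (Suc j))" by (intro SUP_least U_le)
        finally show ?thesis .
      qed
    qed
    have "emeasure (occupation_measure x t) N \<le> 0"
    proof (rule ennreal_le_epsilon)
      fix e :: real assume "0 < e"
      then obtain j where "1 / real (Suc j) < e" using nat_approx_posE by blast
      then have "ennreal (1 / real (Suc j)) \<le> ennreal e" by (intro ennreal_leI) simp
      with le[of j] show "emeasure (occupation_measure x t) N \<le> 0 + ennreal e" by simp
    qed
    then show "N \<in> null_sets (occupation_measure x t)" using N(1) by (simp add: null_sets_def)
  qed
qed

section \<open>Measurability of the weak deviation\<close>

text \<open>The function under the supremum may switch from \<open>h1\<close> to \<open>h0\<close>
  just after a last time \<tau> with \<open>A\<close> and need not be right-continuous there, so a
  countable dense set of times may miss \<open>h1\<close> at \<tau>. Hence \<open>h1\<close> is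
  sampled also up to 1/(n+1) beyond the times with \<open>A\<close>, and the infimum over n removes
  the excess.\<close>

lemma SUP_switch_measurable:
  fixes h1 h0 :: "real \<Rightarrow> 'a \<Rightarrow> ennreal" and A :: "real \<Rightarrow> 'a \<Rightarrow> bool"
  assumes T: "0 \<le> T"
    and [measurable]: "\<And>t. 0 \<le> t \<Longrightarrow> h1 t \<in> borel_measurable M" "\<And>t. 0 \<le> t \<Longrightarrow> h0 t \<in> borel_measurable M"
      "\<And>t. 0 \<le> t \<Longrightarrow> Measurable.pred M (A t)"
    and h1: "\<And>t \<omega>. \<omega> \<in> space M \<Longrightarrow> 0 \<le> t \<Longrightarrow> ((\<lambda>s. h1 s \<omega>) \<longlongrightarrow> h1 t \<omega>) (at_right t)"
    and h0: "\<And>t \<omega>. \<omega> \<in> space M \<Longrightarrow> 0 \<le> t \<Longrightarrow> ((\<lambda>s. h0 s \<omega>) \<longlongrightarrow> h0 t \<omega>) (at_right t)"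
    and A_mono: "\<And>s t \<omega>. \<omega> \<in> space M \<Longrightarrow> 0 \<le> s \<Longrightarrow> s \<le> t \<Longrightarrow> A t \<omega> \<Longrightarrow> A s \<omega>"
    and A_closed: "\<And>t \<omega>. \<omega> \<in> space M \<Longrightarrow> 0 < t \<Longrightarrow> (\<And>s. 0 \<le> s \<Longrightarrow> s < t \<Longrightarrow> A s \<omega>) \<Longrightarrow> A t \<omega>"
  shows "(\<lambda>\<omega>. SUP t\<in>{0..T}. if A t \<omega> then h1 t \<omega> else h0 t \<omega>) \<in> borel_measurable M"
proof -
  define D where "D = insert T (\<rat> \<inter> {0..T})"
  have D: "countable D" "D \<subseteq> {0..T}" "T \<in> D" "\<And>q. q \<in> D \<Longrightarrow> 0 \<le> q" using T by (auto simp: D_def countable_rat)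
  have dense_D: "\<exists>q\<in>D. t < q \<and> q < u" if "0 \<le> t" "t < u" "t < T" for t u
    using Rats_dense_in_real[of t "min u T"] that by (auto simp: D_def)
  let ?F1 = "\<lambda>n \<omega>. SUP q\<in>D. if A (max 0 (q - 1 / real (Suc n))) \<omega> then h1 q \<omega> else 0"
  let ?F0 = "\<lambda>\<omega>. SUP q\<in>D. if \<not> A q \<omega> then h0 q \<omega> else 0"
  have m1: "?F1 n \<in> borel_measurable M" for n
  proof (rule borel_measurable_SUP[OF D(1)])
    fix q assume q: "q \<in> D"
    have [measurable]: "Measurable.pred M (A (max 0 (q - 1 / real (Suc n))))" by (rule assms(4)) simp
    note [measurable] = assms(2)[OF D(4)[OF q]]
    show "(\<lambda>\<omega>. if A (max 0 (q - 1 / real (Suc n))) \<omega> then h1 q \<omega> else 0) \<in> borel_measurable M" by measurable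
  qed
  have m0: "?F0 \<in> borel_measurable M"
  proof (rule borel_measurable_SUP[OF D(1)])
    fix q assume q: "q \<in> D"
    note [measurable] = assms(3)[OF D(4)[OF q]] assms(4)[OF D(4)[OF q]]
    show "(\<lambda>\<omega>. if \<not> A q \<omega> then h0 q \<omega> else 0) \<in> borel_measurable M" by measurable
  qed
  have "(\<lambda>\<omega>. max (INF n. ?F1 n \<omega>) (?F0 \<omega>)) \<in> borel_measurable M"
    using m0 by (intro borel_measurable_max borel_measurable_INF m1) auto
  moreover have "(SUP t\<in>{0..T}. if A t \<omega> then h1 t \<omega> else h0 t \<omega>) = max (INF n. ?F1 n \<omega>) (?F0 \<omega>)"
    if \<omega>: "\<omega> \<in> space M" for \<omega>
  proof -
    let ?Z = "SUP t\<in>{0..T}. if A t \<omega> then h1 t \<omega> else h0 t \<omega>"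
    have approx: "\<exists>q\<in>D. t < q \<and> q < u \<and> a < h q \<omega>"
      if tt: "0 \<le> t" "t < u" "t < T" "a < h t \<omega>" "((\<lambda>s. h s \<omega>) \<longlongrightarrow> h t \<omega>) (at_right t)"
      for h :: "real \<Rightarrow> 'a \<Rightarrow> ennreal" and t u a
    proof -
      from order_tendstoD(1)[OF tt(5,4)] obtain b where b: "b > t" "\<And>s. t < s \<Longrightarrow> s < b \<Longrightarrow> a < h s \<omega>"
        unfolding eventually_at_right_field by auto
      obtain q where "q \<in> D" "t < q" "q < min u b" using dense_D[of t "min u b"] tt b by auto
      then show ?thesis using b by auto
    qed
    have le1: "h1 t \<omega> \<le> ?F1 n \<omega>" if t: "t \<in> {0..T}" "A t \<omega>" for t n
    proof (rule ccontr)
      assume "\<not> ?thesis"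
      then have lt: "?F1 n \<omega> < h1 t \<omega>" by simp
      show False
      proof (cases "t = T")
        case True
        have "A (max 0 (T - 1 / real (Suc n))) \<omega>" using t T True by (intro A_mono[OF \<omega> _ _ t(2)]) auto
        then have "h1 t \<omega> \<le> ?F1 n \<omega>" using True by (intro SUP_upper2[OF D(3)]) auto
        with lt show False by simp
      next
        case False
        with t have "0 \<le> t" "t < T" "t < t + 1 / real (Suc n)" by auto
        from approx[where h = h1, OF this(1,3,2) lt h1[OF \<omega> this(1)]] obtain q where
          q: "q \<in> D" "t < q" "q < t + 1 / real (Suc n)" "?F1 n \<omega> < h1 q \<omega>" by blast
        have "A (max 0 (q - 1 / real (Suc n))) \<omega>" using t q by (intro A_mono[OF \<omega> _ _ t(2)]) auto
        then have "h1 q \<omega> \<le> ?F1 n \<omega>" by (intro SUP_upper2[OF q(1)]) auto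
        with q(4) show False by simp
      qed
    qed
    have le0: "h0 t \<omega> \<le> ?F0 \<omega>" if t: "t \<in> {0..T}" "\<not> A t \<omega>" for t
    proof (rule ccontr)
      assume "\<not> ?thesis"
      then have lt: "?F0 \<omega> < h0 t \<omega>" by simp
      show False
      proof (cases "t = T")
        case True
        then have "h0 t \<omega> \<le> ?F0 \<omega>" using t by (intro SUP_upper2[OF D(3)]) auto
        with lt show False by simp
      next
        case False
        with t have "0 \<le> t" "t < T" by auto
        from approx[where h = h0, OF this(1) less_add_one this(2) lt h0[OF \<omega> this(1)]] obtain q where
          q: "q \<in> D" "t < q" "?F0 \<omega> < h0 q \<omega>" by blast
        have "\<not> A q \<omega>" using A_mono[OF \<omega>, of t q] t q by auto
        then have "h0 q \<omega> \<le> ?F0 \<omega>" by (intro SUP_upper2[OF q(1)]) auto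
        with q(3) show False by simp
      qed
    qed
    show ?thesis
    proof (rule antisym)
      show "?Z \<le> max (INF n. ?F1 n \<omega>) (?F0 \<omega>)"
      proof (rule SUP_least)
        fix t assume t: "t \<in> {0..T}"
        show "(if A t \<omega> then h1 t \<omega> else h0 t \<omega>) \<le> max (INF n. ?F1 n \<omega>) (?F0 \<omega>)"
        proof (cases "A t \<omega>")
          case True
          then have "h1 t \<omega> \<le> (INF n. ?F1 n \<omega>)" by (intro INF_greatest le1 t)
          then show ?thesis using True by (simp add: le_max_iff_disj)
        next
          case False
          then show ?thesis using le0[OF t] by (simp add: le_max_iff_disj)
        qed
      qed
      have "?F0 \<omega> \<le> ?Z"
      proof (rule SUP_least)
        fix q assume "q \<in> D"
        then have "q \<in> {0..T}" using D by auto
        then show "(if \<not> A q \<omega> then h0 q \<omega> else 0) \<le> ?Z" by (intro SUP_upper2[of q]) auto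
      qed
      moreover have "(INF n. ?F1 n \<omega>) \<le> ?Z"
      proof (rule ccontr)
        assume "\<not> ?thesis"
        then have "?Z < (INF n. ?F1 n \<omega>)" by (simp only: not_le)
        from dense[OF this] obtain a where a: "?Z < a" "a < (INF n. ?F1 n \<omega>)" by blast
        have "\<exists>q\<in>D. A (max 0 (q - 1 / real (Suc n))) \<omega> \<and> a < h1 q \<omega>" for n
        proof -
          have "a < ?F1 n \<omega>" using a(2) by (rule order_less_le_trans) (rule INF_lower, simp)
          from this[unfolded less_SUP_iff] obtain q where
            "q \<in> D" "a < (if A (max 0 (q - 1 / real (Suc n))) \<omega> then h1 q \<omega> else 0)" by blast
          then show ?thesis by (intro bexI[of _ q]) (auto split: if_splits)
        qed
        then obtain q where q: "\<And>n. q n \<in> D" "\<And>n. A (max 0 (q n - 1 / real (Suc n))) \<omega>" "\<And>n. a < h1 (q n) \<omega>"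
          by metis
        have qT: "0 \<le> q n" "q n \<le> T" for n using q(1)[of n] D by auto
        have notA: "\<not> A (q n) \<omega>" for n
        proof
          assume "A (q n) \<omega>"
          then have "h1 (q n) \<omega> \<le> ?Z" using qT by (intro SUP_upper2[of "q n"]) auto
          with a(1) q(3)[of n] show False by simp
        qed
        \<comment> \<open>The times \<open>q n\<close> lie outside \<open>A\<close> but within
          1/(n+1) of it, so they converge from the right to the last time \<tau> with
          \<open>A\<close>, where \<open>h1\<close> is right-continuous.\<close>
        define G where "G = {t\<in>{0..T}. A t \<omega>}"
        have max_G: "max 0 (q n - 1 / real (Suc n)) \<in> G" for n
        proof -
          have "0 \<le> 1 / real (Suc n)" by simp
          then have "q n - 1 / real (Suc n) \<le> T" using qT[of n] by linarith
          then show ?thesis using q(2)[of n] T by (simp add: G_def del: of_nat_Suc)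
        qed
        have bdd: "bdd_above G" by (auto simp: G_def intro!: bdd_aboveI[of _ T])
        define \<tau> where "\<tau> = Sup G"
        have upper: "t \<le> \<tau>" if "t \<in> G" for t unfolding \<tau>_def using that bdd by (rule cSup_upper)
        have neG: "G \<noteq> {}" using max_G[of 0] by auto
        have \<tau>T: "\<tau> \<le> T" unfolding \<tau>_def using neG by (intro cSup_least) (auto simp: G_def)
        have \<tau>0: "0 \<le> \<tau>" using upper[OF max_G[of 0]] by simp
        have A\<tau>: "A \<tau> \<omega>"
        proof (cases "\<tau> = 0")
          case True
          have "max 0 (q 0 - 1 / real (Suc 0)) \<le> 0" using upper[OF max_G[of 0]] True by simp
          then have "max 0 (q 0 - 1 / real (Suc 0)) = 0" by simp
          with q(2)[of 0] True show ?thesis by simp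
        next
          case False
          show ?thesis
          proof (rule A_closed[OF \<omega>])
            show "0 < \<tau>" using False \<tau>0 by simp
            fix s assume s: "0 \<le> s" "s < \<tau>"
            then obtain g where "g \<in> G" "s < g" using less_cSupD[OF neG, of s] by (auto simp: \<tau>_def)
            then show "A s \<omega>" using s A_mono[OF \<omega>, of s g] by (auto simp: G_def)
          qed
        qed
        have q\<tau>: "\<tau> < q n" "q n \<le> \<tau> + 1 / real (Suc n)" for n
        proof -
          show "\<tau> < q n" using notA[of n] A_mono[OF \<omega> qT(1)[of n] _ A\<tau>] by (auto simp: not_le[symmetric])
          show "q n \<le> \<tau> + 1 / real (Suc n)" using upper[OF max_G[of n]] by linarith
        qed
        have "q \<longlonglongrightarrow> \<tau>"
        proof (rule tendsto_sandwich[of "\<lambda>_. \<tau>"])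
          have "(\<lambda>n. \<tau> + 1 / real (Suc n)) \<longlonglongrightarrow> \<tau> + 0"
            by (intro tendsto_add tendsto_const LIMSEQ_Suc[OF lim_1_over_n])
          then show "(\<lambda>n. \<tau> + 1 / real (Suc n)) \<longlonglongrightarrow> \<tau>" by simp
        qed (use q\<tau> in \<open>auto intro!: always_eventually less_imp_le\<close>)
        then have "filterlim q (at_right \<tau>) sequentially"
          unfolding filterlim_at using q\<tau>(1) by (auto intro!: always_eventually dest: order.strict_implies_not_eq)
        from filterlim_compose[OF h1[OF \<omega> \<tau>0] this] have "(\<lambda>n. h1 (q n) \<omega>) \<longlonglongrightarrow> h1 \<tau> \<omega>" .
        then have "a \<le> h1 \<tau> \<omega>"
          by (rule LIMSEQ_le_const) (use q(3) in \<open>auto intro: less_imp_le\<close>)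
        also have "h1 \<tau> \<omega> \<le> ?Z" using A\<tau> \<tau>0 \<tau>T by (intro SUP_upper2[of \<tau>]) auto
        finally show False using a(1) by simp
      qed
      ultimately show "max (INF n. ?F1 n \<omega>) (?F0 \<omega>) \<le> ?Z" by simp
    qed
  qed
  ultimately show ?thesis by (subst measurable_cong) auto
qed


section \<open>Right-continuity in time\<close>

lemma alternates_mono_image:
  assumes "alternates H L n S" "mono \<phi>" "\<And>s. s \<in> S \<Longrightarrow> H s \<Longrightarrow> H (\<phi> s)" "\<And>s. s \<in> S \<Longrightarrow> L s \<Longrightarrow> L (\<phi> s)"
  shows "alternates H L n (\<phi> ` S)"
  using assms(1,3,4)
proof (induction n arbitrary: S)
  case (Suc n)
  from Suc.prems(1) obtain s u where su: "s \<in> S" "u \<in> S" "s \<le> u" "H s" "L u"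
    "alternates H L n (S \<inter> {..s})" by auto
  have "alternates H L n (\<phi> ` (S \<inter> {..s}))" by (rule Suc.IH[OF su(6)]) (use Suc.prems in auto)
  then have "alternates H L n (\<phi> ` S \<inter> {..\<phi> s})"
    by (rule alternates_mono) (use assms(2) in \<open>auto dest: monoD\<close>)
  then show ?case using su(1-5) Suc.prems(2,3) assms(2)
    by (intro alternates_SucI[where s = "\<phi> s" and u = "\<phi> u"]) (simp_all add: monoD)
qed simp

text \<open>Just after \<open>t\<close> the path stays on that side of each threshold on which x t
  lies. Times in (t,s] can therefore be collapsed to \<open>t\<close> by the map min v t without
  destroying a chain.\<close>

lemma crossings_eventually_right:
  assumes x: "cadlag x" and c: "c > 0" and t: "0 \<le> t" and y: "y \<noteq> x t - c/2" "y \<noteq> x t + c/2"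
  shows "\<forall>\<^sub>F s in at_right t. crossings y c x 0 s = crossings y c x 0 t"
proof -
  define e where "e = min \<bar>x t - y - c/2\<bar> \<bar>x t - y + c/2\<bar>"
  have e: "e > 0" using y by (auto simp: e_def)
  have "((\<lambda>s. x s) \<longlongrightarrow> x t) (at_right t)" using x t by (simp add: cadlag_def)
  from tendstoD[OF this e] obtain b where b: "b > t" "\<And>v. t < v \<Longrightarrow> v < b \<Longrightarrow> \<bar>x v - x t\<bar> < e"
    unfolding eventually_at_right_field dist_real_def by auto
  have "crossings y c x 0 s = crossings y c x 0 t" if s: "t < s" "s < b" for s
  proof (rule antisym)
    have s0: "0 \<le> s" using s t by simp
    show "crossings y c x 0 t \<le> crossings y c x 0 s" using s t by (intro crossings_mono[OF x c]) auto
    have le: "alt_count H L {0..s} \<le> alt_count H L {0..t}"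
      if HL: "\<And>v. t < v \<Longrightarrow> v \<le> s \<Longrightarrow> H v \<Longrightarrow> H t" "\<And>v. t < v \<Longrightarrow> v \<le> s \<Longrightarrow> L v \<Longrightarrow> L t" for H L
      unfolding alt_count_le_iff
    proof (intro allI impI of_nat_le_alt_count)
      fix n assume "alternates H L n {0..s}"
      then have "alternates H L n ((\<lambda>v. min v t) ` {0..s})"
      proof (rule alternates_mono_image)
        show "H (min v t)" if "v \<in> {0..s}" "H v" for v using HL(1)[of v] that by (cases "v \<le> t") auto
        show "L (min v t)" if "v \<in> {0..s}" "L v" for v using HL(2)[of v] that by (cases "v \<le> t") auto
      qed (auto simp: mono_def)
      then show "alternates H L n {0..t}" by (rule alternates_mono) (use t in auto)
    qed
    have "(of_nat (crossings y c x 0 s) :: ennreal) \<le> of_nat (crossings y c x 0 t)"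
      unfolding of_nat_crossings[OF x c s0] of_nat_crossings[OF x c t]
    proof (intro add_mono le)
      fix v assume v: "t < v" "v \<le> s"
      then have "\<bar>x v - x t\<bar> < \<bar>x t - y - c/2\<bar>" "\<bar>x v - x t\<bar> < \<bar>x t - y + c/2\<bar>"
        using b(2)[of v] s by (auto simp: e_def)
      then show "y + c/2 \<le> x v \<Longrightarrow> y + c/2 \<le> x t" "x v < y - c/2 \<Longrightarrow> x t < y - c/2"
        "x v \<le> y - c/2 \<Longrightarrow> x t \<le> y - c/2" "y + c/2 < x v \<Longrightarrow> y + c/2 < x t" by linarith+
    qed
    then show "crossings y c x 0 s \<le> crossings y c x 0 t" by simp
  qed
  then show ?thesis unfolding eventually_at_right_field using b(1) by blast
qed

text \<open>Dominated convergence, with the count at time t + 1 as majorant; the two levels excluded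
  in \<open>crossings_eventually_right\<close> form a null set.\<close>

lemma crossing_integral_one_right_limit:
  assumes x: "cadlag x" and c: "c > 0" and t: "0 \<le> t"
  shows "(\<lambda>n. crossing_integral \<alpha> x (\<lambda>_. 1) c (t + 1 / real (Suc n))) \<longlonglongrightarrow> crossing_integral \<alpha> x (\<lambda>_. 1) c t"
  unfolding crossing_integral_def
proof (intro tendsto_mult tendsto_const)
  have seq: "filterlim (\<lambda>n. t + 1 / real (Suc n)) (at_right t) sequentially"
    unfolding filterlim_at
  proof
    show "(\<lambda>n. t + 1 / real (Suc n)) \<longlonglongrightarrow> t"
      using tendsto_add[OF tendsto_const LIMSEQ_Suc[OF lim_1_over_n], of t] by (simp only: add_0_right)
  qed (auto intro!: always_eventually)
  show "(\<lambda>n. \<integral>y. 1 * real (crossings y c x 0 (t + 1 / real (Suc n))) \<partial>lborel) \<longlonglongrightarrow>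
      (\<integral>y. 1 * real (crossings y c x 0 t) \<partial>lborel)"
  proof (rule integral_dominated_convergence)
    show "integrable lborel (\<lambda>y. 1 * real (crossings y c x 0 (t + 1)))"
      using t by (intro integrable_crossings[OF x c, of _ _ 1]) auto
    show "(\<lambda>y. 1 * real (crossings y c x 0 t)) \<in> borel_measurable lborel"
      using crossings_borel_measurable[OF x c t] by simp
    show "(\<lambda>y. 1 * real (crossings y c x 0 (t + 1 / real (Suc n)))) \<in> borel_measurable lborel" for n
      using crossings_borel_measurable[OF x c, of "t + 1 / real (Suc n)"] t by simp
    show "AE y in lborel. norm (1 * real (crossings y c x 0 (t + 1 / real (Suc n)))) \<le> 1 * real (crossings y c x 0 (t + 1))" for n
      using t by (intro always_eventually allI) (auto intro!: crossings_mono[OF x c])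
    have "AE y in lborel. y \<noteq> x t - c/2 \<and> y \<noteq> x t + c/2"
      using AE_lborel_singleton[of "x t - c/2"] AE_lborel_singleton[of "x t + c/2"] by eventually_elim auto
    then show "AE y in lborel. (\<lambda>n. 1 * real (crossings y c x 0 (t + 1 / real (Suc n)))) \<longlonglongrightarrow> 1 * real (crossings y c x 0 t)"
    proof eventually_elim
      case (elim y)
      then have "\<forall>\<^sub>F s in at_right t. crossings y c x 0 s = crossings y c x 0 t"
        by (intro crossings_eventually_right[OF x c t]) auto
      then have "\<forall>\<^sub>F n in sequentially. crossings y c x 0 (t + 1 / real (Suc n)) = crossings y c x 0 t"
        using seq by (rule eventually_compose_filterlim)
      then show ?case by (intro tendsto_eventually) (auto elim: eventually_mono)
    qed
  qed
qed

text \<open>Increments are dominated by those of the total mass, which is monotone in time, so its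
  limit along t + 1/(n+1) suffices.\<close>

lemma crossing_integral_right_continuous:
  assumes x: "cadlag x" and c: "c > 0" and t: "0 \<le> t" and g: "g \<in> borel_measurable borel" "\<And>y. \<bar>g y\<bar> \<le> K"
  shows "(crossing_integral \<alpha> x g c \<longlongrightarrow> crossing_integral \<alpha> x g c t) (at_right t)"
proof (rule tendstoI)
  let ?F = "crossing_integral \<alpha> x (\<lambda>_. 1) c"
  fix e :: real assume e: "0 < e"
  have K: "0 \<le> K" using g(2)[of 0] by simp
  have "(\<lambda>n. K * (?F (t + 1 / real (Suc n)) - ?F t)) \<longlonglongrightarrow> K * (?F t - ?F t)"
    by (intro tendsto_intros crossing_integral_one_right_limit[OF x c t])
  from order_tendstoD(2)[OF this, of e] e obtain n where n: "K * (?F (t + 1 / real (Suc n)) - ?F t) < e"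
    by (auto simp: eventually_sequentially)
  have "dist (crossing_integral \<alpha> x g c s) (crossing_integral \<alpha> x g c t) < e" if s: "t < s" "s < t + 1 / real (Suc n)" for s
  proof -
    have "dist (crossing_integral \<alpha> x g c s) (crossing_integral \<alpha> x g c t) \<le> K * (?F s - ?F t)"
      unfolding dist_real_def using s t by (intro crossing_integral_increment_le[OF x c _ _ g]) auto
    also have "\<dots> \<le> K * (?F (t + 1 / real (Suc n)) - ?F t)"
      using s t K by (intro mult_left_mono diff_right_mono crossing_integral_one_mono[OF x c]) auto
    finally show ?thesis using n by simp
  qed
  then show "\<forall>\<^sub>F s in at_right t. dist (crossing_integral \<alpha> x g c s) (crossing_integral \<alpha> x g c t) < e"
    unfolding eventually_at_right_field by (intro exI[of _ "t + 1 / real (Suc n)"]) auto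
qed

lemma path_integral_right_continuous:
  assumes x: "cadlag x" and t: "0 \<le> t" and g: "g \<in> borel_measurable borel" "\<And>y. \<bar>g y\<bar> \<le> K"
  shows "(path_integral x g \<longlongrightarrow> path_integral x g t) (at_right t)"
proof (rule tendstoI)
  fix e :: real assume e: "0 < e"
  have K: "0 \<le> K" using g(2)[of 0] by simp
  define d where "d = e / (K + 1)"
  have d: "d > 0" "K * d < e" using e K by (auto simp: d_def field_simps)
  have "dist (path_integral x g s) (path_integral x g t) < e" if s: "t < s" "s < t + d" for s
  proof -
    have "dist (path_integral x g s) (path_integral x g t) \<le> K * (s - t)"
      using path_integral_close[OF x g t less_imp_le[OF s(1)], of 0 K] g(2) by (simp add: dist_real_def)
    also have "\<dots> \<le> K * d" using s K by (intro mult_left_mono) auto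
    finally show ?thesis using d(2) by simp
  qed
  then show "\<forall>\<^sub>F s in at_right t. dist (path_integral x g s) (path_integral x g t) < e"
    unfolding eventually_at_right_field using d by (intro exI[of _ "t + d"]) auto
qed

lemma finite_crossing_measure:
  assumes x: "cadlag x" and c: "c > 0" and t: "0 \<le> t"
  shows "finite_borel_measure (crossing_measure \<alpha> c x t)"
proof (rule finite_borel_measureI)
  note [measurable] = crossings_borel_measurable[OF x c t]
  have "integrable lborel (\<lambda>y. c powr (\<alpha> - 1) * real (crossings y c x 0 t))"
    using integrable_crossings[OF x c t, of "\<lambda>_. 1" 1] by simp
  then have "(\<integral>\<^sup>+y. ennreal (norm (c powr (\<alpha> - 1) * real (crossings y c x 0 t))) \<partial>lborel) < \<infinity>"
    unfolding integrable_iff_bounded by blast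
  then show "emeasure (crossing_measure \<alpha> c x t) UNIV < \<infinity>"
    unfolding crossing_measure_def by (subst emeasure_density) (auto simp: abs_mult)
qed (simp add: crossing_measure_def)

lemma integral_crossing_measure:
  assumes x: "cadlag x" and c: "c > 0" and t: "0 \<le> t" and g: "g \<in> borel_measurable borel"
  shows "(\<integral>y. g y \<partial>crossing_measure \<alpha> c x t) = crossing_integral \<alpha> x g c t"
proof -
  note [measurable] = crossings_borel_measurable[OF x c t] g
  have "(\<integral>y. g y \<partial>crossing_measure \<alpha> c x t) = (\<integral>y. (c powr (\<alpha> - 1) * real (crossings y c x 0 t)) *\<^sub>R g y \<partial>lborel)"
    unfolding crossing_measure_def by (rule integral_density) auto
  also have "\<dots> = (\<integral>y. c powr (\<alpha> - 1) * (g y * real (crossings y c x 0 t)) \<partial>lborel)"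
    by (simp add: ac_simps)
  finally show ?thesis unfolding crossing_integral_def by simp
qed

section \<open>Measurability in \<omega>\<close>

context levy_process
begin

lemma X_jointly_measurable:
  "(\<lambda>p. X (max 0 (snd p)) (fst p)) \<in> borel_measurable (M \<Otimes>\<^sub>M borel)"
proof -
  have "(\<lambda>p. X (max 0 (fst p)) (snd p)) \<in> borel_measurable (borel \<Otimes>\<^sub>M M)"
    by (rule cadlag_process_jointly_measurable[OF random_variable_X cadlag_paths])
  from measurable_compose[OF measurable_pair_swap' this] show ?thesis by (simp add: case_prod_beta)
qed

lemma emeasure_occupation_measurable:
  assumes [measurable]: "A \<in> sets borel"
  shows "(\<lambda>\<omega>. emeasure (occupation_measure (\<lambda>s. X s \<omega>) t) A) \<in> borel_measurable M"
proof -
  note [measurable] = X_jointly_measurable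
  have "(\<lambda>\<omega>. \<integral>\<^sup>+u. indicator A (X (max 0 u) \<omega>) * indicator {0..t} u \<partial>lborel) \<in> borel_measurable M"
  proof (rule lborel.borel_measurable_nn_integral)
    have "(\<lambda>p. indicator A (X (max 0 (snd p)) (fst p)) * indicator {0..t} (snd p) :: ennreal) \<in> borel_measurable (M \<Otimes>\<^sub>M borel)"
      by measurable
    also have "borel_measurable (M \<Otimes>\<^sub>M borel) = borel_measurable (M \<Otimes>\<^sub>M (lborel :: real measure))"
      by (intro measurable_cong_sets sets_pair_measure_cong) auto
    finally show "(\<lambda>(\<omega>, u). indicator A (X (max 0 u) \<omega>) * indicator {0..t} u :: ennreal) \<in> borel_measurable (M \<Otimes>\<^sub>M lborel)"
      by (simp add: case_prod_beta)
  qed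
  then show ?thesis
    by (rule measurable_cong[THEN iffD1, rotated]) (simp add: emeasure_occupation[OF cadlag_paths])
qed

lemma path_integral_measurable:
  fixes g :: "real \<Rightarrow> real"
  assumes [measurable]: "g \<in> borel_measurable borel"
  shows "(\<lambda>\<omega>. path_integral (\<lambda>s. X s \<omega>) g t) \<in> borel_measurable M"
  unfolding path_integral_def
proof (rule lborel.borel_measurable_lebesgue_integral)
  note [measurable] = X_jointly_measurable
  have "(\<lambda>p. indicator {0..t} (snd p) * g (X (max 0 (snd p)) (fst p)) :: real) \<in> borel_measurable (M \<Otimes>\<^sub>M borel)"
    by measurable
  also have "borel_measurable (M \<Otimes>\<^sub>M borel) = borel_measurable (M \<Otimes>\<^sub>M (lborel :: real measure))"
    by (intro measurable_cong_sets sets_pair_measure_cong) auto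
  finally show "(\<lambda>(\<omega>, u). indicator {0..t} u * g (X (max 0 u) \<omega>) :: real) \<in> borel_measurable (M \<Otimes>\<^sub>M lborel)"
    by (simp add: case_prod_beta)
qed

lemma has_local_time_measurable:
  assumes t: "0 \<le> t"
  shows "Measurable.pred M (\<lambda>\<omega>. has_local_time (\<lambda>s. X s \<omega>) t)"
proof -
  obtain B :: "real set set" where B: "countable B" "topological_basis B" using ex_countable_basis by blast
  let ?Fs = "{F. F \<subseteq> B \<and> finite F}"
  have Fs: "countable ?Fs"
    using countable_Collect_finite_subset[OF B(1)] by (simp add: conj_commute)
  let ?Q = "\<lambda>j k F \<omega>. emeasure lborel (\<Union>F) < ennreal (1 / real (Suc k)) \<longrightarrow>
    emeasure (occupation_measure (\<lambda>s. X s \<omega>) t) (\<Union>F) \<le> ennreal (1 / real (Suc j))"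
  have Q: "Measurable.pred M (?Q j k F)" if "F \<in> ?Fs" for j k F
  proof -
    have "open (\<Union>F)" using that topological_basis_open[OF B(2)] by (intro open_Union) blast
    then have "\<Union>F \<in> sets borel" by simp
    note [measurable] = emeasure_occupation_measurable[OF this, of t]
    show ?thesis by measurable
  qed
  have "Measurable.pred M (\<lambda>\<omega>. \<forall>F\<in>?Fs. ?Q j k F \<omega>)" for j k
    by (rule measurable_pred_countable[OF Fs Q])
  then have "Measurable.pred M (\<lambda>\<omega>. \<forall>j. \<exists>k. \<forall>F\<in>?Fs. ?Q j k F \<omega>)"
    by (intro pred_intros_countable)
  then show ?thesis
    by (rule measurable_cong[THEN iffD1, rotated]) (simp only: has_local_time_iff[OF B cadlag_paths t])
qed

text \<open>The count over countably many times is a jointly measurable version: for each path it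
  agrees with \<open>crossings\<close> at almost every level, and integrals over y do not see the
  difference.\<close>

lemma crossings_jointly_AE:
  assumes c: "c > 0" and t: "0 \<le> t"
  shows "\<exists>N. N \<in> borel_measurable (M \<Otimes>\<^sub>M lborel) \<and>
    (\<forall>\<omega>\<in>space M. AE y in lborel. of_nat (crossings y c (\<lambda>s. X s \<omega>) 0 t) = (N (\<omega>, y) :: ennreal))"
proof -
  define D where "D = insert 0 (insert t (\<rat> \<inter> {0..t}))"
  have D: "dense_times D t" unfolding D_def by (rule dense_times_rat[OF t])
  then have D': "countable D" "\<And>s. s \<in> D \<Longrightarrow> 0 \<le> s" by (auto simp: dense_times_def)
  have "(\<lambda>p. crossing_count (\<lambda>s. X s (fst p)) c (snd p) D) \<in> borel_measurable (M \<Otimes>\<^sub>M lborel)"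
  proof (rule crossing_count_measurable[OF D'(1)])
    fix s assume "s \<in> D"
    note [measurable] = random_variable_X[OF D'(2)[OF this]]
    show "(\<lambda>p. X s (fst p)) \<in> borel_measurable (M \<Otimes>\<^sub>M (lborel :: real measure))" by measurable
  qed measurable
  moreover have "AE y in lborel. of_nat (crossings y c (\<lambda>s. X s \<omega>) 0 t) = crossing_count (\<lambda>s. X s \<omega>) c y D"
    if \<omega>: "\<omega> \<in> space M" for \<omega>
  proof -
    obtain B where B: "countable B" "\<And>y. y \<notin> B \<Longrightarrow> of_nat (crossings y c (\<lambda>s. X s \<omega>) 0 t) = crossing_count (\<lambda>s. X s \<omega>) c y D"
      using crossings_eq_crossing_count[OF cadlag_paths[OF \<omega>] c D] by blast
    have "B \<in> null_sets lborel" using B(1) by (rule countable_imp_null_set_lborel)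
    then show ?thesis using B(2) by (intro AE_I'[of B]) auto
  qed
  ultimately show ?thesis by (intro exI[of _ "\<lambda>p. crossing_count (\<lambda>s. X s (fst p)) c (snd p) D"]) simp
qed

lemma emeasure_crossing_measure_measurable:
  assumes c: "c > 0" and t: "0 \<le> t" and A [measurable]: "A \<in> sets borel"
  shows "(\<lambda>\<omega>. emeasure (crossing_measure \<alpha> c (\<lambda>s. X s \<omega>) t) A) \<in> borel_measurable M"
proof -
  obtain N where N [measurable]: "N \<in> borel_measurable (M \<Otimes>\<^sub>M lborel)"
    and eq: "\<And>\<omega>. \<omega> \<in> space M \<Longrightarrow> AE y in lborel. of_nat (crossings y c (\<lambda>s. X s \<omega>) 0 t) = (N (\<omega>, y) :: ennreal)"
    using crossings_jointly_AE[OF c t] by blast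
  have "(\<lambda>\<omega>. \<integral>\<^sup>+y. ennreal (c powr (\<alpha> - 1)) * N (\<omega>, y) * indicator A y \<partial>lborel) \<in> borel_measurable M"
    by (rule lborel.borel_measurable_nn_integral) measurable
  moreover have "emeasure (crossing_measure \<alpha> c (\<lambda>s. X s \<omega>) t) A = (\<integral>\<^sup>+y. ennreal (c powr (\<alpha> - 1)) * N (\<omega>, y) * indicator A y \<partial>lborel)"
    if \<omega>: "\<omega> \<in> space M" for \<omega>
  proof -
    note [measurable] = crossings_borel_measurable[OF cadlag_paths[OF \<omega>] c t]
    have "emeasure (crossing_measure \<alpha> c (\<lambda>s. X s \<omega>) t) A
      = (\<integral>\<^sup>+y. ennreal (c powr (\<alpha> - 1) * real (crossings y c (\<lambda>s. X s \<omega>) 0 t)) * indicator A y \<partial>lborel)"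
      unfolding crossing_measure_def by (subst emeasure_density) auto
    also have "\<dots> = (\<integral>\<^sup>+y. ennreal (c powr (\<alpha> - 1)) * N (\<omega>, y) * indicator A y \<partial>lborel)"
      by (intro nn_integral_cong_AE eventually_mono[OF eq[OF \<omega>]])
        (simp add: ennreal_mult ennreal_of_nat_eq_real_of_nat)
    finally show ?thesis .
  qed
  ultimately show ?thesis by (subst measurable_cong) auto
qed

lemma crossing_integral_measurable:
  assumes c: "c > 0" and t: "0 \<le> t" and g [measurable]: "g \<in> borel_measurable borel"
  shows "(\<lambda>\<omega>. crossing_integral \<alpha> (\<lambda>s. X s \<omega>) g c t) \<in> borel_measurable M"
proof -
  obtain N where N [measurable]: "N \<in> borel_measurable (M \<Otimes>\<^sub>M lborel)"
    and eq: "\<And>\<omega>. \<omega> \<in> space M \<Longrightarrow> AE y in lborel. of_nat (crossings y c (\<lambda>s. X s \<omega>) 0 t) = (N (\<omega>, y) :: ennreal)"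
    using crossings_jointly_AE[OF c t] by blast
  have "(\<lambda>\<omega>. c powr (\<alpha> - 1) * (\<integral>y. g y * enn2real (N (\<omega>, y)) \<partial>lborel)) \<in> borel_measurable M"
    by (intro borel_measurable_times borel_measurable_const lborel.borel_measurable_lebesgue_integral) measurable
  moreover have "crossing_integral \<alpha> (\<lambda>s. X s \<omega>) g c t = c powr (\<alpha> - 1) * (\<integral>y. g y * enn2real (N (\<omega>, y)) \<partial>lborel)"
    if \<omega>: "\<omega> \<in> space M" for \<omega>
  proof -
    note [measurable] = crossings_borel_measurable[OF cadlag_paths[OF \<omega>] c t]
    have "(\<integral>y. g y * real (crossings y c (\<lambda>s. X s \<omega>) 0 t) \<partial>lborel) = (\<integral>y. g y * enn2real (N (\<omega>, y)) \<partial>lborel)"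
    proof (rule integral_cong_AE)
      show "(\<lambda>y. g y * enn2real (N (\<omega>, y))) \<in> borel_measurable lborel" using \<omega> by measurable
      show "AE y in lborel. g y * real (crossings y c (\<lambda>s. X s \<omega>) 0 t) = g y * enn2real (N (\<omega>, y))"
        using eq[OF \<omega>] by eventually_elim (metis enn2real_of_nat)
    qed measurable
    then show ?thesis by (simp add: crossing_integral_def)
  qed
  ultimately show ?thesis by (subst measurable_cong) auto
qed

lemma finite_random_crossing_measure:
  "c > 0 \<Longrightarrow> 0 \<le> t \<Longrightarrow> finite_random_measure M (\<lambda>\<omega>. crossing_measure \<alpha> c (\<lambda>s. X s \<omega>) t)"
  unfolding finite_random_measure_def
  by (auto intro: finite_crossing_measure cadlag_paths emeasure_crossing_measure_measurable)

lemma finite_random_scaled_local_time: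
  assumes t: "0 \<le> t" and C: "0 \<le> C"
  shows "finite_random_measure M (\<lambda>\<omega>. density lborel (\<lambda>y. ennreal C * local_time (\<lambda>s. X s \<omega>) t y))"
  unfolding finite_random_measure_def
proof (intro conjI ballI)
  fix A :: "real set" assume A: "A \<in> sets borel"
  note [measurable] = emeasure_occupation_measurable[OF A, of t] has_local_time_measurable[OF t]
  show "(\<lambda>\<omega>. emeasure (density lborel (\<lambda>y. ennreal C * local_time (\<lambda>s. X s \<omega>) t y)) A) \<in> borel_measurable M"
    unfolding emeasure_scaled_local_time[OF C A] by measurable
qed (intro finite_scaled_local_time cadlag_paths t C)

text \<open>The second branch stems from the convention that the density is 0 when the occupation
  measure is not absolutely continuous.\<close>

lemma weak_deviation_eq:
  fixes g :: "real \<Rightarrow> real"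
  assumes c: "c > 0" and C: "0 \<le> C" and g: "g \<in> borel_measurable borel" and \<omega>: "\<omega> \<in> space M"
  shows "weak_deviation g T (\<lambda>t \<omega>. crossing_measure \<alpha> c (\<lambda>s. X s \<omega>) t)
      (\<lambda>t \<omega>. density lborel (\<lambda>y. ennreal C * local_time (\<lambda>s. X s \<omega>) t y)) \<omega>
    = (SUP t\<in>{0..T}. if has_local_time (\<lambda>s. X s \<omega>) t
        then ennreal \<bar>crossing_integral \<alpha> (\<lambda>s. X s \<omega>) g c t - C * path_integral (\<lambda>s. X s \<omega>) g t\<bar>
        else ennreal \<bar>crossing_integral \<alpha> (\<lambda>s. X s \<omega>) g c t\<bar>)"
  unfolding weak_deviation_def
  by (intro SUP_cong refl)
    (simp add: integral_crossing_measure[OF cadlag_paths[OF \<omega>] c _ g] integral_scaled_local_time[OF cadlag_paths[OF \<omega>] g C])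

lemma weak_deviation_measurable:
  fixes g :: "real \<Rightarrow> real"
  assumes c: "c > 0" and C: "0 \<le> C" and T: "0 \<le> T" and g: "g \<in> borel_measurable borel" "\<And>y. \<bar>g y\<bar> \<le> K"
  shows "weak_deviation g T (\<lambda>t \<omega>. crossing_measure \<alpha> c (\<lambda>s. X s \<omega>) t)
      (\<lambda>t \<omega>. density lborel (\<lambda>y. ennreal C * local_time (\<lambda>s. X s \<omega>) t y)) \<in> borel_measurable M"
proof (subst measurable_cong[OF weak_deviation_eq[OF c C g(1)]])
  note [measurable] = crossing_integral_measurable[OF c _ g(1)] path_integral_measurable[OF g(1)]
  note R = crossing_integral_right_continuous[OF cadlag_paths c _ g]
  note P = path_integral_right_continuous[OF cadlag_paths _ g]
  show "(\<lambda>\<omega>. SUP t\<in>{0..T}. if has_local_time (\<lambda>s. X s \<omega>) t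
        then ennreal \<bar>crossing_integral \<alpha> (\<lambda>s. X s \<omega>) g c t - C * path_integral (\<lambda>s. X s \<omega>) g t\<bar>
        else ennreal \<bar>crossing_integral \<alpha> (\<lambda>s. X s \<omega>) g c t\<bar>) \<in> borel_measurable M"
  proof (rule SUP_switch_measurable[OF T])
    show "(\<lambda>\<omega>. ennreal \<bar>crossing_integral \<alpha> (\<lambda>s. X s \<omega>) g c t - C * path_integral (\<lambda>s. X s \<omega>) g t\<bar>) \<in> borel_measurable M"
      if "0 \<le> t" for t using that by measurable
    show "(\<lambda>\<omega>. ennreal \<bar>crossing_integral \<alpha> (\<lambda>s. X s \<omega>) g c t\<bar>) \<in> borel_measurable M" if "0 \<le> t" for t
      using that by measurable
    show "Measurable.pred M (\<lambda>\<omega>. has_local_time (\<lambda>s. X s \<omega>) t)" if "0 \<le> t" for t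
      by (rule has_local_time_measurable[OF that])
    fix t \<omega> assume \<omega>: "\<omega> \<in> space M"
    show "((\<lambda>s. ennreal \<bar>crossing_integral \<alpha> (\<lambda>s. X s \<omega>) g c s - C * path_integral (\<lambda>s. X s \<omega>) g s\<bar>) \<longlongrightarrow>
        ennreal \<bar>crossing_integral \<alpha> (\<lambda>s. X s \<omega>) g c t - C * path_integral (\<lambda>s. X s \<omega>) g t\<bar>) (at_right t)" if "0 \<le> t"
      by (intro tendsto_ennrealI tendsto_intros R P \<omega> that)
    show "((\<lambda>s. ennreal \<bar>crossing_integral \<alpha> (\<lambda>s. X s \<omega>) g c s\<bar>) \<longlongrightarrow>
        ennreal \<bar>crossing_integral \<alpha> (\<lambda>s. X s \<omega>) g c t\<bar>) (at_right t)" if "0 \<le> t"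
      by (intro tendsto_ennrealI tendsto_intros R \<omega> that)
    show "has_local_time (\<lambda>s. X s \<omega>) s" if "0 \<le> s" "s \<le> t" "has_local_time (\<lambda>s. X s \<omega>) t" for s
      by (rule has_local_time_antimono[OF cadlag_paths[OF \<omega>] that])
    show "has_local_time (\<lambda>s. X s \<omega>) t" if "0 < t" "\<And>s. 0 \<le> s \<Longrightarrow> s < t \<Longrightarrow> has_local_time (\<lambda>s. X s \<omega>) s"
      by (rule has_local_time_left_closed[OF cadlag_paths[OF \<omega>] that])
  qed
qed

end

section \<open>Existence of local times\<close>

lemma nn_integral_abs_le:
  fixes f :: "real \<Rightarrow> ennreal"
  assumes [measurable]: "f \<in> borel_measurable borel"
  shows "(\<integral>\<^sup>+x. f \<bar>x\<bar> \<partial>lborel) \<le> 2 * (\<integral>\<^sup>+x. f x * indicator {0..} x \<partial>lborel)"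
proof -
  have "(\<integral>\<^sup>+x. f x * indicator {0..} x \<partial>lborel) = (\<integral>\<^sup>+x. f (- x) * indicator {0..} (- x) \<partial>lborel)"
    using nn_integral_real_affine[of "\<lambda>x. f x * indicator {0..} x" "-1" 0] by simp
  moreover have "(\<integral>\<^sup>+x. f \<bar>x\<bar> \<partial>lborel) \<le> (\<integral>\<^sup>+x. f x * indicator {0..} x + f (- x) * indicator {0..} (- x) \<partial>lborel)"
    by (intro nn_integral_mono) (auto simp: indicator_def)
  moreover have "(\<integral>\<^sup>+x. f x * indicator {0..} x + f (- x) * indicator {0..} (- x) \<partial>lborel)
      = (\<integral>\<^sup>+x. f x * indicator {0..} x \<partial>lborel) + (\<integral>\<^sup>+x. f (- x) * indicator {0..} (- x) \<partial>lborel)"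
    by (rule nn_integral_add) measurable
  ultimately show ?thesis by (simp add: mult_2)
qed

lemma nn_integral_indicator_centred:
  assumes "0 \<le> a"
  shows "(\<integral>\<^sup>+y. indicator {-a..a} (y - z) \<partial>lborel) = ennreal (2 * a)"
proof -
  have "(\<integral>\<^sup>+y. indicator {-a..a} (y - z) \<partial>lborel) = (\<integral>\<^sup>+y. indicator {z - a..z + a} y \<partial>lborel)"
    by (intro nn_integral_cong) (auto simp: indicator_def)
  also have "\<dots> = emeasure lborel {z - a..z + a}" by simp
  finally show ?thesis using assms by simp
qed

text \<open>An L^2 argument: the mollified densities \<open>f n\<close> have squared norm at most
  the pair mass divided by r n, hence at most B. They are uniformly integrable, and Fatou's lemma
  bounds \<mu> on open sets by the liminf of their integrals. Suitable radii are asked for only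
  arbitrarily close to 0, because an almost sure liminf provides no more.\<close>

lemma absolutely_continuous_lborelI:
  fixes \<mu> :: "real measure"
  assumes fin: "finite_measure \<mu>" and sets [measurable_cong]: "sets \<mu> = sets borel" and B0: "0 \<le> B"
    and B: "\<And>e. 0 < e \<Longrightarrow> \<exists>r>0. r < e \<and> (\<integral>\<^sup>+y. \<integral>\<^sup>+z. indicator {-r..r} (y - z) \<partial>\<mu> \<partial>\<mu>) \<le> ennreal (B * r)"
  shows "absolutely_continuous lborel \<mu>"
proof -
  interpret finite_measure \<mu> by (rule fin)
  interpret pair_sigma_finite lborel \<mu> by unfold_locales
  have "\<exists>r. 0 < r \<and> r < 1 / real (Suc n) \<and> (\<integral>\<^sup>+y. \<integral>\<^sup>+z. indicator {-r..r} (y - z) \<partial>\<mu> \<partial>\<mu>) \<le> ennreal (B * r)" for n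
    using B[of "1 / real (Suc n)"] by auto
  then obtain r where r: "\<And>n. 0 < r n" "\<And>n. r n < 1 / real (Suc n)"
    "\<And>n. (\<integral>\<^sup>+y. \<integral>\<^sup>+z. indicator {-r n..r n} (y - z) \<partial>\<mu> \<partial>\<mu>) \<le> ennreal (B * r n)" by metis
  define k where "k n y z = (indicator {-(r n / 2)..r n / 2} (y - z) :: ennreal)" for n and y z :: real
  define m where "m n z = (\<integral>\<^sup>+w. indicator {-r n..r n} (z - w) \<partial>\<mu>)" for n z
  define f where "f n y = ennreal (1 / r n) * (\<integral>\<^sup>+z. k n y z \<partial>\<mu>)" for n y
  have k [measurable]: "(\<lambda>p. k n (fst p) (snd p)) \<in> borel_measurable (borel \<Otimes>\<^sub>M borel)" for n
    unfolding k_def by measurable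
  have k' [measurable]: "(\<lambda>z. k n y z) \<in> borel_measurable borel" "(\<lambda>y. k n y z) \<in> borel_measurable borel" for n y z
    unfolding k_def by measurable
  have m [measurable]: "m n \<in> borel_measurable borel" for n
    unfolding m_def by measurable
  have f [measurable]: "f n \<in> borel_measurable borel" for n
    unfolding f_def k_def by measurable
  have k_int: "(\<integral>\<^sup>+y. k n y z \<partial>lborel) = ennreal (r n)" for n z
    unfolding k_def using nn_integral_indicator_centred[of "r n / 2" z] r(1)[of n] by simp
  have inv: "ennreal (1 / r n) * ennreal (r n) = 1" for n
    using r(1)[of n] by (simp flip: ennreal_mult)
  have sq: "(\<integral>\<^sup>+y. f n y * f n y \<partial>lborel) \<le> ennreal B" for n
  proof -
    have "(\<integral>\<^sup>+y. f n y * f n y \<partial>lborel) = (\<integral>\<^sup>+y. \<integral>\<^sup>+z. ennreal (1 / r n) * (k n y z * f n y) \<partial>\<mu> \<partial>lborel)"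
    proof (intro nn_integral_cong)
      fix y
      have "(\<integral>\<^sup>+z. ennreal (1 / r n) * (k n y z * f n y) \<partial>\<mu>) = ennreal (1 / r n) * ((\<integral>\<^sup>+z. k n y z \<partial>\<mu>) * f n y)"
        by (subst nn_integral_cmult) (auto simp: nn_integral_multc)
      then show "f n y * f n y = (\<integral>\<^sup>+z. ennreal (1 / r n) * (k n y z * f n y) \<partial>\<mu>)"
        by (simp add: f_def mult.assoc)
    qed
    \<comment> \<open>If y is within r/2 of z, every w within r/2 of y is within r of z; so the pair
      mass at radius r appears.\<close>
    also have "\<dots> \<le> (\<integral>\<^sup>+y. \<integral>\<^sup>+z. ennreal (1 / r n) * (ennreal (1 / r n) * m n z) * k n y z \<partial>\<mu> \<partial>lborel)"
    proof (intro nn_integral_mono)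
      fix y z
      show "ennreal (1 / r n) * (k n y z * f n y) \<le> ennreal (1 / r n) * (ennreal (1 / r n) * m n z) * k n y z"
      proof (cases "y - z \<in> {-(r n / 2)..r n / 2}")
        case True
        have "(\<integral>\<^sup>+w. k n y w \<partial>\<mu>) \<le> m n z"
          unfolding m_def k_def
        proof (intro nn_integral_mono)
          fix w
          show "indicator {-(r n / 2)..r n / 2} (y - w) \<le> (indicator {-r n..r n} (z - w) :: ennreal)"
            using True by (auto simp: indicator_def split: if_splits)
        qed
        then have "f n y \<le> ennreal (1 / r n) * m n z" unfolding f_def by (intro mult_left_mono) auto
        then have "ennreal (1 / r n) * f n y \<le> ennreal (1 / r n) * (ennreal (1 / r n) * m n z)" by (intro mult_left_mono) auto
        then show ?thesis using True by (simp add: k_def)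
      qed (simp add: k_def)
    qed
    also have "\<dots> = (\<integral>\<^sup>+z. \<integral>\<^sup>+y. ennreal (1 / r n) * (ennreal (1 / r n) * m n z) * k n y z \<partial>lborel \<partial>\<mu>)"
      by (rule Fubini'[symmetric]) (simp add: case_prod_beta)
    also have "\<dots> = (\<integral>\<^sup>+z. ennreal (1 / r n) * m n z \<partial>\<mu>)"
    proof (intro nn_integral_cong)
      fix z
      have "(\<integral>\<^sup>+y. ennreal (1 / r n) * (ennreal (1 / r n) * m n z) * k n y z \<partial>lborel)
        = ennreal (1 / r n) * (ennreal (1 / r n) * m n z) * ennreal (r n)"
        by (subst nn_integral_cmult) (auto simp: k_int)
      also have "\<dots> = (ennreal (1 / r n) * ennreal (r n)) * (ennreal (1 / r n) * m n z)" by (simp only: ac_simps)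
      finally show "(\<integral>\<^sup>+y. ennreal (1 / r n) * (ennreal (1 / r n) * m n z) * k n y z \<partial>lborel) = ennreal (1 / r n) * m n z"
        unfolding inv by simp
    qed
    also have "\<dots> = ennreal (1 / r n) * (\<integral>\<^sup>+z. m n z \<partial>\<mu>)" by (rule nn_integral_cmult) simp
    also have "\<dots> \<le> ennreal (1 / r n) * ennreal (B * r n)"
      using r(3)[of n] by (intro mult_left_mono) (auto simp: m_def)
    also have "\<dots> = ennreal B" using r(1)[of n] B0 by (simp flip: ennreal_mult)
    finally show ?thesis .
  qed
  have upper: "(\<integral>\<^sup>+y. indicator A y * f n y \<partial>lborel) \<le> ennreal K * emeasure lborel A + ennreal (1 / K) * ennreal B"
    if [measurable]: "A \<in> sets borel" and K: "0 < K" for A n K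
  proof -
    \<comment> \<open>The inequality f \<le> K + f^2/K expresses the uniform integrability of an
      L^2-bounded family.\<close>
    have "f n y \<le> ennreal K + ennreal (1 / K) * (f n y * f n y)" for y
    proof (cases "f n y \<le> ennreal K")
      case True then show ?thesis by (rule order_trans) simp
    next
      case False
      have "f n y = ennreal (1 / K) * (ennreal K * f n y)"
        using K by (simp add: mult.assoc[symmetric] flip: ennreal_mult)
      also have "\<dots> \<le> ennreal (1 / K) * (f n y * f n y)"
        using False by (intro mult_left_mono mult_right_mono) auto
      finally show ?thesis by (rule order_trans) simp
    qed
    then have "(\<integral>\<^sup>+y. indicator A y * f n y \<partial>lborel) \<le>
        (\<integral>\<^sup>+y. ennreal K * indicator A y + ennreal (1 / K) * (f n y * f n y) \<partial>lborel)"
      by (intro nn_integral_mono) (auto simp: indicator_def)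
    also have "\<dots> = ennreal K * emeasure lborel A + ennreal (1 / K) * (\<integral>\<^sup>+y. f n y * f n y \<partial>lborel)"
      by (subst nn_integral_add) (auto simp: nn_integral_cmult)
    also have "\<dots> \<le> ennreal K * emeasure lborel A + ennreal (1 / K) * ennreal B"
      by (intro add_left_mono mult_left_mono sq) auto
    finally show ?thesis .
  qed
  have lower: "emeasure \<mu> A \<le> liminf (\<lambda>n. \<integral>\<^sup>+y. indicator A y * f n y \<partial>lborel)" if A: "open A" for A
  proof -
    have [measurable]: "A \<in> sets borel" using A by simp
    let ?g = "\<lambda>n z. ennreal (1 / r n) * (\<integral>\<^sup>+y. indicator A y * k n y z \<partial>lborel)"
    have gm: "?g n \<in> borel_measurable \<mu>" for n
      unfolding k_def by measurable
    have eq: "(\<integral>\<^sup>+y. indicator A y * f n y \<partial>lborel) = (\<integral>\<^sup>+z. ?g n z \<partial>\<mu>)" for n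
    proof -
      have "(\<integral>\<^sup>+y. indicator A y * f n y \<partial>lborel) = (\<integral>\<^sup>+y. \<integral>\<^sup>+z. ennreal (1 / r n) * (indicator A y * k n y z) \<partial>\<mu> \<partial>lborel)"
        by (intro nn_integral_cong) (simp add: f_def nn_integral_cmult mult.left_commute)
      also have "\<dots> = (\<integral>\<^sup>+z. \<integral>\<^sup>+y. ennreal (1 / r n) * (indicator A y * k n y z) \<partial>lborel \<partial>\<mu>)"
        by (rule Fubini'[symmetric]) (simp add: case_prod_beta)
      also have "\<dots> = (\<integral>\<^sup>+z. ?g n z \<partial>\<mu>)" by (intro nn_integral_cong nn_integral_cmult) simp
      finally show ?thesis .
    qed
    have r0: "r \<longlonglongrightarrow> 0"
    proof (rule tendsto_sandwich[OF _ _ tendsto_const LIMSEQ_Suc[OF lim_1_over_n]])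
      show "\<forall>\<^sub>F n in sequentially. 0 \<le> r n" using r(1) by (auto intro!: always_eventually less_imp_le)
      show "\<forall>\<^sub>F n in sequentially. r n \<le> 1 / real (Suc n)" using r(2) by (intro always_eventually allI less_imp_le)
    qed
    \<comment> \<open>An open set contains a ball around each of its points, so the mollified
      indicator is at least 1 there for large n.\<close>
    have ind: "indicator A z \<le> liminf (\<lambda>n. ?g n z)" for z
    proof (cases "z \<in> A")
      case True
      obtain e where e: "e > 0" "\<And>y. \<bar>y - z\<bar> < e \<Longrightarrow> y \<in> A" using A True unfolding open_dist dist_real_def by auto
      have "\<forall>\<^sub>F n in sequentially. r n < e" using order_tendstoD(2)[OF r0 e(1)] .
      then have "\<forall>\<^sub>F n in sequentially. 1 \<le> ?g n z"
      proof eventually_elim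
        case (elim n)
        have "(\<integral>\<^sup>+y. k n y z \<partial>lborel) \<le> (\<integral>\<^sup>+y. indicator A y * k n y z \<partial>lborel)"
        proof (rule nn_integral_mono)
          fix y
          have "y \<in> A" if "y - z \<in> {-(r n / 2)..r n / 2}" using that elim r(1)[of n] by (intro e(2)) (auto simp: abs_le_iff)
          then show "k n y z \<le> indicator A y * k n y z" by (auto simp: k_def indicator_def)
        qed
        then have "ennreal (1 / r n) * ennreal (r n) \<le> ?g n z" unfolding k_int by (intro mult_left_mono) auto
        then show ?case unfolding inv .
      qed
      then have "1 \<le> liminf (\<lambda>n. ?g n z)" by (rule Liminf_bounded)
      then show ?thesis using True by simp
    qed simp
    have "emeasure \<mu> A = (\<integral>\<^sup>+z. indicator A z \<partial>\<mu>)" by (subst nn_integral_indicator) auto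
    also have "\<dots> \<le> (\<integral>\<^sup>+z. liminf (\<lambda>n. ?g n z) \<partial>\<mu>)" by (intro nn_integral_mono ind)
    also have "\<dots> \<le> liminf (\<lambda>n. \<integral>\<^sup>+z. ?g n z \<partial>\<mu>)" by (rule nn_integral_liminf) (rule gm)
    finally show ?thesis unfolding eq .
  qed
  have bound: "emeasure \<mu> A \<le> ennreal K * emeasure lborel A + ennreal (1 / K) * ennreal B" if A: "open A" and K: "0 < K" for A K
  proof -
    have "liminf (\<lambda>n. \<integral>\<^sup>+y. indicator A y * f n y \<partial>lborel) \<le> liminf (\<lambda>n::nat. ennreal K * emeasure lborel A + ennreal (1 / K) * ennreal B)"
      using A K by (intro Liminf_mono always_eventually allI upper) auto
    also have "\<dots> = ennreal K * emeasure lborel A + ennreal (1 / K) * ennreal B" by (simp add: Liminf_const)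
    finally show ?thesis using lower[OF A] by (rule order_trans[rotated])
  qed
  show ?thesis
    unfolding absolutely_continuous_def
  proof
    fix N assume "N \<in> null_sets (lborel :: real measure)"
    then have N: "N \<in> sets borel" "emeasure lborel N = 0" by (auto simp: null_sets_def)
    have "emeasure \<mu> N \<le> 0 + ennreal e" if e: "0 < e" for e
    proof -
      \<comment> \<open>An open neighbourhood of measure at most 1/K^2 yields the bound K/K^2 + B/K
        = (1 + B)/K = e.\<close>
      define K where "K = (1 + B) / e"
      have K: "K > 0" "(1 + B) / K = e" using e B0 by (auto simp: K_def)
      obtain T where T: "open T" "N \<subseteq> T" "emeasure lborel (T - N) < ennreal (1 / (K * K))"
        using outer_regular_lborel[OF N(1), of "1 / (K * K)"] K(1) by auto
      have Tb: "T \<in> sets borel" using T(1) by simp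
      have "emeasure lborel T \<le> emeasure lborel (N \<union> (T - N))" using Tb N(1) T(2) by (intro emeasure_mono) auto
      also have "\<dots> \<le> emeasure lborel N + emeasure lborel (T - N)"
        using Tb N(1) by (intro emeasure_subadditive) auto
      also have "\<dots> \<le> ennreal (1 / (K * K))" using T(3) N(2) by simp
      finally have T_le: "emeasure lborel T \<le> ennreal (1 / (K * K))" .
      have "emeasure \<mu> N \<le> emeasure \<mu> T" using T(2) Tb sets by (intro emeasure_mono) auto
      also have "\<dots> \<le> ennreal K * emeasure lborel T + ennreal (1 / K) * ennreal B" by (rule bound[OF T(1) K(1)])
      also have "\<dots> \<le> ennreal K * ennreal (1 / (K * K)) + ennreal (1 / K) * ennreal B"
        by (intro add_right_mono mult_left_mono T_le) auto
      also have "\<dots> = ennreal (K * (1 / (K * K)) + 1 / K * B)"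
        using K(1) B0 by (simp add: ennreal_plus ennreal_mult del: times_divide_eq_right times_divide_eq_left)
      also have "K * (1 / (K * K)) + 1 / K * B = e" using K by (simp add: add_divide_distrib)
      finally show ?thesis by simp
    qed
    then have "emeasure \<mu> N \<le> 0" by (rule ennreal_le_epsilon)
    then show "N \<in> null_sets \<mu>" using N(1) sets by (simp add: null_sets_def)
  qed
qed

text \<open>The equality case of |E exp(i v X)| \<le> 1: with \<theta> the argument of this
  expectation, 1 - cos(v X - \<theta>) is nonnegative and has expectation 0.\<close>

lemma (in prob_space) AE_cos_eq_1:
  assumes X [measurable]: "X \<in> borel_measurable M" and v: "cmod (char (distr M borel X) v) = 1"
  shows "\<exists>\<theta>. AE \<omega> in M. cos (v * X \<omega> - \<theta>) = 1"
proof -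
  have ch: "char (distr M borel X) v = (\<integral>\<omega>. iexp (v * X \<omega>) \<partial>M)"
    unfolding char_def by (subst integral_distr) auto
  define \<theta> where "\<theta> = Arg (char (distr M borel X) v)"
  have \<theta>: "char (distr M borel X) v = cis \<theta>"
    using rcis_cmod_Arg[of "char (distr M borel X) v"] v by (simp add: \<theta>_def rcis_def)
  have int: "integrable M (\<lambda>\<omega>. cis (- \<theta>) * iexp (v * X \<omega>))"
    by (intro integrable_const_bound[where B = 1]) (auto simp: norm_mult)
  have int1: "integrable M (\<lambda>\<omega>. 1 - cos (v * X \<omega> - \<theta>))"
    by (intro integrable_const_bound[where B = 2]) (auto intro!: always_eventually order_trans[OF abs_triangle_ineq4] simp: abs_cos_le_one)
  have "(\<integral>\<omega>. cos (v * X \<omega> - \<theta>) \<partial>M) = (\<integral>\<omega>. Re (cis (- \<theta>) * iexp (v * X \<omega>)) \<partial>M)"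
    unfolding cis_conv_exp[symmetric] cis_mult by (simp add: algebra_simps)
  also have "\<dots> = Re (\<integral>\<omega>. cis (- \<theta>) * iexp (v * X \<omega>) \<partial>M)"
    by (rule integral_Re[OF int])
  also have "\<dots> = Re (cis (- \<theta>) * cis \<theta>)" unfolding \<theta>[symmetric] ch by simp
  also have "\<dots> = 1" by (simp add: cis_mult)
  finally have "(\<integral>\<omega>. 1 - cos (v * X \<omega> - \<theta>) \<partial>M) = 0"
    by (subst Bochner_Integration.integral_diff) (auto simp: prob_space intro!: integrable_const_bound[where B = 1])
  then have "AE \<omega> in M. 1 - cos (v * X \<omega> - \<theta>) = 0"
    by (subst (asm) integral_nonneg_eq_0_iff_AE[OF int1]) auto
  then show ?thesis by (intro exI[of _ \<theta>]) (auto elim: eventually_mono)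
qed

section \<open>Characteristic function of X_1 and small-ball estimate\<close>

context stable_process_gt_1
begin

abbreviation \<phi> :: "real \<Rightarrow> complex" where "\<phi> \<equiv> char (law 1)"

lemma real_distribution_law: "0 \<le> t \<Longrightarrow> real_distribution (law t)"
  by (rule real_distribution_distr) simp

lemma law_scale: 
  assumes t: "0 < t"
  shows "law t = distr M borel (\<lambda>\<omega>. t powr (1 / \<alpha>) * X 1 \<omega>)"
proof (rule measure_eqI)
  fix A assume "A \<in> sets (law t)"
  then have [measurable]: "A \<in> sets borel" by simp
  have [measurable]: "X t \<in> borel_measurable M" "X 1 \<in> borel_measurable M" using t by auto
  have "emeasure (law t) A = (\<integral>\<^sup>+\<omega>. indicator A (X t \<omega>) \<partial>M)"
    using nn_integral_distr[of "X t" M borel "indicator A"] by simp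
  also have "\<dots> = (\<integral>\<^sup>+\<omega>. indicator A (t powr (1 / \<alpha>) * X 1 \<omega>) \<partial>M)"
    by (rule nn_integral_scale1[OF t]) simp
  also have "\<dots> = emeasure (distr M borel (\<lambda>\<omega>. t powr (1 / \<alpha>) * X 1 \<omega>)) A"
    using nn_integral_distr[of "\<lambda>\<omega>. t powr (1 / \<alpha>) * X 1 \<omega>" M borel "indicator A"] by simp
  finally show "emeasure (law t) A = emeasure (distr M borel (\<lambda>\<omega>. t powr (1 / \<alpha>) * X 1 \<omega>)) A" .
qed simp

lemma char_law_scale:
  assumes t: "0 < t"
  shows "char (law t) u = \<phi> (t powr (1 / \<alpha>) * u)"
proof -
  have [measurable]: "X 1 \<in> borel_measurable M" by simp
  show ?thesis unfolding law_scale[OF t] char_def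
    by (subst (1 2) integral_distr) (auto simp: ac_simps)
qed

lemma char_law_nat: "char (law (real n)) u = \<phi> u ^ n"
proof -
  have [measurable]: "X (real i) \<in> borel_measurable M" for i :: nat by simp
  have "incseq real" by (auto simp: incseq_def)
  from char_distr_sum[OF indep_increments[OF this, of n], of u]
  have "char (distr M borel (\<lambda>\<omega>. \<Sum>i<n. X (real (Suc i)) \<omega> - X (real i) \<omega>)) u
    = (\<Prod>i<n. char (distr M borel (\<lambda>\<omega>. X (real (Suc i)) \<omega> - X (real i) \<omega>)) u)" by simp
  also have "\<dots> = (\<Prod>i<n. \<phi> u)"
  proof (intro prod.cong refl)
    fix i
    have "distr M borel (\<lambda>\<omega>. X (real (Suc i)) \<omega> - X (real i) \<omega>) = law 1"
      using stationary_increments[of "real i" 1] by (simp add: add.commute)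
    then show "char (distr M borel (\<lambda>\<omega>. X (real (Suc i)) \<omega> - X (real i) \<omega>)) u = \<phi> u" by simp
  qed
  also have "(\<lambda>\<omega>. \<Sum>i<n. X (real (Suc i)) \<omega> - X (real i) \<omega>) = (\<lambda>\<omega>. X (real n) \<omega> - X 0 \<omega>)"
    by (subst sum_lessThan_telescope) simp
  also have "distr M borel (\<lambda>\<omega>. X (real n) \<omega> - X 0 \<omega>) = law (real n)"
    by (rule distr_cong_AE) (use starts_at_0 in \<open>auto elim: eventually_mono\<close>)
  finally show ?thesis by simp
qed

text \<open>The law of X_n is computed twice: by scaling X_1, and as a sum of n independent
  increments.\<close>

lemma phi_scale: "0 < n \<Longrightarrow> \<phi> (real n powr (1 / \<alpha>) * u) = \<phi> u ^ n"
  using char_law_scale[of "real n" u] char_law_nat[of n u] by simp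

text \<open>If X_1 = b almost surely, then X_2 = 2b by stationary increments and X_2 =
  2^(1/\<alpha>) b by scaling. As \<alpha> > 1 this gives b = 0, and by scaling the process would
  vanish at every time.\<close>

lemma not_AE_const: "\<not> (AE \<omega> in M. X 1 \<omega> = b)"
proof
  assume b: "AE \<omega> in M. X 1 \<omega> = b"
  have [measurable]: "X 1 \<in> borel_measurable M" "X 2 \<in> borel_measurable M" by simp_all
  have "AE x in law 1. x = b" using b by (subst AE_distr_iff) auto
  moreover have "distr M borel (\<lambda>\<omega>. X 2 \<omega> - X 1 \<omega>) = law 1" using stationary_increments[of 1 1] by simp
  ultimately have "AE x in distr M borel (\<lambda>\<omega>. X 2 \<omega> - X 1 \<omega>). x = b" by (simp only:)
  then have diff: "AE \<omega> in M. X 2 \<omega> - X 1 \<omega> = b" by (subst (asm) AE_distr_iff) auto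
  have scaled: "AE \<omega> in M. X t \<omega> = t powr (1 / \<alpha>) * b" if t: "0 < t" for t
  proof -
    have [measurable]: "X t \<in> borel_measurable M" using t by simp
    have "AE \<omega> in M. t powr (1 / \<alpha>) * X 1 \<omega> = t powr (1 / \<alpha>) * b" using b by (auto elim: eventually_mono)
    then have "AE x in law t. x = t powr (1 / \<alpha>) * b" unfolding law_scale[OF t] by (subst AE_distr_iff) auto
    then show ?thesis by (subst (asm) AE_distr_iff) auto
  qed
  have "AE \<omega> in M. X 2 \<omega> = 2 powr (1 / \<alpha>) * b" by (rule scaled) simp
  with b diff have "AE \<omega> in M. 2 * b = 2 powr (1 / \<alpha>) * b" by eventually_elim simp
  then have "2 * b = 2 powr (1 / \<alpha>) * b" using eventually_happens'[OF ae_filter_bot] by auto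
  moreover have "2 powr (1 / \<alpha>) < 2 powr (1::real)" using index_gt_1 by (intro powr_less_mono) auto
  ultimately have "b = 0" by auto
  have "AE \<omega> in M. X t \<omega> = 0" if "0 \<le> t" for t
    using starts_at_0 scaled[of t] that \<open>b = 0\<close> by (cases "t = 0") auto
  with non_zero show False by simp
qed

text \<open>If |\<phi>(u)| = 1, then \<open>phi_scale\<close> gives modulus 1 at u n^(-1/\<alpha>)
  for all n \<ge> 1. So X_1 lives on shifted lattices of arbitrarily large spacing, and two of its
  values cannot differ.\<close>

lemma cmod_phi_less_1:
  assumes u: "u \<noteq> 0"
  shows "cmod (\<phi> u) < 1"
proof (rule ccontr)
  interpret law: real_distribution "law 1" by (rule real_distribution_law) simp
  assume "\<not> ?thesis"
  then have 1: "cmod (\<phi> u) = 1" using law.cmod_char_le_1[of u] by simp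
  define v where "v n = u * real (Suc n) powr (- (1 / \<alpha>))" for n
  have v1: "cmod (\<phi> (v n)) = 1" for n
  proof (rule ccontr)
    assume "cmod (\<phi> (v n)) \<noteq> 1"
    then have "cmod (\<phi> (v n)) < 1" using law.cmod_char_le_1[of "v n"] by simp
    then have "cmod (\<phi> (v n)) ^ Suc n < 1"
      using power_decreasing[of 1 "Suc n" "cmod (\<phi> (v n))"] by simp
    moreover have "real (Suc n) powr (1 / \<alpha>) * v n = u" by (simp add: v_def powr_minus del: of_nat_Suc)
    then have "\<phi> (v n) ^ Suc n = \<phi> u" using phi_scale[of "Suc n" "v n"] by simp
    then have "cmod (\<phi> (v n)) ^ Suc n = 1" using 1 by (metis norm_power)
    ultimately show False by simp
  qed
  have "\<exists>\<theta>. AE \<omega> in M. cos (v n * X 1 \<omega> - \<theta>) = 1" for n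
    by (rule AE_cos_eq_1) (use v1 in auto)
  then obtain \<theta> where "\<And>n. AE \<omega> in M. cos (v n * X 1 \<omega> - \<theta> n) = 1" by metis
  then have AE: "AE \<omega> in M. \<forall>n. cos (v n * X 1 \<omega> - \<theta> n) = 1" by (simp add: AE_all_countable)
  then obtain \<omega>0 where \<omega>0: "\<And>n. cos (v n * X 1 \<omega>0 - \<theta> n) = 1" using eventually_happens'[OF ae_filter_bot] by blast
  have v0: "v \<longlonglongrightarrow> 0"
  proof -
    have "(\<lambda>n. real (Suc n) powr (- (1 / \<alpha>))) \<longlonglongrightarrow> 0"
      using index_gt_1 by (intro tendsto_neg_powr LIMSEQ_Suc filterlim_real_sequentially) (auto simp: filterlim_Suc filterlim_real_sequentially intro: filterlim_compose[OF filterlim_real_sequentially filterlim_Suc])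
    from tendsto_mult_left[OF this, of u] show ?thesis unfolding v_def by simp
  qed
  from AE have "AE \<omega> in M. X 1 \<omega> = X 1 \<omega>0"
  proof eventually_elim
    case (elim \<omega>)
    show ?case
    proof (rule ccontr)
      assume ne: "X 1 \<omega> \<noteq> X 1 \<omega>0"
      define d where "d = X 1 \<omega> - X 1 \<omega>0"
      have "(\<lambda>n. \<bar>v n * d\<bar>) \<longlonglongrightarrow> \<bar>0 * d\<bar>" by (intro tendsto_intros v0)
      from order_tendstoD(2)[OF this, of "2 * pi"] obtain n where n: "\<bar>v n * d\<bar> < 2 * pi"
        by (auto simp: eventually_sequentially)
      obtain i j :: int where "v n * X 1 \<omega> - \<theta> n = real_of_int i * 2 * pi" "v n * X 1 \<omega>0 - \<theta> n = real_of_int j * 2 * pi"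
        using elim \<omega>0 unfolding cos_one_2pi_int by blast
      then have eq: "v n * d = of_int (i - j) * (2 * pi)" by (simp add: d_def algebra_simps)
      then have "\<bar>of_int (i - j)\<bar> * (2 * pi) < 1 * (2 * pi)" using n by (simp add: abs_mult)
      then have "\<bar>of_int (i - j) :: real\<bar> < 1" by (subst (asm) mult_less_cancel_right_pos) auto
      then have "i - j = 0" by linarith
      then have "v n * d = 0" using eq by simp
      moreover have "v n \<noteq> 0" using u by (simp add: v_def)
      ultimately show False using ne by (simp add: d_def)
    qed
  qed
  then show False using not_AE_const by blast
qed

text \<open>Any v with |v| \<ge> 1 is n^(1/\<alpha>) times a point of the compact set 1 \<le> |w|
  \<le> 2, on which |\<phi>| \<le> \<rho> < 1. Hence |\<phi>(v)| \<le> \<rho>^n, with n the integer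
  part of |v|^\<alpha> \<ge> |v|. The additive l in the exponent pays for the rounding and for |v| <
  1.\<close>

lemma phi_exponential_decay: "\<exists>l>0. \<forall>v. cmod (\<phi> v) \<le> exp (l - l * \<bar>v\<bar>)"
proof -
  interpret law: real_distribution "law 1" by (rule real_distribution_law) simp
  define S :: "real set" where "S = {-2..-1} \<union> {1..2}"
  have "compact S" "S \<noteq> {}" by (auto simp: S_def)
  moreover have "continuous_on S (\<lambda>v. cmod (\<phi> v))"
    by (intro continuous_on_norm continuous_at_imp_continuous_on ballI law.isCont_char)
  ultimately obtain w where w: "w \<in> S" "\<And>v. v \<in> S \<Longrightarrow> cmod (\<phi> v) \<le> cmod (\<phi> w)"
    using continuous_attains_sup by metis
  \<comment> \<open>The maximum with 1/2 keeps \<rho> positive, so that its logarithm is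
    meaningful.\<close>
  define \<rho> where "\<rho> = max (1/2) (cmod (\<phi> w))"
  have \<rho>: "0 < \<rho>" "\<rho> < 1" "\<And>v. v \<in> S \<Longrightarrow> cmod (\<phi> v) \<le> \<rho>"
    using w cmod_phi_less_1[of w] by (auto simp: \<rho>_def S_def le_max_iff_disj)
  define l where "l = - ln \<rho>"
  have l: "l > 0" using \<rho> by (simp add: l_def)
  have "cmod (\<phi> v) \<le> exp (l - l * \<bar>v\<bar>)" for v
  proof (cases "\<bar>v\<bar> < 1")
    case True
    then have "l * \<bar>v\<bar> \<le> l * 1" using l by (intro mult_left_mono) auto
    then have "1 \<le> exp (l - l * \<bar>v\<bar>)" by simp
    then show ?thesis using law.cmod_char_le_1[of v] by linarith
  next
    case False
    have \<alpha>: "0 < 1 / \<alpha>" "1 / \<alpha> \<le> 1" using index_gt_1 by auto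
    define n where "n = nat \<lfloor>\<bar>v\<bar> powr \<alpha>\<rfloor>"
    have pw: "\<bar>v\<bar> \<le> \<bar>v\<bar> powr \<alpha>" using False index_gt_1 powr_mono[of 1 \<alpha> "\<bar>v\<bar>"] by simp
    have n: "real n \<le> \<bar>v\<bar> powr \<alpha>" "\<bar>v\<bar> powr \<alpha> < real n + 1" "1 \<le> n"
      using pw False unfolding n_def by linarith+
    have inv: "(\<bar>v\<bar> powr \<alpha>) powr (1 / \<alpha>) = \<bar>v\<bar>" using index_gt_1 by (simp add: powr_powr)
    define a where "a = real n powr (1 / \<alpha>)"
    have a0: "a > 0" using n by (simp add: a_def)
    have a1: "a \<le> \<bar>v\<bar>" unfolding a_def using n \<alpha> by (subst inv[symmetric]) (intro powr_mono2, auto)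
    have "\<bar>v\<bar> \<le> (2 * real n) powr (1 / \<alpha>)"
      using n \<alpha> by (subst inv[symmetric]) (intro powr_mono2, auto)
    also have "\<dots> = 2 powr (1 / \<alpha>) * a" by (simp add: a_def powr_mult)
    also have "\<dots> \<le> 2 * a" using powr_mono[OF \<alpha>(2), of 2] a0 by (intro mult_right_mono) auto
    finally have a2: "\<bar>v\<bar> \<le> 2 * a" .
    have "v / a \<in> S"
      using a0 a1 a2 unfolding S_def by (auto simp: field_simps abs_if split: if_splits)
    then have "cmod (\<phi> (v / a)) ^ n \<le> \<rho> ^ n" by (intro power_mono \<rho>(3)) auto
    moreover have "\<phi> v = \<phi> (v / a) ^ n" using phi_scale[of n "v / a"] n a0 by (simp add: a_def)
    then have "cmod (\<phi> v) = cmod (\<phi> (v / a)) ^ n" by (simp only: norm_power)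
    moreover have "\<rho> ^ n = exp (- l * real n)"
      using \<rho> by (simp add: l_def exp_of_nat2_mult)
    moreover have "exp (- l * real n) \<le> exp (l - l * \<bar>v\<bar>)"
    proof -
      have "l * \<bar>v\<bar> \<le> l * (real n + 1)" using n pw l by (intro mult_left_mono) auto
      then show ?thesis by (simp add: distrib_left)
    qed
    ultimately show ?thesis by linarith
  qed
  with l show ?thesis by blast
qed

lemma phi_integral_finite: "(\<integral>\<^sup>+v. ennreal (cmod (\<phi> v)) \<partial>lborel) < \<infinity>"
proof -
  obtain l where l: "l > 0" "\<And>v. cmod (\<phi> v) \<le> exp (l - l * \<bar>v\<bar>)" using phi_exponential_decay by blast
  have "(\<integral>\<^sup>+v. ennreal (cmod (\<phi> v)) \<partial>lborel) \<le> (\<integral>\<^sup>+v. ennreal (exp (l - l * \<bar>v\<bar>)) \<partial>lborel)"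
    by (intro nn_integral_mono ennreal_leI l(2))
  also have "\<dots> \<le> 2 * (\<integral>\<^sup>+v. ennreal (exp (l - l * v)) * indicator {0..} v \<partial>lborel)"
    by (rule nn_integral_abs_le) measurable
  also have "(\<integral>\<^sup>+v. ennreal (exp (l - l * v)) * indicator {0..} v \<partial>lborel)
      = (\<integral>\<^sup>+v. ennreal (exp l / l) * ennreal (exponential_density l v) \<partial>lborel)"
    using l(1) by (intro nn_integral_cong)
      (auto simp: exponential_density_def indicator_def exp_diff exp_minus field_simps simp flip: ennreal_mult)
  also have "\<dots> = ennreal (exp l / l) * (\<integral>\<^sup>+v. ennreal (exponential_density l v) \<partial>lborel)"
    by (rule nn_integral_cmult) simp
  also have "(\<integral>\<^sup>+v. ennreal (exponential_density l v) \<partial>lborel) = 1"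
    using prob_space.emeasure_space_1[OF prob_space_exponential_density[OF l(1)]] by (simp add: emeasure_density)
  finally show ?thesis by (rule order_le_less_trans) (simp add: ennreal_mult_less_top)
qed

text \<open>Gaussian smoothing instead of Fourier inversion: the indicator of [-r,r] is at most
  exp(1/2) times exp(-x^2/(2 r^2)), which is the characteristic function of a standard normal Z at
  x/r. Fubini turns its expectation into E \<phi>(Z/r), which is at most r times the integral of
  |\<phi>| as the normal density is at most 1.\<close>

lemma small_ball: "\<exists>K\<ge>0. \<forall>r>0. emeasure M {\<omega>\<in>space M. \<bar>X 1 \<omega>\<bar> \<le> r} \<le> ennreal (K * r)"
proof -
  interpret law: real_distribution "law 1" by (rule real_distribution_law) simp
  interpret N: real_distribution std_normal_distribution by (rule real_dist_normal_dist)
  interpret P: pair_prob_space "law 1" std_normal_distribution ..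
  have [measurable]: "X 1 \<in> borel_measurable M" by simp
  obtain I where I: "0 \<le> I" "(\<integral>\<^sup>+v. ennreal (cmod (\<phi> v)) \<partial>lborel) = ennreal I"
    using phi_integral_finite by (cases "\<integral>\<^sup>+v. ennreal (cmod (\<phi> v)) \<partial>lborel") auto
  have "emeasure M {\<omega>\<in>space M. \<bar>X 1 \<omega>\<bar> \<le> r} \<le> ennreal (exp (1/2) * I * r)" if r: "0 < r" for r
  proof -
    let ?e = "\<lambda>x::real. exp (- ((x / r)\<^sup>2) / 2)"
    have e_int: "integrable (law 1) ?e" by (intro law.integrable_const_bound[where B = 1]) auto
    have "integrable (law 1 \<Otimes>\<^sub>M std_normal_distribution) (\<lambda>(x, z). iexp (z / r * x))"
      by (intro P.P.integrable_const_bound[where B = 1]) (auto simp: case_prod_beta simp del: of_real_mult of_real_divide)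
    from P.Fubini_integral[OF this]
    have "(\<integral>z. \<phi> (z / r) \<partial>std_normal_distribution) = (\<integral>x. (\<integral>z. iexp (z / r * x) \<partial>std_normal_distribution) \<partial>law 1)"
      by (simp only: char_def)
    also have "\<dots> = (\<integral>x. char std_normal_distribution (x / r) \<partial>law 1)"
      unfolding char_def by (intro Bochner_Integration.integral_cong refl) (simp add: ac_simps)
    also have "\<dots> = complex_of_real (\<integral>x. ?e x \<partial>law 1)"
      unfolding char_std_normal_distribution by (rule integral_complex_of_real)
    finally have eq: "complex_of_real (\<integral>x. ?e x \<partial>law 1) = (\<integral>z. \<phi> (z / r) \<partial>std_normal_distribution)" ..
    have "(\<integral>x. ?e x \<partial>law 1) \<le> cmod (complex_of_real (\<integral>x. ?e x \<partial>law 1))" by simp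
    also have "\<dots> \<le> (\<integral>z. cmod (\<phi> (z / r)) \<partial>std_normal_distribution)"
      unfolding eq by (rule integral_norm_bound)
    finally have le: "(\<integral>x. ?e x \<partial>law 1) \<le> (\<integral>z. cmod (\<phi> (z / r)) \<partial>std_normal_distribution)" .
    have phi_int: "integrable std_normal_distribution (\<lambda>z. cmod (\<phi> (z / r)))"
      using law.cmod_char_le_1 by (intro N.integrable_const_bound[where B = 1]) auto
    have "ennreal (exp (-1/2)) * emeasure (law 1) {-r..r} = (\<integral>\<^sup>+x. ennreal (exp (-1/2)) * indicator {-r..r} x \<partial>law 1)"
      by (subst nn_integral_cmult_indicator) auto
    also have "\<dots> \<le> (\<integral>\<^sup>+x. ennreal (?e x) \<partial>law 1)"
    proof (rule nn_integral_mono)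
      fix x
      show "ennreal (exp (-1/2)) * indicator {-r..r} x \<le> ennreal (?e x)"
      proof (cases "x \<in> {-r..r}")
        case True
        then have "\<bar>x / r\<bar> \<le> 1" using r by (auto simp: abs_le_iff field_simps)
        then have "(x / r)\<^sup>2 \<le> 1" by (simp only: abs_square_le_1)
        then show ?thesis using True by (simp add: ennreal_leI)
      qed simp
    qed
    also have "\<dots> = ennreal (\<integral>x. ?e x \<partial>law 1)" by (rule nn_integral_eq_integral[OF e_int]) simp
    also have "\<dots> \<le> ennreal (\<integral>z. cmod (\<phi> (z / r)) \<partial>std_normal_distribution)" by (rule ennreal_leI[OF le])
    also have "\<dots> = (\<integral>\<^sup>+z. ennreal (cmod (\<phi> (z / r))) \<partial>std_normal_distribution)"
      by (rule nn_integral_eq_integral[OF phi_int, symmetric]) simp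
    also have "\<dots> = (\<integral>\<^sup>+z. ennreal (std_normal_density z) * ennreal (cmod (\<phi> (z / r))) \<partial>lborel)"
      by (subst nn_integral_density) auto
    also have "\<dots> \<le> (\<integral>\<^sup>+z. ennreal (cmod (\<phi> (z / r))) \<partial>lborel)"
    proof (rule nn_integral_mono)
      fix z :: real
      have "1 \<le> sqrt (2 * pi)" using pi_gt3 by simp
      then have "std_normal_density z \<le> 1" unfolding std_normal_density_def
        by (intro mult_le_one) auto
      then have "ennreal (std_normal_density z) * ennreal (cmod (\<phi> (z / r))) \<le> 1 * ennreal (cmod (\<phi> (z / r)))"
        by (intro mult_right_mono) auto
      then show "ennreal (std_normal_density z) * ennreal (cmod (\<phi> (z / r))) \<le> ennreal (cmod (\<phi> (z / r)))" by simp
    qed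
    also have "\<dots> = ennreal (r * I)"
    proof -
      have "(\<integral>\<^sup>+z. ennreal (cmod (\<phi> (z / r))) \<partial>lborel) = ennreal r * (\<integral>\<^sup>+z. ennreal (cmod (\<phi> z)) \<partial>lborel)"
        using nn_integral_real_affine[of "\<lambda>z. ennreal (cmod (\<phi> (z / r)))" r 0] r by simp
      then show ?thesis using I r by (simp add: ennreal_mult)
    qed
    finally have "ennreal (exp (1/2)) * (ennreal (exp (-1/2)) * emeasure (law 1) {-r..r}) \<le> ennreal (exp (1/2)) * ennreal (r * I)"
      by (rule mult_left_mono) simp
    moreover have "ennreal (exp (1/2)) * ennreal (exp (-1/2)) = 1"
      by (subst ennreal_mult[symmetric]) (auto simp flip: exp_add)
    ultimately have "emeasure (law 1) {-r..r} \<le> ennreal (exp (1/2)) * ennreal (r * I)"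
      by (simp add: mult.assoc[symmetric])
    also have "\<dots> = ennreal (exp (1/2) * I * r)" using I r by (simp add: ac_simps flip: ennreal_mult)
    also have "emeasure (law 1) {-r..r} = emeasure M {\<omega>\<in>space M. \<bar>X 1 \<omega>\<bar> \<le> r}"
      by (subst emeasure_distr) (auto intro!: arg_cong[where f = "emeasure M"] simp: abs_le_iff)
    finally show ?thesis .
  qed
  then show ?thesis using I(1) by (intro exI[of _ "exp (1/2) * I"]) auto
qed

end

section \<open>Occupation of close pairs\<close>

lemma nn_integral_occupation_pairs:
  assumes x: "cadlag x" and t: "0 \<le> t"
  shows "(\<integral>\<^sup>+y. \<integral>\<^sup>+z. indicator {-r..r} (y - z) \<partial>occupation_measure x t \<partial>occupation_measure x t)
    = (\<integral>\<^sup>+u. (\<integral>\<^sup>+s. indicator {-r..r} (x (max 0 u) - x (max 0 s)) * indicator {0..t} s \<partial>lborel) * indicator {0..t} u \<partial>lborel)"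
proof -
  interpret finite_measure "occupation_measure x t" by (rule finite_measure_occupation[OF x t])
  have "(\<lambda>y. \<integral>\<^sup>+z. indicator {-r..r} (y - z) \<partial>occupation_measure x t) \<in> borel_measurable borel" by measurable
  from nn_integral_occupation[OF x this, of t] show ?thesis
    by (simp add: nn_integral_occupation[OF x])
qed

context stable_process_gt_1
begin

text \<open>Up to sign X_u - X_s has the law of |u - s|^(1/\<alpha>) X_1, so this is
  \<open>small_ball\<close> with radius r |u - s|^(-1/\<alpha>).\<close>

lemma X_small_difference:
  "\<exists>K\<ge>0. \<forall>r>0. \<forall>u\<ge>0. \<forall>s\<ge>0. u \<noteq> s \<longrightarrow>
     (\<integral>\<^sup>+\<omega>. indicator {-r..r} (X u \<omega> - X s \<omega>) \<partial>M) \<le> ennreal (K * r * \<bar>s - u\<bar> powr (- (1 / \<alpha>)))"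
proof -
  obtain K where K: "0 \<le> K" "\<And>r. 0 < r \<Longrightarrow> emeasure M {\<omega>\<in>space M. \<bar>X 1 \<omega>\<bar> \<le> r} \<le> ennreal (K * r)"
    using small_ball by blast
  have less: "(\<integral>\<^sup>+\<omega>. indicator {-r..r} (X u \<omega> - X s \<omega>) \<partial>M) \<le> ennreal (K * r * \<bar>s - u\<bar> powr (- (1 / \<alpha>)))"
    if r: "0 < r" and s: "0 \<le> s" "s < u" for r s u
  proof -
    define h where "h = u - s"
    have h: "0 < h" "s + h = u" using s by (auto simp: h_def)
    define a where "a = h powr (1 / \<alpha>)"
    have a: "0 < a" using h by (simp add: a_def)
    have [measurable]: "X 1 \<in> borel_measurable M" "X s \<in> borel_measurable M" "X u \<in> borel_measurable M" using s by auto
    have law: "distr M borel (\<lambda>\<omega>. X u \<omega> - X s \<omega>) = distr M borel (\<lambda>\<omega>. a * X 1 \<omega>)"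
      using stationary_increments[of s h] s h law_scale[OF h(1)] by (simp add: a_def)
    have "(\<integral>\<^sup>+\<omega>. indicator {-r..r} (X u \<omega> - X s \<omega>) \<partial>M) = emeasure (distr M borel (\<lambda>\<omega>. X u \<omega> - X s \<omega>)) {-r..r}"
      using nn_integral_distr[of "\<lambda>\<omega>. X u \<omega> - X s \<omega>" M borel "indicator {-r..r}"] by simp
    also have "\<dots> = emeasure M {\<omega>\<in>space M. \<bar>X 1 \<omega>\<bar> \<le> r / a}"
    proof -
      have iff: "a * y \<in> {-r..r} \<longleftrightarrow> \<bar>y\<bar> \<le> r / a" for y using a by (auto simp: abs_le_iff field_simps)
      have "(\<lambda>\<omega>. a * X 1 \<omega>) -` {-r..r} \<inter> space M = {\<omega>\<in>space M. \<bar>X 1 \<omega>\<bar> \<le> r / a}"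
        unfolding vimage_def iff by blast
      moreover have "emeasure (distr M borel (\<lambda>\<omega>. a * X 1 \<omega>)) {-r..r} = emeasure M ((\<lambda>\<omega>. a * X 1 \<omega>) -` {-r..r} \<inter> space M)"
        by (rule emeasure_distr) auto
      ultimately show ?thesis unfolding law by simp
    qed
    also have "\<dots> \<le> ennreal (K * (r / a))" using r a by (intro K(2)) simp
    also have "K * (r / a) = K * r * \<bar>s - u\<bar> powr (- (1 / \<alpha>))"
      using s by (simp add: a_def h_def powr_minus divide_inverse)
    finally show ?thesis .
  qed
  have "(\<integral>\<^sup>+\<omega>. indicator {-r..r} (X u \<omega> - X s \<omega>) \<partial>M) \<le> ennreal (K * r * \<bar>s - u\<bar> powr (- (1 / \<alpha>)))"
    if "0 < r" "0 \<le> s" "0 \<le> u" "u \<noteq> s" for r s u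
  proof (cases "s < u")
    case True then show ?thesis using less that by blast
  next
    case False
    have "indicator {-r..r} (X u \<omega> - X s \<omega>) = (indicator {-r..r} (X s \<omega> - X u \<omega>) :: ennreal)" for \<omega>
      by (auto simp: indicator_def)
    then show ?thesis using less[of r u s] that False by (simp add: abs_minus_commute)
  qed
  with K(1) show ?thesis by blast
qed

text \<open>The mass that the product of the occupation measure with itself gives to pairs at
  distance at most r, written over times (\<open>nn_integral_occupation_pairs\<close>) so that
  measurability in \<omega> can be read off.\<close>

definition small_pairs :: "real \<Rightarrow> real \<Rightarrow> 'a \<Rightarrow> ennreal" where
  "small_pairs T r \<omega> = (\<integral>\<^sup>+u. (\<integral>\<^sup>+s. indicator {-r..r} (X (max 0 u) \<omega> - X (max 0 s) \<omega>) * indicator {0..T} s \<partial>lborel)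
     * indicator {0..T} u \<partial>lborel)"

lemma pair_indicator_measurable:
  "(\<lambda>q. indicator {-r..r} (X (max 0 (snd (fst q))) (fst (fst q)) - X (max 0 (snd q)) (fst (fst q))) * indicator {0..T} (snd q) :: ennreal)
    \<in> borel_measurable ((M \<Otimes>\<^sub>M lborel) \<Otimes>\<^sub>M lborel)"
proof -
  have sets: "borel_measurable (M \<Otimes>\<^sub>M borel) = borel_measurable (M \<Otimes>\<^sub>M (lborel :: real measure))"
    by (intro measurable_cong_sets sets_pair_measure_cong) auto
  have [measurable]: "(\<lambda>q. X (max 0 (snd (fst q))) (fst (fst q))) \<in> borel_measurable ((M \<Otimes>\<^sub>M lborel) \<Otimes>\<^sub>M (lborel :: real measure))"
    using measurable_compose[OF measurable_fst X_jointly_measurable[unfolded sets]] .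
  have "(\<lambda>q. (fst (fst q), snd q)) \<in> (M \<Otimes>\<^sub>M lborel) \<Otimes>\<^sub>M (lborel :: real measure) \<rightarrow>\<^sub>M M \<Otimes>\<^sub>M (lborel :: real measure)" by measurable
  from measurable_compose[OF this X_jointly_measurable[unfolded sets]]
  have [measurable]: "(\<lambda>q. X (max 0 (snd q)) (fst (fst q))) \<in> borel_measurable ((M \<Otimes>\<^sub>M lborel) \<Otimes>\<^sub>M (lborel :: real measure))" by simp
  show ?thesis by measurable
qed

lemma pair_integral_measurable:
  "(\<lambda>(\<omega>, u). (\<integral>\<^sup>+s. indicator {-r..r} (X (max 0 u) \<omega> - X (max 0 s) \<omega>) * indicator {0..T} s \<partial>lborel)
     * indicator {0..T} u :: ennreal) \<in> borel_measurable (M \<Otimes>\<^sub>M lborel)"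
proof -
  have [measurable]: "(\<lambda>p. \<integral>\<^sup>+s. indicator {-r..r} (X (max 0 (snd p)) (fst p) - X (max 0 s) (fst p)) * indicator {0..T} s \<partial>lborel)
      \<in> borel_measurable (M \<Otimes>\<^sub>M (lborel :: real measure))"
    by (rule lborel.borel_measurable_nn_integral) (use pair_indicator_measurable in \<open>simp add: case_prod_beta\<close>)
  show ?thesis unfolding case_prod_beta by measurable
qed

lemma small_pairs_measurable [measurable]: "small_pairs T r \<in> borel_measurable M"
  unfolding small_pairs_def using pair_integral_measurable by (rule lborel.borel_measurable_nn_integral)

lemma nn_integral_small_pairs:
  assumes T: "0 \<le> T"
  shows "\<exists>c\<ge>0. \<forall>r>0. (\<integral>\<^sup>+\<omega>. small_pairs T r \<omega> \<partial>M) \<le> ennreal (c * r)"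
proof -
  interpret pair_sigma_finite M lborel by unfold_locales
  obtain K where K: "0 \<le> K" "\<And>r u s. 0 < r \<Longrightarrow> 0 \<le> u \<Longrightarrow> 0 \<le> s \<Longrightarrow> u \<noteq> s \<Longrightarrow>
     (\<integral>\<^sup>+\<omega>. indicator {-r..r} (X u \<omega> - X s \<omega>) \<partial>M) \<le> ennreal (K * r * \<bar>s - u\<bar> powr (- (1 / \<alpha>)))"
    using X_small_difference by blast
  define p where "p = - (1 / \<alpha>)"
  have p: "-1 < p" using index_gt_1 by (simp add: p_def)
  \<comment> \<open>The integral of |v|^(-1/\<alpha>) over [-T,T], finite since 1/\<alpha> < 1. It
    dominates the integral of |s - u|^(-1/\<alpha>) over s in [0,T] for every u in [0,T].\<close>
  define D where "D = 2 * (T powr (p + 1) / (p + 1))"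
  have D0: "0 \<le> D" using p by (simp add: D_def)
  let ?f = "\<lambda>v. ennreal (v powr p) * indicator {0..T} v"
  have "(\<integral>\<^sup>+v. ?f \<bar>v\<bar> \<partial>lborel) \<le> 2 * (\<integral>\<^sup>+v. ?f v * indicator {0..} v \<partial>lborel)"
    by (rule nn_integral_abs_le) measurable
  also have "(\<integral>\<^sup>+v. ?f v * indicator {0..} v \<partial>lborel) = (\<integral>\<^sup>+v. ?f v \<partial>lborel)"
    by (intro nn_integral_cong) (auto simp: indicator_def)
  also have "\<dots> = ennreal (T powr (p + 1) / (p + 1))"
    by (rule nn_integral_has_integral_lebesgue'[OF _ has_integral_powr_from_0[OF p T]]) simp
  also have "2 * ennreal (T powr (p + 1) / (p + 1)) = ennreal D"
    unfolding D_def using p by (subst ennreal_mult) auto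
  finally have D: "(\<integral>\<^sup>+v. ?f \<bar>v\<bar> \<partial>lborel) \<le> ennreal D" .
  have "(\<integral>\<^sup>+\<omega>. small_pairs T r \<omega> \<partial>M) \<le> ennreal (K * D * T * r)" if r: "0 < r" for r
  proof -
    have "(\<integral>\<^sup>+\<omega>. small_pairs T r \<omega> \<partial>M) = (\<integral>\<^sup>+u. \<integral>\<^sup>+\<omega>. (\<integral>\<^sup>+s. indicator {-r..r} (X (max 0 u) \<omega> - X (max 0 s) \<omega>)
        * indicator {0..T} s \<partial>lborel) * indicator {0..T} u \<partial>M \<partial>lborel)"
      unfolding small_pairs_def by (rule Fubini'[OF pair_integral_measurable, symmetric])
    also have "\<dots> \<le> (\<integral>\<^sup>+u. ennreal (K * r * D) * indicator {0..T} u \<partial>lborel)"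
    proof (rule nn_integral_mono)
      fix u :: real
      show "(\<integral>\<^sup>+\<omega>. (\<integral>\<^sup>+s. indicator {-r..r} (X (max 0 u) \<omega> - X (max 0 s) \<omega>) * indicator {0..T} s \<partial>lborel)
          * indicator {0..T} u \<partial>M) \<le> ennreal (K * r * D) * indicator {0..T} u"
      proof (cases "u \<in> {0..T}")
        case True
        have [measurable]: "X u \<in> borel_measurable M" using True by simp
        have sets: "borel_measurable (M \<Otimes>\<^sub>M borel) = borel_measurable (M \<Otimes>\<^sub>M (lborel :: real measure))"
          by (intro measurable_cong_sets sets_pair_measure_cong) auto
        note [measurable] = X_jointly_measurable[unfolded sets]
        have "(\<integral>\<^sup>+\<omega>. \<integral>\<^sup>+s. indicator {-r..r} (X u \<omega> - X (max 0 s) \<omega>) * indicator {0..T} s \<partial>lborel \<partial>M)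
          = (\<integral>\<^sup>+s. \<integral>\<^sup>+\<omega>. indicator {-r..r} (X u \<omega> - X (max 0 s) \<omega>) * indicator {0..T} s \<partial>M \<partial>lborel)"
          by (rule Fubini'[symmetric]) (simp add: case_prod_beta)
        also have "\<dots> \<le> (\<integral>\<^sup>+s. ennreal (K * r) * ?f \<bar>s - u\<bar> \<partial>lborel)"
        proof (rule nn_integral_mono_AE)
          show "AE s in lborel. (\<integral>\<^sup>+\<omega>. indicator {-r..r} (X u \<omega> - X (max 0 s) \<omega>) * indicator {0..T} s \<partial>M)
              \<le> ennreal (K * r) * ?f \<bar>s - u\<bar>"
            using AE_lborel_singleton[of u]
          proof eventually_elim
            case (elim s)
            show ?case
            proof (cases "s \<in> {0..T}")
              case s: True
              then have "\<bar>s - u\<bar> \<in> {0..T}" using True by auto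
              then show ?thesis using K(2)[of r u s] K(1) s True r elim
                by (simp add: p_def max_def flip: ennreal_mult)
            qed simp
          qed
        qed
        also have "\<dots> = ennreal (K * r) * (\<integral>\<^sup>+s. ?f \<bar>s - u\<bar> \<partial>lborel)" by (rule nn_integral_cmult) measurable
        also have "(\<integral>\<^sup>+s. ?f \<bar>s - u\<bar> \<partial>lborel) = (\<integral>\<^sup>+v. ?f \<bar>v\<bar> \<partial>lborel)"
          using nn_integral_real_affine[of "\<lambda>s. ?f \<bar>s - u\<bar>" 1 u] by simp
        also have "ennreal (K * r) * (\<integral>\<^sup>+v. ?f \<bar>v\<bar> \<partial>lborel) \<le> ennreal (K * r) * ennreal D"
          by (intro mult_left_mono D) simp
        also have "\<dots> = ennreal (K * r * D)" using K(1) r D0 by (simp flip: ennreal_mult)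
        finally show ?thesis using True by (simp add: max_def)
      qed simp
    qed
    also have "\<dots> = ennreal (K * r * D) * ennreal T" using T by (subst nn_integral_cmult_indicator) auto
    also have "\<dots> = ennreal (K * D * T * r)" using K(1) r D0 T by (simp add: ac_simps flip: ennreal_mult)
    finally show ?thesis .
  qed
  then show ?thesis using K(1) D0 T by (intro exI[of _ "K * D * T"]) auto
qed

text \<open>The expected pair mass is O(r), so by Fatou's lemma the liminf of the pair mass divided
  by r = 1/(n+1) is almost surely finite. This supplies path-dependent radii for
  \<open>absolutely_continuous_lborelI\<close>.\<close>

lemma AE_has_local_time_fixed:
  assumes T: "0 \<le> T"
  shows "AE \<omega> in M. has_local_time (\<lambda>s. X s \<omega>) T"
proof -
  obtain c where c: "0 \<le> c" "\<And>r. 0 < r \<Longrightarrow> (\<integral>\<^sup>+\<omega>. small_pairs T r \<omega> \<partial>M) \<le> ennreal (c * r)"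
    using nn_integral_small_pairs[OF T] by blast
  let ?r = "\<lambda>n::nat. 1 / real (Suc n)"
  let ?J = "\<lambda>n \<omega>. ennreal (real (Suc n)) * small_pairs T (?r n) \<omega>"
  have cancel: "ennreal (?r n) * ennreal (real (Suc n)) = 1" for n by (simp flip: ennreal_mult del: of_nat_Suc)
  have "(\<integral>\<^sup>+\<omega>. liminf (\<lambda>n. ?J n \<omega>) \<partial>M) \<le> liminf (\<lambda>n. \<integral>\<^sup>+\<omega>. ?J n \<omega> \<partial>M)"
    by (rule nn_integral_liminf) measurable
  also have "\<dots> \<le> liminf (\<lambda>n::nat. ennreal c)"
  proof (intro Liminf_mono always_eventually allI)
    fix n
    have "(\<integral>\<^sup>+\<omega>. ?J n \<omega> \<partial>M) = ennreal (real (Suc n)) * (\<integral>\<^sup>+\<omega>. small_pairs T (?r n) \<omega> \<partial>M)"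
      by (rule nn_integral_cmult) simp
    also have "\<dots> \<le> ennreal (real (Suc n)) * ennreal (c * ?r n)" by (intro mult_left_mono c(2)) auto
    also have "\<dots> = ennreal c" using c(1) by (simp flip: ennreal_mult del: of_nat_Suc)
    finally show "(\<integral>\<^sup>+\<omega>. ?J n \<omega> \<partial>M) \<le> ennreal c" .
  qed
  also have "\<dots> = ennreal c" by (simp add: Liminf_const)
  finally have "(\<integral>\<^sup>+\<omega>. liminf (\<lambda>n. ?J n \<omega>) \<partial>M) \<noteq> \<infinity>" by (auto simp: top_unique)
  then have "AE \<omega> in M. liminf (\<lambda>n. ?J n \<omega>) \<noteq> \<infinity>" by (intro nn_integral_PInf_AE) measurable
  then have "AE \<omega> in M. \<omega> \<in> space M \<and> liminf (\<lambda>n. ?J n \<omega>) \<noteq> \<infinity>" by (auto simp: AE_conj_iff)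
  then show ?thesis
  proof eventually_elim
    case (elim \<omega>)
    have x: "cadlag (\<lambda>s. X s \<omega>)" using elim by (intro cadlag_paths) simp
    obtain b where b: "0 \<le> b" "liminf (\<lambda>n. ?J n \<omega>) = ennreal b"
      using elim by (cases "liminf (\<lambda>n. ?J n \<omega>)") auto
    show ?case
    proof (rule absolutely_continuous_lborelI[OF finite_measure_occupation[OF x T]])
      show "0 \<le> b + 1" using b by simp
      fix e :: real assume "0 < e"
      then obtain N where N: "?r N < e" using nat_approx_posE by blast
      \<comment> \<open>As b + 1 exceeds the liminf, the bound holds for infinitely many n, hence
        for radii below any e.\<close>
      have "\<not> (\<forall>\<^sub>F n in sequentially. ennreal (b + 1) \<le> ?J n \<omega>)"
      proof
        assume "\<forall>\<^sub>F n in sequentially. ennreal (b + 1) \<le> ?J n \<omega>"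
        then have "ennreal (b + 1) \<le> ennreal b" unfolding b(2)[symmetric] by (rule Liminf_bounded)
        then show False using b(1) by simp
      qed
      then obtain n where n: "N \<le> n" "?J n \<omega> < ennreal (b + 1)"
        unfolding eventually_sequentially by (auto simp: not_le)
      have "small_pairs T (?r n) \<omega> = (ennreal (?r n) * ennreal (real (Suc n))) * small_pairs T (?r n) \<omega>"
        unfolding cancel by simp
      also have "\<dots> = ennreal (?r n) * ?J n \<omega>" by (simp only: mult.assoc)
      also have "\<dots> \<le> ennreal (?r n) * ennreal (b + 1)" using n(2) by (intro mult_left_mono) auto
      also have "\<dots> = ennreal ((b + 1) * ?r n)" using b(1) by (subst ennreal_mult[symmetric]) (simp_all add: mult.commute del: of_nat_Suc)
      finally have "small_pairs T (?r n) \<omega> \<le> ennreal ((b + 1) * ?r n)" .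
      moreover have "?r n < e" using N n(1) by (intro order_le_less_trans[OF _ N] divide_left_mono) auto
      ultimately show "\<exists>r>0. r < e \<and> (\<integral>\<^sup>+y. \<integral>\<^sup>+z. indicator {-r..r} (y - z) \<partial>occupation_measure (\<lambda>s. X s \<omega>) T
          \<partial>occupation_measure (\<lambda>s. X s \<omega>) T) \<le> ennreal ((b + 1) * r)"
        unfolding nn_integral_occupation_pairs[OF x T] small_pairs_def by (intro exI[of _ "?r n"]) auto
    qed simp
  qed
qed

lemma AE_has_local_time: "AE \<omega> in M. \<forall>t\<ge>0. has_local_time (\<lambda>s. X s \<omega>) t"
proof -
  have "AE \<omega> in M. \<forall>n. has_local_time (\<lambda>s. X s \<omega>) (real n)"
    by (subst AE_all_countable) (intro allI AE_has_local_time_fixed, simp)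
  then have "AE \<omega> in M. \<omega> \<in> space M \<and> (\<forall>n. has_local_time (\<lambda>s. X s \<omega>) (real n))" by (simp add: AE_conj_iff)
  then show ?thesis
  proof eventually_elim
    case (elim \<omega>)
    show ?case
    proof (intro allI impI)
      fix t :: real assume t: "0 \<le> t"
      obtain n :: nat where n: "t \<le> real n" using real_arch_simple by blast
      have "has_local_time (\<lambda>s. X s \<omega>) (real n)" using elim by blast
      then show "has_local_time (\<lambda>s. X s \<omega>) t"
        using elim by (intro has_local_time_antimono[OF cadlag_paths t n]) auto
    qed
  qed
qed

end

section \<open>Convergence of the crossing measures\<close>

lemma truncated_variation_singleton:
  assumes "0 \<le> c"
  shows "truncated_variation c x t t = 0"
proof -
  have "(\<Sum>K\<in>\<pi>. max (\<bar>x (Sup K) - x (Inf K)\<bar> - c) 0) = 0" if \<pi>: "\<pi> division_of {t..t}" for \<pi>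
  proof (rule sum.neutral, rule ballI)
    fix K assume "K \<in> \<pi>"
    then have "K \<subseteq> {t..t}" "K \<noteq> {}" using division_ofD(2,3)[OF \<pi>] by auto
    then have "K = {t}" by auto
    then show "max (\<bar>x (Sup K) - x (Inf K)\<bar> - c) 0 = 0" using assms by simp
  qed
  then have "truncated_variation c x t t \<le> 0"
    unfolding truncated_variation_def by (intro SUP_least) simp
  then show ?thesis by simp
qed

context stable_process_gt_1
begin

text \<open>Stated for every null sequence: the almost sure claim uses one of them, convergence in
  probability uses arbitrary ones.\<close>

lemma AE_limit_subseq:
  fixes c :: "nat \<Rightarrow> real"
  assumes c: "\<And>n. c n > 0" "c \<longlonglongrightarrow> 0"
  shows "\<exists>r. strict_mono r \<and> (AE \<omega> in M. \<omega> \<in> space M \<and> (\<forall>t\<ge>0. has_local_time (\<lambda>s. X s \<omega>) t) \<and>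
    (\<forall>t\<ge>0. (\<lambda>n. crossing_integral \<alpha> (\<lambda>s. X s \<omega>) (\<lambda>_. 1) (c (r n)) t) \<longlonglongrightarrow> limit_const * t))"
proof -
  obtain r where r: "strict_mono r"
    "AE \<omega> in M. \<forall>q\<in>\<rat>. 0 < q \<longrightarrow> (\<lambda>n. mass (c (r n)) q \<omega>) \<longlonglongrightarrow> limit_const * q"
    using mass_AE_subseq[OF c] by blast
  have "AE \<omega> in M. \<omega> \<in> space M" by simp
  with r(2) AE_has_local_time
  have "AE \<omega> in M. \<omega> \<in> space M \<and> (\<forall>t\<ge>0. has_local_time (\<lambda>s. X s \<omega>) t) \<and>
    (\<forall>t\<ge>0. (\<lambda>n. crossing_integral \<alpha> (\<lambda>s. X s \<omega>) (\<lambda>_. 1) (c (r n)) t) \<longlonglongrightarrow> limit_const * t)"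
  proof eventually_elim
    case (elim \<omega>)
    note x = cadlag_paths[OF elim(3)]
    have "(\<lambda>n. crossing_integral \<alpha> (\<lambda>s. X s \<omega>) (\<lambda>_. 1) (c (r n)) q) \<longlonglongrightarrow> limit_const * q"
      if q: "q \<in> \<rat>" "0 \<le> q" for q
    \<comment> \<open>Scaling gave the limit for q > 0 only; at 0 the truncated variation
      vanishes.\<close>
    proof (cases "q = 0")
      case True
      then show ?thesis
        using c(1) by (simp add: crossing_integral_one_eq[OF x] truncated_variation_singleton less_imp_le)
    next
      case False
      then have "(\<lambda>n. mass (c (r n)) q \<omega>) \<longlonglongrightarrow> limit_const * q" using elim(1) q by auto
      moreover have "mass (c (r n)) q \<omega> = crossing_integral \<alpha> (\<lambda>s. X s \<omega>) (\<lambda>_. 1) (c (r n)) q" for n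
        unfolding mass_def by (rule crossing_integral_one_eq[OF x c(1) q(2), symmetric])
      ultimately show ?thesis by simp
    qed
    then have "(\<lambda>n. crossing_integral \<alpha> (\<lambda>s. X s \<omega>) (\<lambda>_. 1) (c (r n)) t) \<longlonglongrightarrow> limit_const * t" if "0 \<le> t" for t
      by (rule crossing_integral_one_limit[OF x c(1) limit_const_nonneg _ that])
    then show ?case using elim by blast
  qed
  with r(1) show ?thesis by blast
qed

lemma weakly_converges_crossing_measure:
  fixes c :: "nat \<Rightarrow> real"
  assumes \<omega>: "\<omega> \<in> space M" and c: "\<And>n. c n > 0" "c \<longlonglongrightarrow> 0" and t: "0 \<le> t"
    and ac: "has_local_time (\<lambda>s. X s \<omega>) t"
    and lim: "\<And>t. 0 \<le> t \<Longrightarrow> (\<lambda>n. crossing_integral \<alpha> (\<lambda>s. X s \<omega>) (\<lambda>_. 1) (c n) t) \<longlonglongrightarrow> limit_const * t"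
  shows "weakly_converges (\<lambda>n. crossing_measure \<alpha> (c n) (\<lambda>s. X s \<omega>) t)
    (density lborel (\<lambda>y. ennreal limit_const * local_time (\<lambda>s. X s \<omega>) t y))"
  unfolding weakly_converges_def
proof (intro conjI allI impI)
  note x = cadlag_paths[OF \<omega>]
  show "finite_borel_measure (crossing_measure \<alpha> (c n) (\<lambda>s. X s \<omega>) t)" for n
    by (rule finite_crossing_measure[OF x c(1) t])
  show "finite_borel_measure (density lborel (\<lambda>y. ennreal limit_const * local_time (\<lambda>s. X s \<omega>) t y))"
    by (rule finite_scaled_local_time[OF x t limit_const_nonneg])
  fix g :: "real \<Rightarrow> real" assume g: "continuous_on UNIV g" "bounded (range g)"
  obtain K where K: "\<And>y. \<bar>g y\<bar> \<le> K" using g(2) by (auto simp: bounded_iff)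
  have gm: "g \<in> borel_measurable borel" using g(1) by (rule borel_measurable_continuous_onI)
  have "(\<lambda>n. crossing_integral \<alpha> (\<lambda>s. X s \<omega>) g (c n) t) \<longlonglongrightarrow> limit_const * path_integral (\<lambda>s. X s \<omega>) g t"
    by (rule crossing_integral_limit[OF x c index_gt_1 limit_const_nonneg lim g(1) K t])
  then show "(\<lambda>n. \<integral>y. g y \<partial>crossing_measure \<alpha> (c n) (\<lambda>s. X s \<omega>) t) \<longlonglongrightarrow>
      (\<integral>y. g y \<partial>density lborel (\<lambda>y. ennreal limit_const * local_time (\<lambda>s. X s \<omega>) t y))"
    unfolding integral_crossing_measure[OF x c(1) t gm] integral_scaled_local_time[OF x gm limit_const_nonneg]
    using ac by simp
qed

text \<open>The subsequence principle: if the probabilities stayed above e along some sequence, a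
  further subsequence would converge almost surely, uniformly on [0,T], and dominated convergence of
  the indicators would give a contradiction.\<close>

lemma weak_deviation_tendsto_0:
  fixes g :: "real \<Rightarrow> real"
  assumes g: "continuous_on UNIV g" "\<And>y. \<bar>g y\<bar> \<le> K" and T: "0 \<le> T" and \<epsilon>: "0 < \<epsilon>"
  defines "W \<equiv> \<lambda>c. weak_deviation g T (\<lambda>t \<omega>. crossing_measure \<alpha> c (\<lambda>s. X s \<omega>) t)
      (\<lambda>t \<omega>. density lborel (\<lambda>y. ennreal limit_const * local_time (\<lambda>s. X s \<omega>) t y))"
  shows "((\<lambda>c. measure M {\<omega>\<in>space M. W c \<omega> > ennreal \<epsilon>}) \<longlongrightarrow> 0) (at_right 0)"
proof (rule tendsto_at_right_sequentially[of 0 1])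
  have gm: "g \<in> borel_measurable borel" using g(1) by (rule borel_measurable_continuous_onI)
  let ?A = "\<lambda>c. {\<omega>\<in>space M. W c \<omega> > ennreal \<epsilon>}"
  have A: "?A c \<in> sets M" if "0 < c" for c
  proof -
    have [measurable]: "W c \<in> borel_measurable M"
      unfolding W_def by (rule weak_deviation_measurable[OF that limit_const_nonneg T gm g(2)])
    show ?thesis by measurable
  qed
  fix S :: "nat \<Rightarrow> real" assume S: "\<And>n. 0 < S n" "S \<longlonglongrightarrow> 0"
  show "(\<lambda>n. measure M (?A (S n))) \<longlonglongrightarrow> 0"
  proof (rule ccontr)
    assume "\<not> ?thesis"
    then obtain e where e: "0 < e" "\<not> (\<forall>\<^sub>F n in sequentially. dist (measure M (?A (S n))) 0 < e)"
      unfolding tendsto_iff by blast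
    then have "infinite {n. e \<le> measure M (?A (S n))}"
      by (auto simp: not_eventually not_less frequently_cofinite[symmetric] cofinite_eq_sequentially)
    then obtain h :: "nat \<Rightarrow> nat" where h: "strict_mono h" "\<And>n. e \<le> measure M (?A (S (h n)))"
      using infinite_enumerate by blast
    define c where "c n = S (h n)" for n
    have c: "\<And>n. c n > 0" "c \<longlonglongrightarrow> 0"
      using S(1) LIMSEQ_subseq_LIMSEQ[OF S(2) h(1)] unfolding c_def comp_def by auto
    obtain r where r: "strict_mono r" and AE: "AE \<omega> in M. \<omega> \<in> space M \<and> (\<forall>t\<ge>0. has_local_time (\<lambda>s. X s \<omega>) t) \<and>
      (\<forall>t\<ge>0. (\<lambda>n. crossing_integral \<alpha> (\<lambda>s. X s \<omega>) (\<lambda>_. 1) (c (r n)) t) \<longlonglongrightarrow> limit_const * t)"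
      using AE_limit_subseq[OF c] by blast
    have cr: "(\<lambda>n. c (r n)) \<longlonglongrightarrow> 0" using LIMSEQ_subseq_LIMSEQ[OF c(2) r] by (simp add: comp_def)
    have "(\<lambda>n. \<integral>\<omega>. indicator (?A (c (r n))) \<omega> \<partial>M) \<longlonglongrightarrow> (\<integral>\<omega>. (0::real) \<partial>M)"
    proof (rule integral_dominated_convergence[where w = "\<lambda>_. 1"])
      show "(\<lambda>\<omega>. indicator (?A (c (r n))) \<omega> :: real) \<in> borel_measurable M" for n
        using A[OF c(1)] by (rule borel_measurable_indicator)
      show "AE \<omega> in M. (\<lambda>n. indicator (?A (c (r n))) \<omega> :: real) \<longlonglongrightarrow> 0"
        using AE
      proof eventually_elim
        case (elim \<omega>)
        then have \<omega>: "\<omega> \<in> space M" and ac: "\<And>t. 0 \<le> t \<Longrightarrow> has_local_time (\<lambda>s. X s \<omega>) t"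
          and lim: "\<And>t. 0 \<le> t \<Longrightarrow> (\<lambda>n. crossing_integral \<alpha> (\<lambda>s. X s \<omega>) (\<lambda>_. 1) (c (r n)) t) \<longlonglongrightarrow> limit_const * t"
          by auto
        have "\<forall>\<^sub>F n in sequentially. \<forall>t\<in>{0..T}.
            \<bar>crossing_integral \<alpha> (\<lambda>s. X s \<omega>) g (c (r n)) t - limit_const * path_integral (\<lambda>s. X s \<omega>) g t\<bar> \<le> \<epsilon>"
          by (rule crossing_integral_limit_uniform[OF cadlag_paths[OF \<omega>] c(1) cr index_gt_1 limit_const_nonneg lim g T \<epsilon>])
        then have "\<forall>\<^sub>F n in sequentially. indicator (?A (c (r n))) \<omega> = (0::real)"
        proof eventually_elim
          case (elim n)
          have "W (c (r n)) \<omega> \<le> ennreal \<epsilon>"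
            unfolding W_def weak_deviation_eq[OF c(1) limit_const_nonneg gm \<omega>]
          proof (rule SUP_least)
            fix t assume t: "t \<in> {0..T}"
            then show "(if has_local_time (\<lambda>s. X s \<omega>) t
                then ennreal \<bar>crossing_integral \<alpha> (\<lambda>s. X s \<omega>) g (c (r n)) t - limit_const * path_integral (\<lambda>s. X s \<omega>) g t\<bar>
                else ennreal \<bar>crossing_integral \<alpha> (\<lambda>s. X s \<omega>) g (c (r n)) t\<bar>) \<le> ennreal \<epsilon>"
              using ac[of t] elim by (auto intro!: ennreal_leI)
          qed
          then show ?case by (simp add: indicator_def not_less)
        qed
        then show ?case by (rule tendsto_eventually)
      qed
    qed (auto simp: indicator_def)
    then have "(\<lambda>n. measure M (?A (c (r n)))) \<longlonglongrightarrow> 0" using A[OF c(1)] by simp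
    then have "e \<le> 0" by (rule LIMSEQ_le_const) (use h(2) in \<open>auto simp: c_def\<close>)
    with e(1) show False by simp
  qed
qed simp

end

theorem fact5p4:
  fixes M :: "'a measure" and X :: "real \<Rightarrow> 'a \<Rightarrow> real" and \<alpha> :: real and C :: ennreal
  assumes "strictly_stable_process M X \<alpha>"
    and "1 < \<alpha>" and "\<alpha> \<le> 2"
    and "C = lim (\<lambda>n::nat. (\<integral>\<^sup>+\<omega>. truncated_variation 1 (\<lambda>s. X s \<omega>) 0 (real n) \<partial>M) / of_nat n)"
  shows
    "(\<exists>(c :: nat \<Rightarrow> real) \<Omega>\<^sub>\<alpha>.
        (\<forall>n. c n > 0) \<and> c \<longlonglongrightarrow> 0 \<and> \<Omega>\<^sub>\<alpha> \<in> sets M \<and> measure M \<Omega>\<^sub>\<alpha> = 1 \<and>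
        (\<forall>\<omega>\<in>\<Omega>\<^sub>\<alpha>. \<forall>t\<ge>0.
           weakly_converges (\<lambda>n. crossing_measure \<alpha> (c n) (\<lambda>s. X s \<omega>) t)
             (density lborel (\<lambda>y. C * local_time (\<lambda>s. X s \<omega>) t y))))
     \<and> tends_weakly_loc_unif_in_prob M
         (\<lambda>c t \<omega>. crossing_measure \<alpha> c (\<lambda>s. X s \<omega>) t)
         (\<lambda>t \<omega>. density lborel (\<lambda>y. C * local_time (\<lambda>s. X s \<omega>) t y))"
proof
  interpret stable_process_gt_1 M X \<alpha>
    using assms(1,2) by (intro stable_process_gt_1.intro stable_process_gt_1_axioms.intro)
  have C: "C = ennreal limit_const" unfolding assms(4) by (rule lim_expected_tv)
  show "\<exists>(c :: nat \<Rightarrow> real) \<Omega>\<^sub>\<alpha>.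
        (\<forall>n. c n > 0) \<and> c \<longlonglongrightarrow> 0 \<and> \<Omega>\<^sub>\<alpha> \<in> sets M \<and> measure M \<Omega>\<^sub>\<alpha> = 1 \<and>
        (\<forall>\<omega>\<in>\<Omega>\<^sub>\<alpha>. \<forall>t\<ge>0.
           weakly_converges (\<lambda>n. crossing_measure \<alpha> (c n) (\<lambda>s. X s \<omega>) t)
             (density lborel (\<lambda>y. C * local_time (\<lambda>s. X s \<omega>) t y)))"
  proof -
    have 0: "\<And>n. 0 < 1 / real (Suc n)" "(\<lambda>n. 1 / real (Suc n)) \<longlonglongrightarrow> 0"
      by (simp, rule LIMSEQ_Suc[OF lim_1_over_n])
    obtain r where r: "strict_mono r" and AE: "AE \<omega> in M. \<omega> \<in> space M \<and> (\<forall>t\<ge>0. has_local_time (\<lambda>s. X s \<omega>) t) \<and>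
      (\<forall>t\<ge>0. (\<lambda>n. crossing_integral \<alpha> (\<lambda>s. X s \<omega>) (\<lambda>_. 1) (1 / real (Suc (r n))) t) \<longlonglongrightarrow> limit_const * t)"
      using AE_limit_subseq[OF 0] by blast
    define c where "c n = 1 / real (Suc (r n))" for n
    have c: "\<And>n. c n > 0" "c \<longlonglongrightarrow> 0"
      using LIMSEQ_subseq_LIMSEQ[OF 0(2) r] unfolding c_def comp_def by auto
    \<comment> \<open>The set of good paths is not itself shown to be an event, so a measurable
      subset of full probability is taken.\<close>
    obtain \<Omega> where \<Omega>: "\<Omega> \<subseteq> {\<omega>\<in>space M. \<omega> \<in> space M \<and> (\<forall>t\<ge>0. has_local_time (\<lambda>s. X s \<omega>) t) \<and>
      (\<forall>t\<ge>0. (\<lambda>n. crossing_integral \<alpha> (\<lambda>s. X s \<omega>) (\<lambda>_. 1) (1 / real (Suc (r n))) t) \<longlonglongrightarrow> limit_const * t)}"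
      "\<Omega> \<in> events" "prob \<Omega> = 1"
      by (rule AE_E_prob[OF AE])
    have "weakly_converges (\<lambda>n. crossing_measure \<alpha> (c n) (\<lambda>s. X s \<omega>) t)
        (density lborel (\<lambda>y. C * local_time (\<lambda>s. X s \<omega>) t y))" if "\<omega> \<in> \<Omega>" "0 \<le> t" for \<omega> t
      unfolding C using \<Omega>(1) that by (intro weakly_converges_crossing_measure c) (auto simp: c_def)
    with c \<Omega>(2,3) show ?thesis by blast
  qed
  show "tends_weakly_loc_unif_in_prob M (\<lambda>c t \<omega>. crossing_measure \<alpha> c (\<lambda>s. X s \<omega>) t)
         (\<lambda>t \<omega>. density lborel (\<lambda>y. C * local_time (\<lambda>s. X s \<omega>) t y))"
    unfolding tends_weakly_loc_unif_in_prob_def C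
  proof (intro conjI allI impI)
    show "finite_random_measure M (\<lambda>\<omega>. crossing_measure \<alpha> c (\<lambda>s. X s \<omega>) t)" if "0 < c" "0 \<le> t" for c t
      by (rule finite_random_crossing_measure[OF that])
    show "finite_random_measure M (\<lambda>\<omega>. density lborel (\<lambda>y. ennreal limit_const * local_time (\<lambda>s. X s \<omega>) t y))"
      if "0 \<le> t" for t
      by (rule finite_random_scaled_local_time[OF that limit_const_nonneg])
    fix g :: "real \<Rightarrow> real" and T :: real
    assume g: "continuous_on UNIV g" "bounded (range g)" and T: "0 \<le> T"
    obtain K where K: "\<And>y. \<bar>g y\<bar> \<le> K" using g(2) by (auto simp: bounded_iff)
    have gm: "g \<in> borel_measurable borel" using g(1) by (rule borel_measurable_continuous_onI)
    show "weak_deviation g T (\<lambda>t \<omega>. crossing_measure \<alpha> c (\<lambda>s. X s \<omega>) t)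
        (\<lambda>t \<omega>. density lborel (\<lambda>y. ennreal limit_const * local_time (\<lambda>s. X s \<omega>) t y)) \<in> borel_measurable M" if "0 < c" for c
      by (rule weak_deviation_measurable[OF that limit_const_nonneg T gm K])
    show "((\<lambda>c. measure M {\<omega>\<in>space M. ennreal \<epsilon> < weak_deviation g T (\<lambda>t \<omega>. crossing_measure \<alpha> c (\<lambda>s. X s \<omega>) t)
        (\<lambda>t \<omega>. density lborel (\<lambda>y. ennreal limit_const * local_time (\<lambda>s. X s \<omega>) t y)) \<omega>}) \<longlongrightarrow> 0) (at_right 0)"
      if "0 < \<epsilon>" for \<epsilon>
      by (rule weak_deviation_tendsto_0[OF g(1) K T that])
  qed
qed

end
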